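(* Let $P=(P_1,\dots,P_n)$ be a $(\delta_1,\dots,\delta_n)$-proper polynomial map from $\mathbf{C}^n$ to $\mathbf{C}^n$, where $\delta_j>0$ for all $j$, and let $D_j=\deg P_j$, $j=1,\dots,n$. Let $Q_{jk}$, $j,k=1,\dots,n$, be polynomials in $(X_1,\dots,X_n,Y_1,\dots,Y_n)$ with $\deg Q_{jk}\le D_j-1$ and $$P_j(Y)-P_j(X)=\sum_{k=1}^nQ_{jk}(X,Y)(Y_k-X_k),\qquad j=1,\dots,n,$$ and write $$\det\big[Q_{jk}(X,Y)\big]_{1\le j,k\le n}=\sum_{\substack{\alpha,\beta\in\mathbf{N}^n \\ |\alpha|+|\beta|\le D_1+\cdots+D_n-n}}\gamma_{\alpha,\beta}X^\alpha Y^\beta .$$ Then for any polynomial $Q\in\mathbf{C}[X_1,\dots,X_n]$ of degree $D$ one has the identity $$Q(Y)=\sum_{\substack{\alpha,\beta\in\mathbf{N}^n \\ |\alpha|+|\beta|\le D_1+\cdots+D_n-n}}\ \sum_{\substack{\mu\in\mathbf{N}^n \\ \langle\mu+\underline{1},\delta\rangle\le|\alpha|+D+n}}\gamma_{\alpha,\beta}\ \mathrm{Res}\begin{bmatrix} Q(X)X^\alpha\,dX \\ P_1^{\mu_1+1},\dots,P_n^{\mu_n+1} \end{bmatrix}\,Y^\beta P(Y)^\mu .$$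
   Context: Given rational numbers $0<\delta_j\le\deg P_j$, the map $P=(P_1,\dots,P_n)$ is called $(\delta_1,\dots,\delta_n)$-proper if there exist $c>0$, $R>0$ such that $\sum_{j=1}^n|P_j(\zeta)|(1+\|\zeta\|^2)^{-\delta_j/2}\ge c$ for all $\zeta\in\mathbf{C}^n$ with $\|\zeta\|\ge R$ (Euclidean norm). Notation: $\zeta^m=\zeta_1^{m_1}\cdots\zeta_n^{m_n}$, $P(Y)^\mu=P_1(Y)^{\mu_1}\cdots P_n(Y)^{\mu_n}$, $|\alpha|=\alpha_1+\cdots+\alpha_n$, $\underline{1}=(1,\dots,1)$, $\langle\mu+\underline{1},\delta\rangle=\sum_j(\mu_j+1)\delta_j$. For polynomials $f_1,\dots,f_n$ with finite common zero set $V(f)\subset\mathbf{C}^n$ and a polynomial $h$, the global residue is $$\mathrm{Res}\begin{bmatrix} h\,dX \\ {f_1,\dots,f_n} \end{bmatrix}=\sum_{a\in V(f)}\frac{1}{(2\pi i)^n}\lim_{\epsilon_1,\dots,\epsilon_n\to 0}\int_{\{\zeta\in U_a:\ |f_1|=\epsilon_1,\dots,|f_n|=\epsilon_n\}}\frac{h\,d\zeta_1\wedge\cdots\wedge d\zeta_n}{f_1\cdots f_n},$$ where $U_a$ is a bounded open neighbourhood of $a$ whose closure meets $V(f)$ only at $a$ and the cycle is oriented so that $d\arg f_1\wedge\cdots\wedge d\arg f_n$ is positive (the integral is independent of generic sufficiently small $\epsilon_j>0$). *)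

theory Defs
  imports "HOL-Analysis.Analysis" "HOL-Library.Poly_Mapping"
begin

text \<open>Complex polynomials in the variables indexed by the finite type \<open>'v\<close>: finitely supported
  maps from multi-indices to coefficients.\<close>

type_synonym 'v multi_index = "'v \<Rightarrow>\<^sub>0 nat"
type_synonym 'v cpoly = "('v \<Rightarrow>\<^sub>0 nat) \<Rightarrow>\<^sub>0 complex"

definition mi_abs :: "'v::finite multi_index \<Rightarrow> nat" where
  "mi_abs m = (\<Sum>i\<in>UNIV. Poly_Mapping.lookup m i)"

definition mi_power :: "('v::finite \<Rightarrow> complex) \<Rightarrow> 'v multi_index \<Rightarrow> complex" where
  "mi_power z m = (\<Prod>i\<in>UNIV. z i ^ Poly_Mapping.lookup m i)"

definition peval :: "'v::finite cpoly \<Rightarrow> ('v \<Rightarrow> complex) \<Rightarrow> complex" where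
  "peval p z = (\<Sum>m\<in>Poly_Mapping.keys p. Poly_Mapping.lookup p m * mi_power z m)"

text \<open>Total degree, with the convention that the zero polynomial has degree \<open>0\<close>.\<close>

definition total_degree :: "'v::finite cpoly \<Rightarrow> nat" where
  "total_degree p = Max (insert 0 (mi_abs ` Poly_Mapping.keys p))"

text \<open>Polynomials in \<open>(X, Y)\<close> have variables indexed by \<open>'n + 'n\<close>: \<open>Inl k\<close> stands for \<open>X\<^sub>k\<close> and
  \<open>Inr k\<close> for \<open>Y\<^sub>k\<close>.\<close>

definition peval2 :: "('n::finite + 'n) cpoly \<Rightarrow> complex ^ 'n \<Rightarrow> complex ^ 'n \<Rightarrow> complex" where
  "peval2 p x y = peval p (case_sum (($) x) (($) y))"

definition delta_proper :: "('n::finite \<Rightarrow> rat) \<Rightarrow> ('n \<Rightarrow> 'n cpoly) \<Rightarrow> bool" where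
  "delta_proper \<delta> P \<longleftrightarrow>
     (\<forall>j. 0 < \<delta> j \<and> \<delta> j \<le> of_nat (total_degree (P j))) \<and>
     (\<exists>c>0. \<exists>R>0. \<forall>\<zeta> :: complex ^ 'n. norm \<zeta> \<ge> R \<longrightarrow>
        (\<Sum>j\<in>UNIV. cmod (peval (P j) (($) \<zeta>)) * (1 + (norm \<zeta>)\<^sup>2) powr (- of_rat (\<delta> j) / 2)) \<ge> c)"

definition common_zeros :: "('n::finite \<Rightarrow> complex ^ 'n \<Rightarrow> complex) \<Rightarrow> (complex ^ 'n) set" where
  "common_zeros f = {\<zeta>. \<forall>j. f j \<zeta> = 0}"

definition res_cycle ::
  "('n::finite \<Rightarrow> complex ^ 'n \<Rightarrow> complex) \<Rightarrow> (complex ^ 'n) set \<Rightarrow> real ^ 'n \<Rightarrow> (complex ^ 'n) set" where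
  "res_cycle f U \<epsilon> = {\<zeta> \<in> U. \<forall>j. cmod (f j \<zeta>) = \<epsilon> $ j}"

text \<open>The matrix \<open>\<partial>\<phi>\<^sub>i/\<partial>t\<^sub>k\<close>. Its determinant is the coefficient of \<open>dt\<^sub>1 \<and> \<dots> \<and> dt\<^sub>n\<close> in the
  pull-back of \<open>d\<zeta>\<^sub>1 \<and> \<dots> \<and> d\<zeta>\<^sub>n\<close> under \<open>\<phi>\<close>.\<close>

definition partials :: "(real ^ 'n::finite \<Rightarrow> complex ^ 'n) \<Rightarrow> real ^ 'n \<Rightarrow> complex ^ 'n ^ 'n" where
  "partials \<phi> t = (\<chi> i k. frechet_derivative \<phi> (at t) (axis k 1) $ i)"

text \<open>The coefficient of \<open>dt\<^sub>1 \<and> \<dots> \<and> dt\<^sub>n\<close> in the pull-back under \<open>\<phi>\<close> of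
  \<open>d arg f\<^sub>1 \<and> \<dots> \<and> d arg f\<^sub>n\<close>, where \<open>d arg f = Im (df/f)\<close>. The \<open>f\<^sub>j\<close>, the \<open>\<zeta>\<^sub>j\<close> and the \<open>t\<^sub>j\<close>
  carry the same index type, so only their common order enters, and it cancels.\<close>

definition darg_coeff ::
  "('n::finite \<Rightarrow> complex ^ 'n \<Rightarrow> complex) \<Rightarrow> (real ^ 'n \<Rightarrow> complex ^ 'n) \<Rightarrow> real ^ 'n \<Rightarrow> real" where
  "darg_coeff f \<phi> t =
     det (\<chi> j k. Im (frechet_derivative (\<lambda>s. f j (\<phi> s)) (at t) (axis k 1) / f j (\<phi> t)))"

definition oriented_chart ::
  "('n::finite \<Rightarrow> complex ^ 'n \<Rightarrow> complex) \<Rightarrow> (complex ^ 'n) set \<Rightarrow>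
     (real ^ 'n) set \<Rightarrow> (real ^ 'n \<Rightarrow> complex ^ 'n) \<Rightarrow> bool" where
  "oriented_chart f M W \<phi> \<longleftrightarrow>
     open W \<and> inj_on \<phi> W \<and> \<phi> ` W \<subseteq> M \<and>
     \<phi> differentiable_on W \<and> continuous_on W (partials \<phi>) \<and>
     (\<forall>t\<in>W. darg_coeff f \<phi> t > 0)"

text \<open>\<open>cycle_integral f M g I\<close>: the integral of \<open>g d\<zeta>\<^sub>1 \<and> \<dots> \<and> d\<zeta>\<^sub>n\<close> over the \<open>n\<close>-dimensional cycle
  \<open>M = {|f\<^sub>1| = \<epsilon>\<^sub>1, \<dots>, |f\<^sub>n| = \<epsilon>\<^sub>n}\<close>, oriented by \<open>d arg f\<^sub>1 \<and> \<dots> \<and> d arg f\<^sub>n > 0\<close>, converges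
  absolutely with value \<open>I\<close>. The cycle is cut into countably many disjoint measurable pieces
  \<open>\<phi>\<^sub>i(S\<^sub>i)\<close>, each inside one positively oriented \<open>C\<^sup>1\<close> chart. The pieces cover all points of
  \<open>M\<close> around which there is such a chart, i.e. at which \<open>d arg f\<^sub>1 \<and> \<dots> \<and> d arg f\<^sub>n\<close> does not
  vanish on \<open>M\<close>. The remaining points of \<open>M\<close>, where the Jacobian determinant of \<open>f\<close> is zero, form a
  set of dimension less than \<open>n\<close>; they may occur even if \<open>M\<close> is smooth.\<close>

definition cycle_integral ::
  "('n::finite \<Rightarrow> complex ^ 'n \<Rightarrow> complex) \<Rightarrow> (complex ^ 'n) set \<Rightarrow>
     (complex ^ 'n \<Rightarrow> complex) \<Rightarrow> complex \<Rightarrow> bool" where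
  "cycle_integral f M g I \<longleftrightarrow>
     (\<exists>(W :: nat \<Rightarrow> (real ^ 'n) set) S \<phi>.
        (\<forall>i. oriented_chart f M (W i) (\<phi> i) \<and> S i \<subseteq> W i \<and> S i \<in> sets lebesgue) \<and>
        disjoint_family (\<lambda>i. \<phi> i ` S i) \<and>
        (\<Union>i. \<phi> i ` S i) = {\<zeta>. \<exists>V \<psi>. oriented_chart f M V \<psi> \<and> \<zeta> \<in> \<psi> ` V} \<and>
        (\<forall>i. (\<lambda>t. g (\<phi> i t) * det (partials (\<phi> i) t)) absolutely_integrable_on S i) \<and>
        summable (\<lambda>i. integral (S i) (\<lambda>t. norm (g (\<phi> i t) * det (partials (\<phi> i) t)))) \<and>
        (\<lambda>i. integral (S i) (\<lambda>t. g (\<phi> i t) * det (partials (\<phi> i) t))) sums I)"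

text \<open>\<open>r\<close> is the limit of \<open>(2\<pi>i)\<^sup>-\<^sup>n \<integral> h d\<zeta> / (f\<^sub>1 \<cdots> f\<^sub>n)\<close> over the cycles in \<open>U\<close>, as
  \<open>\<epsilon>\<^sub>1, \<dots>, \<epsilon>\<^sub>n\<close> tend to \<open>0\<close> independently through generic (almost all) positive values.\<close>

definition residue_limit ::
  "('n::finite \<Rightarrow> complex ^ 'n \<Rightarrow> complex) \<Rightarrow> (complex ^ 'n \<Rightarrow> complex) \<Rightarrow>
     (complex ^ 'n) set \<Rightarrow> complex \<Rightarrow> bool" where
  "residue_limit f h U r \<longleftrightarrow>
     (\<forall>e>0. \<exists>\<rho>>0. AE \<epsilon> in (lborel :: (real ^ 'n) measure).
        (\<forall>j. 0 < \<epsilon> $ j \<and> \<epsilon> $ j < \<rho>) \<longrightarrow>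
        (\<exists>I. cycle_integral f (res_cycle f U \<epsilon>) (\<lambda>\<zeta>. h \<zeta> / (\<Prod>j\<in>UNIV. f j \<zeta>)) I \<and>
             dist (I / (2 * of_real pi * \<i>) ^ CARD('n)) r < e))"

text \<open>The limit does not depend on the neighbourhood \<open>U\<close>, since the cycles in two such neighbourhoods
  coincide for small \<open>\<epsilon>\<close>.\<close>

definition local_residue ::
  "('n::finite \<Rightarrow> complex ^ 'n \<Rightarrow> complex) \<Rightarrow> (complex ^ 'n \<Rightarrow> complex) \<Rightarrow> complex ^ 'n \<Rightarrow> complex" where
  "local_residue f h a =
     (THE r. \<forall>U. open U \<and> bounded U \<and> a \<in> U \<and> closure U \<inter> common_zeros f = {a} \<longrightarrow>
                 residue_limit f h U r)"

definition global_residue ::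
  "(complex ^ 'n::finite \<Rightarrow> complex) \<Rightarrow> ('n \<Rightarrow> complex ^ 'n \<Rightarrow> complex) \<Rightarrow> complex" where
  "global_residue h f = (\<Sum>a\<in>common_zeros f. local_residue f h a)"

end

theory Submission
  imports Defs "HOL-Computational_Algebra.Polynomial"
begin

text \<open>
  Let \<open>J\<close> be the Jacobian determinant of \<open>P\<close>. For functions \<open>\<xi>\<^sub>j\<close> on \<open>\<complex>\<close> consider
  \<open>LP U h \<xi> = \<integral>\<^sub>U h \<cdot> cnj J \<cdot> \<Prod>\<^sub>j \<xi>\<^sub>j(P\<^sub>j)\<close> (Lebesgue measure). By Stokes it vanishes as soon as one factor is an
  antiholomorphic derivative of a compactly supported function; hence for radial bumps times
  \<open>P\<^sub>j\<^sup>-\<^sup>m\<close> it equals a constant (the coefficient of \<open>h\<close> at \<open>m\<close>) times the masses of the bumps.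
  Scaling by \<open>\<delta>\<close>-properness shows that the coefficients vanish for large \<open>m\<close>. Concentrating the
  \<open>\<xi>\<^sub>j\<close> around \<open>P(y)\<close>, for a regular value \<open>P(y)\<close>, localises the integral to the fibre of \<open>P(y)\<close>, where
  \<open>det Q\<^sub>j\<^sub>k(x, y)\<close> vanishes except at \<open>x = y\<close>; expanding \<open>1 / (P\<^sub>j(x) - P\<^sub>j(y))\<close> geometrically gives the
  division formula with coefficients in place of residues, and regular points are dense.
  Applied to powers of the coordinates, the formula also shows that the zero set is finite.
  Finally, in the local coordinates \<open>ln P\<^sub>j = u\<^sub>j + \<i> t\<^sub>j\<close> Fubini's theorem slices \<open>LP\<close> for indicator functions of
  shells into the cycle integrals over \<open>|P\<^sub>j| = exp u\<^sub>j\<close>. These are therefore constant for almost all \<open>u\<close>,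
  which identifies the residue with the coefficient divided by \<open>\<pi>\<^sup>n\<close>.\<close>

text \<open>The factor \<open>cnj J\<close> is the coefficient of the conjugate of dP_1 ... dP_n, so
  \<open>LP\<close> pairs h dX with smoothings of the residue current of P. Smoothing avoids chains:
  the cycles |P_j| = \<epsilon>_j may contain critical points of P, whereas \<open>LP\<close> needs
  Stokes only for compactly supported functions on open sets, and points with J = 0 carry no weight.
  The exponent shift is built in: in polar coordinates the area is ds d\<theta>/2 with s = |w|^2,
  and d\<theta> = dw/(i w), so P_j^-m under \<open>LP\<close> matches the denominator P_j^(m+1). The
  range of \<mu> comes from shells |P_j| ~ t^\<delta>_j. Properness puts them into a ball of radius
  O(t). The integral of |J|^2 / (|P_1| ... |P_n|)^2 over them is itself a coefficient, that of J,
  hence independent of t; balanced against the ball volume O(t^(2n)) it bounds the integral of |J| /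
  (|P_1| ... |P_n|) by O(t^n). This is the n next to |\<alpha>| + D. Finiteness of the zero set has
  to be derived because the global residue is a sum over that set, and small balls around the zeros
  must separate the local contributions.\<close>

section \<open>Change of variables for real and complex vectors\<close>

text \<open>Rows outside the range of \<sigma> are unit rows, so the Leibniz expansion reduces to
  permutations that fix every index outside the range. A bijective \<sigma> renames indices;
  \<open>Inl\<close> and \<open>Inr\<close> give the determinants of the block factors in
  \<open>det_realification\<close>.\<close>

lemma det_embed:
  fixes A :: "'a::comm_ring_1^'m^'m" and B :: "'a^'k^'k" and \<sigma> :: "'m \<Rightarrow> 'k"
  assumes inj: "inj \<sigma>" and B: "\<And>i j. B $ \<sigma> i $ \<sigma> j = A $ i $ j"
    and B1: "\<And>i j. i \<notin> range \<sigma> \<Longrightarrow> B $ i $ j = of_bool (i = j)"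
  shows "det B = det A"
proof -
  let ?f = "\<lambda>p. of_int (sign p) * (\<Prod>i\<in>UNIV. B $ i $ p i)"
  have "det B = sum ?f {p. p permutes (UNIV::'k set)}"
    by (simp add: det_def)
  also have "\<dots> = sum ?f {p. p permutes range \<sigma>}"
  proof (rule sum.mono_neutral_right)
    show "finite {p. p permutes (UNIV::'k set)}" by (simp add: finite_permutations)
    show "{p. p permutes range \<sigma>} \<subseteq> {p. p permutes UNIV}"
      using permutes_subset by blast
    show "\<forall>p\<in>{p. p permutes UNIV} - {p. p permutes range \<sigma>}. ?f p = 0"
    proof
      fix p assume p: "p \<in> {p. p permutes (UNIV::'k set)} - {p. p permutes range \<sigma>}"
      then obtain i where i: "i \<notin> range \<sigma>" "p i \<noteq> i"
        by (auto simp: permutes_def)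
      then have "B $ i $ p i = 0" using B1 by auto
      then have "(\<Prod>i\<in>UNIV. B $ i $ p i) = 0" by (meson UNIV_I finite prod_zero)
      then show "?f p = 0" by simp
    qed
  qed
  also have "\<dots> = (\<Sum>p | p permutes (UNIV::'m set). ?f (map_permutation UNIV \<sigma> p))"
  proof (rule sum.reindex_bij_witness[where i="map_permutation UNIV \<sigma>" and j="map_permutation (range \<sigma>) (inv \<sigma>)"])
    fix p assume "p \<in> {p. p permutes range \<sigma>}"
    then have p: "p permutes range \<sigma>" by simp
    show 1: "map_permutation UNIV \<sigma> (map_permutation (range \<sigma>) (inv \<sigma>) p) = p"
      by (rule map_permutation_compose_inv[where A="range \<sigma>"])
         (use p inj in \<open>auto simp: f_inv_into_f bij_betw_def intro: inj_on_inv_into\<close>)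
    show "map_permutation (range \<sigma>) (inv \<sigma>) p \<in> {p. p permutes UNIV}"
      using map_permutation_permutes[OF _ p, of "inv \<sigma>" UNIV] inj
      by (auto simp: bij_betw_def inj_on_inv_into image_inv_f_f)
    show "?f (map_permutation UNIV \<sigma> (map_permutation (range \<sigma>) (inv \<sigma>) p)) = ?f p"
      by (simp add: 1)
  next
    fix p assume "p \<in> {p. p permutes (UNIV::'m set)}"
    then have p: "p permutes UNIV" by simp
    show "map_permutation (range \<sigma>) (inv \<sigma>) (map_permutation UNIV \<sigma> p) = p"
      by (rule map_permutation_compose_inv) (use p inj in \<open>auto simp: bij_betw_def\<close>)
    show "map_permutation UNIV \<sigma> p \<in> {p. p permutes range \<sigma>}"
      using map_permutation_permutes[OF _ p, of \<sigma> "range \<sigma>"] inj by (auto simp: bij_betw_def)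
  qed
  also have "\<dots> = (\<Sum>p | p permutes (UNIV::'m set). of_int (sign p) * (\<Prod>i\<in>UNIV. A $ i $ p i))"
  proof (rule sum.cong[OF refl])
    fix p assume "p \<in> {p. p permutes (UNIV::'m set)}"
    then have p: "p permutes UNIV" by simp
    let ?q = "map_permutation UNIV \<sigma> p"
    have q: "?q permutes range \<sigma>"
      using map_permutation_permutes[OF _ p, of \<sigma> "range \<sigma>"] inj by (auto simp: bij_betw_def)
    have "(\<Prod>i\<in>UNIV. B $ i $ ?q i) = (\<Prod>i\<in>range \<sigma>. B $ i $ ?q i)"
      by (rule prod.mono_neutral_right) (use q B1 in \<open>auto simp: permutes_def\<close>)
    also have "\<dots> = (\<Prod>i\<in>UNIV. B $ \<sigma> i $ ?q (\<sigma> i))"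
      by (subst prod.reindex) (use inj in auto)
    also have "\<dots> = (\<Prod>i\<in>UNIV. A $ i $ p i)"
      using inj by (simp add: map_permutation_apply B)
    finally show "?f ?q = of_int (sign p) * (\<Prod>i\<in>UNIV. A $ i $ p i)"
      using sign_map_permutation[OF inj p] by simp
  qed
  finally show ?thesis by (simp add: det_def)
qed

text \<open>A copy of a finite type carrying some well-order, because the change of variables theorem
  of the library is stated for well-ordered index types only.\<close>

typedef 'a wo = "UNIV :: 'a set" by simp

definition wo_rank :: "'a::finite wo \<Rightarrow> nat" where
  "wo_rank = (SOME f. inj f)"

lemma UNIV_wo: "(UNIV :: 'a wo set) = range Abs_wo"
  by (metis Abs_wo_cases surj_def)

lemma finite_UNIV_wo: "finite (UNIV :: 'a::finite wo set)"
  by (simp add: UNIV_wo)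

lemma inj_wo_rank: "inj (wo_rank :: 'a::finite wo \<Rightarrow> nat)"
  unfolding wo_rank_def
  using finite_imp_inj_to_nat_seg[OF finite_UNIV_wo[where 'a='a]] by (metis someI)

instantiation wo :: (finite) wellorder
begin
definition less_eq_wo :: "'a wo \<Rightarrow> 'a wo \<Rightarrow> bool" where "less_eq_wo x y \<longleftrightarrow> wo_rank x \<le> wo_rank y"
definition less_wo :: "'a wo \<Rightarrow> 'a wo \<Rightarrow> bool" where "less_wo x y \<longleftrightarrow> wo_rank x < wo_rank y"
instance
proof
  fix x y z :: "'a wo"
  show "(x < y) = (x \<le> y \<and> \<not> y \<le> x)" by (auto simp: less_eq_wo_def less_wo_def)
  show "x \<le> x" by (simp add: less_eq_wo_def)
  show "x \<le> y \<Longrightarrow> y \<le> z \<Longrightarrow> x \<le> z" by (simp add: less_eq_wo_def)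
  show "x \<le> y \<Longrightarrow> y \<le> x \<Longrightarrow> x = y" using inj_wo_rank by (auto simp: less_eq_wo_def inj_def)
  show "x \<le> y \<or> y \<le> x" by (auto simp: less_eq_wo_def)
next
  fix Q :: "'a wo \<Rightarrow> bool" and a :: "'a wo"
  assume "\<And>x. (\<And>y. y < x \<Longrightarrow> Q y) \<Longrightarrow> Q x"
  moreover have "wf {(x, y :: 'a wo). x < y}"
    by (rule wf_subset[OF wf_measure[of wo_rank]]) (auto simp: less_wo_def)
  ultimately show "Q a"
    by (metis (no_types, lifting) case_prodI mem_Collect_eq wf_induct_rule)
qed
end

instance wo :: (finite) finite
  by standard (rule finite_UNIV_wo)

lemma bij_Rep_wo: "bij (Rep_wo :: 'a wo \<Rightarrow> 'a)"
  by (metis Abs_wo_inverse Rep_wo_inverse UNIV_I bijI')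

text \<open>A linear isometry that permutes basis vectors pulls boxes back to boxes with the same
  side lengths, and this determines Lebesgue measure. It serves for renaming indices, for splitting
  complex vectors into real and imaginary parts, and for \<open>cvec\<close>.\<close>

lemma lborel_basis_iso:
  fixes T :: "'a::euclidean_space \<Rightarrow> 'b::euclidean_space"
  assumes lin: "linear T" and bij: "bij_betw T Basis Basis"
    and inner: "\<And>x y. T x \<bullet> T y = x \<bullet> y" and surj: "surj T"
  shows "distr lborel borel T = lborel"
proof (rule lborel_eqI[symmetric])
  have meas: "T \<in> borel_measurable borel"
    using lin by (intro borel_measurable_continuous_onI linear_continuous_on) (simp add: linear_conv_bounded_linear)
  fix l u :: 'b assume lu: "\<And>b. b \<in> Basis \<Longrightarrow> l \<bullet> b \<le> u \<bullet> b"
  obtain l' where l': "T l' = l" using surj by (metis surjD)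
  obtain u' where u': "T u' = u" using surj by (metis surjD)
  have bas: "\<And>b. b \<in> Basis \<Longrightarrow> T b \<in> Basis" using bij by (auto simp: bij_betw_def)
  have *: "T -` box l u = box l' u'"
  proof (intro set_eqI)
    fix x
    have "T x \<in> box l u \<longleftrightarrow> (\<forall>b\<in>T ` Basis. l \<bullet> b < T x \<bullet> b \<and> T x \<bullet> b < u \<bullet> b)"
      using bij by (simp add: mem_box bij_betw_def)
    also have "\<dots> \<longleftrightarrow> x \<in> box l' u'"
      by (simp add: mem_box inner flip: l' u')
    finally show "x \<in> T -` box l u \<longleftrightarrow> x \<in> box l' u'" by simp
  qed
  have "emeasure (distr lborel borel T) (box l u) = emeasure lborel (box l' u')"
    using meas by (subst emeasure_distr) (auto simp: *)
  also have "\<dots> = (\<Prod>b\<in>Basis. (u' - l') \<bullet> b)"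
    using lu bas by (subst emeasure_lborel_box) (auto simp flip: inner simp: l' u')
  also have "\<dots> = (\<Prod>b\<in>Basis. (u - l) \<bullet> b)"
  proof -
    have "(\<Prod>b\<in>Basis. (u - l) \<bullet> b) = (\<Prod>b\<in>Basis. (u - l) \<bullet> T b)"
      by (rule prod.reindex_bij_betw[OF bij, symmetric])
    also have "\<dots> = (\<Prod>b\<in>Basis. (u' - l') \<bullet> b)"
      using lin by (intro prod.cong refl) (simp add: linear_diff flip: inner l' u')
    finally show ?thesis by simp
  qed
  finally show "emeasure (distr lborel borel T) (box l u) = ennreal (\<Prod>b\<in>Basis. (u - l) \<bullet> b)" .
qed simp

lemma lebesgue_basis_iso:
  fixes T :: "'a::euclidean_space \<Rightarrow> 'b::euclidean_space"
  assumes lin: "linear T" and bij: "bij_betw T Basis Basis"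
    and inner: "\<And>x y. T x \<bullet> T y = x \<bullet> y" and surj: "surj T"
  shows "distr lebesgue lebesgue T = lebesgue" and "T \<in> lebesgue \<rightarrow>\<^sub>M lebesgue"
proof -
  have meas: "T \<in> borel_measurable borel"
    using lin by (intro borel_measurable_continuous_onI linear_continuous_on) (simp add: linear_conv_bounded_linear)
  have mT: "T \<in> lebesgue \<rightarrow>\<^sub>M lborel"
    using meas by (intro measurable_completion) simp
  have d: "distr lborel lborel T = lborel"
    using lborel_basis_iso[OF assms] by (simp cong: distr_cong)
  have d': "distr lebesgue lborel T = lborel"
    using distr_completion[of T lborel lborel] meas d by simp
  show "distr lebesgue lebesgue T = lebesgue"
    using completion.completion_distr_eq[OF mT] d' by simp
  show "T \<in> lebesgue \<rightarrow>\<^sub>M lebesgue"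
    using completion.measurable_completion2[OF mT] d'
    by (auto simp: null_sets_distr_iff[OF mT, symmetric])
qed

lemma image_eq_vimage_inverse:
  assumes "\<And>x. T (U x) = x" "\<And>x. U (T x) = x"
  shows "U ` S = T -` S"
  using assms by (auto simp: image_iff) metis

lemma sum_UNIV_Plus:
  fixes f :: "'a::finite + 'b::finite \<Rightarrow> 'c::comm_monoid_add"
  shows "(\<Sum>x\<in>UNIV. f x) = (\<Sum>i\<in>UNIV. f (Inl i)) + (\<Sum>i\<in>UNIV. f (Inr i))"
  by (subst UNIV_Plus_UNIV[symmetric], subst sum.Plus) auto

lemma det_of_real:
  fixes M :: "real^'k^'k"
  shows "det (\<chi> i j. complex_of_real (M $ i $ j)) = of_real (det M)"
  by (simp add: det_def)

lemma det_cnj: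
  fixes M :: "complex^'k^'k"
  shows "det (\<chi> i j. cnj (M $ i $ j)) = cnj (det M)"
  by (simp add: det_def)

text \<open>The realification is conjugate over the complex numbers to the block matrix with diagonal
  blocks \<open>A\<close> and its complex conjugate.\<close>

lemma det_realification:
  fixes A :: "complex^'n^'n" and M :: "real^('n+'n)^('n+'n)"
  assumes "\<And>i j. M $ Inl i $ Inl j = Re (A $ i $ j)" "\<And>i j. M $ Inl i $ Inr j = - Im (A $ i $ j)"
    "\<And>i j. M $ Inr i $ Inl j = Im (A $ i $ j)" "\<And>i j. M $ Inr i $ Inr j = Re (A $ i $ j)"
  shows "det M = (cmod (det A))\<^sup>2"
proof -
  define Mc where "Mc = (\<chi> i j. complex_of_real (M $ i $ j))"
  \<comment> \<open>The columns of \<open>Z\<close> span the eigenspaces of the complex structure: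
    the realification sends (v, -i v) to (A v, -i A v) and acts on (v, i v) through the conjugate of
    A.\<close>
  define Z where "Z = (\<chi> i j. (case (i,j) of (Inl a, Inl b) \<Rightarrow> of_bool (a=b) | (Inl a, Inr b) \<Rightarrow> of_bool (a=b)
     | (Inr a, Inl b) \<Rightarrow> - \<i> * of_bool (a=b) | (Inr a, Inr b) \<Rightarrow> \<i> * of_bool (a=b)) :: complex^('n+'n)^('n+'n))"
  define Z' where "Z' = (\<chi> i j. (case (i,j) of (Inl a, Inl b) \<Rightarrow> (1/2) * of_bool (a=b) | (Inl a, Inr b) \<Rightarrow> (\<i>/2) * of_bool (a=b)
     | (Inr a, Inl b) \<Rightarrow> (1/2) * of_bool (a=b) | (Inr a, Inr b) \<Rightarrow> (- \<i>/2) * of_bool (a=b)) :: complex^('n+'n)^('n+'n))"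
  define D1 where "D1 = (\<chi> i j. (case (i,j) of (Inl a, Inl b) \<Rightarrow> A $ a $ b | (Inr a, Inr b) \<Rightarrow> of_bool (a=b) | _ \<Rightarrow> 0) :: complex^('n+'n)^('n+'n))"
  define D2 where "D2 = (\<chi> i j. (case (i,j) of (Inr a, Inr b) \<Rightarrow> cnj (A $ a $ b) | (Inl a, Inl b) \<Rightarrow> of_bool (a=b) | _ \<Rightarrow> 0) :: complex^('n+'n)^('n+'n))"
  have ifm: "(if p then a else b) * x = (if p then a * x else b * x)" "x * (if p then a else b) = (if p then x * a else x * b)"
     for p and a b x :: complex
    by auto
  have d1: "det D1 = det A"
    by (rule det_embed[of Inl]) (auto simp: D1_def split: sum.split)
  have d2: "det D2 = cnj (det A)"
    by (subst det_cnj[symmetric], rule det_embed[of Inr]) (auto simp: D2_def split: sum.split)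
  have "Mc ** Z = (Z ** D1) ** D2"
    unfolding matrix_matrix_mult_def vec_eq_iff
  proof (intro allI)
    fix i j
    show "(\<chi> i j. \<Sum>k\<in>UNIV. Mc $ i $ k * Z $ k $ j) $ i $ j =
      (\<chi> i j. \<Sum>k\<in>UNIV. (\<chi> i j. \<Sum>k\<in>UNIV. Z $ i $ k * D1 $ k $ j) $ i $ k * D2 $ k $ j) $ i $ j"
      by (cases i; cases j)
        (simp_all add: sum_UNIV_Plus Mc_def Z_def D1_def D2_def assms ifm of_bool_def complex_eq_iff sum_negf cong: if_cong)
  qed
  moreover have "Z ** Z' = mat 1"
    unfolding matrix_matrix_mult_def vec_eq_iff
  proof (intro allI)
    fix i j
    show "(\<chi> i j. \<Sum>k\<in>UNIV. Z $ i $ k * Z' $ k $ j) $ i $ j = mat 1 $ i $ j"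
      by (cases i; cases j)
        (auto simp add: sum_UNIV_Plus Z_def  Z'_def mat_def ifm of_bool_def cong: if_cong)
  qed
  then have "det Z * det Z' = 1" by (metis det_I det_mul)
  ultimately have "det Mc * det Z = det Z * det D1 * det D2" "det Z \<noteq> 0"
    by (metis det_mul, auto)
  then have "det Mc = det A * cnj (det A)" by (simp add: d1 d2)
  also have "\<dots> = of_real ((cmod (det A))\<^sup>2)" by (rule complex_norm_square[symmetric])
  finally show ?thesis
    unfolding Mc_def det_of_real by (metis of_real_eq_iff)
qed

lemma absolutely_integrable_basis_iso:
  fixes T :: "'a::euclidean_space \<Rightarrow> 'b::euclidean_space" and f :: "'b \<Rightarrow> 'c::euclidean_space"
  assumes T: "linear T" "bij_betw T Basis Basis" "\<And>x y. T x \<bullet> T y = x \<bullet> y" "surj T"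
    and f: "f absolutely_integrable_on S"
  shows "(\<lambda>x. f (T x)) absolutely_integrable_on (T -` S)"
    and "integral (T -` S) (\<lambda>x. f (T x)) = integral S f"
proof -
  note lT = lebesgue_basis_iso[OF T]
  have f': "integrable lebesgue (\<lambda>x. indicator S x *\<^sub>R f x)"
    using f by (simp add: set_integrable_def)
  have m: "(\<lambda>x. indicator S x *\<^sub>R f x) \<in> borel_measurable lebesgue"
    using f' by auto
  have ind: "indicator S (T x) = (indicator (T -` S) x :: real)" for x
    by (simp add: indicator_def)
  have "integrable (distr lebesgue lebesgue T) (\<lambda>x. indicator S x *\<^sub>R f x)"
    using f' lT(1) by simp
  then have "integrable lebesgue (\<lambda>x. indicator S (T x) *\<^sub>R f (T x))"
    using m lT(2) by (subst (asm) integrable_distr_eq) auto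
  then show a: "(\<lambda>x. f (T x)) absolutely_integrable_on (T -` S)"
    by (simp add: ind set_integrable_def)
  have "integral\<^sup>L (distr lebesgue lebesgue T) (\<lambda>x. indicator S x *\<^sub>R f x) =
      integral\<^sup>L lebesgue (\<lambda>x. indicator S (T x) *\<^sub>R f (T x))"
    using m lT(2) by (intro integral_distr) auto
  then show "integral (T -` S) (\<lambda>x. f (T x)) = integral S f"
    using set_lebesgue_integral_eq_integral(2)[OF a] set_lebesgue_integral_eq_integral(2)[OF f] lT(1)
    by (simp add: ind set_lebesgue_integral_def)
qed

lemma absolutely_integrable_basis_iso_iff:
  fixes T :: "'a::euclidean_space \<Rightarrow> 'b::euclidean_space" and f :: "'b \<Rightarrow> 'c::euclidean_space"
  assumes T: "linear T" "bij_betw T Basis Basis" "\<And>x y. T x \<bullet> T y = x \<bullet> y" "surj T"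
  shows "(\<lambda>x. f (T x)) absolutely_integrable_on (T -` S) \<and> integral (T -` S) (\<lambda>x. f (T x)) = b
    \<longleftrightarrow> f absolutely_integrable_on S \<and> integral S f = b" (is "?L \<longleftrightarrow> ?R")
proof
  show "?R \<Longrightarrow> ?L" using absolutely_integrable_basis_iso[OF T] by blast
next
  assume L: ?L
  have inj: "inj T"
  proof (rule injI)
    fix x y assume "T x = T y"
    then have "T (x - y) = 0" using T(1) by (simp add: linear_diff)
    then have "(x - y) \<bullet> (x - y) = 0" by (simp flip: T(3))
    then show "x = y" by simp
  qed
  let ?Ti = "inv T"
  have Ti: "T (?Ti y) = y" "?Ti (T x) = x" for x y
    using T(4) inj by (auto simp: surj_f_inv_f)
  have lin: "linear ?Ti"
  proof (rule linearI)
    show "?Ti (x + y) = ?Ti x + ?Ti y" for x y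
      by (metis Ti linear_add[OF T(1)])
    show "?Ti (c *\<^sub>R x) = c *\<^sub>R ?Ti x" for c x
      by (metis Ti linear_cmul[OF T(1)])
  qed
  have bb: "bij_betw ?Ti Basis Basis"
    by (rule bij_betw_byWitness[where f'=T]) (use Ti T(2) in \<open>auto simp: bij_betw_def\<close>, metis image_iff)
  have inn: "?Ti x \<bullet> ?Ti y = x \<bullet> y" for x y using T(3)[of "?Ti x" "?Ti y"] by (simp add: Ti)
  have su: "surj ?Ti" by (metis Ti(2) surjI)
  have *: "?Ti -` (T -` S) = S" by (auto simp: Ti)
  show ?R
    using absolutely_integrable_basis_iso[OF lin bb inn su conjunct1[OF L]] L by (simp add: Ti *)
qed

definition reindex_vec :: "('a \<Rightarrow> 'b) \<Rightarrow> 'c^'b::finite \<Rightarrow> 'c^'a::finite" where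
  "reindex_vec s x = (\<chi> i. x $ s i)"

lemma reindex_vec_iso:
  fixes s :: "'a::finite \<Rightarrow> 'b::finite"
  assumes s: "bij s"
  shows "linear (reindex_vec s :: real^'b \<Rightarrow> real^'a)" "bij_betw (reindex_vec s :: real^'b \<Rightarrow> real^'a) Basis Basis"
    "\<And>x y :: real^'b. reindex_vec s x \<bullet> reindex_vec s y = x \<bullet> y" "surj (reindex_vec s :: real^'b \<Rightarrow> real^'a)"
proof -
  show "linear (reindex_vec s :: real^'b \<Rightarrow> real^'a)"
    by (rule linearI) (auto simp: reindex_vec_def vec_eq_iff)
  have ax: "reindex_vec s (axis (s i) 1) = (axis i 1 :: real^'a)" for i
    using s by (auto simp: reindex_vec_def vec_eq_iff axis_def bij_def inj_eq)
  show "bij_betw (reindex_vec s :: real^'b \<Rightarrow> real^'a) Basis Basis"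
  proof (rule bij_betw_byWitness[where f'="reindex_vec (inv s)"])
    have r: "reindex_vec (inv s) (reindex_vec s x) = x" "reindex_vec s (reindex_vec (inv s) y) = y" for x :: "real^'b" and y :: "real^'a"
      using s by (auto simp: reindex_vec_def vec_eq_iff bij_def surj_f_inv_f)
    show "\<forall>a\<in>Basis. reindex_vec (inv s) (reindex_vec s a :: real^'a) = a"
      "\<forall>a\<in>Basis. reindex_vec s (reindex_vec (inv s) a :: real^'b) = a"
      using r by auto
    have ax': "reindex_vec s (axis j 1) = (axis (inv s j) 1 :: real^'a)" for j
      using ax[of "inv s j"] s by (simp add: bij_def surj_f_inv_f)
    then show "reindex_vec s ` (Basis :: (real^'b) set) \<subseteq> (Basis :: (real^'a) set)"
      by (auto simp: Basis_vec_def)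
    have "reindex_vec (inv s) (axis i 1) = (axis (s i) 1 :: real^'b)" for i
      using r(1)[of "axis (s i) 1"] ax by simp
    then show "reindex_vec (inv s) ` (Basis :: (real^'a) set) \<subseteq> (Basis :: (real^'b) set)"
      by (auto simp: Basis_vec_def)
  qed
  show "reindex_vec s x \<bullet> reindex_vec s y = x \<bullet> y" for x y :: "real^'b"
    unfolding inner_vec_def reindex_vec_def
    using sum.reindex_bij_betw[OF s, of "\<lambda>i. x $ i \<bullet> y $ i"] by simp
  show "surj (reindex_vec s :: real^'b \<Rightarrow> real^'a)"
    by (rule surjI[of _ "reindex_vec (inv s)"]) (use s in \<open>auto simp: reindex_vec_def vec_eq_iff bij_def inv_f_f\<close>)
qed

text \<open>Complex integrands are passed through this isomorphism to a change of variables formula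
  for integrands with values in real coordinate spaces.\<close>

definition complex_to_real2 :: "complex \<Rightarrow> real^2" where
  "complex_to_real2 z = vector [Re z, Im z]"

definition real2_to_complex :: "real^2 \<Rightarrow> complex" where
  "real2_to_complex v = Complex (v $ 1) (v $ 2)"

lemma real2_to_complex_inverse [simp]: "real2_to_complex (complex_to_real2 z) = z"
  by (simp add: real2_to_complex_def complex_to_real2_def)

lemma bounded_linear_complex_to_real2: "bounded_linear complex_to_real2"
  by (auto simp: linear_conv_bounded_linear[symmetric] complex_to_real2_def vec_eq_iff forall_2 intro!: linearI)

lemma bounded_linear_real2_to_complex: "bounded_linear real2_to_complex"
  by (auto simp: linear_conv_bounded_linear[symmetric] real2_to_complex_def complex_eq_iff intro!: linearI)

lemma absolutely_integrable_complex_to_real2: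
  fixes f :: "'a::euclidean_space \<Rightarrow> complex"
  shows "(\<lambda>x. complex_to_real2 (f x)) absolutely_integrable_on S \<and> integral S (\<lambda>x. complex_to_real2 (f x)) = complex_to_real2 b
    \<longleftrightarrow> f absolutely_integrable_on S \<and> integral S f = b" (is "?L \<longleftrightarrow> ?R")
proof
  assume ?R
  then show ?L
    using absolutely_integrable_linear[OF _ bounded_linear_complex_to_real2, of S f]
      integral_linear[OF _ bounded_linear_complex_to_real2, of f S]
    by (auto simp: o_def absolutely_integrable_on_def)
next
  assume ?L
  then show ?R
    using absolutely_integrable_linear[OF _ bounded_linear_real2_to_complex, of S "\<lambda>x. complex_to_real2 (f x)"]
      integral_linear[OF _ bounded_linear_real2_to_complex, of "\<lambda>x. complex_to_real2 (f x)" S]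
    by (auto simp: o_def absolutely_integrable_on_def)
qed

text \<open>Conjugation with the renamings \<open>?T\<close> and \<open>?U\<close> reduces the claim
  to well-ordered index types; by \<open>det_embed\<close> the Jacobian determinant does not notice
  the renaming.\<close>

theorem change_of_variables_real_vec:
  fixes f :: "real^'k::finite \<Rightarrow> complex" and g :: "real^'k \<Rightarrow> real^'k"
  assumes S: "S \<in> sets lebesgue"
    and der: "\<And>x. x \<in> S \<Longrightarrow> (g has_derivative g' x) (at x within S)"
    and inj: "inj_on g S"
  shows "(\<lambda>x. \<bar>det (matrix (g' x))\<bar> *\<^sub>R f (g x)) absolutely_integrable_on S \<and>
           integral S (\<lambda>x. \<bar>det (matrix (g' x))\<bar> *\<^sub>R f (g x)) = b
     \<longleftrightarrow> f absolutely_integrable_on (g ` S) \<and> integral (g ` S) f = b"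
proof -
  let ?T = "reindex_vec Abs_wo :: real^'k wo \<Rightarrow> real^'k"
  let ?U = "reindex_vec Rep_wo :: real^'k \<Rightarrow> real^'k wo"
  have bA: "bij (Abs_wo :: 'k \<Rightarrow> 'k wo)"
    by (metis Abs_wo_inverse Rep_wo_inverse UNIV_I bijI')
  note iT = reindex_vec_iso[OF bA] and iU = reindex_vec_iso[OF bij_Rep_wo[where 'a='k]]
  have TU: "?T (?U y) = y" "?U (?T x) = x" for x y
    by (auto simp: reindex_vec_def vec_eq_iff Abs_wo_inverse Rep_wo_inverse)
  define S' where "S' = ?T -` S"
  have S'U: "S' = ?U ` S" unfolding S'_def using image_eq_vimage_inverse[of ?T ?U S, OF TU] by simp
  have S': "S' \<in> sets lebesgue"
    unfolding S'_def using measurable_sets[OF lebesgue_basis_iso(2)[OF iT] S] by simp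
  define h where "h = (\<lambda>x. ?U (g (?T x)))"
  define h' where "h' = (\<lambda>x v. ?U (g' (?T x) (?T v)))"
  have blT: "bounded_linear ?T" and blU: "bounded_linear ?U"
    using iT(1) iU(1) by (auto simp: linear_conv_bounded_linear)
  have derh: "(h has_derivative h' x) (at x within S')" if "x \<in> S'" for x
  proof -
    have 1: "(g has_derivative g' (?T x)) (at (?T x) within ?T ` S')"
      using der[of "?T x"] that by (auto simp: S'_def intro: has_derivative_subset)
    have "(g \<circ> ?T has_derivative g' (?T x) \<circ> ?T) (at x within S')"
      by (rule diff_chain_within[OF bounded_linear_imp_has_derivative[OF blT] 1])
    from bounded_linear.has_derivative[OF blU this] show ?thesis by (simp add: h_def h'_def o_def)
  qed
  have injh: "inj_on h S'"
    using inj by (auto simp: inj_on_def h_def S'_def) (metis TU)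
  have deth: "det (matrix (h' x)) = det (matrix (g' (?T x)))" if "x \<in> S'" for x
  proof (rule det_embed[of Abs_wo])
    show "inj (Abs_wo :: 'k \<Rightarrow> 'k wo)" using bA by (rule bij_is_inj)
    have "?T (axis (Abs_wo j) 1) = axis j 1" for j
      by (auto simp: reindex_vec_def vec_eq_iff axis_def Abs_wo_inject)
    then show "matrix (h' x) $ Abs_wo i $ Abs_wo j = matrix (g' (?T x)) $ i $ j" for i j
      by (simp add: matrix_def h'_def reindex_vec_def[of Rep_wo] Abs_wo_inverse)
    show "i \<notin> range (Abs_wo::'k \<Rightarrow> 'k wo) \<Longrightarrow> matrix (h' x) $ i $ j = of_bool (i = j)" for i j
      using bA by (auto simp: bij_def)
  qed
  have him: "h ` S' = ?T -` (g ` S)"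
  proof -
    have "h ` S' = ?U ` g ` S" unfolding S'U h_def by (auto simp: TU image_iff)
    also have "\<dots> = ?T -` (g ` S)" by (rule image_eq_vimage_inverse[OF TU])
    finally show ?thesis .
  qed
  have "(\<lambda>x. \<bar>det (matrix (g' x))\<bar> *\<^sub>R f (g x)) absolutely_integrable_on S \<and>
           integral S (\<lambda>x. \<bar>det (matrix (g' x))\<bar> *\<^sub>R f (g x)) = b
     \<longleftrightarrow> (\<lambda>x. \<bar>det (matrix (g' (?T x)))\<bar> *\<^sub>R f (g (?T x))) absolutely_integrable_on S' \<and>
           integral S' (\<lambda>x. \<bar>det (matrix (g' (?T x)))\<bar> *\<^sub>R f (g (?T x))) = b"
    unfolding S'_def by (rule absolutely_integrable_basis_iso_iff[OF iT, symmetric])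
  also have "\<dots> \<longleftrightarrow> (\<lambda>x. \<bar>det (matrix (h' x))\<bar> *\<^sub>R f (?T (h x))) absolutely_integrable_on S' \<and>
           integral S' (\<lambda>x. \<bar>det (matrix (h' x))\<bar> *\<^sub>R f (?T (h x))) = b"
    using deth by (intro arg_cong2[where f="(\<and>)"] arg_cong2[where f="(=)"] refl integral_cong set_integrable_cong)
      (auto simp: h_def TU)
  also have "\<dots> \<longleftrightarrow> (\<lambda>x. \<bar>det (matrix (h' x))\<bar> *\<^sub>R complex_to_real2 (f (?T (h x)))) absolutely_integrable_on S' \<and>
           integral S' (\<lambda>x. \<bar>det (matrix (h' x))\<bar> *\<^sub>R complex_to_real2 (f (?T (h x)))) = complex_to_real2 b"
    by (subst absolutely_integrable_complex_to_real2[symmetric])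
       (simp add: linear_cmul[OF bounded_linear.linear[OF bounded_linear_complex_to_real2]])
  also have "\<dots> \<longleftrightarrow> (\<lambda>x. complex_to_real2 (f (?T x))) absolutely_integrable_on (h ` S') \<and>
           integral (h ` S') (\<lambda>x. complex_to_real2 (f (?T x))) = complex_to_real2 b"
    by (rule has_absolute_integral_change_of_variables[OF S' derh injh])
  also have "\<dots> \<longleftrightarrow> (\<lambda>x. f (?T x)) absolutely_integrable_on (h ` S') \<and>
           integral (h ` S') (\<lambda>x. f (?T x)) = b"
    by (rule absolutely_integrable_complex_to_real2)
  also have "\<dots> \<longleftrightarrow> f absolutely_integrable_on (g ` S) \<and> integral (g ` S) f = b"
    unfolding him by (rule absolutely_integrable_basis_iso_iff[OF iT])
  finally show ?thesis .
qed

definition realify :: "real^('n+'n) \<Rightarrow> complex^'n::finite" where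
  "realify x = (\<chi> i. Complex (x $ Inl i) (x $ Inr i))"

definition realify_inv :: "complex^'n \<Rightarrow> real^('n::finite+'n)" where
  "realify_inv z = (\<chi> i. case i of Inl a \<Rightarrow> Re (z $ a) | Inr a \<Rightarrow> Im (z $ a))"

lemma realify_realify_inv [simp]: "realify (realify_inv z) = z" "realify_inv (realify x) = x"
  by (auto simp: realify_def realify_inv_def vec_eq_iff split: sum.split)

lemma realify_axis: "realify (axis (Inl a) 1) = axis a 1" "realify (axis (Inr a) 1) = axis a \<i>"
  by (auto simp: realify_def vec_eq_iff axis_def complex_eq_iff)

lemma realify_iso:
  shows "linear (realify :: _ \<Rightarrow> complex^'n::finite)" "bij_betw (realify :: _ \<Rightarrow> complex^'n) Basis Basis"
    "\<And>x y. (realify x :: complex^'n) \<bullet> realify y = x \<bullet> y" "surj (realify :: _ \<Rightarrow> complex^'n)"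
proof -
  show "linear (realify :: _ \<Rightarrow> complex^'n::finite)"
    by (rule linearI) (auto simp: realify_def vec_eq_iff complex_eq_iff)
  have ax': "realify_inv (axis a 1 :: complex^'n) = axis (Inl a) 1" "realify_inv (axis a \<i> :: complex^'n) = axis (Inr a) 1" for a
    by (metis realify_axis realify_realify_inv(2))+
  show "bij_betw (realify :: _ \<Rightarrow> complex^'n) Basis Basis"
  proof (rule bij_betw_byWitness[where f'=realify_inv])
    show "realify ` Basis \<subseteq> (Basis :: (complex^'n) set)"
    proof
      fix y :: "complex^'n" assume "y \<in> realify ` Basis"
      then obtain i where "y = realify (axis i 1)" by (auto simp: Basis_vec_def)
      then show "y \<in> Basis" by (cases i) (auto simp: realify_axis Basis_vec_def Basis_complex_def)
    qed
    show "realify_inv ` (Basis :: (complex^'n) set) \<subseteq> Basis"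
      by (auto simp: Basis_vec_def Basis_complex_def ax')
  qed auto
  show "(realify x :: complex^'n) \<bullet> realify y = x \<bullet> y" for x y
    by (simp add: inner_vec_def sum_UNIV_Plus realify_def inner_complex_def sum.distrib)
  show "surj (realify :: _ \<Rightarrow> complex^'n)" by (metis realify_realify_inv(1) surjI)
qed

text \<open>The real Jacobian of a complex differentiable map is |det A|^2, by
  \<open>det_realification\<close>. This is why \<open>h * cnj J\<close> is transported by P like
  the density h / J.\<close>

theorem change_of_variables_complex_vec:
  fixes f :: "complex^'n::finite \<Rightarrow> complex" and g :: "complex^'n \<Rightarrow> complex^'n" and A :: "complex^'n \<Rightarrow> complex^'n^'n"
  assumes S: "S \<in> sets lebesgue"
    and der: "\<And>x. x \<in> S \<Longrightarrow> (g has_derivative (*v) (A x)) (at x within S)"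
    and inj: "inj_on g S"
  shows "(\<lambda>x. (cmod (det (A x)))\<^sup>2 *\<^sub>R f (g x)) absolutely_integrable_on S \<and>
           integral S (\<lambda>x. (cmod (det (A x)))\<^sup>2 *\<^sub>R f (g x)) = b
     \<longleftrightarrow> f absolutely_integrable_on (g ` S) \<and> integral (g ` S) f = b"
proof -
  let ?T = "realify :: _ \<Rightarrow> complex^'n"
  let ?U = "realify_inv :: complex^'n \<Rightarrow> _"
  define S' where "S' = ?T -` S"
  have S'U: "S' = ?U ` S" unfolding S'_def using image_eq_vimage_inverse[of ?T ?U S] by simp
  have S': "S' \<in> sets lebesgue"
    unfolding S'_def using measurable_sets[OF lebesgue_basis_iso(2)[OF realify_iso] S] by simp
  define h where "h = (\<lambda>x. ?U (g (?T x)))"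
  define h' where "h' = (\<lambda>x v. ?U (A (?T x) *v ?T v))"
  have "linear ?U" by (rule linearI) (auto simp: realify_inv_def vec_eq_iff split: sum.split)
  then have blU: "bounded_linear ?U" and blT: "bounded_linear ?T"
    using realify_iso(1) by (auto simp: linear_conv_bounded_linear)
  have derh: "(h has_derivative h' x) (at x within S')" if "x \<in> S'" for x
  proof -
    have 1: "(g has_derivative (*v) (A (?T x))) (at (?T x) within ?T ` S')"
      using der[of "?T x"] that by (auto simp: S'_def intro: has_derivative_subset)
    have "(g \<circ> ?T has_derivative (*v) (A (?T x)) \<circ> ?T) (at x within S')"
      by (rule diff_chain_within[OF bounded_linear_imp_has_derivative[OF blT] 1])
    from bounded_linear.has_derivative[OF blU this] show ?thesis by (simp add: h_def h'_def o_def)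
  qed
  have injh: "inj_on h S'"
    using inj by (auto simp: inj_on_def h_def S'_def) (metis realify_realify_inv)
  have mv: "(M *v axis b c) $ a = M $ a $ b * c" for M :: "complex^'n^'n" and a b c
    by (simp add: matrix_vector_mult_def axis_def if_distrib cong: if_cong)
  have deth: "det (matrix (h' x)) = (cmod (det (A (?T x))))\<^sup>2" for x
    by (rule det_realification)
       (simp_all add: matrix_def h'_def realify_axis mv, simp_all add: realify_inv_def mv)
  have him: "h ` S' = ?T -` (g ` S)"
  proof -
    have "h ` S' = ?U ` g ` S" unfolding S'U h_def by (auto simp: image_iff)
    also have "\<dots> = ?T -` (g ` S)" by (rule image_eq_vimage_inverse) auto
    finally show ?thesis .
  qed
  have "(\<lambda>x. (cmod (det (A x)))\<^sup>2 *\<^sub>R f (g x)) absolutely_integrable_on S \<and>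
           integral S (\<lambda>x. (cmod (det (A x)))\<^sup>2 *\<^sub>R f (g x)) = b
    \<longleftrightarrow> (\<lambda>x. \<bar>det (matrix (h' x))\<bar> *\<^sub>R f (?T (h x))) absolutely_integrable_on S' \<and>
           integral S' (\<lambda>x. \<bar>det (matrix (h' x))\<bar> *\<^sub>R f (?T (h x))) = b"
    unfolding S'_def h_def deth
    by (subst absolutely_integrable_basis_iso_iff[OF realify_iso, symmetric]) simp
  also have "\<dots> \<longleftrightarrow> (\<lambda>x. f (?T x)) absolutely_integrable_on (h ` S') \<and>
           integral (h ` S') (\<lambda>x. f (?T x)) = b"
    by (rule change_of_variables_real_vec[OF S' derh injh])
  also have "\<dots> \<longleftrightarrow> f absolutely_integrable_on (g ` S) \<and> integral (g ` S) f = b"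
    unfolding him by (rule absolutely_integrable_basis_iso_iff[OF realify_iso])
  finally show ?thesis .
qed

section \<open>Polynomial functions, Jacobians and cofactors\<close>

text \<open>A class of functions closed under partial derivatives, determinants and translations, so
  that Jacobians and perturbed maps are formed without computing with coefficients.\<close>

inductive polyfun :: "(complex^'n::finite \<Rightarrow> complex) \<Rightarrow> bool" where
  const: "polyfun (\<lambda>x. c)"
| coord: "polyfun (\<lambda>x. x $ i)"
| add: "polyfun f \<Longrightarrow> polyfun g \<Longrightarrow> polyfun (\<lambda>x. f x + g x)"
| mult: "polyfun f \<Longrightarrow> polyfun g \<Longrightarrow> polyfun (\<lambda>x. f x * g x)"

text \<open>The real Frechet derivative evaluated at a unit vector. For polynomial functions that
  derivative is complex linear, so these values determine it
  (\<open>polyfun_has_derivative\<close>).\<close>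

definition pd :: "'n \<Rightarrow> (complex^'n::finite \<Rightarrow> complex) \<Rightarrow> complex^'n \<Rightarrow> complex" where
  "pd l f x = frechet_derivative f (at x) (axis l 1)"

lemma sum_axis [simp]: "(\<Sum>l\<in>UNIV. c l * axis m (z::complex) $ l) = c m * z"
  by (simp add: axis_def if_distrib cong: if_cong)

lemma pd_unique:
  assumes "\<And>x. (f has_derivative (\<lambda>v. \<Sum>l\<in>UNIV. g l x * v $ l)) (at x)"
  shows "pd m f = g m"
proof
  fix x show "pd m f x = g m x"
    unfolding pd_def frechet_derivative_at[OF assms, symmetric] by simp
qed

lemma polyfun_exists_derivative:
  assumes "polyfun f"
  shows "\<exists>g. (\<forall>x. (f has_derivative (\<lambda>v. \<Sum>l\<in>UNIV. g l x * v $ l)) (at x)) \<and> (\<forall>l. polyfun (g l))"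
  using assms
proof induction
  case (const c)
  show ?case by (intro exI[of _ "\<lambda>l x. 0"] conjI allI polyfun.const) simp
next
  case (coord i)
  have "((\<lambda>x. x $ i) has_derivative (\<lambda>v. \<Sum>l\<in>UNIV. of_bool (l = i) * v $ l)) (at x)" for x :: "complex^'a"
    by (simp add: of_bool_def if_distrib[of "\<lambda>x. x * _"] bounded_linear_imp_has_derivative bounded_linear_vec_nth cong: if_cong)
  then show ?case by (intro exI[of _ "\<lambda>l x. of_bool (l = i)"] conjI allI polyfun.const)
next
  case (add f g)
  then obtain f' g' where f: "\<And>x. (f has_derivative (\<lambda>v. \<Sum>l\<in>UNIV. f' l x * v $ l)) (at x)" "\<And>l. polyfun (f' l)"
    and g: "\<And>x. (g has_derivative (\<lambda>v. \<Sum>l\<in>UNIV. g' l x * v $ l)) (at x)" "\<And>l. polyfun (g' l)"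
    by blast
  show ?case
    using has_derivative_add[OF f(1) g(1)] f(2) g(2)
    by (intro exI[of _ "\<lambda>l x. f' l x + g' l x"] conjI allI polyfun.add)
       (simp_all add: sum.distrib ring_distribs)
next
  case (mult f g)
  then obtain f' g' where f: "\<And>x. (f has_derivative (\<lambda>v. \<Sum>l\<in>UNIV. f' l x * v $ l)) (at x)" "\<And>l. polyfun (f' l)"
    and g: "\<And>x. (g has_derivative (\<lambda>v. \<Sum>l\<in>UNIV. g' l x * v $ l)) (at x)" "\<And>l. polyfun (g' l)"
    by blast
  show ?case
    using has_derivative_mult[OF f(1) g(1)] f(2) g(2) mult.hyps
    by (intro exI[of _ "\<lambda>l x. f x * g' l x + f' l x * g x"] conjI allI polyfun.add polyfun.mult)
       (simp_all add: sum.distrib ring_distribs sum_distrib_left sum_distrib_right mult_ac)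
qed

lemma polyfun_has_derivative:
  assumes "polyfun f"
  shows "(f has_derivative (\<lambda>v. \<Sum>l\<in>UNIV. pd l f x * v $ l)) (at x)"
proof -
  obtain g where g: "\<And>x. (f has_derivative (\<lambda>v. \<Sum>l\<in>UNIV. g l x * v $ l)) (at x)"
    using polyfun_exists_derivative[OF assms] by blast
  show ?thesis using g pd_unique[OF g] by simp
qed

lemma polyfun_pd:
  assumes "polyfun f"
  shows "polyfun (pd l f)"
proof -
  obtain g where g: "\<And>x. (f has_derivative (\<lambda>v. \<Sum>l\<in>UNIV. g l x * v $ l)) (at x)" "\<And>l. polyfun (g l)"
    using polyfun_exists_derivative[OF assms] by blast
  show ?thesis using g(2) pd_unique[OF g(1)] by simp
qed

lemma pd_const [simp]: "pd l (\<lambda>x. c) = (\<lambda>x. 0)"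
  by (rule pd_unique) simp

lemma pd_coord: "pd l (\<lambda>x. x $ i) = (\<lambda>x. of_bool (l = i))"
  by (rule pd_unique)
     (simp add: of_bool_def if_distrib[of "\<lambda>x. x * _"] bounded_linear_imp_has_derivative bounded_linear_vec_nth cong: if_cong)

lemma pd_add: "polyfun f \<Longrightarrow> polyfun g \<Longrightarrow> pd l (\<lambda>x. f x + g x) = (\<lambda>x. pd l f x + pd l g x)"
  by (rule pd_unique) (use has_derivative_add[OF polyfun_has_derivative polyfun_has_derivative] in
     \<open>simp add: sum.distrib ring_distribs\<close>)

lemma pd_mult: "polyfun f \<Longrightarrow> polyfun g \<Longrightarrow> pd l (\<lambda>x. f x * g x) = (\<lambda>x. f x * pd l g x + pd l f x * g x)"
  by (rule pd_unique) (use has_derivative_mult[OF polyfun_has_derivative polyfun_has_derivative, of f g] in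
     \<open>simp add: sum.distrib ring_distribs sum_distrib_left sum_distrib_right mult_ac\<close>)

lemma pd_commute: "polyfun f \<Longrightarrow> pd k (pd l f) = pd l (pd k f)"
proof (induction rule: polyfun.induct)
  case (mult f g)
  then show ?case
    by (simp add: pd_mult pd_add polyfun_pd polyfun.mult fun_eq_iff algebra_simps)
qed (auto simp: pd_coord pd_add polyfun_pd)

lemma polyfun_sum: "(\<And>i. i \<in> I \<Longrightarrow> polyfun (f i)) \<Longrightarrow> polyfun (\<lambda>x. \<Sum>i\<in>I. f i x)"
  by (induction I rule: infinite_finite_induct) (simp_all add: polyfun.intros)

lemma polyfun_prod: "(\<And>i. i \<in> I \<Longrightarrow> polyfun (f i)) \<Longrightarrow> polyfun (\<lambda>x. \<Prod>i\<in>I. f i x)"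
  by (induction I rule: infinite_finite_induct) (simp_all add: polyfun.intros)

lemma polyfun_power: "polyfun f \<Longrightarrow> polyfun (\<lambda>x. f x ^ m)"
  by (induction m) (simp_all add: polyfun.intros)

lemma polyfun_diff: "polyfun f \<Longrightarrow> polyfun g \<Longrightarrow> polyfun (\<lambda>x. f x - g x)"
  using polyfun.add[OF _ polyfun.mult[OF polyfun.const[of "-1"]], of f g] by simp

lemma polyfun_det: "(\<And>i j. polyfun (M i j)) \<Longrightarrow> polyfun (\<lambda>x. det (\<chi> i j. M i j x))"
  by (auto simp: det_def intro!: polyfun_sum polyfun.mult polyfun.const polyfun_prod)

lemma polyfun_peval: "polyfun (\<lambda>x. peval p (($) x))"
  unfolding peval_def mi_power_def
  by (intro polyfun_sum polyfun.mult polyfun.const polyfun_prod polyfun_power polyfun.coord)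

lemma polyfun_mi_power: "polyfun (\<lambda>x. mi_power (($) x) m)"
  unfolding mi_power_def by (intro polyfun_prod polyfun_power polyfun.coord)

lemma pd_sum: "finite I \<Longrightarrow> (\<And>i. i \<in> I \<Longrightarrow> polyfun (f i)) \<Longrightarrow> pd l (\<lambda>x. \<Sum>i\<in>I. f i x) = (\<lambda>x. \<Sum>i\<in>I. pd l (f i) x)"
  by (induction I rule: finite_induct) (auto simp: pd_add polyfun_sum)

lemma pd_cmult: "polyfun f \<Longrightarrow> pd l (\<lambda>x. c * f x) = (\<lambda>x. c * pd l f x)"
  by (subst pd_mult) (auto intro: polyfun.const)

lemma pd_prod:
  "finite I \<Longrightarrow> (\<And>i. i \<in> I \<Longrightarrow> polyfun (f i)) \<Longrightarrow>
    pd l (\<lambda>x. \<Prod>i\<in>I. f i x) = (\<lambda>x. \<Sum>i\<in>I. pd l (f i) x * (\<Prod>j\<in>I-{i}. f j x))"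
proof (induction I rule: finite_induct)
  case (insert a I)
  have "(\<Sum>i\<in>I. pd l (f i) x * (\<Prod>j\<in>insert a I-{i}. f j x)) = f a x * (\<Sum>i\<in>I. pd l (f i) x * (\<Prod>j\<in>I-{i}. f j x))" for x
    unfolding sum_distrib_left
  proof (rule sum.cong[OF refl])
    fix i assume "i \<in> I"
    then have "insert a I - {i} = insert a (I - {i})" using insert.hyps by auto
    then show "pd l (f i) x * (\<Prod>j\<in>insert a I-{i}. f j x) = f a x * (pd l (f i) x * (\<Prod>j\<in>I-{i}. f j x))"
      using insert.hyps by simp
  qed
  then show ?case using insert by (simp add: pd_mult polyfun_prod algebra_simps)
qed simp

lemma continuous_on_polyfun:
  assumes "polyfun f" shows "continuous_on S f"
  by (rule has_derivative_continuous_on[OF has_derivative_at_withinI[OF polyfun_has_derivative[OF assms]]])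

definition jmat :: "('n \<Rightarrow> complex^'n \<Rightarrow> complex) \<Rightarrow> complex^'n \<Rightarrow> complex^'n^'n::finite" where
  "jmat P x = (\<chi> j l. pd l (P j) x)"

definition jac :: "('n \<Rightarrow> complex^'n \<Rightarrow> complex) \<Rightarrow> complex^'n::finite \<Rightarrow> complex" where
  "jac P x = det (jmat P x)"

text \<open>The signed minor of the Jacobian matrix for row k and column l, taken as the part of the
  Leibniz sum with p k = l. Keeping the sum over all permutations makes the sign-reversing
  involution of \<open>sum_pd_cofac\<close> available.\<close>

definition cofac :: "('n \<Rightarrow> complex^'n \<Rightarrow> complex) \<Rightarrow> 'n \<Rightarrow> 'n \<Rightarrow> complex^'n::finite \<Rightarrow> complex" where
  "cofac P k l x = (\<Sum>p | p permutes UNIV. of_int (sign p) * of_bool (p k = l) * (\<Prod>i\<in>UNIV-{k}. pd (p i) (P i) x))"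

lemma polyfun_jac: "(\<And>j. polyfun (P j)) \<Longrightarrow> polyfun (jac P)"
  unfolding jac_def[abs_def] jmat_def by (intro polyfun_det polyfun_pd)

lemma polyfun_cofac: "(\<And>j. polyfun (P j)) \<Longrightarrow> polyfun (cofac P k l)"
  unfolding cofac_def[abs_def]
  by (intro polyfun_sum polyfun.mult polyfun_prod polyfun_pd polyfun.const)

text \<open>Expansion along row k of the Jacobian determinant whose row k has been replaced by row
  j; if j differs from k, two rows coincide.\<close>

lemma sum_cofac: "(\<Sum>l\<in>UNIV. cofac P k l x * pd l (P j) x) = (if j = k then jac P x else 0)"
proof -
  let ?M = "(\<chi> i l. if i = k then pd l (P j) x else pd l (P i) x)"
  have "(\<Sum>l\<in>UNIV. cofac P k l x * pd l (P j) x) =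
     (\<Sum>p | p permutes UNIV. \<Sum>l\<in>UNIV. of_int (sign p) * of_bool (p k = l) * (\<Prod>i\<in>UNIV-{k}. pd (p i) (P i) x) * pd l (P j) x)"
    unfolding cofac_def sum_distrib_right by (rule sum.swap)
  also have "\<dots> = (\<Sum>p | p permutes UNIV. of_int (sign p) * (pd (p k) (P j) x * (\<Prod>i\<in>UNIV-{k}. pd (p i) (P i) x)))"
    by (intro sum.cong refl) (simp add: of_bool_def if_distrib[of "\<lambda>x. x * _"] if_distrib[of "\<lambda>x. _ * x"] mult_ac cong: if_cong)
  also have "\<dots> = det ?M"
    unfolding det_def
    by (intro sum.cong refl arg_cong2[where f="(*)"])
       (subst (2) prod.remove[where x=k], auto intro!: arg_cong2[where f="(*)"] prod.cong)
  also have "\<dots> = (if j = k then jac P x else 0)"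
  proof (cases "j = k")
    case True
    then have "?M = jmat P x" by (auto simp: jmat_def vec_eq_iff)
    then show ?thesis using True by (simp add: jac_def)
  next
    case False
    then have "det ?M = 0"
      by (intro det_identical_rows[of j k]) (auto simp: row_def vec_eq_iff)
    then show ?thesis using False by simp
  qed
  finally show ?thesis .
qed

text \<open>The rows of the cofactor matrix are divergence free (Piola's identity): composing a permutation
  with the transposition of \<open>i\<close> and \<open>k\<close> changes the sign of the corresponding summand.\<close>

lemma sum_pd_cofac:
  assumes P: "\<And>j. polyfun (P j)"
  shows "(\<Sum>l\<in>UNIV. pd l (cofac P k l) x) = 0"
proof -
  let ?t = "\<lambda>p i. pd (p k) (pd (p i) (P i)) x * (\<Prod>j\<in>UNIV-{k}-{i}. pd (p j) (P j) x)"
  have "pd l (cofac P k l) x = (\<Sum>p | p permutes UNIV. of_int (sign p) * of_bool (p k = l) *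
      (\<Sum>i\<in>UNIV-{k}. pd l (pd (p i) (P i)) x * (\<Prod>j\<in>UNIV-{k}-{i}. pd (p j) (P j) x)))" for l
    unfolding cofac_def[abs_def]
    using P by (simp add: pd_sum pd_cmult pd_prod polyfun_pd polyfun_prod polyfun.mult polyfun.const)
  then have "(\<Sum>l\<in>UNIV. pd l (cofac P k l) x) =
    (\<Sum>p | p permutes UNIV. \<Sum>l\<in>UNIV. of_int (sign p) * of_bool (p k = l) *
      (\<Sum>i\<in>UNIV-{k}. pd l (pd (p i) (P i)) x * (\<Prod>j\<in>UNIV-{k}-{i}. pd (p j) (P j) x)))"
    by simp (rule sum.swap)
  also have "\<dots> = (\<Sum>p | p permutes UNIV. of_int (sign p) * (\<Sum>i\<in>UNIV-{k}. ?t p i))"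
    by (intro sum.cong refl) (simp add: of_bool_def if_distrib[of "\<lambda>x. x * _"] if_distrib[of "\<lambda>x. _ * x"] cong: if_cong)
  also have "\<dots> = (\<Sum>i\<in>UNIV-{k}. \<Sum>p | p permutes UNIV. of_int (sign p) * ?t p i)"
    unfolding sum_distrib_left by (rule sum.swap)
  also have "\<dots> = 0"
  proof (rule sum.neutral, intro ballI)
    fix i assume i: "i \<in> UNIV - {k}"
    let ?\<tau> = "Transposition.transpose i k"
    let ?S = "\<Sum>p | p permutes UNIV. of_int (sign p) * ?t p i"
    have "?S = (\<Sum>p | p permutes UNIV. of_int (sign (p \<circ> ?\<tau>)) * ?t (p \<circ> ?\<tau>) i)"
      by (rule sum.reindex_bij_witness[where i="\<lambda>p. p \<circ> ?\<tau>" and j="\<lambda>p. p \<circ> ?\<tau>"])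
        (auto simp: o_assoc[symmetric] intro: permutes_compose[OF permutes_swap_id])
    also have "\<dots> = (\<Sum>p | p permutes UNIV. - (of_int (sign p) * ?t p i))"
    proof (rule sum.cong[OF refl])
      fix p assume "p \<in> {p. p permutes (UNIV::'a set)}"
      then have p: "p permutes UNIV" by simp
      have s: "sign (p \<circ> ?\<tau>) = - sign p"
        using i p by (subst sign_compose) (auto simp: sign_swap_id permutation_swap_id permutation_permutes permutes_swap_id intro!: exI[of _ UNIV])
      have "(\<Prod>j\<in>UNIV-{k}-{i}. pd ((p \<circ> ?\<tau>) j) (P j) x) = (\<Prod>j\<in>UNIV-{k}-{i}. pd (p j) (P j) x)"
        by (intro prod.cong refl) (auto simp: Transposition.transpose_def)
      then have "?t (p \<circ> ?\<tau>) i = ?t p i"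
        using pd_commute[OF P, of "p i" "p k" i] by (simp add: o_def)
      with s show "of_int (sign (p \<circ> ?\<tau>)) * ?t (p \<circ> ?\<tau>) i = - (of_int (sign p) * ?t p i)" by simp
    qed
    also have "\<dots> = - ?S" by (rule sum_negf)
    finally show "?S = 0" by (metis (no_types, lifting) add.inverse_neutral eq_neg_iff_add_eq_0 mult_2 no_zero_divisors zero_neq_numeral)
  qed
  finally show ?thesis .
qed

section \<open>Stokes' theorem for the conjugated Jacobian form\<close>

text \<open>Difference quotients along v integrate to zero by translation invariance. The mean value
  inequality bounds them uniformly and their supports lie in one ball, so dominated convergence
  carries the zero over to the derivative.\<close>

lemma integral_directional_derivative_zero:
  fixes g :: "'a::euclidean_space \<Rightarrow> complex"
  assumes der: "\<And>x. (g has_derivative g' x) (at x)"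
    and cont: "continuous_on UNIV (\<lambda>x. g' x v)"
    and C: "compact C" "\<And>x. x \<notin> C \<Longrightarrow> g x = 0"
  shows "integrable lborel (\<lambda>x. g' x v)" and "integral\<^sup>L lborel (\<lambda>x. g' x v) = 0"
proof -
  have g'0: "g' x v = 0" if "x \<notin> C" for x
  proof -
    have "open (- C)" using C(1) by (simp add: compact_imp_closed open_Compl)
    then have "((\<lambda>x. 0) has_derivative g' x) (at x)"
      by (rule has_derivative_transform_within_open[OF der]) (use that C in auto)
    then have "g' x = (\<lambda>v. 0)" using has_derivative_unique has_derivative_const by blast
    then show ?thesis by simp
  qed
  obtain B where "\<And>x. x \<in> C \<Longrightarrow> norm x \<le> B" using compact_imp_bounded[OF C(1)] unfolding bounded_iff by blast
  then have B: "C \<subseteq> cball 0 B" by auto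
  have "compact ((\<lambda>x. g' x v) ` C)" by (rule compact_continuous_image[OF continuous_on_subset[OF cont] C(1)]) simp
  from compact_imp_bounded[OF this] obtain M where "\<forall>y\<in>(\<lambda>x. g' x v) ` C. norm y \<le> M"
    unfolding bounded_iff by blast
  then have "\<And>x. x \<in> C \<Longrightarrow> norm (g' x v) \<le> M" by simp
  then have M: "norm (g' x v) \<le> max M 0" for x
    using g'0[of x] by (cases "x \<in> C") (auto simp: le_max_iff_disj)
  have contg: "continuous_on UNIV g"
    using der by (meson differentiable_at_withinI differentiable_def differentiable_imp_continuous_on differentiable_on_def)
  let ?h = "\<lambda>n x. (real (Suc n)) *\<^sub>R (g (x + v /\<^sub>R real (Suc n)) - g x)"
  \<comment> \<open>This ball contains C and all its translates by vectors of length at most norm v,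
    hence the supports of all difference quotients.\<close>
  let ?K = "cball (0::'a) (B + norm v)"
  have int_g: "integrable lborel g"
  proof -
    have "integrable lborel (\<lambda>x. indicator C x *\<^sub>R g x)"
      using borel_integrable_compact[OF C(1) continuous_on_subset[OF contg]] by simp
    also have "(\<lambda>x. indicator C x *\<^sub>R g x) = g" using C by (auto simp: fun_eq_iff indicator_def)
    finally show ?thesis .
  qed
  have shift: "integrable lborel (\<lambda>x. g (x + t)) \<and> integral\<^sup>L lborel (\<lambda>x. g (x + t)) = integral\<^sup>L lborel g" for t
  proof -
    have m: "g \<in> borel_measurable borel" using contg by (rule borel_measurable_continuous_onI)
    have "integrable (distr lborel borel ((+) t)) g" using int_g by (simp add: lborel_distr_plus)
    then have "integrable lborel (\<lambda>x. g (t + x))" by (subst (asm) integrable_distr_eq) (use m in auto)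
    moreover have "integral\<^sup>L (distr lborel borel ((+) t)) g = integral\<^sup>L lborel (\<lambda>x. g (t + x))"
      by (rule integral_distr) (use m in auto)
    ultimately show ?thesis by (simp add: lborel_distr_plus add.commute)
  qed
  have hzero: "integral\<^sup>L lborel (?h n) = 0" for n
    using shift[of "v /\<^sub>R real (Suc n)"] int_g by (simp add: Bochner_Integration.integral_diff)
  have bound: "norm (?h n x) \<le> indicator ?K x * max M 0" for n x
  proof (cases "x \<in> ?K")
    case True
    let ?\<phi> = "\<lambda>s::real. g (x + s *\<^sub>R v)"
    have "norm (?\<phi> (1 / real (Suc n)) - ?\<phi> 0) \<le> max M 0 * norm (1 / real (Suc n) - 0)"
    proof (rule differentiable_bound[where S="UNIV" and f'="\<lambda>s t. t *\<^sub>R g' (x + s *\<^sub>R v) v"])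
      fix s :: real
      have lin: "linear (g' (x + s *\<^sub>R v))" using der by (rule has_derivative_linear)
      have "((\<lambda>s. x + s *\<^sub>R v) has_derivative (\<lambda>t. t *\<^sub>R v)) (at s)" by (auto intro!: derivative_eq_intros)
      from diff_chain_at[OF this der]
      show "(?\<phi> has_derivative (\<lambda>t. t *\<^sub>R g' (x + s *\<^sub>R v) v)) (at s within UNIV)"
        by (simp add: o_def linear_cmul[OF lin])
      show "onorm (\<lambda>t. t *\<^sub>R g' (x + s *\<^sub>R v) v) \<le> max M 0"
        using M[of "x + s *\<^sub>R v"] by (intro onorm_le) (metis norm_scaleR mult.commute mult_right_mono norm_ge_zero real_norm_def)
    qed auto
    also have "?\<phi> (1 / real (Suc n)) = g (x + v /\<^sub>R real (Suc n))" by (simp add: divide_inverse)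
    finally have "norm (g (x + v /\<^sub>R real (Suc n)) - g x) \<le> max M 0 / real (Suc n)" by simp
    then have "norm (?h n x) \<le> real (Suc n) * (max M 0 / real (Suc n))"
      unfolding norm_scaleR by (intro mult_mono) auto
    then show ?thesis using True by simp
  next
    case False
    have "norm (v /\<^sub>R real (Suc n)) \<le> norm v"
      by (simp add: divide_simps algebra_simps)
    then have "norm x \<le> norm (x + v /\<^sub>R real (Suc n)) + norm v"
      by (smt (verit) norm_triangle_ineq4 add_diff_cancel_right')
    then have "x + v /\<^sub>R real (Suc n) \<notin> C" using False B by fastforce
    moreover have "x \<notin> C" using False B by (auto simp: subset_iff) (smt (verit) norm_ge_zero)
    ultimately show ?thesis using C False by simp
  qed
  have lim: "(\<lambda>n. ?h n x) \<longlonglongrightarrow> g' x v" for x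
  proof -
    have "((\<lambda>s. x + s *\<^sub>R v) has_derivative (\<lambda>t. t *\<^sub>R v)) (at 0)" by (auto intro!: derivative_eq_intros)
    from diff_chain_at[OF this, of g "g' x"] der
    have "((\<lambda>s. g (x + s *\<^sub>R v)) has_vector_derivative g' x v) (at 0)"
      using has_derivative_linear[OF der] by (simp add: o_def has_vector_derivative_def linear_cmul)
    then have "((\<lambda>s. norm (g (x + s *\<^sub>R v) - g x - s *\<^sub>R g' x v) / norm s) \<longlongrightarrow> 0) (at 0)"
      by (simp add: has_vector_derivative_def has_derivative_at)
    then have "((\<lambda>n. norm (g (x + inverse (real (Suc n)) *\<^sub>R v) - g x - inverse (real (Suc n)) *\<^sub>R g' x v)
        / norm (inverse (real (Suc n)))) \<longlongrightarrow> 0) sequentially"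
      by (rule filterlim_compose) (simp add: filterlim_at LIMSEQ_inverse_real_of_nat del: of_nat_Suc)
    moreover have "norm (g (x + inverse (real (Suc n)) *\<^sub>R v) - g x - inverse (real (Suc n)) *\<^sub>R g' x v)
        / norm (inverse (real (Suc n))) = norm (?h n x - g' x v)" for n
    proof -
      have "norm (?h n x - g' x v) = norm (real (Suc n) *\<^sub>R (g (x + inverse (real (Suc n)) *\<^sub>R v) - g x - inverse (real (Suc n)) *\<^sub>R g' x v))"
        by (simp add: scaleR_right_diff_distrib del: of_nat_Suc)
      then show ?thesis by (simp add: divide_inverse mult.commute del: of_nat_Suc)
    qed
    ultimately have "(\<lambda>n. norm (?h n x - g' x v)) \<longlonglongrightarrow> 0" by simp
    then show ?thesis by (simp add: tendsto_norm_zero_iff LIM_zero_iff)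
  qed
  have mh: "?h n \<in> borel_measurable lborel" for n
    using shift[of "v /\<^sub>R real (Suc n)"] int_g by (intro borel_measurable_integrable) auto
  have mg': "(\<lambda>x. g' x v) \<in> borel_measurable lborel"
    using borel_measurable_continuous_onI[OF cont] by simp
  have K: "integrable lborel (\<lambda>x. indicator ?K x * max M 0)"
    by (intro integrable_mult_left integrable_real_indicator) (auto intro!: emeasure_bounded_finite simp flip: infinity_ennreal_def)
  show "integrable lborel (\<lambda>x. g' x v)"
    by (rule integrable_dominated_convergence[where s="?h", OF mg' mh K]) (rule AE_I2, rule lim, rule AE_I2, rule bound)
  have "(\<lambda>n. integral\<^sup>L lborel (?h n)) \<longlonglongrightarrow> integral\<^sup>L lborel (\<lambda>x. g' x v)"
    by (rule integral_dominated_convergence[where s="?h", OF mg' mh K]) (rule AE_I2, rule lim, rule AE_I2, rule bound)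
  then show "integral\<^sup>L lborel (\<lambda>x. g' x v) = 0"
    unfolding hzero by (simp add: LIMSEQ_const_iff)
qed

text \<open>\<open>a\<close> and \<open>b\<close> are the Wirtinger derivatives \<open>\<partial>\<xi>/\<partial>z\<close> and \<open>\<partial>\<xi>/\<partial>\<bar>z\<close> of \<open>\<xi>\<close>.\<close>

definition wirtinger :: "(complex \<Rightarrow> complex) \<Rightarrow> (complex \<Rightarrow> complex) \<Rightarrow> (complex \<Rightarrow> complex) \<Rightarrow> bool" where
  "wirtinger \<xi> a b \<longleftrightarrow> (\<forall>z. (\<xi> has_derivative (\<lambda>v. a z * v + b z * cnj v)) (at z))
     \<and> continuous_on UNIV a \<and> continuous_on UNIV b"

lemma wirtinger_continuous: "wirtinger \<xi> a b \<Longrightarrow> continuous_on S \<xi>"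
  unfolding wirtinger_def by (intro continuous_at_imp_continuous_on ballI has_derivative_continuous) auto

locale pushforward =
  fixes P :: "'n::finite \<Rightarrow> complex^'n \<Rightarrow> complex"
  assumes P: "\<And>j. polyfun (P j)"
begin

abbreviation J where "J \<equiv> jac P"

text \<open>Up to a constant factor, the integral over U of F times the form h dX wedge the
  conjugate of dP_1 ... dP_n.\<close>

definition L :: "(complex^'n) set \<Rightarrow> (complex^'n \<Rightarrow> complex) \<Rightarrow> (complex^'n \<Rightarrow> complex) \<Rightarrow> complex" where
  "L U h F = integral\<^sup>L lborel (\<lambda>x. indicator U x *\<^sub>R (h x * cnj (J x) * F x))"

lemma P_deriv: "(P j has_derivative (\<lambda>v. \<Sum>l\<in>UNIV. pd l (P j) x * v $ l)) (at x)"
  by (rule polyfun_has_derivative[OF P])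

text \<open>In terms of forms the integrand is d-bar exact. In coordinates \<open>?W l\<close> is a
  vector field built from the conjugated cofactors of row k. Its d-bar divergence retains only the
  wanted term: h and P are holomorphic, cofactor rows are divergence free
  (\<open>sum_pd_cofac\<close>), and \<open>sum_cofac\<close> removes the derivatives of the factors
  with index other than k.\<close>

lemma stokes:
  assumes h: "polyfun h" and w: "\<And>j. wirtinger (\<xi> j) (a j) (b j)"
    and U: "open U" and C: "compact C" "C \<subseteq> U"
    and supp: "\<And>x. x \<in> U \<Longrightarrow> x \<notin> C \<Longrightarrow> (\<Prod>j\<in>UNIV. \<xi> j (P j x)) = 0"
  shows "L U h (\<lambda>x. b k (P k x) * (\<Prod>j\<in>UNIV-{k}. \<xi> j (P j x))) = 0"
proof -
  let ?F = "\<lambda>x. \<Prod>j\<in>UNIV. \<xi> j (P j x)"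
  let ?dP = "\<lambda>j x v. \<Sum>l\<in>UNIV. pd l (P j) x * v $ l"
  let ?dF = "\<lambda>x v. \<Sum>j\<in>UNIV. (a j (P j x) * ?dP j x v + b j (P j x) * cnj (?dP j x v)) * (\<Prod>i\<in>UNIV-{j}. \<xi> i (P i x))"
  let ?dh = "\<lambda>x v. \<Sum>l\<in>UNIV. pd l h x * v $ l"
  let ?c = "\<lambda>l. cofac P k l"
  let ?dc = "\<lambda>l x v. \<Sum>m\<in>UNIV. pd m (?c l) x * v $ m"
  let ?W = "\<lambda>l x. h x * cnj (?c l x) * ?F x"
  let ?dW = "\<lambda>l x v. h x * cnj (?c l x) * ?dF x v + (h x * cnj (?dc l x v) + ?dh x v * cnj (?c l x)) * ?F x"
  \<comment> \<open>Extension by zero is C^1 on the whole space: the product vanishes on U - C, and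
    U together with the complement of the compact set C covers everything.\<close>
  let ?V = "\<lambda>l x. if x \<in> U then ?W l x else 0"
  let ?dV = "\<lambda>l x v. if x \<in> U then ?dW l x v else 0"
  have pc: "polyfun (?c l)" for l by (rule polyfun_cofac[OF P])
  have dF: "(?F has_derivative ?dF x) (at x)" for x
  proof -
    have 1: "((\<lambda>x. \<xi> j (P j x)) has_derivative (\<lambda>v. a j (P j x) * ?dP j x v + b j (P j x) * cnj (?dP j x v))) (at x)" for j
      using diff_chain_at[OF P_deriv, of "\<xi> j"] w[of j] unfolding wirtinger_def o_def by blast
    show ?thesis by (rule has_derivative_prod[of UNIV, OF 1])
  qed
  have dcc: "((\<lambda>x. cnj (?c l x)) has_derivative (\<lambda>v. cnj (?dc l x v))) (at x)" for l x
    by (rule bounded_linear.has_derivative[OF bounded_linear_cnj polyfun_has_derivative[OF pc]])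
  have dW: "(?W l has_derivative ?dW l x) (at x)" for l x
    by (rule has_derivative_mult[OF has_derivative_mult[OF polyfun_has_derivative[OF h] dcc] dF])
  have oC: "open (- C)" using C(1) by (simp add: compact_imp_closed open_Compl)
  have V0: "?V l x = 0" if "x \<notin> C" for l x
    using supp[of x] that by auto
  have dV: "(?V l has_derivative ?dV l x) (at x)" for l x
  proof (cases "x \<in> U")
    case True
    have "(?V l has_derivative ?dW l x) (at x)"
      by (rule has_derivative_transform_within_open[OF dW U True]) simp
    then show ?thesis using True by simp
  next
    case False
    have "(?V l has_derivative (\<lambda>v. 0)) (at x)"
      by (rule has_derivative_transform_within_open[OF has_derivative_const[of 0] oC])
         (use False C(2) V0[of _ l] in auto)
    then show ?thesis using False by simp
  qed
  have dV0: "?dV l x v = 0" if "x \<notin> C" for l x v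
  proof -
    have "((\<lambda>x. 0) has_derivative ?dV l x) (at x)"
      by (rule has_derivative_transform_within_open[OF dV oC]) (use that V0[of _ l] in auto)
    then have "?dV l x = (\<lambda>v. 0)" by (rule has_derivative_unique) (rule has_derivative_const)
    then show ?thesis by (simp add: fun_eq_iff)
  qed
  have contP: "continuous_on S (\<lambda>x. f (P j x))" if "continuous_on UNIV f" for f :: "complex \<Rightarrow> complex" and j S
    by (rule continuous_on_compose2[OF that continuous_on_polyfun[OF P]]) simp
  have contdV: "continuous_on UNIV (\<lambda>x. ?dV l x v)" for l v
  proof -
    have "continuous_on S (\<lambda>x. ?dW l x v)" for S
      using w wirtinger_continuous[OF w]
      by (intro continuous_intros continuous_on_cnj contP continuous_on_polyfun[OF h] continuous_on_polyfun[OF pc]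
          continuous_on_polyfun[OF polyfun_pd[OF P]] continuous_on_polyfun[OF polyfun_pd[OF h]]
          continuous_on_polyfun[OF polyfun_pd[OF pc]]) (auto simp: wirtinger_def)
    then have 1: "continuous_on U (\<lambda>x. ?dV l x v)" by (simp cong: continuous_on_cong)
    have 2: "continuous_on (- C) (\<lambda>x. ?dV l x v)"
      using dV0[of _ l v] by (intro continuous_on_eq[OF continuous_on_const[of _ 0]]) simp
    have "U \<union> - C = UNIV" using C by auto
    with continuous_on_open_Un[OF U oC 1 2] show ?thesis by simp
  qed
  define V where "V = ?V"
  define dV' where "dV' = ?dV"
  have Z: "integrable lborel (\<lambda>x. dV' l x v)" "integral\<^sup>L lborel (\<lambda>x. dV' l x v) = 0" for l v
  proof -
    have "\<And>x. (V l has_derivative dV' l x) (at x)" "continuous_on UNIV (\<lambda>x. dV' l x v)" "\<And>x. x \<notin> C \<Longrightarrow> V l x = 0"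
      unfolding V_def dV'_def by (fact dV, fact contdV, fact V0)
    from integral_directional_derivative_zero[OF this(1,2) C(1) this(3)]
    show "integrable lborel (\<lambda>x. dV' l x v)" "integral\<^sup>L lborel (\<lambda>x. dV' l x v) = 0" by auto
  qed
  have eq: "indicator U x *\<^sub>R (h x * cnj (J x) * (b k (P k x) * (\<Prod>j\<in>UNIV-{k}. \<xi> j (P j x))))
     = (\<Sum>l\<in>UNIV. (dV' l x (axis l 1) + \<i> * dV' l x (axis l \<i>)) / 2)" for x
  proof (cases "x \<in> U")
    case True
    let ?Pr = "\<lambda>j. \<Prod>i\<in>UNIV-{j}. \<xi> i (P i x)"
    \<comment> \<open>The left side is twice the derivative with respect to the conjugate of the
      l-th coordinate; the complex linear terms with \<open>a j\<close> cancel in it.\<close>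
    have 1: "?dF x (axis l 1) + \<i> * ?dF x (axis l \<i>) = 2 * (\<Sum>j\<in>UNIV. b j (P j x) * cnj (pd l (P j) x) * ?Pr j)" for l
      by (simp add: sum_distrib_left flip: sum.distrib) (simp add: algebra_simps)
    have 2: "(?dV l x (axis l 1) + \<i> * ?dV l x (axis l \<i>)) / 2 =
       h x * (\<Sum>j\<in>UNIV. b j (P j x) * ?Pr j * cnj (?c l x * pd l (P j) x)) + h x * cnj (pd l (?c l) x) * ?F x" for l
    proof -
      have "?dV l x (axis l 1) + \<i> * ?dV l x (axis l \<i>) = h x * cnj (?c l x) * (?dF x (axis l 1) + \<i> * ?dF x (axis l \<i>))
         + 2 * h x * cnj (pd l (?c l) x) * ?F x"
        using True by (simp only: sum_axis if_True complex_cnj_mult complex_cnj_i complex_cnj_one) (simp add: algebra_simps)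
      moreover have "(\<Sum>j\<in>UNIV. b j (P j x) * ?Pr j * cnj (?c l x * pd l (P j) x)) =
          cnj (?c l x) * (\<Sum>j\<in>UNIV. b j (P j x) * cnj (pd l (P j) x) * ?Pr j)"
        unfolding sum_distrib_left by (intro sum.cong refl) (simp only: complex_cnj_mult mult_ac)
      moreover have "(H * c * (2 * S) + 2 * H * d * F) / 2 = H * (c * S) + H * d * F" for H c S d F :: complex
        by (simp add: field_simps)
      ultimately show ?thesis unfolding 1 by presburger
    qed
    have "(\<Sum>l\<in>UNIV. (?dV l x (axis l 1) + \<i> * ?dV l x (axis l \<i>)) / 2) =
       h x * (\<Sum>l\<in>UNIV. \<Sum>j\<in>UNIV. b j (P j x) * ?Pr j * cnj (?c l x * pd l (P j) x)) +
       h x * cnj (\<Sum>l\<in>UNIV. pd l (?c l) x) * ?F x"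
      unfolding 2 sum.distrib by (simp only: sum_distrib_left sum_distrib_right cnj_sum)
    also have "(\<Sum>l\<in>UNIV. pd l (?c l) x) = 0" by (rule sum_pd_cofac[OF P])
    also have "(\<Sum>l\<in>UNIV. \<Sum>j\<in>UNIV. b j (P j x) * ?Pr j * cnj (?c l x * pd l (P j) x)) =
       (\<Sum>j\<in>UNIV. b j (P j x) * ?Pr j * cnj (\<Sum>l\<in>UNIV. ?c l x * pd l (P j) x))"
      unfolding cnj_sum sum_distrib_left by (rule sum.swap)
    also have "\<dots> = b k (P k x) * ?Pr k * cnj (J x)"
      unfolding sum_cofac by (simp add: if_distrib[of cnj] if_distrib[of "\<lambda>z. _ * z"] cong: if_cong)
    finally have e: "(\<Sum>l\<in>UNIV. (dV' l x (axis l 1) + \<i> * dV' l x (axis l \<i>)) / 2) =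
       h x * (b k (P k x) * ?Pr k * cnj (J x)) + h x * cnj 0 * ?F x"
      unfolding dV'_def .
    show ?thesis unfolding e using True by simp
  qed (simp add: dV'_def)
  show ?thesis
    unfolding L_def eq
    by (subst Bochner_Integration.integral_sum) (auto simp: Z)
qed

end

section \<open>Radial bumps and their Wirtinger derivatives\<close>

text \<open>The argument stands for s = |w|^2. Since 0 < p, a bump lives on an annulus of the plane
  away from 0, where negative powers of w are holomorphic.\<close>

definition bump :: "real \<Rightarrow> real \<Rightarrow> (real \<Rightarrow> real) \<Rightarrow> bool" where
  "bump p q \<eta> \<longleftrightarrow> 0 < p \<and> p < q \<and> (\<exists>\<eta>'. continuous_on UNIV \<eta>' \<and> (\<forall>s. (\<eta> has_real_derivative \<eta>' s) (at s)))
     \<and> (\<forall>s. s \<le> p \<or> q \<le> s \<longrightarrow> \<eta> s = 0)"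

definition mass :: "(real \<Rightarrow> real) \<Rightarrow> real" where
  "mass \<eta> = integral UNIV \<eta>"

lemma bump_continuous: "bump p q \<eta> \<Longrightarrow> continuous_on S \<eta>"
  unfolding bump_def using DERIV_isCont by (blast intro: continuous_at_imp_continuous_on)

lemma bump_zero: "bump p q \<eta> \<Longrightarrow> s \<le> p \<or> q \<le> s \<Longrightarrow> \<eta> s = 0"
  by (auto simp: bump_def)

lemma bump_has_integral:
  assumes "bump p q \<eta>" "a \<le> p" "q \<le> b"
  shows "(\<eta> has_integral mass \<eta>) {a..b}" "(\<eta> has_integral mass \<eta>) UNIV"
proof -
  have z: "\<eta> s = 0" if "s \<notin> {a..b}" for s
    using bump_zero[OF assms(1), of s] that assms by auto
  have 1: "\<eta> integrable_on {a..b}"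
    by (rule integrable_continuous_real[OF bump_continuous[OF assms(1)]])
  have "(\<lambda>x. if x \<in> {a..b} then \<eta> x else 0) = \<eta>" using z by auto
  then have 2: "(\<eta> has_integral i) {a..b} \<longleftrightarrow> (\<eta> has_integral i) UNIV" for i
    using has_integral_restrict_UNIV[of "{a..b}" \<eta> i] by simp
  then have "integral UNIV \<eta> = integral {a..b} \<eta>"
    using 1 by (metis integral_unique integrable_integral)
  then show "(\<eta> has_integral mass \<eta>) {a..b}" using 1 by (simp add: mass_def integrable_integral)
  then show "(\<eta> has_integral mass \<eta>) UNIV" using 2 by blast
qed

text \<open>Normalised to vanish beyond the support, so that radial functions made from it are
  compactly supported in the plane. Inside the hole it is constant, and zero exactly when the mass
  is zero.\<close>

lemma bump_primitive:
  assumes b: "bump p q \<eta>"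
  obtains H where "\<And>s. (H has_real_derivative \<eta> s) (at s)" "\<And>s. s \<le> p \<Longrightarrow> H s = - mass \<eta>" "\<And>s. q \<le> s \<Longrightarrow> H s = 0"
proof
  define G where "G s = integral {p-1..s} \<eta>" for s
  have G0: "G s = 0" if "s \<le> p" for s
    unfolding G_def using that by (intro integral_unique has_integral_is_0) (auto intro!: bump_zero[OF b])
  have G1: "G s = mass \<eta>" if "q \<le> s" for s
    unfolding G_def using bump_has_integral(1)[OF b, of "p-1" s] that by (simp add: integral_unique)
  have dG: "(G has_real_derivative \<eta> s) (at s)" for s
  proof (cases "s < p")
    case True
    have "(G has_real_derivative 0) (at s)"
      by (rule has_field_derivative_transform_within_open[OF DERIV_const, where S="{..<p}"]) (use True G0 in auto)
    then show ?thesis using True bump_zero[OF b, of s] by simp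
  next
    case False
    have "(G has_real_derivative \<eta> s) (at s within {p-1..s+1})"
      unfolding G_def[abs_def] using False by (intro integral_has_real_derivative bump_continuous[OF b]) auto
    then show ?thesis using False by (subst (asm) at_within_interior) auto
  qed
  show "((\<lambda>s. G s - mass \<eta>) has_real_derivative \<eta> s) (at s)" for s
    using dG[of s] by (auto intro!: derivative_eq_intros)
  show "G s - mass \<eta> = - mass \<eta>" if "s \<le> p" for s using G0[OF that] by simp
  show "G s - mass \<eta> = 0" if "q \<le> s" for s using G1[OF that] by simp
qed

lemma bump_lincomb:
  assumes b1: "bump p q \<eta>" and b2: "bump p' q' \<theta>"
  shows "bump (min p p') (max q q') (\<lambda>s. \<eta> s - c * \<theta> s)" "mass (\<lambda>s. \<eta> s - c * \<theta> s) = mass \<eta> - c * mass \<theta>"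
proof -
  obtain f g where f: "continuous_on UNIV f" "\<And>s. (\<eta> has_real_derivative f s) (at s)"
    and g: "continuous_on UNIV g" "\<And>s. (\<theta> has_real_derivative g s) (at s)"
    using assms unfolding bump_def by blast
  show "bump (min p p') (max q q') (\<lambda>s. \<eta> s - c * \<theta> s)"
    unfolding bump_def
  proof (intro conjI exI[of _ "\<lambda>s. f s - c * g s"] allI impI)
    show "continuous_on UNIV (\<lambda>s. f s - c * g s)" using f g by (intro continuous_intros)
    show "((\<lambda>s. \<eta> s - c * \<theta> s) has_real_derivative f s - c * g s) (at s)" for s
      using f(2)[of s] g(2)[of s] by (auto intro!: derivative_eq_intros)
    show "\<eta> s - c * \<theta> s = 0" if "s \<le> min p p' \<or> max q q' \<le> s" for s
      using that bump_zero[OF b1, of s] bump_zero[OF b2, of s] by auto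
  qed (use assms in \<open>auto simp: bump_def\<close>)
  show "mass (\<lambda>s. \<eta> s - c * \<theta> s) = mass \<eta> - c * mass \<theta>"
    unfolding mass_def[of "\<lambda>s. \<eta> s - c * \<theta> s"]
    using bump_has_integral(2)[OF b1 order_refl order_refl] bump_has_integral(2)[OF b2 order_refl order_refl]
    by (intro integral_unique has_integral_diff has_integral_mult_right)
qed

text \<open>A parabola squared vanishes to second order at p and q, which makes it C^1 after
  extension by zero; the denominator keeps the values in [0,1].\<close>

definition bumpsq :: "real \<Rightarrow> real \<Rightarrow> real \<Rightarrow> real" where
  "bumpsq p q s = (if s \<le> p \<or> q \<le> s then 0 else ((s - p) * (q - s))\<^sup>2 / ((q - p)^2)\<^sup>2)"

lemma bumpsq_deriv:
  assumes "p < q"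
  shows "(bumpsq p q has_real_derivative
     (if s \<le> p \<or> q \<le> s then 0 else 2 * ((s - p) * (q - s)) * (q - s - (s - p)) / ((q - p)^2)\<^sup>2)) (at s)" (is "(_ has_real_derivative ?d s) _")
    and "continuous_on UNIV (\<lambda>s. if s \<le> p \<or> q \<le> s then 0 else 2 * ((s - p) * (q - s)) * (q - s - (s - p)) / ((q - p)^2)\<^sup>2)"
proof -
  let ?K = "((q - p)^2)\<^sup>2"
  let ?m = "\<lambda>s. max 0 ((s - p) * (q - s))"
  have mx: "?m s = (if s \<le> p \<or> q \<le> s then 0 else (s - p) * (q - s))" for s
    using assms by (auto simp: max_def mult_le_0_iff zero_le_mult_iff)
  have "?d s = 2 * ?m s * (q - s - (s - p)) / ?K" for s
    unfolding mx by simp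
  then have d: "?d = (\<lambda>s. 2 * ?m s * (q - s - (s - p)) / ?K)" by auto
  show "continuous_on UNIV ?d"
    unfolding d using assms by (intro continuous_intros) auto
  have poly: "((\<lambda>s. ((s - p) * (q - s))\<^sup>2 / ?K) has_real_derivative 2 * ((s - p) * (q - s)) * (q - s - (s - p)) / ?K) (at s)" for s
  proof -
    have "((\<lambda>s. ((s - p) * (q - s))\<^sup>2) has_real_derivative 2 * ((s - p) * (q - s)) * (q - s - (s - p))) (at s)"
      by (auto intro!: derivative_eq_intros simp: algebra_simps)
    then show ?thesis by (rule DERIV_cdivide)
  qed
  have bz: "bumpsq p q p = 0" "bumpsq p q q = 0" by (auto simp: bumpsq_def)
  have bb: "\<bar>bumpsq p q y\<bar> \<le> ((y - p) * (q - y))\<^sup>2 / (q - p) ^ 4" for y by (auto simp: bumpsq_def)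
  have bb': "\<bar>bumpsq p q y\<bar> / \<bar>y - c\<bar> \<le> ((y - p) * (q - y))\<^sup>2 / ((q - p) ^ 4 * \<bar>y - c\<bar>)" for y c
    using divide_right_mono[OF bb[of y], of "\<bar>y - c\<bar>"] by simp
  consider "s < p" | "s > q" | "p < s" "s < q" | "s = p" | "s = q" by linarith
  then show "(bumpsq p q has_real_derivative ?d s) (at s)"
  proof cases
    case 1
    have "(bumpsq p q has_real_derivative 0) (at s)"
      by (rule has_field_derivative_transform_within_open[OF DERIV_const, where S="{..<p}"]) (use 1 in \<open>auto simp: bumpsq_def\<close>)
    then show ?thesis using 1 by simp
  next
    case 2
    have "(bumpsq p q has_real_derivative 0) (at s)"
      by (rule has_field_derivative_transform_within_open[OF DERIV_const, where S="{q<..}"]) (use 2 in \<open>auto simp: bumpsq_def\<close>)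
    then show ?thesis using 2 by simp
  next
    case 3
    have "(bumpsq p q has_real_derivative 2 * ((s - p) * (q - s)) * (q - s - (s - p)) / ?K) (at s)"
      by (rule has_field_derivative_transform_within_open[OF poly, where S="{p<..<q}"]) (use 3 in \<open>auto simp: bumpsq_def\<close>)
    then show ?thesis using 3 by simp
  next
    case 4
    \<comment> \<open>At an endpoint the difference quotients of \<open>bumpsq\<close> are dominated
      by those of the polynomial, whose derivative vanishes there.\<close>
    have zero: "((\<lambda>s. ((s - p) * (q - s))\<^sup>2 / ?K) has_real_derivative 0) (at p)" using poly[of p] by simp
    have "((\<lambda>y. (bumpsq p q y - bumpsq p q p) / (y - p)) \<longlongrightarrow> 0) (at p)"
    proof (rule tendsto_rabs_zero_cancel, rule tendsto_sandwich[OF _ _ tendsto_const])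
      show "((\<lambda>y. \<bar>(((y - p) * (q - y))\<^sup>2 / ?K - ((p - p) * (q - p))\<^sup>2 / ?K) / (y - p)\<bar>) \<longlongrightarrow> 0) (at p)"
        using zero unfolding has_field_derivative_iff by (rule tendsto_rabs_zero)
      show "\<forall>\<^sub>F y in at p. \<bar>(bumpsq p q y - bumpsq p q p) / (y - p)\<bar> \<le> \<bar>(((y - p) * (q - y))\<^sup>2 / ?K - ((p - p) * (q - p))\<^sup>2 / ?K) / (y - p)\<bar>"
        by (intro always_eventually allI) (simp only: bz abs_divide, simp add: bb')
    qed simp
    then show ?thesis using 4 by (simp add: has_field_derivative_iff)
  next
    case 5
    have zero: "((\<lambda>s. ((s - p) * (q - s))\<^sup>2 / ?K) has_real_derivative 0) (at q)" using poly[of q] by simp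
    have "((\<lambda>y. (bumpsq p q y - bumpsq p q q) / (y - q)) \<longlongrightarrow> 0) (at q)"
    proof (rule tendsto_rabs_zero_cancel, rule tendsto_sandwich[OF _ _ tendsto_const])
      show "((\<lambda>y. \<bar>(((y - p) * (q - y))\<^sup>2 / ?K - ((q - p) * (q - q))\<^sup>2 / ?K) / (y - q)\<bar>) \<longlongrightarrow> 0) (at q)"
        using zero unfolding has_field_derivative_iff by (rule tendsto_rabs_zero)
      show "\<forall>\<^sub>F y in at q. \<bar>(bumpsq p q y - bumpsq p q q) / (y - q)\<bar> \<le> \<bar>(((y - p) * (q - y))\<^sup>2 / ?K - ((q - p) * (q - q))\<^sup>2 / ?K) / (y - q)\<bar>"
        by (intro always_eventually allI) (simp only: bz abs_divide, simp add: bb')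
    qed simp
    then show ?thesis using 5 by (simp add: has_field_derivative_iff)
  qed
qed

lemma bumpsq_bounds:
  assumes "p < q"
  shows "0 \<le> bumpsq p q s" "bumpsq p q s \<le> 1" "p < s \<Longrightarrow> s < q \<Longrightarrow> 0 < bumpsq p q s"
proof -
  show "0 \<le> bumpsq p q s" by (simp add: bumpsq_def)
  show "p < s \<Longrightarrow> s < q \<Longrightarrow> 0 < bumpsq p q s" using assms by (simp add: bumpsq_def)
  show "bumpsq p q s \<le> 1"
  proof (cases "s \<le> p \<or> q \<le> s")
    case False
    have "(s - p) * (q - s) \<le> (q - p) * (q - p)" by (rule mult_mono) (use False in auto)
    then have "((s - p) * (q - s))\<^sup>2 \<le> ((q - p)\<^sup>2)\<^sup>2"
      using False by (intro power_mono) (auto simp: power2_eq_square)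
    then show ?thesis using False assms by (simp add: bumpsq_def)
  qed (simp add: bumpsq_def)
qed

lemma bump_bumpsq: "0 < p \<Longrightarrow> p < q \<Longrightarrow> bump p q (bumpsq p q)"
  unfolding bump_def using bumpsq_deriv[of p q] by (auto simp: bumpsq_def)

lemma mass_bumpsq_pos:
  assumes "0 < p" "p < q" shows "0 < mass (bumpsq p q)"
proof -
  note b = bump_bumpsq[OF assms]
  have "0 < integral {p..q} (bumpsq p q)"
    using integral_less_real[of p q "\<lambda>x. 0" "bumpsq p q"] assms
      integrable_continuous_real[OF bump_continuous[OF b]] bump_continuous[OF b] bumpsq_bounds[OF assms(2)] by auto
  then show ?thesis using bump_has_integral(1)[OF b order_refl order_refl] by (simp add: integral_unique)
qed

text \<open>The Wirtinger derivatives of |w - c|^2 are cnj (w - c) and w - c. Hence a primitive of a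
  radial bump provides a d-bar primitive of the bump times w - c.\<close>

lemma wirtinger_radial:
  assumes "\<And>s. (H has_real_derivative H' s) (at s)" "continuous_on UNIV H'"
  shows "wirtinger (\<lambda>w. of_real (H ((cmod (w - c))\<^sup>2))) (\<lambda>w. of_real (H' ((cmod (w - c))\<^sup>2)) * cnj (w - c))
     (\<lambda>w. of_real (H' ((cmod (w - c))\<^sup>2)) * (w - c))"
  unfolding wirtinger_def
proof (intro conjI allI)
  fix z
  have "((\<lambda>w. (cmod (w - c))\<^sup>2) has_derivative (\<lambda>v. 2 * Re (cnj (z - c) * v))) (at z)"
    unfolding cmod_power2 by (rule derivative_eq_intros refl | simp)+ (simp add: fun_eq_iff algebra_simps)
  from diff_chain_at[OF this assms(1)[unfolded has_field_derivative_def]]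
  have "((\<lambda>w. H ((cmod (w - c))\<^sup>2)) has_derivative (\<lambda>v. H' ((cmod (z - c))\<^sup>2) * (2 * Re (cnj (z - c) * v)))) (at z)"
    by (simp add: o_def)
  from has_derivative_of_real[OF this]
  have "((\<lambda>w. complex_of_real (H ((cmod (w - c))\<^sup>2))) has_derivative (\<lambda>v. of_real (H' ((cmod (z - c))\<^sup>2) * (2 * Re (cnj (z - c) * v))))) (at z)"
    by simp
  moreover have *: "complex_of_real (k * (2 * Re (cnj w * v))) = of_real k * cnj w * v + of_real k * w * cnj v" for k w v
    by (simp add: complex_eq_iff algebra_simps)
  ultimately show "((\<lambda>w. complex_of_real (H ((cmod (w - c))\<^sup>2))) has_derivative (\<lambda>v. of_real (H' ((cmod (z - c))\<^sup>2)) * cnj (z - c) * v + of_real (H' ((cmod (z - c))\<^sup>2)) * (z - c) * cnj v)) (at z)"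
    by (simp only: *)
next
  have "continuous_on UNIV (\<lambda>w. H' ((cmod (w - c))\<^sup>2))"
    by (rule continuous_on_compose2[OF assms(2)]) (auto intro!: continuous_intros)
  then show "continuous_on UNIV (\<lambda>w. complex_of_real (H' ((cmod (w - c))\<^sup>2)) * cnj (w - c))"
    "continuous_on UNIV (\<lambda>w. complex_of_real (H' ((cmod (w - c))\<^sup>2)) * (w - c))"
    by (auto intro!: continuous_intros)
qed

text \<open>The factor g may have a pole outside D, provided f vanishes on a neighbourhood N of it;
  the value assigned to g at the pole is then immaterial. Being holomorphic, g enters the d-bar
  derivative only as a factor.\<close>

lemma wirtinger_mult_holomorphic:
  assumes f: "wirtinger f a b" and D: "open D" "\<And>z. z \<in> D \<Longrightarrow> (g has_field_derivative g' z) (at z)" "continuous_on D g'"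
    and N: "open N" "N \<union> D = UNIV" "\<And>z. z \<in> N \<Longrightarrow> f z = 0"
  shows "wirtinger (\<lambda>z. f z * g z) (\<lambda>z. f z * g' z + a z * g z) (\<lambda>z. b z * g z)"
proof -
  have ab: "a z = 0" "b z = 0" if z: "z \<in> N" for z
  proof -
    have "((\<lambda>z. 0) has_derivative (\<lambda>v. a z * v + b z * cnj v)) (at z)"
      by (rule has_derivative_transform_within_open[of f, OF _ N(1) z]) (use f N(3) in \<open>auto simp: wirtinger_def\<close>)
    then have "(\<lambda>v. a z * v + b z * cnj v) = (\<lambda>v. 0)"
      by (rule has_derivative_unique) (rule has_derivative_const)
    then have "a z * 1 + b z * cnj 1 = 0" "a z * \<i> + b z * cnj \<i> = 0" by meson+
    then have "a z + b z = 0" "\<i> * (a z - b z) = 0" by (simp_all add: algebra_simps)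
    then show "a z = 0" "b z = 0" by simp_all
  qed
  have zN: "f z * g z = 0" "f z * g' z + a z * g z = 0" "b z * g z = 0" if "z \<in> N" for z
    using ab[OF that] N(3)[OF that] by auto
  have contD: "continuous_on D f" "continuous_on D g" "continuous_on D a" "continuous_on D b"
  proof -
    show "continuous_on D g" using D(2) DERIV_isCont by (blast intro: continuous_at_imp_continuous_on)
  qed (use f wirtinger_continuous[OF f] in \<open>auto simp: wirtinger_def intro: continuous_on_subset\<close>)
  have glue: "continuous_on UNIV k" if "continuous_on D k" "\<And>z. z \<in> N \<Longrightarrow> k z = 0" for k :: "complex \<Rightarrow> complex"
    using continuous_on_open_Un[OF N(1) D(1) _ that(1)] continuous_on_eq[OF continuous_on_const[of _ 0], of N k] that(2) N(2)
    by auto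
  show ?thesis
    unfolding wirtinger_def
  proof (intro conjI allI)
    fix z
    show "((\<lambda>z. f z * g z) has_derivative (\<lambda>v. (f z * g' z + a z * g z) * v + b z * g z * cnj v)) (at z)"
    proof (cases "z \<in> N")
      case True
      have "((\<lambda>z. f z * g z) has_derivative (\<lambda>v. 0)) (at z)"
        by (rule has_derivative_transform_within_open[OF has_derivative_const[of 0] N(1) True]) (use zN in auto)
      then show ?thesis using ab[OF True] N(3)[OF True] by simp
    next
      case False
      then have z: "z \<in> D" using N by auto
      have "((\<lambda>z. f z * g z) has_derivative (\<lambda>v. f z * (g' z * v) + (a z * v + b z * cnj v) * g z)) (at z)"
        using f D(2)[OF z] by (intro has_derivative_mult) (auto simp: wirtinger_def has_field_derivative_def)
      then show ?thesis by (simp add: algebra_simps)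
    qed
  next
    show "continuous_on UNIV (\<lambda>z. f z * g' z + a z * g z)"
      by (rule glue) (use contD D(3) zN in \<open>auto intro!: continuous_intros\<close>)
    show "continuous_on UNIV (\<lambda>z. b z * g z)"
      by (rule glue) (use contD D(3) zN in \<open>auto intro!: continuous_intros\<close>)
  qed
qed

lemma wirtinger_diff:
  assumes "wirtinger f a b" "wirtinger g c d"
  shows "wirtinger (\<lambda>z. f z - g z) (\<lambda>z. a z - c z) (\<lambda>z. b z - d z)"
  unfolding wirtinger_def
proof (intro conjI allI)
  fix z
  have "((\<lambda>z. f z - g z) has_derivative (\<lambda>v. (a z * v + b z * cnj v) - (c z * v + d z * cnj v))) (at z)"
    using assms by (intro has_derivative_diff) (auto simp: wirtinger_def)
  then show "((\<lambda>z. f z - g z) has_derivative (\<lambda>v. (a z - c z) * v + (b z - d z) * cnj v)) (at z)"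
    by (simp add: algebra_simps)
qed (use assms in \<open>auto simp: wirtinger_def intro!: continuous_intros\<close>)

definition csupp :: "real \<Rightarrow> (complex \<Rightarrow> complex) \<Rightarrow> bool" where
  "csupp \<rho> f \<longleftrightarrow> (\<forall>w. \<rho> < (cmod w)\<^sup>2 \<longrightarrow> f w = 0)"

text \<open>Bounded Borel functions suffice for integrability and limits; the smaller class
  \<open>C1_test_fun\<close> is the one to which Stokes applies. In both, \<rho> bounds |w|^2 on the
  support.\<close>

definition test_fun :: "real \<Rightarrow> (complex \<Rightarrow> complex) \<Rightarrow> bool" where
  "test_fun \<rho> f \<longleftrightarrow> f \<in> borel_measurable borel \<and> (\<exists>B. \<forall>w. cmod (f w) \<le> B) \<and> csupp \<rho> f"

definition C1_test_fun :: "real \<Rightarrow> (complex \<Rightarrow> complex) \<Rightarrow> bool" where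
  "C1_test_fun \<rho> f \<longleftrightarrow> (\<exists>a b. wirtinger f a b) \<and> csupp \<rho> f"

text \<open>The kernel w^-m smeared over the circles |w|^2 = s with density \<eta>. If \<eta>
  vanishes at 0, the default value of \<open>inverse 0\<close> has no influence.\<close>

definition shell_fun :: "(real \<Rightarrow> real) \<Rightarrow> nat \<Rightarrow> complex \<Rightarrow> complex" where
  "shell_fun \<eta> m w = of_real (\<eta> ((cmod w)\<^sup>2)) * inverse w ^ m"

lemma continuous_csupp_test_fun:
  assumes c: "continuous_on UNIV f" and s: "csupp \<rho> f"
  shows "test_fun \<rho> f"
proof -
  have "compact (f ` cball 0 (sqrt \<bar>\<rho>\<bar>))"
    by (rule compact_continuous_image[OF continuous_on_subset[OF c]]) auto
  from compact_imp_bounded[OF this] obtain B where B: "\<forall>y\<in>f ` cball 0 (sqrt \<bar>\<rho>\<bar>). norm y \<le> B"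
    unfolding bounded_iff by blast
  have "cmod (f w) \<le> max B 0" for w
  proof (cases "w \<in> cball 0 (sqrt \<bar>\<rho>\<bar>)")
    case True
    then have "norm (f w) \<le> B" using B by blast
    then show ?thesis by simp
  next
    case False
    then have "sqrt \<bar>\<rho>\<bar> < cmod w" by simp
    then have "(sqrt \<bar>\<rho>\<bar>)\<^sup>2 < (cmod w)\<^sup>2" by (intro power_strict_mono) auto
    then show ?thesis using s by (simp add: csupp_def)
  qed
  then show ?thesis
    unfolding test_fun_def using borel_measurable_continuous_onI[OF c] s by blast
qed

lemma C1_test_fun_imp: "C1_test_fun \<rho> f \<Longrightarrow> test_fun \<rho> f"
  unfolding C1_test_fun_def by (blast intro: continuous_csupp_test_fun wirtinger_continuous)

lemma wirtinger_shell_fun: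
  assumes d: "\<And>s. (\<eta> has_real_derivative \<eta>' s) (at s)" "continuous_on UNIV \<eta>'" and p: "0 < p" "\<And>s. s \<le> p \<Longrightarrow> \<eta> s = 0"
  shows "\<exists>a. wirtinger (shell_fun \<eta> m) a (\<lambda>w. of_real (\<eta>' ((cmod w)\<^sup>2)) * w * inverse w ^ m)"
proof -
  have w: "wirtinger (\<lambda>w. of_real (\<eta> ((cmod (w - 0))\<^sup>2))) (\<lambda>w. of_real (\<eta>' ((cmod (w - 0))\<^sup>2)) * cnj (w - 0))
     (\<lambda>w. of_real (\<eta>' ((cmod (w - 0))\<^sup>2)) * (w - 0))"
    by (rule wirtinger_radial[OF d])
  have h: "((\<lambda>w. inverse w ^ m) has_field_derivative - (of_nat m * inverse w ^ Suc m)) (at w)" if "w \<in> - {0}" for w :: complex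
  proof -
    have "((\<lambda>w. inverse w ^ m) has_field_derivative of_nat m * inverse w ^ (m - 1) * (- (inverse w ^ 2))) (at w)"
      using that by (auto intro!: derivative_eq_intros simp: power2_eq_square)
    moreover have "of_nat m * inverse w ^ (m - 1) * (- (inverse w ^ 2)) = - (of_nat m * inverse w ^ Suc m)"
      by (cases m) (auto simp: power2_eq_square)
    ultimately show ?thesis by (simp only:)
  qed
  have o: "open {w::complex. (cmod w)\<^sup>2 < p}" by (intro open_Collect_less continuous_intros)
  have "wirtinger (\<lambda>z. of_real (\<eta> ((cmod (z - 0))\<^sup>2)) * inverse z ^ m)
     (\<lambda>z. of_real (\<eta> ((cmod (z - 0))\<^sup>2)) * (- (of_nat m * inverse z ^ Suc m)) + of_real (\<eta>' ((cmod (z - 0))\<^sup>2)) * cnj (z - 0) * inverse z ^ m)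
     (\<lambda>z. of_real (\<eta>' ((cmod (z - 0))\<^sup>2)) * (z - 0) * inverse z ^ m)"
    by (rule wirtinger_mult_holomorphic[where D="- {0}", OF w _ h _ o]) (use p in \<open>auto intro!: continuous_intros\<close>)
  moreover have "(\<lambda>z. of_real (\<eta> ((cmod (z - 0))\<^sup>2)) * inverse z ^ m) = shell_fun \<eta> m"
    by (auto simp: shell_fun_def fun_eq_iff)
  ultimately show ?thesis by auto
qed

lemma C1_test_fun_shell_fun:
  assumes b: "bump p q \<eta>" and q: "q \<le> \<rho>"
  shows "C1_test_fun \<rho> (shell_fun \<eta> m)"
proof -
  obtain \<eta>' where d: "continuous_on UNIV \<eta>'" "\<And>s. (\<eta> has_real_derivative \<eta>' s) (at s)"
    using b unfolding bump_def by blast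
  have "0 < p" using b by (simp add: bump_def)
  from wirtinger_shell_fun[OF d(2,1) this] bump_zero[OF b]
  have "\<exists>a b. wirtinger (shell_fun \<eta> m) a b" by blast
  moreover have "csupp \<rho> (shell_fun \<eta> m)"
    using bump_zero[OF b] q by (auto simp: csupp_def shell_fun_def)
  ultimately show ?thesis by (auto simp: C1_test_fun_def)
qed

section \<open>The functional LP and its coefficients\<close>

context pushforward
begin

text \<open>The sublevel sets stay away from the boundary of U, which yields integrability and the
  compact set for \<open>stokes\<close>. Both the whole space, by properness, and small
  neighbourhoods of isolated zeros qualify.\<close>

definition adm :: "(complex^'n) set \<Rightarrow> real \<Rightarrow> bool" where
  "adm U \<rho> \<longleftrightarrow> open U \<and> compact {x \<in> U. \<forall>j. (cmod (P j x))\<^sup>2 \<le> \<rho>}"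

definition LP :: "(complex^'n) set \<Rightarrow> (complex^'n \<Rightarrow> complex) \<Rightarrow> ('n \<Rightarrow> complex \<Rightarrow> complex) \<Rightarrow> complex" where
  "LP U h \<xi> = L U h (\<lambda>x. \<Prod>j\<in>UNIV. \<xi> j (P j x))"

text \<open>C is a Laurent-type coefficient of h relative to P: it records the only dependence on
  the bumps, namely through their masses. By the polar form of the area element, the exponent m
  belongs to the residue with denominators P_j^(m_j + 1).\<close>

definition is_coeff :: "(complex^'n) set \<Rightarrow> real \<Rightarrow> (complex^'n \<Rightarrow> complex) \<Rightarrow> ('n \<Rightarrow> nat) \<Rightarrow> complex \<Rightarrow> bool" where
  "is_coeff U \<rho> h m C \<longleftrightarrow> (\<forall>p q \<eta>. (\<forall>j. bump (p j) (q j) (\<eta> j) \<and> q j \<le> \<rho>) \<longrightarrow>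
      LP U h (\<lambda>j. shell_fun (\<eta> j) (m j)) = C * (\<Prod>j\<in>UNIV. of_real (mass (\<eta> j))))"

lemma borel_measurable_polyfun: "polyfun f \<Longrightarrow> f \<in> borel_measurable borel"
  by (intro borel_measurable_continuous_onI continuous_on_polyfun)

lemma measurable_P: "P j \<in> borel_measurable borel"
  by (rule borel_measurable_polyfun[OF P])

lemma measurable_J: "J \<in> borel_measurable borel"
  by (rule borel_measurable_polyfun[OF polyfun_jac[OF P]])

lemma measurable_LP_integrand:
  assumes h: "polyfun h" and U: "open U" and m: "\<And>j. \<xi> j \<in> borel_measurable borel"
  shows "(\<lambda>x. indicator U x *\<^sub>R (h x * cnj (J x) * (\<Prod>j\<in>UNIV. \<xi> j (P j x)))) \<in> borel_measurable lborel"
proof -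
  note [measurable] = borel_measurable_polyfun[OF h] measurable_J measurable_P m
  have [measurable]: "U \<in> sets borel" using U by simp
  have [measurable]: "(\<lambda>x. cnj (J x)) \<in> borel_measurable borel"
    by (rule measurable_compose[OF measurable_J]) (intro borel_measurable_continuous_onI continuous_intros)
  have [measurable]: "(\<lambda>x. \<xi> j (P j x)) \<in> borel_measurable borel" for j
    by (rule measurable_compose[OF measurable_P m])
  show ?thesis by measurable
qed

text \<open>The constant is uniform in the test functions, so that one dominating function serves a
  whole sequence in \<open>LP_tendsto\<close>.\<close>

lemma LP_integrand_bound:
  assumes h: "polyfun h" and U: "adm U \<rho>"
  obtains K where "K \<ge> 0" "\<And>\<xi> B x. (\<And>j w. cmod (\<xi> j w) \<le> B j) \<Longrightarrow> (\<And>j. csupp \<rho> (\<xi> j)) \<Longrightarrow>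
    norm (indicator U x *\<^sub>R (h x * cnj (J x) * (\<Prod>j\<in>UNIV. \<xi> j (P j x)))) \<le>
    indicator {x \<in> U. \<forall>j. (cmod (P j x))\<^sup>2 \<le> \<rho>} x * (K * (\<Prod>j\<in>UNIV. B j))"
proof -
  let ?C = "{x \<in> U. \<forall>j. (cmod (P j x))\<^sup>2 \<le> \<rho>}"
  have "compact ((\<lambda>x. h x * cnj (J x)) ` ?C)"
    using U unfolding adm_def
    by (intro compact_continuous_image continuous_intros continuous_on_cnj continuous_on_polyfun[OF h] continuous_on_polyfun[OF polyfun_jac[OF P]]) auto
  from compact_imp_bounded[OF this] obtain K where K: "\<forall>y\<in>(\<lambda>x. h x * cnj (J x)) ` ?C. norm y \<le> K"
    unfolding bounded_iff by blast
  show ?thesis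
  proof (rule that[of "max K 0"])
    fix \<xi> :: "'n \<Rightarrow> complex \<Rightarrow> complex" and B x
    assume B: "\<And>j w. cmod (\<xi> j w) \<le> B j" and s: "\<And>j. csupp \<rho> (\<xi> j)"
    show "norm (indicator U x *\<^sub>R (h x * cnj (J x) * (\<Prod>j\<in>UNIV. \<xi> j (P j x)))) \<le> indicator ?C x * (max K 0 * (\<Prod>j\<in>UNIV. B j))"
    proof (cases "x \<in> ?C")
      case True
      have "norm (h x * cnj (J x)) \<le> max K 0" using K True by (auto simp: le_max_iff_disj)
      moreover have "norm (\<Prod>j\<in>UNIV. \<xi> j (P j x)) \<le> (\<Prod>j\<in>UNIV. B j)"
        unfolding prod_norm[symmetric] by (rule prod_mono) (use B in auto)
      ultimately have "norm (h x * cnj (J x)) * norm (\<Prod>j\<in>UNIV. \<xi> j (P j x)) \<le> max K 0 * (\<Prod>j\<in>UNIV. B j)"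
        by (rule mult_mono) auto
      then show ?thesis using True by (simp add: norm_mult)
    next
      case False
      show ?thesis
      proof (cases "x \<in> U")
        case True
        with False obtain j where "\<not> (cmod (P j x))\<^sup>2 \<le> \<rho>" by auto
        then have "\<xi> j (P j x) = 0" using s[of j] by (auto simp: csupp_def)
        then have z: "(\<Prod>j\<in>UNIV. \<xi> j (P j x)) = 0" by (meson UNIV_I finite prod_zero)
        show ?thesis unfolding z using False by simp
      qed (use False in auto)
    qed
  qed simp
qed

lemma adm_lborel: "adm U \<rho> \<Longrightarrow> {x \<in> U. \<forall>j. (cmod (P j x))\<^sup>2 \<le> \<rho>} \<in> sets lborel"
  "adm U \<rho> \<Longrightarrow> emeasure lborel {x \<in> U. \<forall>j. (cmod (P j x))\<^sup>2 \<le> \<rho>} < \<infinity>"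
  using emeasure_bounded_finite[OF compact_imp_bounded] by (auto simp: adm_def intro: borel_compact)

lemma integrable_LP:
  assumes h: "polyfun h" and U: "adm U \<rho>" and t: "\<And>j. test_fun \<rho> (\<xi> j)"
  shows "integrable lborel (\<lambda>x. indicator U x *\<^sub>R (h x * cnj (J x) * (\<Prod>j\<in>UNIV. \<xi> j (P j x))))"
proof -
  obtain B where B: "\<And>j w. cmod (\<xi> j w) \<le> B j" using t unfolding test_fun_def by metis
  obtain K where K: "\<And>\<xi> B x. (\<And>j w. cmod (\<xi> j w) \<le> B j) \<Longrightarrow> (\<And>j. csupp \<rho> (\<xi> j)) \<Longrightarrow>
    norm (indicator U x *\<^sub>R (h x * cnj (J x) * (\<Prod>j\<in>UNIV. \<xi> j (P j x)))) \<le>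
    indicator {x \<in> U. \<forall>j. (cmod (P j x))\<^sup>2 \<le> \<rho>} x * (K * (\<Prod>j\<in>UNIV. B j))"
    using LP_integrand_bound[OF h U] by blast
  show ?thesis
  proof (rule Bochner_Integration.integrable_bound)
    show "integrable lborel (\<lambda>x. indicator {x \<in> U. \<forall>j. (cmod (P j x))\<^sup>2 \<le> \<rho>} x * (K * (\<Prod>j\<in>UNIV. B j)))"
      using adm_lborel[OF U] by (intro integrable_mult_left integrable_real_indicator)
    show "(\<lambda>x. indicator U x *\<^sub>R (h x * cnj (J x) * (\<Prod>j\<in>UNIV. \<xi> j (P j x)))) \<in> borel_measurable lborel"
      by (rule measurable_LP_integrand[OF h]) (use U t in \<open>auto simp: adm_def test_fun_def\<close>)
    show "AE x in lborel. norm (indicator U x *\<^sub>R (h x * cnj (J x) * (\<Prod>j\<in>UNIV. \<xi> j (P j x))))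
      \<le> norm (indicator {x \<in> U. \<forall>j. (cmod (P j x))\<^sup>2 \<le> \<rho>} x * (K * (\<Prod>j\<in>UNIV. B j)))"
    proof (rule AE_I2)
      fix x
      have "norm (indicator U x *\<^sub>R (h x * cnj (J x) * (\<Prod>j\<in>UNIV. \<xi> j (P j x)))) \<le>
        indicator {x \<in> U. \<forall>j. (cmod (P j x))\<^sup>2 \<le> \<rho>} x * (K * (\<Prod>j\<in>UNIV. B j))"
        by (rule K[OF B]) (use t in \<open>simp add: test_fun_def\<close>)
      then show "norm (indicator U x *\<^sub>R (h x * cnj (J x) * (\<Prod>j\<in>UNIV. \<xi> j (P j x))))
        \<le> norm (indicator {x \<in> U. \<forall>j. (cmod (P j x))\<^sup>2 \<le> \<rho>} x * (K * (\<Prod>j\<in>UNIV. B j)))"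
        using order_trans[OF _ abs_ge_self] by simp
    qed
  qed
qed

lemma LP_tendsto:
  assumes h: "polyfun h" and U: "adm U \<rho>" and m: "\<And>n j. \<xi> n j \<in> borel_measurable borel" "\<And>j. \<zeta> j \<in> borel_measurable borel"
    and B: "\<And>n j w. cmod (\<xi> n j w) \<le> B j" and s: "\<And>n j. csupp \<rho> (\<xi> n j)"
    and lim: "\<And>j w. (\<lambda>n. \<xi> n j w) \<longlonglongrightarrow> \<zeta> j w"
  shows "(\<lambda>n. LP U h (\<xi> n)) \<longlonglongrightarrow> LP U h \<zeta>"
proof -
  obtain K where K: "\<And>\<xi> B x. (\<And>j w. cmod (\<xi> j w) \<le> B j) \<Longrightarrow> (\<And>j. csupp \<rho> (\<xi> j)) \<Longrightarrow>
    norm (indicator U x *\<^sub>R (h x * cnj (J x) * (\<Prod>j\<in>UNIV. \<xi> j (P j x)))) \<le>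
    indicator {x \<in> U. \<forall>j. (cmod (P j x))\<^sup>2 \<le> \<rho>} x * (K * (\<Prod>j\<in>UNIV. B j))"
    using LP_integrand_bound[OF h U] by blast
  have oU: "open U" using U by (simp add: adm_def)
  show ?thesis
    unfolding LP_def L_def
  proof (rule integral_dominated_convergence)
    show "integrable lborel (\<lambda>x. indicator {x \<in> U. \<forall>j. (cmod (P j x))\<^sup>2 \<le> \<rho>} x * (K * (\<Prod>j\<in>UNIV. B j)))"
      using adm_lborel[OF U] by (intro integrable_mult_left integrable_real_indicator)
    show "AE x in lborel. norm (indicator U x *\<^sub>R (h x * cnj (J x) * (\<Prod>j\<in>UNIV. \<xi> n j (P j x)))) \<le>
      indicator {x \<in> U. \<forall>j. (cmod (P j x))\<^sup>2 \<le> \<rho>} x * (K * (\<Prod>j\<in>UNIV. B j))" for n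
      by (rule AE_I2, rule K[OF B s])
    show "AE x in lborel. (\<lambda>n. indicator U x *\<^sub>R (h x * cnj (J x) * (\<Prod>j\<in>UNIV. \<xi> n j (P j x))))
        \<longlonglongrightarrow> indicator U x *\<^sub>R (h x * cnj (J x) * (\<Prod>j\<in>UNIV. \<zeta> j (P j x)))"
      by (rule AE_I2) (intro tendsto_intros lim)
  qed (intro measurable_LP_integrand[OF h oU] m)+
qed

lemma LP_diff:
  assumes h: "polyfun h" and U: "adm U \<rho>" and t: "\<And>j. j \<noteq> k \<Longrightarrow> test_fun \<rho> (\<xi> j)"
    and f: "test_fun \<rho> f" and g: "test_fun \<rho> g"
  shows "LP U h (\<xi>(k := (\<lambda>w. f w - c * g w))) = LP U h (\<xi>(k := f)) - c * LP U h (\<xi>(k := g))"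
proof -
  have pr: "(\<Prod>j\<in>UNIV. (\<xi>(k := F)) j (P j x)) = F (P k x) * (\<Prod>j\<in>UNIV-{k}. \<xi> j (P j x))" for F x
    by (subst prod.remove[of _ k]) (auto intro!: prod.cong)
  define G where "G F x = indicator U x *\<^sub>R (h x * cnj (J x) * (\<Prod>j\<in>UNIV. (\<xi>(k := F)) j (P j x)))" for F x
  have i1: "integrable lborel (G f)"
    unfolding G_def by (rule integrable_LP[OF h U]) (use t f in simp)
  have i2: "integrable lborel (G g)"
    unfolding G_def by (rule integrable_LP[OF h U]) (use t g in simp)
  have LPG: "LP U h (\<xi>(k := F)) = integral\<^sup>L lborel (G F)" for F
    unfolding LP_def L_def G_def ..
  have "G (\<lambda>w. f w - c * g w) = (\<lambda>x. G f x - c * G g x)"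
    unfolding G_def pr by (simp add: algebra_simps)
  then show ?thesis
    unfolding LPG using i1 i2 by simp
qed

lemma LP_stokes:
  assumes h: "polyfun h" and U: "adm U \<rho>" and t: "\<And>j. j \<noteq> k \<Longrightarrow> C1_test_fun \<rho> (\<xi> j)"
    and f: "wirtinger f a b" "csupp \<rho> f"
  shows "LP U h (\<xi>(k := b)) = 0"
proof -
  have "\<exists>a b. wirtinger (\<xi> j) a b" if "j \<noteq> k" for j
    using t[OF that] by (simp add: C1_test_fun_def)
  then obtain A B where AB: "\<And>j. j \<noteq> k \<Longrightarrow> wirtinger (\<xi> j) (A j) (B j)" by metis
  have *: "L U h (\<lambda>x. (B(k := b)) k (P k x) * (\<Prod>j\<in>UNIV-{k}. (\<xi>(k := f)) j (P j x))) = 0"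
  proof (rule stokes[OF h, where \<xi>="\<xi>(k := f)" and a="A(k := a)" and b="B(k := b)"])
    show "wirtinger ((\<xi>(k := f)) j) ((A(k := a)) j) ((B(k := b)) j)" for j
      using AB f by simp
    show "open U" "compact {x \<in> U. \<forall>j. (cmod (P j x))\<^sup>2 \<le> \<rho>}" using U by (auto simp: adm_def)
    fix x assume "x \<in> U" "x \<notin> {x \<in> U. \<forall>j. (cmod (P j x))\<^sup>2 \<le> \<rho>}"
    then obtain j where "\<rho> < (cmod (P j x))\<^sup>2" by (auto simp: not_le)
    moreover have "csupp \<rho> ((\<xi>(k := f)) j)" using t[of j] f(2) by (auto simp: C1_test_fun_def)
    ultimately have "(\<xi>(k := f)) j (P j x) = 0" by (simp add: csupp_def)
    then show "(\<Prod>j\<in>UNIV. (\<xi>(k := f)) j (P j x)) = 0" by (meson UNIV_I finite prod_zero)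
  qed auto
  have "(\<Prod>j\<in>UNIV. (\<xi>(k := b)) j (P j x)) = (B(k := b)) k (P k x) * (\<Prod>j\<in>UNIV-{k}. (\<xi>(k := f)) j (P j x))" for x
    by (subst prod.remove[of _ k]) (auto intro!: prod.cong)
  then show ?thesis unfolding LP_def using * by simp
qed

text \<open>Factors are exchanged one at a time, therefore the single exchange must be possible next
  to every mixture of f and g in the other places.\<close>

lemma LP_replace:
  assumes "\<And>k \<xi>. (\<And>j. j \<noteq> k \<Longrightarrow> \<xi> j = f j \<or> \<xi> j = g j) \<Longrightarrow> LP U h (\<xi>(k := f k)) = c k * LP U h (\<xi>(k := g k))"
  shows "LP U h f = (\<Prod>k\<in>UNIV. c k) * LP U h g"
proof -
  have "LP U h (\<lambda>j. if j \<in> A then f j else g j) = (\<Prod>k\<in>A. c k) * LP U h g" if "finite A" for A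
    using that
  proof induction
    case (insert k A)
    let ?\<xi> = "\<lambda>j. if j \<in> A then f j else g j"
    have "(\<lambda>j. if j \<in> insert k A then f j else g j) = ?\<xi>(k := f k)" by auto
    moreover have "?\<xi>(k := g k) = ?\<xi>" using insert.hyps by auto
    moreover have "LP U h (?\<xi>(k := f k)) = c k * LP U h (?\<xi>(k := g k))"
      by (rule assms) auto
    ultimately have "LP U h (\<lambda>j. if j \<in> insert k A then f j else g j) = c k * LP U h ?\<xi>" by presburger
    then show ?case using insert by simp
  qed simp
  from this[of UNIV] show ?thesis by simp
qed

text \<open>Zero mass gives a primitive H supported in the same annulus, and the d-bar derivative of
  H(|w|^2) / w^(m+1) is the shell function of exponent m.\<close>

lemma LP_shell_mass_zero:
  assumes h: "polyfun h" and U: "adm U \<rho>" and t: "\<And>j. j \<noteq> k \<Longrightarrow> C1_test_fun \<rho> (\<xi> j)"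
    and b: "bump p q \<eta>" "q \<le> \<rho>" "mass \<eta> = 0"
  shows "LP U h (\<xi>(k := shell_fun \<eta> m)) = 0"
proof -
  obtain H where H: "\<And>s. (H has_real_derivative \<eta> s) (at s)" "\<And>s. s \<le> p \<Longrightarrow> H s = 0" "\<And>s. q \<le> s \<Longrightarrow> H s = 0"
    using bump_primitive[OF b(1)] b(3) by (metis add.inverse_neutral)
  have p: "0 < p" using b(1) by (simp add: bump_def)
  obtain a where w: "wirtinger (shell_fun H (Suc m)) a (\<lambda>w. of_real (\<eta> ((cmod w)\<^sup>2)) * w * inverse w ^ Suc m)"
    using wirtinger_shell_fun[OF H(1) bump_continuous[OF b(1)] p H(2)] by blast
  have cs: "csupp \<rho> (shell_fun H (Suc m))" using H(3) b(2) by (auto simp: csupp_def shell_fun_def)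
  have "LP U h (\<xi>(k := (\<lambda>w. of_real (\<eta> ((cmod w)\<^sup>2)) * w * inverse w ^ Suc m))) = 0"
    by (rule LP_stokes[OF h U _ w cs]) (rule t)
  moreover have "(\<lambda>w. of_real (\<eta> ((cmod w)\<^sup>2)) * w * inverse w ^ Suc m) = shell_fun \<eta> m"
  proof
    fix w :: complex
    show "of_real (\<eta> ((cmod w)\<^sup>2)) * w * inverse w ^ Suc m = shell_fun \<eta> m w"
      using bump_zero[OF b(1), of 0] p by (cases "w = 0") (auto simp: shell_fun_def)
  qed
  ultimately show ?thesis by simp
qed

text \<open>Subtracting from each bump the multiple of a reference bump \<theta> with the same mass
  leaves a bump of mass zero, which contributes nothing. So every bump may be replaced by its
  multiple of \<theta>.\<close>

lemma is_coeff_exists: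
  assumes h: "polyfun h" and U: "adm U \<rho>" and \<rho>: "0 < \<rho>"
  shows "\<exists>C. is_coeff U \<rho> h m C"
proof -
  define \<theta> where "\<theta> = bumpsq (\<rho>/2) \<rho>"
  have b0: "bump (\<rho>/2) \<rho> \<theta>" and m0: "mass \<theta> \<noteq> 0"
    unfolding \<theta>_def using bump_bumpsq[of "\<rho>/2" \<rho>] mass_bumpsq_pos[of "\<rho>/2" \<rho>] \<rho> by auto
  let ?L = "LP U h (\<lambda>j. shell_fun \<theta> (m j))"
  have *: "LP U h (\<lambda>j. shell_fun (\<eta> j) (m j)) = (\<Prod>j\<in>UNIV. of_real (mass (\<eta> j) / mass \<theta>)) * ?L"
    if b: "\<And>j. bump (p j) (q j) (\<eta> j)" "\<And>j. q j \<le> \<rho>" for p q \<eta>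
  proof (rule LP_replace)
    fix k and \<xi> :: "'n \<Rightarrow> complex \<Rightarrow> complex"
    assume \<xi>: "\<And>j. j \<noteq> k \<Longrightarrow> \<xi> j = shell_fun (\<eta> j) (m j) \<or> \<xi> j = shell_fun \<theta> (m j)"
    let ?c = "mass (\<eta> k) / mass \<theta>"
    have t: "C1_test_fun \<rho> (\<xi> j)" if "j \<noteq> k" for j
      using \<xi>[OF that] C1_test_fun_shell_fun[OF b(1)[of j] b(2)[of j]] C1_test_fun_shell_fun[OF b0 order_refl] by auto
    note lc = bump_lincomb[OF b(1)[of k] b0, of ?c]
    have "LP U h (\<xi>(k := shell_fun (\<lambda>s. \<eta> k s - ?c * \<theta> s) (m k))) = 0"
      by (rule LP_shell_mass_zero[OF h U t lc(1)]) (use b(2)[of k] lc(2) m0 in auto)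
    moreover have "shell_fun (\<lambda>s. \<eta> k s - ?c * \<theta> s) (m k) = (\<lambda>w. shell_fun (\<eta> k) (m k) w - of_real ?c * shell_fun \<theta> (m k) w)"
      by (auto simp: shell_fun_def algebra_simps fun_eq_iff)
    moreover have "LP U h (\<xi>(k := (\<lambda>w. shell_fun (\<eta> k) (m k) w - of_real ?c * shell_fun \<theta> (m k) w))) =
       LP U h (\<xi>(k := shell_fun (\<eta> k) (m k))) - of_real ?c * LP U h (\<xi>(k := shell_fun \<theta> (m k)))"
      by (rule LP_diff[OF h U]) (use t C1_test_fun_imp C1_test_fun_shell_fun[OF b(1)[of k] b(2)[of k]] C1_test_fun_shell_fun[OF b0 order_refl] in blast)+
    ultimately show "LP U h (\<xi>(k := shell_fun (\<eta> k) (m k))) = of_real ?c * LP U h (\<xi>(k := shell_fun \<theta> (m k)))"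
      by simp
  qed
  have "is_coeff U \<rho> h m (?L / (\<Prod>j\<in>(UNIV::'n set). of_real (mass \<theta>)))"
    unfolding is_coeff_def
  proof (intro allI impI)
    fix p q :: "'n \<Rightarrow> real" and \<eta> :: "'n \<Rightarrow> real \<Rightarrow> real" assume "\<forall>j. bump (p j) (q j) (\<eta> j) \<and> q j \<le> \<rho>"
    then show "LP U h (\<lambda>j. shell_fun (\<eta> j) (m j)) =
      ?L / (\<Prod>j\<in>(UNIV::'n set). of_real (mass \<theta>)) * (\<Prod>j\<in>UNIV. of_real (mass (\<eta> j)))"
      using *[of p q \<eta>] by (simp add: prod_dividef mult.commute)
  qed
  then show ?thesis by blast
qed

lemma is_coeff_mono: "is_coeff U \<rho> h m C \<Longrightarrow> \<rho>' \<le> \<rho> \<Longrightarrow> is_coeff U \<rho>' h m C"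
  unfolding is_coeff_def by (meson order_trans)

lemma is_coeff_unique:
  assumes "is_coeff U \<rho> h m C" "is_coeff U \<rho> h m C'" "0 < \<rho>"
  shows "C = C'"
proof -
  define \<theta> where "\<theta> = bumpsq (\<rho>/2) \<rho>"
  have b0: "bump (\<rho>/2) \<rho> \<theta>" and m0: "mass \<theta> \<noteq> 0"
    unfolding \<theta>_def using bump_bumpsq[of "\<rho>/2" \<rho>] mass_bumpsq_pos[of "\<rho>/2" \<rho>] assms(3) by auto
  have "LP U h (\<lambda>j. shell_fun \<theta> (m j)) = K * (\<Prod>j\<in>(UNIV::'n set). of_real (mass \<theta>))" if "is_coeff U \<rho> h m K" for K
    using that[unfolded is_coeff_def, rule_format, of "\<lambda>_. \<rho>/2" "\<lambda>_. \<rho>" "\<lambda>_. \<theta>"] b0 by simp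
  from this[OF assms(1)] this[OF assms(2)] m0 show ?thesis by simp
qed

end

section \<open>Sharp shells, shifted shells and the geometric series\<close>

lemma bump_one_minus_power:
  assumes "bump p q b"
  shows "bump p q (\<lambda>s. 1 - (1 - b s) ^ n)"
proof -
  obtain b' where b': "continuous_on UNIV b'" "\<And>s. (b has_real_derivative b' s) (at s)"
    using assms unfolding bump_def by blast
  have "((\<lambda>s. 1 - (1 - b s) ^ n) has_real_derivative real n * (1 - b s) ^ (n - 1) * b' s) (at s)" for s
    using b'(2)[of s] by (auto intro!: derivative_eq_intros)
  moreover have "continuous_on UNIV (\<lambda>s. real n * (1 - b s) ^ (n - 1) * b' s)"
    using b'(1) bump_continuous[OF assms] by (intro continuous_intros)
  ultimately show ?thesis
    using assms bump_zero[OF assms] unfolding bump_def by (auto intro!: exI[of _ "\<lambda>s. real n * (1 - b s) ^ (n - 1) * b' s"])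
qed

lemma bump_divide:
  assumes "bump p q b"
  shows "bump p q (\<lambda>s. b s / s)"
proof -
  obtain b' where b': "continuous_on UNIV b'" "\<And>s. (b has_real_derivative b' s) (at s)"
    using assms unfolding bump_def by blast
  have p: "0 < p" using assms by (simp add: bump_def)
  let ?d = "\<lambda>s. b' s / s - b s / s\<^sup>2"
  have b'0: "b' s = 0" if "s < p" for s
  proof -
    have "((\<lambda>s. 0) has_real_derivative b' s) (at s)"
      by (rule has_field_derivative_transform_within_open[OF b'(2), where S="{..<p}"]) (use that bump_zero[OF assms] in auto)
    then show ?thesis using DERIV_unique DERIV_const by blast
  qed
  have d0: "?d s = 0" if "s < p" for s using b'0[OF that] bump_zero[OF assms, of s] that by simp
  have "((\<lambda>s. b s / s) has_real_derivative ?d s) (at s)" for s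
  proof (cases "s < p")
    case True
    have "((\<lambda>s. b s / s) has_real_derivative 0) (at s)"
      by (rule has_field_derivative_transform_within_open[OF DERIV_const, where S="{..<p}"]) (use True bump_zero[OF assms] in auto)
    then show ?thesis using d0[OF True] by simp
  next
    case False
    then have "0 < s" using p by simp
    then show ?thesis using b'(2)[of s] by (auto intro!: derivative_eq_intros simp: field_simps power2_eq_square)
  qed
  moreover have "continuous_on UNIV ?d"
  proof -
    have 1: "continuous_on {0<..} ?d"
      using b'(1) bump_continuous[OF assms] by (intro continuous_intros) (auto intro: continuous_on_subset)
    have 2: "continuous_on {..<p} ?d"
      by (rule continuous_on_eq[OF continuous_on_const[of _ 0]]) (use d0 in auto)
    have "{0<..} \<union> {..<p} = UNIV" using p by auto
    then show ?thesis using continuous_on_open_Un[OF _ _ 1 2] by simp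
  qed
  ultimately show ?thesis
    using assms bump_zero[OF assms] unfolding bump_def by (auto intro!: exI[of _ ?d])
qed

text \<open>As \<open>bumpsq\<close> lies in (0,1] inside the interval, 1 - (1 - b)^n increases to
  the indicator of the open interval; all terms are bumps, so the coefficients are known on
  them.\<close>

definition shell_approx :: "real \<Rightarrow> real \<Rightarrow> nat \<Rightarrow> real \<Rightarrow> real" where
  "shell_approx p q n s = (1 - (1 - bumpsq p q s) ^ n) / s"

lemma shell_approx:
  assumes p: "0 < p" "p < q"
  shows "bump p q (shell_approx p q n)" "\<bar>shell_approx p q n s\<bar> \<le> indicator {p<..<q} s / s"
    "(\<lambda>n. shell_approx p q n s) \<longlonglongrightarrow> indicator {p<..<q} s / s"
    "(\<lambda>n. mass (shell_approx p q n)) \<longlonglongrightarrow> ln (q / p)"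
proof -
  show b: "bump p q (shell_approx p q n)" for n
    unfolding shell_approx_def[abs_def] by (intro bump_divide bump_one_minus_power bump_bumpsq p)
  show bd: "\<bar>shell_approx p q n s\<bar> \<le> indicator {p<..<q} s / s" for n s
  proof (cases "s \<in> {p<..<q}")
    case True
    have "0 \<le> (1 - bumpsq p q s) ^ n" "(1 - bumpsq p q s) ^ n \<le> 1"
      using bumpsq_bounds(1,2)[OF p(2), of s] by (auto intro: power_le_one)
    then show ?thesis using True p by (auto simp: shell_approx_def divide_right_mono)
  next
    case False
    then show ?thesis using bump_zero[OF b, of s] by auto
  qed
  show lim: "(\<lambda>n. shell_approx p q n s) \<longlonglongrightarrow> indicator {p<..<q} s / s" for s
  proof (cases "s \<in> {p<..<q}")
    case True
    have "(\<lambda>n. (1 - bumpsq p q s) ^ n) \<longlonglongrightarrow> 0"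
      using bumpsq_bounds(2,3)[OF p(2), of s] True by (intro LIMSEQ_power_zero) (simp add: abs_if)
    then have "(\<lambda>n. (1 - (1 - bumpsq p q s) ^ n) / s) \<longlonglongrightarrow> (1 - 0) / s"
      using True p by (intro tendsto_divide tendsto_diff tendsto_const) auto
    then show ?thesis using True by (simp add: shell_approx_def)
  next
    case False
    then have "shell_approx p q n s = 0" for n using bump_zero[OF b, of s] by auto
    then show ?thesis using False by simp
  qed
  have lnI: "((\<lambda>s. indicator {p<..<q} s / s) has_integral ln q - ln p) {p..q}"
  proof (rule has_integral_spike_finite[of "{p, q}"])
    show "((\<lambda>s. 1 / s) has_integral ln q - ln p) {p..q}"
      by (rule fundamental_theorem_of_calculus)
        (use p in \<open>auto intro!: derivative_eq_intros simp: has_real_derivative_iff_has_vector_derivative[symmetric]\<close>)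
  qed auto
  have "(\<lambda>n. integral {p..q} (shell_approx p q n)) \<longlonglongrightarrow> integral {p..q} (\<lambda>s. indicator {p<..<q} s / s)"
  proof (rule dominated_convergence(2)[where h="\<lambda>s. indicator {p<..<q} s / s"])
    show "shell_approx p q n integrable_on {p..q}" for n
      by (rule integrable_continuous_real[OF bump_continuous[OF b]])
    show "(\<lambda>s. indicator {p<..<q} s / s :: real) integrable_on {p..q}" using lnI by blast
    show "norm (shell_approx p q n s) \<le> indicator {p<..<q} s / s" for n s using bd by simp
    show "(\<lambda>n. shell_approx p q n s) \<longlonglongrightarrow> indicator {p<..<q} s / s" for s by (rule lim)
  qed
  moreover have "integral {p..q} (shell_approx p q n) = mass (shell_approx p q n)" for n
    using bump_has_integral(1)[OF b order_refl order_refl] by (simp add: integral_unique)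
  moreover have "ln q - ln p = ln (q / p)" using p by (simp add: ln_div)
  ultimately show "(\<lambda>n. mass (shell_approx p q n)) \<longlonglongrightarrow> ln (q / p)"
    using integral_unique[OF lnI] by simp
qed

lemma shell_fun_bound:
  assumes "\<And>s. \<bar>\<eta> s\<bar> \<le> B * indicator {p<..<q} s" "0 < p" "0 \<le> B"
  shows "cmod (shell_fun \<eta> m w) \<le> B * inverse (sqrt p) ^ m"
proof (cases "p < (cmod w)\<^sup>2")
  case True
  then have "sqrt p \<le> cmod w" using assms(2) by (metis abs_norm_cancel less_imp_le real_sqrt_abs real_sqrt_le_iff)
  then have "inverse (cmod w) ^ m \<le> inverse (sqrt p) ^ m"
    using assms(2) by (intro power_mono le_imp_inverse_le) auto
  moreover have "\<bar>\<eta> ((cmod w)\<^sup>2)\<bar> \<le> B"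
    using assms(1)[of "(cmod w)\<^sup>2"] assms(3) True by (cases "(cmod w)\<^sup>2 < q") (auto simp: indicator_def)
  ultimately show ?thesis
    unfolding shell_fun_def norm_mult norm_power norm_inverse norm_of_real
    using assms by (intro mult_mono) auto
next
  case False
  then have "\<eta> ((cmod w)\<^sup>2) = 0" using assms(1)[of "(cmod w)\<^sup>2"] by (auto simp: indicator_def)
  then show ?thesis using assms by (simp add: shell_fun_def)
qed

lemma measurable_shell_fun:
  assumes "\<eta> \<in> borel_measurable borel"
  shows "shell_fun \<eta> m \<in> borel_measurable borel"
proof -
  have [measurable]: "(\<lambda>w::complex. \<eta> ((cmod w)\<^sup>2)) \<in> borel_measurable borel"
    by (rule measurable_compose[OF _ assms]) (intro borel_measurable_continuous_onI continuous_intros)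
  have [measurable]: "(\<lambda>w::complex. complex_of_real (\<eta> ((cmod w)\<^sup>2))) \<in> borel_measurable borel"
    by measurable
  have [measurable]: "(\<lambda>w::complex. inverse w ^ m) \<in> borel_measurable borel" by measurable
  show ?thesis unfolding shell_fun_def[abs_def] by measurable
qed

text \<open>With u = ln |w| the density ds/s is 2 du: in logarithmic coordinates these shells are
  uniform on intervals, which is what the slicing into cycles requires.\<close>

definition ind_shell :: "real \<Rightarrow> real \<Rightarrow> real \<Rightarrow> real" where
  "ind_shell p q s = indicator {p<..<q} s / s"

lemma test_fun_ind_shell:
  assumes p: "0 < p" "q \<le> \<rho>"
  shows "test_fun \<rho> (shell_fun (ind_shell p q) m)"
proof -
  have "cmod (shell_fun (ind_shell p q) m w) \<le> (1/p) * inverse (sqrt p) ^ m" for w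
    by (rule shell_fun_bound[where q=q]) (use p in \<open>auto simp: ind_shell_def indicator_def divide_simps\<close>)
  moreover have "ind_shell p q \<in> borel_measurable borel" unfolding ind_shell_def[abs_def] by measurable
  moreover have "csupp \<rho> (shell_fun (ind_shell p q) m)"
    using p by (auto simp: csupp_def shell_fun_def ind_shell_def indicator_def)
  ultimately show ?thesis unfolding test_fun_def using measurable_shell_fun by blast
qed

definition shift_fun :: "(real \<Rightarrow> real) \<Rightarrow> complex \<Rightarrow> complex \<Rightarrow> complex" where
  "shift_fun \<eta> c w = of_real (\<eta> ((cmod (w - c))\<^sup>2))"

text \<open>For w different from 0 the last factor is 1 / (1 - c/w), the sum of the geometric series
  in c/w where |c| < |w|.\<close>

definition geom_fun :: "(real \<Rightarrow> real) \<Rightarrow> complex \<Rightarrow> complex \<Rightarrow> complex" where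
  "geom_fun \<eta> c w = of_real (\<eta> ((cmod w)\<^sup>2)) * (w * inverse (w - c))"

lemma cmod_diff_square_ge:
  assumes "0 \<le> q" "(sqrt q + cmod c)\<^sup>2 \<le> \<rho>" "\<rho> < (cmod w)\<^sup>2"
  shows "q \<le> (cmod (w - c))\<^sup>2"
proof -
  have "(sqrt q + cmod c)\<^sup>2 < (cmod w)\<^sup>2" using assms by simp
  then have "sqrt q + cmod c < cmod w" by (rule power2_less_imp_less) simp
  then have "sqrt q \<le> cmod (w - c)" using norm_triangle_ineq2[of w c] by simp
  then have "(sqrt q)\<^sup>2 \<le> (cmod (w - c))\<^sup>2" by (rule power_mono) (use assms in simp)
  then show ?thesis using assms(1) by simp
qed

text \<open>The first condition on c puts the pole c into the hole of the annulus; the second makes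
  the disc around c that carries the shifted bump fit into |w|^2 <= \<rho>.\<close>

lemma C1_test_fun_shift_geom:
  assumes b: "bump p q \<eta>" and c: "(cmod c)\<^sup>2 < p" "(sqrt q + cmod c)\<^sup>2 \<le> \<rho>"
  shows "C1_test_fun \<rho> (shift_fun \<eta> c)" "C1_test_fun \<rho> (geom_fun \<eta> c)"
proof -
  obtain \<eta>' where d: "continuous_on UNIV \<eta>'" "\<And>s. (\<eta> has_real_derivative \<eta>' s) (at s)"
    using b unfolding bump_def by blast
  have pq: "0 < p" "p < q" using b by (auto simp: bump_def)
  have "\<exists>a b. wirtinger (shift_fun \<eta> c) a b"
    unfolding shift_fun_def[abs_def] using wirtinger_radial[OF d(2,1)] by blast
  moreover have "csupp \<rho> (shift_fun \<eta> c)"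
    using cmod_diff_square_ge[OF _ c(2)] pq bump_zero[OF b] by (auto simp: csupp_def shift_fun_def)
  ultimately show "C1_test_fun \<rho> (shift_fun \<eta> c)" by (simp add: C1_test_fun_def)
  note w = wirtinger_radial[OF d(2,1), of 0]
  have g: "((\<lambda>w. w * inverse (w - c)) has_field_derivative inverse (w - c) - w * inverse (w - c) ^ 2) (at w)" if "w \<in> - {c}" for w
    using that by (auto intro!: derivative_eq_intros simp: power2_eq_square)
  have o: "open {w::complex. (cmod w)\<^sup>2 < p}" by (intro open_Collect_less continuous_intros)
  have "\<exists>a b. wirtinger (\<lambda>z. of_real (\<eta> ((cmod (z - 0))\<^sup>2)) * (z * inverse (z - c))) a b"
    by (rule exI, rule exI, rule wirtinger_mult_holomorphic[where D="- {c}", OF w _ g _ o])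
       (use c bump_zero[OF b] in \<open>auto intro!: continuous_intros\<close>)
  then have "\<exists>a b. wirtinger (geom_fun \<eta> c) a b" by (simp add: geom_fun_def[abs_def])
  moreover have "q \<le> \<rho>"
  proof -
    have "(sqrt q)\<^sup>2 \<le> (sqrt q + cmod c)\<^sup>2" using pq by (intro power_mono) auto
    then show ?thesis using c(2) pq by simp
  qed
  then have "csupp \<rho> (geom_fun \<eta> c)"
    using bump_zero[OF b] by (auto simp: csupp_def geom_fun_def)
  ultimately show "C1_test_fun \<rho> (geom_fun \<eta> c)" by (simp add: C1_test_fun_def)
qed

context pushforward
begin

text \<open>Dominated convergence along \<open>shell_approx\<close>, whose masses tend to the
  logarithmic length of the shell.\<close>

lemma LP_ind_shell:
  assumes h: "polyfun h" and U: "adm U \<rho>" and C: "is_coeff U \<rho> h m C"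
    and pq: "\<And>j. 0 < p j" "\<And>j. p j < q j" "\<And>j. q j \<le> \<rho>"
  shows "LP U h (\<lambda>j. shell_fun (ind_shell (p j) (q j)) (m j)) = C * (\<Prod>j\<in>UNIV. of_real (ln (q j / p j)))"
proof -
  note sa = shell_approx[OF pq(1,2)]
  have "LP U h (\<lambda>j. shell_fun (shell_approx (p j) (q j) n) (m j)) = C * (\<Prod>j\<in>UNIV. of_real (mass (shell_approx (p j) (q j) n)))" for n
    using C[unfolded is_coeff_def, rule_format, of p q "\<lambda>j. shell_approx (p j) (q j) n"] sa(1) pq(3) by blast
  moreover have "(\<lambda>n. LP U h (\<lambda>j. shell_fun (shell_approx (p j) (q j) n) (m j))) \<longlonglongrightarrow> LP U h (\<lambda>j. shell_fun (ind_shell (p j) (q j)) (m j))"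
  proof (rule LP_tendsto[OF h U, where B="\<lambda>j. (1 / p j) * inverse (sqrt (p j)) ^ m j"])
    show "cmod (shell_fun (shell_approx (p j) (q j) n) (m j) w) \<le> (1 / p j) * inverse (sqrt (p j)) ^ m j" for n j w
    proof (rule shell_fun_bound)
      show "\<bar>shell_approx (p j) (q j) n s\<bar> \<le> 1 / p j * indicator {p j<..<q j} s" for s
      proof (cases "s \<in> {p j<..<q j}")
        case True
        then have "\<bar>shell_approx (p j) (q j) n s\<bar> \<le> 1 / s" using sa(2)[of j n s] by simp
        also have "\<dots> \<le> 1 / p j" using True pq(1)[of j] by (intro frac_le) auto
        finally show ?thesis using True by simp
      next
        case False
        then show ?thesis using sa(2)[of j n s] by simp
      qed
    qed (use pq in \<open>auto simp: less_imp_le\<close>)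
    show "shell_fun (shell_approx (p j) (q j) n) (m j) \<in> borel_measurable borel" for n j
      by (intro measurable_shell_fun borel_measurable_continuous_onI bump_continuous[OF sa(1)])
    show "shell_fun (ind_shell (p j) (q j)) (m j) \<in> borel_measurable borel" for j
      using test_fun_ind_shell[OF pq(1) pq(3)] by (simp add: test_fun_def)
    show "csupp \<rho> (shell_fun (shell_approx (p j) (q j) n) (m j))" for n j
      using C1_test_fun_shell_fun[OF sa(1) pq(3)] by (simp add: C1_test_fun_def)
    show "(\<lambda>n. shell_fun (shell_approx (p j) (q j) n) (m j) w) \<longlonglongrightarrow> shell_fun (ind_shell (p j) (q j)) (m j) w" for j w
      unfolding shell_fun_def ind_shell_def by (intro tendsto_intros sa(3))
  qed
  moreover have "(\<lambda>n. C * (\<Prod>j\<in>UNIV. of_real (mass (shell_approx (p j) (q j) n)))) \<longlonglongrightarrow> C * (\<Prod>j\<in>UNIV. of_real (ln (q j / p j)))"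
    by (intro tendsto_intros sa(4))
  ultimately show ?thesis by (simp add: LIMSEQ_unique)
qed

text \<open>Moving the centre of a shell from c to 0 costs a d-bar exact term. With H the primitive
  of the bump, (H(|w - c|^2) - H(|w|^2)) / (w - c) has d-bar derivative \<open>shift_fun\<close>
  minus \<open>geom_fun\<close>.\<close>

lemma LP_shift:
  assumes h: "polyfun h" and U: "adm U \<rho>" and b: "\<And>j. bump (p j) (q j) (\<eta> j)"
    and c: "\<And>j. (cmod (c j))\<^sup>2 < p j" "\<And>j. (sqrt (q j) + cmod (c j))\<^sup>2 \<le> \<rho>"
  shows "LP U h (\<lambda>j. shift_fun (\<eta> j) (c j)) = LP U h (\<lambda>j. geom_fun (\<eta> j) (c j))"
proof -
  note t = C1_test_fun_shift_geom[OF b c]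
  have "LP U h (\<lambda>j. shift_fun (\<eta> j) (c j)) = (\<Prod>j\<in>(UNIV::'n set). 1) * LP U h (\<lambda>j. geom_fun (\<eta> j) (c j))"
  proof (rule LP_replace)
    fix k and \<xi> :: "'n \<Rightarrow> complex \<Rightarrow> complex"
    assume \<xi>: "\<And>j. j \<noteq> k \<Longrightarrow> \<xi> j = shift_fun (\<eta> j) (c j) \<or> \<xi> j = geom_fun (\<eta> j) (c j)"
    have t': "C1_test_fun \<rho> (\<xi> j)" if "j \<noteq> k" for j using \<xi>[OF that] t[of j] by metis
    obtain H where H: "\<And>s. (H has_real_derivative \<eta> k s) (at s)" "\<And>s. s \<le> p k \<Longrightarrow> H s = - mass (\<eta> k)" "\<And>s. q k \<le> s \<Longrightarrow> H s = 0"
      using bump_primitive[OF b[of k]] by blast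
    have pq: "0 < p k" "p k < q k" using b[of k] by (auto simp: bump_def)
    have ce: "continuous_on UNIV (\<eta> k)" by (rule bump_continuous[OF b])
    note w = wirtinger_diff[OF wirtinger_radial[OF H(1) ce, of "c k"] wirtinger_radial[OF H(1) ce, of 0]]
    have g: "((\<lambda>w. inverse (w - c k)) has_field_derivative - (inverse (w - c k) ^ 2)) (at w)" if "w \<in> - {c k}" for w
      using that by (auto intro!: derivative_eq_intros simp: power2_eq_square)
    have o: "open ({w::complex. (cmod w)\<^sup>2 < p k} \<inter> {w. (cmod (w - c k))\<^sup>2 < p k})"
      by (intro open_Int open_Collect_less continuous_intros)
    \<comment> \<open>Near the pole c both values of H equal minus the mass, so the numerator
      vanishes there; far out both values are zero, which gives compact support.\<close>
    let ?f = "\<lambda>z. (of_real (H ((cmod (z - c k))\<^sup>2)) - of_real (H ((cmod (z - 0))\<^sup>2))) * inverse (z - c k)"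
    let ?b = "\<lambda>z. (of_real (\<eta> k ((cmod (z - c k))\<^sup>2)) * (z - c k) - of_real (\<eta> k ((cmod (z - 0))\<^sup>2)) * (z - 0)) * inverse (z - c k)"
    have "\<exists>a. wirtinger ?f a ?b"
    proof (rule exI, rule wirtinger_mult_holomorphic[where D="- {c k}", OF w _ g _ o])
      show "{w. (cmod w)\<^sup>2 < p k} \<inter> {w. (cmod (w - c k))\<^sup>2 < p k} \<union> - {c k} = UNIV"
        using c(1)[of k] pq by auto
      show "complex_of_real (H ((cmod (z - c k))\<^sup>2)) - of_real (H ((cmod (z - 0))\<^sup>2)) = 0"
        if "z \<in> {w. (cmod w)\<^sup>2 < p k} \<inter> {w. (cmod (w - c k))\<^sup>2 < p k}" for z
        using that H(2)[of "(cmod (z - c k))\<^sup>2"] H(2)[of "(cmod (z - 0))\<^sup>2"] by simp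
    qed (auto intro!: continuous_intros)
    then obtain a where wf: "wirtinger ?f a ?b" by blast
    have "q k \<le> \<rho>"
    proof -
      have "(sqrt (q k))\<^sup>2 \<le> (sqrt (q k) + cmod (c k))\<^sup>2" using pq by (intro power_mono) auto
      then show ?thesis using c(2)[of k] pq by simp
    qed
    then have cs: "csupp \<rho> ?f"
      using cmod_diff_square_ge[OF _ c(2)[of k]] pq H(3) by (auto simp: csupp_def)
    have "LP U h (\<xi>(k := ?b)) = 0"
      by (rule LP_stokes[OF h U _ wf cs]) (rule t')
    moreover have "?b = (\<lambda>w. shift_fun (\<eta> k) (c k) w - 1 * geom_fun (\<eta> k) (c k) w)"
    proof
      fix w
      show "?b w = shift_fun (\<eta> k) (c k) w - 1 * geom_fun (\<eta> k) (c k) w"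
        using bump_zero[OF b[of k], of 0] pq
        by (cases "w = c k") (auto simp: shift_fun_def geom_fun_def field_simps)
    qed
    moreover have "LP U h (\<xi>(k := (\<lambda>w. shift_fun (\<eta> k) (c k) w - 1 * geom_fun (\<eta> k) (c k) w))) =
       LP U h (\<xi>(k := shift_fun (\<eta> k) (c k))) - 1 * LP U h (\<xi>(k := geom_fun (\<eta> k) (c k)))"
      by (rule LP_diff[OF h U]) (rule C1_test_fun_imp, rule t', assumption, rule C1_test_fun_imp[OF t(1)], rule C1_test_fun_imp[OF t(2)])
    ultimately show "LP U h (\<xi>(k := shift_fun (\<eta> k) (c k))) = 1 * LP U h (\<xi>(k := geom_fun (\<eta> k) (c k)))"
      by simp
  qed
  then show ?thesis by simp
qed

text \<open>Partial sums of the geometric series are combinations of shell functions. Only exponents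
  in F contribute, so the values of \<open>LP\<close> on partial sums are eventually constant, while
  dominated convergence identifies their limit.\<close>

lemma LP_geom:
  assumes h: "polyfun h" and U: "adm U \<rho>" and b: "\<And>j. bump (p j) (q j) (\<eta> j)" "\<And>j. q j \<le> \<rho>"
    and c: "\<And>j. (cmod (c j))\<^sup>2 < p j"
    and C: "\<And>m. is_coeff U \<rho> h m (C m)" and F: "finite F" "\<And>m. m \<notin> F \<Longrightarrow> C m = 0"
  shows "LP U h (\<lambda>j. geom_fun (\<eta> j) (c j)) = (\<Sum>m\<in>F. C m * (\<Prod>j\<in>UNIV. c j ^ m j)) * (\<Prod>j\<in>UNIV. of_real (mass (\<eta> j)))"
proof -
  define \<xi> where "\<xi> M j w = (\<Sum>i<M. c j ^ i * shell_fun (\<eta> j) i w)" for M :: nat and j w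
  let ?Pi = "\<lambda>M::nat. PiE (UNIV::'n set) (\<lambda>_. {..<M})"
  have pq: "0 < p j" "p j < q j" for j using b[of j] by (auto simp: bump_def)
  have t: "test_fun \<rho> (shell_fun (\<eta> j) i)" for i j
    by (rule C1_test_fun_imp[OF C1_test_fun_shell_fun[OF b]])
  have LPxi: "LP U h (\<xi> M) = (\<Sum>m\<in>?Pi M. (\<Prod>j\<in>UNIV. c j ^ m j) * LP U h (\<lambda>j. shell_fun (\<eta> j) (m j)))" for M
  proof -
    have "(\<Prod>j\<in>UNIV. \<xi> M j (P j x)) = (\<Sum>m\<in>?Pi M. (\<Prod>j\<in>UNIV. c j ^ m j) * (\<Prod>j\<in>UNIV. shell_fun (\<eta> j) (m j) (P j x)))" for x
      unfolding \<xi>_def by (subst prod_sum_PiE) (auto simp: prod.distrib)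
    note pr = this
    define G where "G m x = indicator U x *\<^sub>R (h x * cnj (J x) * (\<Prod>j\<in>UNIV. shell_fun (\<eta> j) (m j) (P j x)))" for m :: "'n \<Rightarrow> nat" and x
    have i: "integrable lborel (G m)" for m unfolding G_def by (rule integrable_LP[OF h U t])
    have "indicator U x *\<^sub>R (h x * cnj (J x) * (\<Prod>j\<in>UNIV. \<xi> M j (P j x))) = (\<Sum>m\<in>?Pi M. (\<Prod>j\<in>UNIV. c j ^ m j) * G m x)" for x
      unfolding pr G_def sum_distrib_left scaleR_sum_right by (intro sum.cong refl) (simp add: mult_ac)
    then have "LP U h (\<xi> M) = integral\<^sup>L lborel (\<lambda>x. \<Sum>m\<in>?Pi M. (\<Prod>j\<in>UNIV. c j ^ m j) * G m x)"
      unfolding LP_def L_def by (simp only:)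
    also have "\<dots> = (\<Sum>m\<in>?Pi M. (\<Prod>j\<in>UNIV. c j ^ m j) * integral\<^sup>L lborel (G m))"
      using i by (subst Bochner_Integration.integral_sum) auto
    finally show ?thesis unfolding LP_def L_def G_def .
  qed
  define K where "K = (\<Sum>m\<in>F. C m * (\<Prod>j\<in>UNIV. c j ^ m j)) * (\<Prod>j\<in>UNIV. of_real (mass (\<eta> j)))"
  have ev: "eventually (\<lambda>M. LP U h (\<xi> M) = K) sequentially"
  proof -
    obtain M0 where M0: "\<And>m j. m \<in> F \<Longrightarrow> m j < M0"
    proof
      fix m j assume "m \<in> F"
      then have "m j \<in> (\<lambda>(m, j). m j) ` (F \<times> UNIV)" by force
      then have "m j \<le> Max ((\<lambda>(m, j). m j) ` (F \<times> UNIV))" using F(1) by (intro Max_ge) auto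
      then show "m j < Suc (Max ((\<lambda>(m, j). m j) ` (F \<times> UNIV)))" by simp
    qed
    have "LP U h (\<xi> M) = K" if "M0 \<le> M" for M
    proof -
      have "LP U h (\<lambda>j. shell_fun (\<eta> j) (m j)) = C m * (\<Prod>j\<in>UNIV. of_real (mass (\<eta> j)))" for m
        using C[unfolded is_coeff_def, rule_format, of p q \<eta> m] b by blast
      then have "LP U h (\<xi> M) = (\<Sum>m\<in>?Pi M. C m * (\<Prod>j\<in>UNIV. c j ^ m j)) * (\<Prod>j\<in>UNIV. of_real (mass (\<eta> j)))"
        unfolding LPxi sum_distrib_right by (simp add: mult_ac)
      also have "(\<Sum>m\<in>?Pi M. C m * (\<Prod>j\<in>UNIV. c j ^ m j)) = (\<Sum>m\<in>F. C m * (\<Prod>j\<in>UNIV. c j ^ m j))"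
      proof (rule sum.mono_neutral_right)
        show "finite (?Pi M)" by (intro finite_PiE) auto
        show "F \<subseteq> ?Pi M" using M0 that by (auto simp: PiE_iff intro: less_le_trans)
      qed (use F in auto)
      finally show ?thesis by (simp add: K_def)
    qed
    then show ?thesis by (auto simp: eventually_sequentially)
  qed
  have "(\<lambda>M. LP U h (\<xi> M)) \<longlonglongrightarrow> LP U h (\<lambda>j. geom_fun (\<eta> j) (c j))"
  proof -
    have "test_fun \<rho> (shell_fun (\<eta> j) 0)" for j by (rule t)
    then have "\<forall>j. \<exists>B. \<forall>w. cmod (shell_fun (\<eta> j) 0 w) \<le> B" by (simp add: test_fun_def)
    then obtain B where B: "\<And>j w. cmod (shell_fun (\<eta> j) 0 w) \<le> B j" by metis
    \<comment> \<open>On the support |w|^2 > p j, so this is a bound below 1 for |c j / w|, uniform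
      in w.\<close>
    define r where "r j = cmod (c j) / sqrt (p j)" for j
    have r: "0 \<le> r j" "r j < 1" for j
    proof -
      have "sqrt ((cmod (c j))\<^sup>2) < sqrt (p j)" using c[of j] by (rule real_sqrt_less_mono)
      then show "0 \<le> r j" "r j < 1" using pq(1)[of j] by (auto simp: r_def)
    qed
    have xi: "\<xi> M j w = shell_fun (\<eta> j) 0 w * (\<Sum>i<M. (c j * inverse w) ^ i)" for M j w
      unfolding \<xi>_def shell_fun_def sum_distrib_left by (simp add: power_mult_distrib mult_ac)
    have small: "cmod (c j * inverse w) \<le> r j" if "p j < (cmod w)\<^sup>2" for j w
    proof -
      have "sqrt (p j) \<le> cmod w" using that by (metis abs_norm_cancel less_imp_le real_sqrt_abs real_sqrt_le_iff)
      then show ?thesis unfolding r_def norm_mult norm_inverse divide_inverse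
        using pq(1)[of j] by (intro mult_left_mono le_imp_inverse_le) auto
    qed
    have zero: "shell_fun (\<eta> j) 0 w = 0" if "\<not> p j < (cmod w)\<^sup>2" for j w
      using bump_zero[OF b(1)[of j]] that by (auto simp: shell_fun_def)
    show ?thesis
    proof (rule LP_tendsto[OF h U, where B="\<lambda>j. B j * (1 / (1 - r j))"])
      show "\<xi> n j \<in> borel_measurable borel" for n j
        unfolding \<xi>_def[abs_def] using t by (intro borel_measurable_sum borel_measurable_times borel_measurable_const) (simp add: test_fun_def)
      show "geom_fun (\<eta> j) (c j) \<in> borel_measurable borel" for j
        unfolding geom_fun_def[abs_def] using t[of j 0] by (intro borel_measurable_times borel_measurable_inverse) (auto simp: test_fun_def shell_fun_def[abs_def])
      show "cmod (\<xi> n j w) \<le> B j * (1 / (1 - r j))" for n j w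
      proof (cases "p j < (cmod w)\<^sup>2")
        case True
        have "cmod (\<Sum>i<n. (c j * inverse w) ^ i) \<le> (\<Sum>i<n. r j ^ i)"
          by (rule sum_norm_le) (unfold norm_power, intro power_mono small[OF True] norm_ge_zero)
        also have "\<dots> \<le> 1 / (1 - r j)"
          using r[of j] by (simp add: sum_gp_strict divide_simps)
        finally show ?thesis unfolding xi norm_mult using B[of j w]
          by (intro mult_mono) (auto intro: order_trans[OF norm_ge_zero])
      next
        case False
        then show ?thesis using zero[OF False] B[of j w] r[of j] unfolding xi by simp
      qed
      show "csupp \<rho> (\<xi> n j)" for n j
        using t[of j 0] by (auto simp: xi csupp_def test_fun_def)
      show "(\<lambda>n. \<xi> n j w) \<longlonglongrightarrow> geom_fun (\<eta> j) (c j) w" for j w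
      proof (cases "p j < (cmod w)\<^sup>2")
        case True
        have "cmod (c j * inverse w) < 1" using small[OF True] r(2)[of j] by simp
        then have "(\<lambda>n. shell_fun (\<eta> j) 0 w * (\<Sum>i<n. (c j * inverse w) ^ i)) \<longlonglongrightarrow> shell_fun (\<eta> j) 0 w * (1 / (1 - c j * inverse w))"
          by (intro tendsto_mult tendsto_const) (use geometric_sums in \<open>auto simp: sums_def\<close>)
        moreover have "shell_fun (\<eta> j) 0 w * (1 / (1 - c j * inverse w)) = geom_fun (\<eta> j) (c j) w"
        proof -
          have "w \<noteq> 0" using True pq(1)[of j] by auto
          moreover have "w \<noteq> c j" using True c[of j] by auto
          ultimately show ?thesis by (auto simp: shell_fun_def geom_fun_def field_simps)
        qed
        ultimately show ?thesis unfolding xi by simp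
      next
        case False
        then have "geom_fun (\<eta> j) (c j) w = 0" using bump_zero[OF b(1)[of j]] by (auto simp: geom_fun_def)
        then show ?thesis unfolding xi zero[OF False] by simp
      qed
    qed
  qed
  moreover have "(\<lambda>M. LP U h (\<xi> M)) \<longlonglongrightarrow> K"
    using ev by (rule tendsto_eventually)
  ultimately show ?thesis unfolding K_def[symmetric] by (rule LIMSEQ_unique)
qed

end

section \<open>Vanishing of coefficients under properness\<close>

locale proper_pushforward = pushforward P for P :: "'n::finite \<Rightarrow> complex^'n \<Rightarrow> complex" +
  fixes \<delta> :: "'n \<Rightarrow> real" and c R :: real
  assumes \<delta>: "\<And>j. 0 < \<delta> j" and c: "0 < c" and R: "0 < R"
    and proper: "\<And>x. R \<le> norm x \<Longrightarrow> c \<le> (\<Sum>j\<in>UNIV. cmod (P j x) * (1 + (norm x)\<^sup>2) powr (- \<delta> j / 2))"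
begin

text \<open>The scaling x ~ t, P_j ~ t^\<delta>_j balances the properness sum: if norm x > A t, the
  sum is at most that of K A^-\<delta>_j, which drops below c for large A because every \<delta>_j
  is positive.\<close>

lemma bound_region:
  assumes K: "0 \<le> K"
  shows "\<exists>A\<ge>1. \<forall>t x. 1 \<le> t \<longrightarrow> (\<forall>j. cmod (P j x) \<le> K * t powr \<delta> j) \<longrightarrow> norm x \<le> A * t"
proof -
  have "((\<lambda>A. \<Sum>j\<in>UNIV. K * A powr (- \<delta> j)) \<longlongrightarrow> (\<Sum>j\<in>(UNIV::'n set). K * 0)) at_top"
    using \<delta> by (intro tendsto_sum tendsto_mult tendsto_const tendsto_neg_powr filterlim_ident) auto
  then have "((\<lambda>A. \<Sum>j\<in>UNIV. K * A powr (- \<delta> j)) \<longlongrightarrow> 0) at_top" by simp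
  then have "eventually (\<lambda>A. (\<Sum>j\<in>UNIV. K * A powr (- \<delta> j)) < c) at_top"
    using c by (rule order_tendstoD(2))
  moreover have "eventually (\<lambda>A. max 1 R \<le> A) at_top" by (rule eventually_ge_at_top)
  ultimately obtain A where A: "(\<Sum>j\<in>UNIV. K * A powr (- \<delta> j)) < c" "max 1 R \<le> A"
    using eventually_conj eventually_happens'[OF trivial_limit_at_top_linorder] by (metis (mono_tags, lifting))
  show ?thesis
  proof (intro exI[of _ A] conjI allI impI)
    show "1 \<le> A" using A by simp
    fix t :: real and x :: "complex^'n" assume t: "1 \<le> t" and x: "\<forall>j. cmod (P j x) \<le> K * t powr \<delta> j"
    show "norm x \<le> A * t"
    proof (rule ccontr)
      assume "\<not> norm x \<le> A * t"
      then have n: "A * t < norm x" by simp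
      have At: "0 < A * t" "A \<le> A * t" using A t by auto
      then have "R \<le> norm x" using A n by linarith
      then have "c \<le> (\<Sum>j\<in>UNIV. cmod (P j x) * (1 + (norm x)\<^sup>2) powr (- \<delta> j / 2))" by (rule proper)
      also have "\<dots> \<le> (\<Sum>j\<in>UNIV. K * A powr (- \<delta> j))"
      proof (rule sum_mono)
        fix j
        have "(A * t)\<^sup>2 \<le> 1 + (norm x)\<^sup>2"
        proof -
          have "(A * t)\<^sup>2 \<le> (norm x)\<^sup>2" using n At by (intro power_mono) auto
          then show ?thesis by linarith
        qed
        then have "(1 + (norm x)\<^sup>2) powr (- \<delta> j / 2) \<le> ((A * t)\<^sup>2) powr (- \<delta> j / 2)"
          using \<delta>[of j] At by (intro powr_mono2') auto
        also have "\<dots> = (A * t) powr (- \<delta> j)"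
          using At by (simp add: powr_powr flip: powr_numeral)
        also have "\<dots> = A powr (- \<delta> j) * t powr (- \<delta> j)" using A t by (simp add: powr_mult)
        finally have 1: "(1 + (norm x)\<^sup>2) powr (- \<delta> j / 2) \<le> A powr (- \<delta> j) * t powr (- \<delta> j)" .
        have "cmod (P j x) * (1 + (norm x)\<^sup>2) powr (- \<delta> j / 2) \<le> (K * t powr \<delta> j) * (A powr (- \<delta> j) * t powr (- \<delta> j))"
          using x K by (intro mult_mono 1) auto
        also have "\<dots> = K * A powr (- \<delta> j) * (t powr \<delta> j * t powr (- \<delta> j))" by simp
        also have "t powr \<delta> j * t powr (- \<delta> j) = 1" using t by (simp flip: powr_add)
        finally show "cmod (P j x) * (1 + (norm x)\<^sup>2) powr (- \<delta> j / 2) \<le> K * A powr (- \<delta> j)" by simp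
      qed
      also have "\<dots> < c" by (rule A(1))
      finally show False by simp
    qed
  qed
qed

lemma adm_UNIV: "adm UNIV \<rho>"
proof -
  obtain A where A: "1 \<le> A" "\<And>t x. 1 \<le> t \<Longrightarrow> \<forall>j. cmod (P j x) \<le> sqrt \<bar>\<rho>\<bar> * t powr \<delta> j \<Longrightarrow> norm x \<le> A * t"
    using bound_region[of "sqrt \<bar>\<rho>\<bar>"] by auto
  have "norm x \<le> A" if "\<forall>j. (cmod (P j x))\<^sup>2 \<le> \<rho>" for x
  proof -
    have "cmod (P j x) \<le> sqrt \<bar>\<rho>\<bar> * 1 powr \<delta> j" for j
      using that[rule_format, of j] by (simp add: real_le_rsqrt)
    then have "\<forall>j. cmod (P j x) \<le> sqrt \<bar>\<rho>\<bar> * 1 powr \<delta> j" ..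
    from A(2)[OF order_refl this] show ?thesis by simp
  qed
  then have "bounded {x. \<forall>j. (cmod (P j x))\<^sup>2 \<le> \<rho>}" unfolding bounded_iff by blast
  moreover have "closed {x. \<forall>j. (cmod (P j x))\<^sup>2 \<le> \<rho>}"
    by (intro closed_Collect_all closed_Collect_le continuous_intros continuous_on_polyfun[OF P])
  ultimately show ?thesis by (simp add: adm_def compact_eq_bounded_closed)
qed

definition coeff :: "(complex^'n \<Rightarrow> complex) \<Rightarrow> ('n \<Rightarrow> nat) \<Rightarrow> complex" where
  "coeff h m = (SOME C. is_coeff UNIV 1 h m C)"

text \<open>Every sublevel set of the whole space is compact, and uniqueness forces the coefficient
  chosen at radius 1 to agree with the one at any larger radius.\<close>

lemma is_coeff_coeff:
  assumes h: "polyfun h"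
  shows "is_coeff UNIV \<rho> h m (coeff h m)"
proof -
  have 1: "is_coeff UNIV 1 h m (coeff h m)"
    unfolding coeff_def by (rule someI_ex[OF is_coeff_exists[OF h adm_UNIV]]) simp
  obtain C where C: "is_coeff UNIV (max 1 \<rho>) h m C"
    using is_coeff_exists[OF h adm_UNIV, of "max 1 \<rho>" m] by (auto simp: less_max_iff_disj)
  have "C = coeff h m"
    by (rule is_coeff_unique[OF is_coeff_mono[OF C] 1]) auto
  then show ?thesis using is_coeff_mono[OF C, of \<rho>] by simp
qed

text \<open>Test with shells where |P_j| is comparable to t^\<delta>_j, so that norm x <= A t. There
  h contributes t^d and the powers of the P_j contribute t^-S, S being the weighted sum. The
  remaining factor |J| / (|P_1| ... |P_n|) integrates to O(t^n), so the coefficient is O(t^(d+n-S))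
  and tends to zero.\<close>

lemma coeff_eq_0:
  assumes h: "polyfun h" and hd: "\<And>x. cmod (h x) \<le> Kh * (1 + norm x) ^ d"
    and big: "real (d + CARD('n)) < (\<Sum>j\<in>UNIV. (real (m j) + 1) * \<delta> j)"
  shows "coeff h m = 0"
proof -
  let ?n = "CARD('n)"
  let ?S = "\<Sum>j\<in>UNIV. (real (m j) + 1) * \<delta> j"
  have Kh: "0 \<le> Kh" using order_trans[OF norm_ge_zero hd[of 0]] by simp
  have pJ: "polyfun J" by (rule polyfun_jac[OF P])
  obtain A where A: "1 \<le> A" "\<And>t x. 1 \<le> t \<Longrightarrow> \<forall>j. cmod (P j x) \<le> exp (1/2) * t powr \<delta> j \<Longrightarrow> norm x \<le> A * t"
    using bound_region[of "exp (1/2)"] by auto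
  \<comment> \<open>The mass of |J|^2 / (|P_1| ... |P_n|)^2 on each of the shells used below is the
    same coefficient of J, whence a bound uniform in t.\<close>
  define N where "N = cmod (coeff J (\<lambda>_. 0))"
  define V where "V = unit_ball_vol (real DIM(complex^'n))"
  define K where "K = Kh * (2 * A) ^ d * ((N + V * A ^ (2 * ?n)) / 2)"
  have main: "cmod (coeff h m) \<le> K * t powr (real (d + ?n) - ?S)" if t: "1 \<le> t" for t
  proof -
    define p where "p j = t powr (2 * \<delta> j)" for j
    \<comment> \<open>The ratio exp 1 gives every shell logarithmic length 1, so \<open>LP\<close>
      on these shells equals the coefficient itself.\<close>
    define q where "q j = exp 1 * p j" for j
    have p: "0 < p j" for j using t by (simp add: p_def)
    have pq: "p j < q j" for j using p[of j] by (simp add: q_def)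
    define \<rho> where "\<rho> = (\<Sum>j\<in>UNIV. q j)"
    have q\<rho>: "q j \<le> \<rho>" for j
      unfolding \<rho>_def by (rule member_le_sum) (use p in \<open>auto simp: q_def less_imp_le\<close>)
    have ln1: "ln (q j / p j) = 1" for j using p[of j] by (simp add: q_def)
    define I where "I j = ind_shell (p j) (q j)" for j
    have LPeq: "LP UNIV g (\<lambda>j. shell_fun (I j) (k j)) = coeff g k" if "polyfun g" for g k
      using LP_ind_shell[OF that adm_UNIV is_coeff_coeff[OF that] p pq q\<rho>] by (simp add: ln1 I_def)
    have int: "integrable lborel (\<lambda>x. indicator UNIV x *\<^sub>R (g x * cnj (J x) * (\<Prod>j\<in>UNIV. shell_fun (I j) (k j) (P j x))))"
      if "polyfun g" for g k
      unfolding I_def by (rule integrable_LP[OF that adm_UNIV test_fun_ind_shell[OF p q\<rho>]])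
    define b where "b x = (cmod (J x))\<^sup>2 * (\<Prod>j\<in>UNIV. I j ((cmod (P j x))\<^sup>2))" for x
    have beq: "(\<lambda>x. indicator UNIV x *\<^sub>R (J x * cnj (J x) * (\<Prod>j\<in>UNIV. shell_fun (I j) 0 (P j x)))) = (\<lambda>x. complex_of_real (b x))"
    proof
      fix x
      show "indicator UNIV x *\<^sub>R (J x * cnj (J x) * (\<Prod>j\<in>UNIV. shell_fun (I j) 0 (P j x))) = complex_of_real (b x)"
        unfolding complex_norm_square[symmetric] by (simp add: b_def shell_fun_def)
    qed
    have ib: "integrable lborel b"
      using int[OF pJ, of "\<lambda>_. 0"] unfolding beq by (subst (asm) complex_of_real_integrable_eq)
    have Ib: "integral\<^sup>L lborel b \<le> N"
    proof -
      have "complex_of_real (integral\<^sup>L lborel b) = coeff J (\<lambda>_. 0)"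
        using LPeq[OF pJ, of "\<lambda>_. 0"] unfolding LP_def L_def beq by simp
      then have "\<bar>integral\<^sup>L lborel b\<bar> = N" unfolding N_def by (metis norm_of_real)
      then show ?thesis by simp
    qed
    have t0: "0 < t" using t by simp
    have Iz: "I j s = 0 \<or> (p j < s \<and> s < q j \<and> I j s = 1 / s)" for j s
      by (cases "s \<in> {p j<..<q j}") (auto simp: I_def ind_shell_def)
    have pt: "norm (indicator UNIV x *\<^sub>R (h x * cnj (J x) * (\<Prod>j\<in>UNIV. shell_fun (I j) (m j) (P j x))))
       \<le> Kh * (2 * A * t) ^ d * t powr (- ?S) * ((t ^ ?n * b x + indicator (cball 0 (A * t)) x / t ^ ?n) / 2)" for x
    proof (cases "\<exists>j. I j ((cmod (P j x))\<^sup>2) = 0")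
      case True
      then have "\<exists>j. shell_fun (I j) (m j) (P j x) = 0" by (auto simp: shell_fun_def)
      then have z: "(\<Prod>j\<in>UNIV. shell_fun (I j) (m j) (P j x)) = 0" by (meson UNIV_I finite prod_zero)
      have "b x = 0" unfolding b_def using True by (auto intro: prod_zero)
      then show ?thesis unfolding z using Kh A t by simp
    next
      case False
      then have s: "p j < (cmod (P j x))\<^sup>2" "(cmod (P j x))\<^sup>2 < q j" "I j ((cmod (P j x))\<^sup>2) = 1 / (cmod (P j x))\<^sup>2" for j
        using Iz[of j "(cmod (P j x))\<^sup>2"] by auto
      have p2: "p j = (t powr \<delta> j)\<^sup>2" for j unfolding p_def by (simp add: power2_eq_square flip: powr_add)
      have lo: "t powr \<delta> j \<le> cmod (P j x)" for j
        using s(1)[of j] unfolding p2 by (rule power2_le_imp_le[OF less_imp_le]) simp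
      have hi: "cmod (P j x) \<le> exp (1/2) * t powr \<delta> j" for j
      proof (rule power2_le_imp_le)
        have "(exp (1/2) * t powr \<delta> j)\<^sup>2 = q j"
          by (simp add: power_mult_distrib q_def p2 flip: exp_double)
        then show "(cmod (P j x))\<^sup>2 \<le> (exp (1/2) * t powr \<delta> j)\<^sup>2" using s(2)[of j] by simp
      qed simp
      have nx: "norm x \<le> A * t" using A(2)[OF t] hi by blast
      have Pp: "0 < cmod (P j x)" for j using less_le_trans[OF _ lo[of j], of 0] t0 by simp
      let ?a = "cmod (J x) * (\<Prod>j\<in>UNIV. inverse (cmod (P j x)))"
      have hb: "cmod (h x) \<le> Kh * (2 * A * t) ^ d"
      proof -
        have "1 \<le> A * t" using mult_mono[of 1 A 1 t] A t by simp
        then have "(1 + norm x) ^ d \<le> (2 * A * t) ^ d" using nx by (intro power_mono) auto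
        then show ?thesis using hd[of x] Kh by (meson mult_left_mono order_trans)
      qed
      have eqn: "norm (indicator UNIV x *\<^sub>R (h x * cnj (J x) * (\<Prod>j\<in>UNIV. shell_fun (I j) (m j) (P j x))))
         = cmod (h x) * (\<Prod>j\<in>UNIV. inverse (cmod (P j x)) ^ (m j + 1)) * ?a"
      proof -
        have "cmod (shell_fun (I j) (m j) (P j x)) = inverse (cmod (P j x)) ^ (m j + 1) * inverse (cmod (P j x))" for j
          unfolding shell_fun_def s(3) by (simp add: norm_mult norm_divide norm_power norm_inverse power2_eq_square divide_inverse)
        then show ?thesis by (simp add: norm_mult prod.distrib flip: prod_norm)
      qed
      have P1: "(\<Prod>j\<in>UNIV. inverse (cmod (P j x)) ^ (m j + 1)) \<le> t powr (- ?S)"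
      proof -
        have "(\<Prod>j\<in>UNIV. inverse (cmod (P j x)) ^ (m j + 1)) \<le> (\<Prod>j\<in>UNIV. t powr (- ((real (m j) + 1) * \<delta> j)))"
        proof (rule prod_mono, intro conjI)
          fix j
          have "inverse (cmod (P j x)) ^ (m j + 1) \<le> inverse (t powr \<delta> j) ^ (m j + 1)"
            using lo[of j] t0 by (intro power_mono le_imp_inverse_le) auto
          also have "\<dots> = t powr (- ((real (m j) + 1) * \<delta> j))"
            using t0 by (simp add: powr_minus[symmetric] powr_realpow[symmetric] powr_powr algebra_simps del: power_Suc)
          finally show "inverse (cmod (P j x)) ^ (m j + 1) \<le> t powr (- ((real (m j) + 1) * \<delta> j))" .
        qed simp
        also have "\<dots> = t powr (- ?S)"
          using t0 by (simp add: powr_sum sum_negf[symmetric])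
        finally show ?thesis .
      qed
      have b2: "b x = ?a\<^sup>2"
        unfolding b_def s(3) by (simp add: power_mult_distrib divide_inverse prod_power_distrib power_inverse)
      \<comment> \<open>The weights t^n and t^-n equalise the two parts after integration: the mass
        N against a ball volume of order t^(2n).\<close>
      have amgm: "?a \<le> (t ^ ?n * b x + 1 / t ^ ?n) / 2"
      proof -
        have "0 \<le> (t ^ ?n * ?a - 1)\<^sup>2 / t ^ ?n" using t0 by simp
        also have "\<dots> = t ^ ?n * ?a\<^sup>2 - 2 * ?a + 1 / t ^ ?n"
          using t0 by (simp add: field_simps power2_eq_square)
        finally show ?thesis by (simp add: b2)
      qed
      have "cmod (h x) * (\<Prod>j\<in>UNIV. inverse (cmod (P j x)) ^ (m j + 1)) * ?a \<le>
         Kh * (2 * A * t) ^ d * t powr (- ?S) * ((t ^ ?n * b x + 1 / t ^ ?n) / 2)"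
        using hb P1 amgm Kh A t by (intro mult_mono) (auto intro!: prod_nonneg mult_nonneg_nonneg)
      then show ?thesis unfolding eqn using nx by simp
    qed
    have ic: "integrable lborel (\<lambda>x::complex^'n. indicator (cball 0 (A * t)) x :: real)"
      by (rule integrable_real_indicator) (auto intro!: emeasure_bounded_finite simp flip: infinity_ennreal_def)
    have "cmod (coeff h m) = cmod (integral\<^sup>L lborel (\<lambda>x. indicator UNIV x *\<^sub>R (h x * cnj (J x) * (\<Prod>j\<in>UNIV. shell_fun (I j) (m j) (P j x)))))"
      using LPeq[OF h, of m] unfolding LP_def L_def by simp
    also have "\<dots> \<le> integral\<^sup>L lborel (\<lambda>x. Kh * (2 * A * t) ^ d * t powr (- ?S) * ((t ^ ?n * b x + indicator (cball 0 (A * t)) x / t ^ ?n) / 2))"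
      by (rule order_trans[OF integral_norm_bound], rule integral_mono)
         (use int[OF h] ib ic pt in \<open>auto intro!: integrable_norm\<close>)
    also have "\<dots> = Kh * (2 * A * t) ^ d * t powr (- ?S) * ((t ^ ?n * integral\<^sup>L lborel b + measure lborel (cball (0::complex^'n) (A * t)) / t ^ ?n) / 2)"
      using ib ic by simp
    also have "\<dots> \<le> Kh * (2 * A * t) ^ d * t powr (- ?S) * ((t ^ ?n * N + V * (A * t) ^ (2 * ?n) / t ^ ?n) / 2)"
    proof -
      have "measure lborel (cball (0::complex^'n) (A * t)) = V * (A * t) ^ (2 * ?n)"
        unfolding V_def using A t by (subst content_cball) (auto simp: mult.commute)
      then show ?thesis using Ib Kh A t by (intro mult_left_mono divide_right_mono add_mono mult_nonneg_nonneg) auto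
    qed
    also have "\<dots> = K * (t ^ d * t ^ ?n * t powr (- ?S))"
      using t0 by (simp add: K_def field_simps power_mult_distrib power_mult power2_eq_square)
    also have "t ^ d * t ^ ?n * t powr (- ?S) = t powr (real (d + ?n) - ?S)"
      using t0 by (simp add: powr_realpow[symmetric] powr_diff powr_add powr_minus divide_inverse)
    finally show ?thesis .
  qed
  have "((\<lambda>t. K * t powr (real (d + ?n) - ?S)) \<longlongrightarrow> K * 0) at_top"
    using big by (intro tendsto_mult tendsto_const tendsto_neg_powr filterlim_ident) auto
  moreover have "eventually (\<lambda>t. cmod (coeff h m) \<le> K * t powr (real (d + ?n) - ?S)) at_top"
    using eventually_ge_at_top[of 1] by eventually_elim (rule main)
  ultimately have "cmod (coeff h m) \<le> K * 0"
    by (intro tendsto_lowerbound[where F=at_top]) auto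
  then show ?thesis by simp
qed

end

section \<open>Local inverses and the normalising constant\<close>

lemma bounded_linear_matrix_vector_mult_complex: "bounded_linear ((*v) (A :: complex^'n^'m))"
proof -
  have "linear ((*v) A)"
    by (rule linearI) (auto simp: matrix_vector_mult_def vec_eq_iff ring_distribs sum.distrib scaleR_sum_right)
  then show ?thesis by (simp add: linear_conv_bounded_linear)
qed

lemma has_derivative_vecI:
  fixes f :: "'a::euclidean_space \<Rightarrow> 'b::euclidean_space^'n::finite"
  assumes "\<And>i. ((\<lambda>x. f x $ i) has_derivative (\<lambda>v. f' v $ i)) (at x within S)"
  shows "(f has_derivative f') (at x within S)"
proof (subst has_derivative_componentwise_within, intro ballI)
  fix b :: "'b^'n" assume "b \<in> Basis"
  then obtain i u where b: "b = axis i u" by (auto simp: Basis_vec_def)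
  show "((\<lambda>x. f x \<bullet> b) has_derivative (\<lambda>v. f' v \<bullet> b)) (at x within S)"
    unfolding b inner_axis by (rule has_derivative_inner_left[OF assms])
qed

lemma matrix_inv_left_right:
  fixes A :: "complex^'n^'n::finite"
  assumes "det A \<noteq> 0"
  shows "matrix_inv A ** A = mat 1" "A ** matrix_inv A = mat 1"
proof -
  have "\<exists>B. A ** B = mat 1 \<and> B ** A = mat 1"
    using assms by (simp add: invertible_det_nz[symmetric] invertible_def)
  then have "A ** matrix_inv A = mat 1 \<and> matrix_inv A ** A = mat 1"
    unfolding matrix_inv_def by (rule someI_ex)
  then show "matrix_inv A ** A = mat 1" "A ** matrix_inv A = mat 1" by auto
qed

text \<open>The real inverse function theorem for a derivative that is a complex matrix; the
  derivative of the inverse is then multiplication by the inverse matrix, hence again complex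
  linear.\<close>

lemma complex_inverse_function:
  fixes G :: "complex^'n \<Rightarrow> complex^'n" and A :: "complex^'n \<Rightarrow> complex^'n^'n::finite"
  assumes U: "open U" and der: "\<And>x. x \<in> U \<Longrightarrow> (G has_derivative (*v) (A x)) (at x)"
    and cont: "\<And>i j. continuous_on U (\<lambda>x. A x $ i $ j)" and x0: "x0 \<in> U" and det: "\<And>x. x \<in> U \<Longrightarrow> det (A x) \<noteq> 0"
  obtains U' V g where "open U'" "U' \<subseteq> U" "x0 \<in> U'" "open V" "G x0 \<in> V" "homeomorphism U' V G g"
    "\<And>y. y \<in> V \<Longrightarrow> (g has_derivative (*v) (matrix_inv (A (g y)))) (at y)"
proof -
  define f' where "f' x = Blinfun ((*v) (A x))" for x
  have ap: "blinfun_apply (f' x) = (*v) (A x)" for x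
    unfolding f'_def by (rule bounded_linear_Blinfun_apply[OF bounded_linear_matrix_vector_mult_complex])
  have inv: "matrix_inv (A x) ** A x = mat 1" "A x ** matrix_inv (A x) = mat 1" if "x \<in> U" for x
    using matrix_inv_left_right[OF det[OF that]] by auto
  define invf where "invf = Blinfun ((*v) (matrix_inv (A x0)))"
  have api: "blinfun_apply invf = (*v) (matrix_inv (A x0))"
    unfolding invf_def by (rule bounded_linear_Blinfun_apply[OF bounded_linear_matrix_vector_mult_complex])
  have 1: "(G has_derivative blinfun_apply (f' x)) (at x)" if "x \<in> U" for x
    using der[OF that] by (simp add: ap)
  have 2: "continuous_on U f'"
  proof (rule continuous_on_blinfun_componentwise)
    fix v :: "complex^'n"
    show "continuous_on U (\<lambda>x. blinfun_apply (f' x) v)"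
      unfolding ap matrix_vector_mult_def by (intro continuous_on_vec_lambda continuous_intros cont)
  qed
  have 3: "invf o\<^sub>L f' x0 = id_blinfun"
    by (rule blinfun_eqI) (simp add: ap api matrix_vector_mul_assoc inv[OF x0])
  obtain U' V g g' where *: "open U'" "U' \<subseteq> U" "x0 \<in> U'" "open V" "G x0 \<in> V" "homeomorphism U' V G g"
    "\<And>y. y \<in> V \<Longrightarrow> (g has_derivative (g' y)) (at y)" "\<And>y. y \<in> V \<Longrightarrow> g' y = inv (blinfun_apply (f'(g y)))"
    "\<And>y. y \<in> V \<Longrightarrow> bij (blinfun_apply (f'(g y)))"
    using inverse_function_theorem[OF U 1 2 x0 3] by metis
  show ?thesis
  proof (rule that[OF *(1-6)])
    fix y assume y: "y \<in> V"
    then have "g y \<in> U" using *(2,6) by (auto simp: homeomorphism_def)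
    then have "inv ((*v) (A (g y))) = (*v) (matrix_inv (A (g y)))"
      by (intro inv_equality) (simp_all add: matrix_vector_mul_assoc inv)
    then show "(g has_derivative (*v) (matrix_inv (A (g y)))) (at y)"
      using *(7,8)[OF y] by (simp add: ap)
  qed
qed

lemma absolutely_integrable_on_lborel:
  fixes f :: "'a::euclidean_space \<Rightarrow> 'b::euclidean_space"
  assumes "(\<lambda>x. indicator S x *\<^sub>R f x) \<in> borel_measurable borel"
  shows "f absolutely_integrable_on S \<longleftrightarrow> integrable lborel (\<lambda>x. indicator S x *\<^sub>R f x)"
    "f absolutely_integrable_on S \<Longrightarrow> integral S f = integral\<^sup>L lborel (\<lambda>x. indicator S x *\<^sub>R f x)"
proof -
  have m: "(\<lambda>x. indicator S x *\<^sub>R f x) \<in> borel_measurable lborel" using assms by simp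
  show "f absolutely_integrable_on S \<longleftrightarrow> integrable lborel (\<lambda>x. indicator S x *\<^sub>R f x)"
    unfolding set_integrable_def by (rule integrable_completion[OF m])
  assume "f absolutely_integrable_on S"
  then show "integral S f = integral\<^sup>L lborel (\<lambda>x. indicator S x *\<^sub>R f x)"
    using set_lebesgue_integral_eq_integral(2) integral_completion[OF m]
    by (metis set_lebesgue_integral_def)
qed

lemma absolutely_integrable_integral_cong:
  assumes "\<And>x. x \<in> S \<Longrightarrow> f x = g x"
  shows "f absolutely_integrable_on S \<and> integral S f = b \<longleftrightarrow> g absolutely_integrable_on S \<and> integral S g = b"
  using set_integrable_cong[OF refl refl, of S f g lebesgue] integral_cong[of S f g] assms by auto

lemma polyfun_vec_has_derivative:
  assumes P: "\<And>j. polyfun (P j)"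
  shows "((\<lambda>x. \<chi> j. P j x) has_derivative (*v) (jmat P x)) (at x)"
proof -
  have "((\<lambda>x. (\<chi> j. P j x) $ i) has_derivative (\<lambda>v. (jmat P x *v v) $ i)) (at x)" for i
    using polyfun_has_derivative[OF P, of i x] by (simp add: jmat_def matrix_vector_mult_def)
  then show ?thesis by (rule has_derivative_vecI)
qed

text \<open>The identity map is the model case: near a point with J nonzero, P is a coordinate
  change to it, so its coefficient gives the universal constant.\<close>

interpretation idpf: pushforward "\<lambda>j x. x $ j"
  by unfold_locales (rule polyfun.coord)

lemma jac_id: "jac (\<lambda>j x. x $ j) x = 1"
proof -
  have "jmat (\<lambda>j x. x $ j) x = mat 1"
    by (auto simp: jmat_def mat_def pd_coord vec_eq_iff)
  then show ?thesis by (simp add: jac_def)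
qed

lemma idpf_adm: "idpf.adm (UNIV :: (complex^'n::finite) set) \<rho>"
proof -
  have "norm x \<le> sqrt (real CARD('n) * \<bar>\<rho>\<bar>)" if "\<forall>j. (cmod (x $ j))\<^sup>2 \<le> \<rho>" for x :: "complex^'n"
  proof -
    have "(\<Sum>i\<in>UNIV. (cmod (x $ i))\<^sup>2) \<le> (\<Sum>i\<in>(UNIV::'n set). \<bar>\<rho>\<bar>)"
      by (rule sum_mono) (use that in \<open>meson abs_ge_self order_trans\<close>)
    then show ?thesis unfolding norm_vec_def L2_set_def by (simp add: real_sqrt_le_iff)
  qed
  then have "bounded {x::complex^'n. \<forall>j. (cmod (x $ j))\<^sup>2 \<le> \<rho>}" unfolding bounded_iff by blast
  moreover have "closed {x::complex^'n. \<forall>j. (cmod (x $ j))\<^sup>2 \<le> \<rho>}"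
    by (intro closed_Collect_all closed_Collect_le continuous_intros)
  ultimately show ?thesis by (simp add: idpf.adm_def compact_eq_bounded_closed)
qed

definition exp_vec :: "complex^'n::finite \<Rightarrow> complex^'n" where
  "exp_vec z = (\<chi> j. exp (z $ j))"

lemma exp_vec_has_derivative:
  "(exp_vec has_derivative (*v) (\<chi> i j. if i = j then exp (z $ i) else 0)) (at (z::complex^'n::finite))"
proof -
  let ?A = "(\<chi> i j. if i = j then exp (z $ i) else 0) :: complex^'n^'n"
  have "((\<lambda>x. exp (x $ i)) has_derivative (\<lambda>v. (?A *v v) $ i)) (at z)" for i
  proof -
    have "((\<lambda>x. exp (x $ i)) has_derivative (\<lambda>v. exp (z $ i) * v $ i)) (at z)"
      using diff_chain_at[OF bounded_linear_imp_has_derivative[OF bounded_linear_vec_nth[of i]], of exp "(*) (exp (z $ i))" z]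
        DERIV_exp[of "z $ i", unfolded has_field_derivative_def] by (simp add: o_def)
    then show ?thesis by (simp add: matrix_vector_mult_def if_distrib[of "\<lambda>x. x * _"] cong: if_cong)
  qed
  then show ?thesis by (intro has_derivative_vecI) (simp add: exp_vec_def)
qed

lemma content_strip:
  "measure lborel {z::complex^'n::finite. \<forall>j. 0 < Re (z $ j) \<and> Re (z $ j) < 1 \<and> - pi < Im (z $ j) \<and> Im (z $ j) < pi} = (2 * pi) ^ CARD('n)"
  "{z::complex^'n::finite. \<forall>j. 0 < Re (z $ j) \<and> Re (z $ j) < 1 \<and> - pi < Im (z $ j) \<and> Im (z $ j) < pi} =
     box (\<chi> j. Complex 0 (-pi)) (\<chi> j. Complex 1 pi)"
proof -
  let ?l = "(\<chi> j. Complex 0 (-pi)) :: complex^'n" and ?u = "(\<chi> j. Complex 1 pi) :: complex^'n"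
  have B: "(Basis :: (complex^'n) set) = (\<lambda>i. axis i 1) ` UNIV \<union> (\<lambda>i. axis i \<i>) ` UNIV"
    by (auto simp: Basis_vec_def Basis_complex_def)
  have in1: "x \<bullet> axis i 1 = Re (x $ i)" "x \<bullet> axis i \<i> = Im (x $ i)" for x :: "complex^'n" and i
    by (simp_all add: inner_axis inner_complex_def)
  show eq: "{z::complex^'n::finite. \<forall>j. 0 < Re (z $ j) \<and> Re (z $ j) < 1 \<and> - pi < Im (z $ j) \<and> Im (z $ j) < pi} = box ?l ?u"
    by (simp add: set_eq_iff mem_box B in1 ball_Un) blast
  have "measure lborel (box ?l ?u) = (\<Prod>b\<in>Basis. (?u - ?l) \<bullet> b)"
    by (subst measure_lborel_box) (auto simp: B in1)
  also have "\<dots> = (\<Prod>b\<in>(\<lambda>i. axis i 1) ` (UNIV::'n set). (?u - ?l) \<bullet> b) * (\<Prod>b\<in>(\<lambda>i. axis i \<i>) ` (UNIV::'n set). (?u - ?l) \<bullet> b)"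
    unfolding B by (rule prod.union_disjoint) (auto simp: axis_eq_axis)
  also have "\<dots> = (2 * pi) ^ CARD('n)"
    by (subst (1 2) prod.reindex) (auto simp: inj_on_def axis_eq_axis inner_diff_left in1)
  finally show "measure lborel {z::complex^'n::finite. \<forall>j. 0 < Re (z $ j) \<and> Re (z $ j) < 1 \<and> - pi < Im (z $ j) \<and> Im (z $ j) < pi} = (2 * pi) ^ CARD('n)"
    unfolding eq .
qed

lemma shell_negligible:
  "negligible {w::complex^'n::finite. \<exists>j. Im (w $ j) = 0}"
proof -
  have "{w::complex^'n. \<exists>j. Im (w $ j) = 0} = (\<Union>j\<in>UNIV. {w. axis j \<i> \<bullet> w = 0})"
    by (auto simp: inner_axis' inner_complex_def)
  moreover have "negligible {w::complex^'n. axis j \<i> \<bullet> w = 0}" for j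
    by (rule negligible_hyperplane) (simp add: axis_eq_0_iff)
  ultimately show ?thesis by (auto intro: negligible_Union)
qed

text \<open>The normalising constant is the volume of the exponential image of the box in \<open>content_strip\<close>.\<close>

lemma idpf_is_coeff: "idpf.is_coeff (UNIV :: (complex^'n::finite) set) \<rho> (\<lambda>_. 1) (\<lambda>_. 0) (of_real (pi ^ CARD('n)))"
proof -
  obtain C where C: "idpf.is_coeff (UNIV :: (complex^'n) set) (max \<rho> (exp 2)) (\<lambda>_. 1) (\<lambda>_. 0) C"
    using idpf.is_coeff_exists[OF polyfun.const idpf_adm] by (metis exp_gt_zero less_max_iff_disj)
  let ?B = "{z::complex^'n. \<forall>j. 0 < Re (z $ j) \<and> Re (z $ j) < 1 \<and> - pi < Im (z $ j) \<and> Im (z $ j) < pi}"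
  let ?F = "\<lambda>w::complex^'n. \<Prod>j\<in>UNIV. shell_fun (ind_shell 1 (exp 2)) 0 (w $ j)"
  \<comment> \<open>The shell 1 < |w|^2 < exp 2 has logarithmic length 2 and corresponds to 0 < Re z
    < 1 for w = exp z. Comparison with the volume of the strip will read C 2^n = (2 pi)^n.\<close>
  have LPv: "idpf.LP UNIV (\<lambda>_. 1) (\<lambda>j::'n. shell_fun (ind_shell 1 (exp 2)) 0) = C * 2 ^ CARD('n)"
    using idpf.LP_ind_shell[OF polyfun.const idpf_adm C, of "\<lambda>_. 1" "\<lambda>_. exp 2"] by simp
  have LPd: "idpf.LP UNIV (\<lambda>_. 1) (\<lambda>j::'n. shell_fun (ind_shell 1 (exp 2)) 0) = integral\<^sup>L lborel ?F"
    unfolding idpf.LP_def idpf.L_def by (simp add: jac_id)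
  have iF: "integrable lborel (\<lambda>x. indicator UNIV x *\<^sub>R ?F x)"
    using idpf.integrable_LP[OF polyfun.const[of 1] idpf_adm test_fun_ind_shell[OF zero_less_one max.cobounded2]]
    by (simp add: jac_id)
  have mF: "(\<lambda>x. indicator UNIV x *\<^sub>R ?F x) \<in> borel_measurable borel" using borel_measurable_integrable[OF iF] by simp
  have aF: "?F absolutely_integrable_on UNIV" "integral UNIV ?F = integral\<^sup>L lborel ?F"
    using absolutely_integrable_on_lborel[OF mF] iF by auto
  define A where "A z = ((\<chi> i j. if i = j then exp (z $ i) else 0) :: complex^'n^'n)" for z :: "complex^'n"
  have detA: "det (A z) = (\<Prod>j\<in>UNIV. exp (z $ j))" for z
    unfolding A_def by (subst det_diagonal) auto
  have inj: "inj_on exp_vec ?B"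
  proof (rule inj_onI)
    fix z z' :: "complex^'n" assume z: "z \<in> ?B" "z' \<in> ?B" "exp_vec z = exp_vec z'"
    show "z = z'"
      unfolding vec_eq_iff
    proof
      fix j
      have "exp (z $ j) = exp (z' $ j)" using z(3) by (simp add: exp_vec_def vec_eq_iff)
      then show "z $ j = z' $ j"
        by (rule exp_complex_eqI[rotated]) (use z(1,2) in \<open>auto simp: abs_less_iff dest!: spec[of _ j]\<close>)
    qed
  qed
  have derB: "(exp_vec has_derivative (*v) (A z)) (at z within ?B)" for z
    unfolding A_def by (rule has_derivative_at_withinI[OF exp_vec_has_derivative])
  have Bl: "?B \<in> sets lebesgue" unfolding content_strip(2) by simp
  have FB: "(cmod (det (A z)))\<^sup>2 *\<^sub>R ?F (exp_vec z) = 1" if "z \<in> ?B" for z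
  proof -
    have "shell_fun (ind_shell 1 (exp 2)) 0 (exp_vec z $ j) = of_real (inverse ((cmod (exp (z $ j)))\<^sup>2))" for j
    proof -
      have "1 < (exp (Re (z $ j)))\<^sup>2" "(exp (Re (z $ j)))\<^sup>2 < exp 2"
        using that by (auto simp flip: exp_double)
      then show ?thesis by (simp add: shell_fun_def ind_shell_def exp_vec_def divide_inverse)
    qed
    then have "?F (exp_vec z) = of_real (\<Prod>j\<in>UNIV. inverse ((cmod (exp (z $ j)))\<^sup>2))" by simp
    moreover have "(cmod (det (A z)))\<^sup>2 = (\<Prod>j\<in>UNIV. (cmod (exp (z $ j)))\<^sup>2)"
      unfolding detA by (simp only: prod_norm[symmetric] prod_power_distrib)
    ultimately show ?thesis by (simp add: prod_inversef[symmetric] scaleR_conv_of_real flip: of_real_mult prod.distrib)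
  qed
  have sB: "(\<lambda>z::complex^'n. 1::complex) absolutely_integrable_on ?B" "integral ?B (\<lambda>z. 1::complex) = of_real ((2 * pi) ^ CARD('n))"
  proof -
    have lm: "?B \<in> lmeasurable" unfolding content_strip(2) by simp
    then have 1: "(\<lambda>z::complex^'n. 1::real) absolutely_integrable_on ?B"
      by (simp add: absolutely_integrable_on_const)
    show 2: "(\<lambda>z::complex^'n. 1::complex) absolutely_integrable_on ?B"
      using lm by (rule absolutely_integrable_on_const)
    have "integral ?B (\<lambda>z. 1::real) = measure lebesgue ?B" using lm by (rule lmeasure_integral[symmetric])
    also have "\<dots> = (2 * pi) ^ CARD('n)" using content_strip(1) unfolding content_strip(2) by (simp add: measure_completion)
    finally have "integral ?B (\<lambda>z. 1::real) = (2 * pi) ^ CARD('n)" .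
    moreover have "integral ?B (\<lambda>z. of_real (1::real) :: complex) = of_real (integral ?B (\<lambda>z. 1::real))"
      using integral_linear[OF set_lebesgue_integral_eq_integral(1)[OF 1] bounded_linear_of_real] by (simp add: o_def)
    ultimately show "integral ?B (\<lambda>z. 1::complex) = of_real ((2 * pi) ^ CARD('n))" by simp
  qed
  have "(\<lambda>z. (cmod (det (A z)))\<^sup>2 *\<^sub>R ?F (exp_vec z)) absolutely_integrable_on ?B \<and>
      integral ?B (\<lambda>z. (cmod (det (A z)))\<^sup>2 *\<^sub>R ?F (exp_vec z)) = of_real ((2 * pi) ^ CARD('n))"
    by (rule iffD2[OF absolutely_integrable_integral_cong[OF FB] conjI[OF sB]])
  then have img: "integral (exp_vec ` ?B) ?F = of_real ((2 * pi) ^ CARD('n))"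
    by (rule conjunct2[OF iffD1[OF change_of_variables_complex_vec[OF Bl derB inj, where f="?F"]]])
  have "integral UNIV ?F = integral (exp_vec ` ?B) ?F"
  proof -
    \<comment> \<open>The principal logarithm inverts the exponential except on the branch cut;
      discarding all vectors with a real coordinate covers this and is a null set.\<close>
    have "?F w = 0" if "w \<notin> exp_vec ` ?B" "w \<notin> {w. \<exists>j. Im (w $ j) = 0}" for w
    proof (rule ccontr)
      assume "?F w \<noteq> 0"
      then have "shell_fun (ind_shell 1 (exp 2)) 0 (w $ j) \<noteq> 0" for j by auto
      then have w: "1 < (cmod (w $ j))\<^sup>2" "(cmod (w $ j))\<^sup>2 < exp 2" for j
        by (auto simp: shell_fun_def ind_shell_def indicator_def split: if_splits)
      have w0: "w $ j \<noteq> 0" for j using w(1)[of j] by auto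
      define z where "z = (\<chi> j. Ln (w $ j))"
      have "exp_vec z = w" using w0 by (simp add: exp_vec_def z_def vec_eq_iff)
      moreover have "z \<in> ?B"
      proof (rule CollectI, intro allI)
        fix j
        have c1: "1 < cmod (w $ j)" using w(1)[of j] by (metis norm_ge_zero one_power2 power_less_imp_less_base)
        have c2: "cmod (w $ j) < exp 1"
        proof (rule power_less_imp_less_base)
          show "(cmod (w $ j))\<^sup>2 < (exp 1)\<^sup>2" using w(2)[of j] by (simp flip: exp_double)
        qed simp
        have "0 < ln (cmod (w $ j))" using c1 by (rule ln_gt_zero)
        moreover have "ln (cmod (w $ j)) < ln (exp 1)" using c1 c2 by (subst ln_less_cancel_iff) auto
        then have "ln (cmod (w $ j)) < 1" by simp
        moreover have "Im (Ln (w $ j)) \<noteq> pi"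
        proof
          assume "Im (Ln (w $ j)) = pi"
          then have "Im (w $ j) = 0" using Im_Ln_eq_pi[OF w0] by simp
          then show False using that(2) by blast
        qed
        moreover have "- pi < Im (Ln (w $ j))" "Im (Ln (w $ j)) \<le> pi" using w0 by (auto simp: mpi_less_Im_Ln Im_Ln_le_pi)
        ultimately show "0 < Re (z $ j) \<and> Re (z $ j) < 1 \<and> - pi < Im (z $ j) \<and> Im (z $ j) < pi"
          using w0[of j] by (simp add: z_def)
      qed
      ultimately show False using that(1) by blast
    qed
    then have "{w \<in> UNIV - exp_vec ` ?B. ?F w \<noteq> 0} \<subseteq> {w. \<exists>j. Im (w $ j) = 0}" by blast
    then have "negligible {w \<in> UNIV - exp_vec ` ?B. ?F w \<noteq> 0}" by (rule negligible_subset[OF shell_negligible])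
    moreover have "{w \<in> exp_vec ` ?B - UNIV. ?F w \<noteq> 0} = {}" by blast
    ultimately show ?thesis
      by (intro integral_spike_set) auto
  qed
  then have "C * 2 ^ CARD('n) = of_real ((2 * pi) ^ CARD('n))"
    using LPv LPd aF(2) img by simp
  then have "C = of_real (pi ^ CARD('n))" by (simp add: power_mult_distrib)
  then show ?thesis using idpf.is_coeff_mono[OF C, of \<rho>] by simp
qed

section \<open>Localisation at a regular value\<close>

context pushforward
begin

lemma pushforward_diff: "pushforward (\<lambda>j x. P j x - a j)"
  by unfold_locales (intro polyfun_diff P polyfun.const)

lemma jac_diff: "jac (\<lambda>j x. P j x - a j) = J"
proof -
  have "pd l (\<lambda>x. P j x - a j) = pd l (P j)" for l j
    using pd_add[OF P[of j] polyfun.const[of "- a j"], of l] by simp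
  then show ?thesis by (simp add: jac_def[abs_def] jmat_def)
qed

lemma LP_diff_translate:
  "pushforward.LP (\<lambda>j x. P j x - a j) U h (\<lambda>j. shell_fun (\<eta> j) 0) = LP U h (\<lambda>j. shift_fun (\<eta> j) (a j))"
proof -
  interpret P': pushforward "\<lambda>j x. P j x - a j" by (rule pushforward_diff)
  show ?thesis
    unfolding P'.LP_def LP_def P'.L_def L_def jac_diff by (simp add: shell_fun_def shift_fun_def)
qed

text \<open>The zeroth coefficient for the translated map, which has the same Jacobian J. It is the
  density at the value a of the pushforward of h cnj J.\<close>

abbreviation is_coeff_at :: "('n \<Rightarrow> complex) \<Rightarrow> (complex^'n) set \<Rightarrow> real \<Rightarrow> (complex^'n \<Rightarrow> complex) \<Rightarrow> complex \<Rightarrow> bool" where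
  "is_coeff_at a U \<rho> h C \<equiv> pushforward.is_coeff (\<lambda>j x. P j x - a j) U \<rho> h (\<lambda>_. 0) C"

lemma is_coeff_atD:
  assumes "is_coeff_at a U \<rho> h C" "\<And>j. bump (p j) (q j) (\<eta> j)" "\<And>j. q j \<le> \<rho>"
  shows "LP U h (\<lambda>j. shift_fun (\<eta> j) (a j)) = C * (\<Prod>j\<in>UNIV. of_real (mass (\<eta> j)))"
proof -
  interpret P': pushforward "\<lambda>j x. P j x - a j" by (rule pushforward_diff)
  show ?thesis
    using assms(1)[unfolded P'.is_coeff_def, rule_format, of p q \<eta>] assms(2,3)
    by (simp add: LP_diff_translate)
qed

text \<open>Near y the map P is a local biholomorphism with real Jacobian |J|^2, and h = J makes the
  weight h cnj J equal to it. So the integral is the one for the identity map, with constant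
  pi^n.\<close>

lemma local_mass:
  assumes y: "J y \<noteq> 0" and O: "open O'" "y \<in> O'"
  shows "\<exists>U r. open U \<and> U \<subseteq> O' \<and> y \<in> U \<and> 0 < r \<and>
    (\<forall>p q \<eta>. (\<forall>j. bump (p j) (q j) (\<eta> j) \<and> q j \<le> r) \<longrightarrow>
      LP U J (\<lambda>j. shift_fun (\<eta> j) (P j y)) = of_real (pi ^ CARD('n)) * (\<Prod>j\<in>UNIV. of_real (mass (\<eta> j))))"
proof -
  define G where "G x = (\<chi> j. P j x)" for x
  have contJ: "continuous_on S J" for S by (rule continuous_on_polyfun[OF polyfun_jac[OF P]])
  define W where "W = O' \<inter> {x. J x \<noteq> 0}"
  have W: "open W" "y \<in> W"
    unfolding W_def using O y contJ by (auto intro!: open_Int open_Collect_neq continuous_intros)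
  have derG: "(G has_derivative (*v) (jmat P x)) (at x)" for x
    unfolding G_def[abs_def] by (rule polyfun_vec_has_derivative[OF P])
  have cj: "continuous_on W (\<lambda>x. jmat P x $ i $ j)" for i j
    unfolding jmat_def using continuous_on_polyfun[OF polyfun_pd[OF P]] by simp
  have dt: "det (jmat P x) \<noteq> 0" if "x \<in> W" for x using that by (simp add: W_def jac_def)
  obtain U V g where U: "open U" "U \<subseteq> W" "y \<in> U" "open V" "G y \<in> V" "homeomorphism U V G g"
    using complex_inverse_function[OF W(1) derG cj W(2) dt] by metis
  obtain e where e: "0 < e" "ball (G y) e \<subseteq> V" using U(4,5) by (meson openE)
  \<comment> \<open>If n squared coordinate distances are at most r, their sum is at most e^2/2, so
    the shells around P(y) stay inside the ball contained in V.\<close>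
  define r where "r = e\<^sup>2 / (2 * real CARD('n))"
  have r: "0 < r" using e by (simp add: r_def)
  show ?thesis
  proof (intro exI[of _ U] exI[of _ r] conjI allI impI U(1) U(3) r)
    show "U \<subseteq> O'" using U(2) by (auto simp: W_def)
    fix p q :: "'n \<Rightarrow> real" and \<eta> :: "'n \<Rightarrow> real \<Rightarrow> real"
    assume bq: "\<forall>j. bump (p j) (q j) (\<eta> j) \<and> q j \<le> r"
    then have b: "\<And>j. bump (p j) (q j) (\<eta> j)" and q: "\<And>j. q j \<le> r" by auto
    define f where "f w = (\<Prod>j\<in>UNIV. shift_fun (\<eta> j) (P j y) (w $ j))" for w :: "complex^'n"
    have cf: "continuous_on UNIV f"
      unfolding f_def shift_fun_def
      by (intro continuous_intros continuous_on_of_real continuous_on_compose2[OF bump_continuous[OF b]]) auto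
    have f0: "f w = 0" if "w \<notin> V" for w
    proof (rule ccontr)
      assume "f w \<noteq> 0"
      then have "shift_fun (\<eta> j) (P j y) (w $ j) \<noteq> 0" for j by (auto simp: f_def)
      then have "\<not> q j \<le> (cmod (w $ j - P j y))\<^sup>2" for j
        using bump_zero[OF b[of j]] by (auto simp: shift_fun_def)
      then have s: "(cmod (w $ j - P j y))\<^sup>2 \<le> r" for j using q[of j] by (meson less_imp_le not_le order_trans)
      have "(dist w (G y))\<^sup>2 = (\<Sum>j\<in>UNIV. (cmod (w $ j - P j y))\<^sup>2)"
        unfolding dist_norm norm_vec_def L2_set_def by (simp add: G_def sum_nonneg)
      also have "\<dots> \<le> (\<Sum>j\<in>(UNIV::'n set). r)" by (rule sum_mono) (rule s)
      also have "\<dots> < e\<^sup>2" using e by (simp add: r_def field_simps)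
      finally have "dist w (G y) < e" using e by (simp add: power_less_imp_less_base)
      then show False using e(2) that by (auto simp: dist_commute)
    qed
    have GU: "G ` U = V" "inj_on G U" using U(6) by (auto simp: homeomorphism_def inj_on_def) metis+
    define F where "F x = (cmod (J x))\<^sup>2 *\<^sub>R f (G x)" for x
    have LPF: "LP U J (\<lambda>j. shift_fun (\<eta> j) (P j y)) = integral\<^sup>L lborel (\<lambda>x. indicator U x *\<^sub>R F x)"
    proof -
      have "J x * cnj (J x) * (\<Prod>j\<in>UNIV. shift_fun (\<eta> j) (P j y) (P j x)) = F x" for x
        unfolding F_def f_def G_def complex_norm_square[symmetric] by (simp add: scaleR_conv_of_real)
      then show ?thesis unfolding LP_def L_def by simp
    qed
    have mf: "(\<lambda>w. indicator V w *\<^sub>R f w) = f" using f0 by (auto simp: fun_eq_iff indicator_def)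
    have fb: "f \<in> borel_measurable borel" by (rule borel_measurable_continuous_onI[OF cf])
    have fi: "integrable lborel f \<and> integral\<^sup>L lborel f = of_real (pi ^ CARD('n)) * (\<Prod>j\<in>UNIV. of_real (mass (\<eta> j)))"
    proof -
      define f1 where "f1 w = (\<Prod>j\<in>UNIV. shell_fun (\<eta> j) 0 (w $ j))" for w :: "complex^'n"
      have t: "test_fun r (shell_fun (\<eta> j) 0)" for j by (rule C1_test_fun_imp[OF C1_test_fun_shell_fun[OF b q]])
      have i1: "integrable lborel f1"
        using idpf.integrable_LP[OF polyfun.const[of 1] idpf_adm t] by (simp add: jac_id f1_def[abs_def])
      have I1: "integral\<^sup>L lborel f1 = of_real (pi ^ CARD('n)) * (\<Prod>j\<in>UNIV. of_real (mass (\<eta> j)))"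
        using idpf_is_coeff[of r, unfolded idpf.is_coeff_def, rule_format, of p q \<eta>] b q
        unfolding idpf.LP_def idpf.L_def by (simp add: jac_id f1_def[abs_def])
      have ff: "f w = f1 (- G y + w)" for w by (simp add: f_def f1_def shift_fun_def shell_fun_def G_def)
      have m1: "f1 \<in> borel_measurable borel" using borel_measurable_integrable[OF i1] by simp
      have "integrable (distr lborel borel ((+) (- G y))) f1" using i1 by (simp add: lborel_distr_plus)
      then have "integrable lborel (\<lambda>x. f1 (- G y + x))" by (subst (asm) integrable_distr_eq) (use m1 in auto)
      moreover have "integral\<^sup>L (distr lborel borel ((+) (- G y))) f1 = integral\<^sup>L lborel (\<lambda>x. f1 (- G y + x))"
        by (rule integral_distr) (use m1 in auto)
      ultimately show ?thesis using I1 by (simp add: lborel_distr_plus ff[abs_def])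
    qed
    have aV: "f absolutely_integrable_on V \<and> integral V f = of_real (pi ^ CARD('n)) * (\<Prod>j\<in>UNIV. of_real (mass (\<eta> j)))"
      using absolutely_integrable_on_lborel[of V f] fb fi unfolding mf by simp
    have "F absolutely_integrable_on U \<and> integral U F = of_real (pi ^ CARD('n)) * (\<Prod>j\<in>UNIV. of_real (mass (\<eta> j)))"
      unfolding F_def jac_def
      by (rule iffD2[OF change_of_variables_complex_vec[where f=f and g=G and A="jmat P" and S=U]])
         (use U(1) derG GU aV in \<open>auto intro: has_derivative_at_withinI\<close>)
    moreover have "(\<lambda>x. indicator U x *\<^sub>R F x) \<in> borel_measurable borel"
    proof -
      have "continuous_on UNIV F"
        unfolding F_def G_def
        by (intro continuous_intros contJ continuous_on_compose2[OF cf] continuous_on_vec_lambda continuous_on_polyfun[OF P]) auto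
      then have "F \<in> borel_measurable borel" by (rule borel_measurable_continuous_onI)
      moreover have "U \<in> sets borel" using U(1) by simp
      ultimately show ?thesis by measurable
    qed
    ultimately show "LP U J (\<lambda>j. shift_fun (\<eta> j) (P j y)) = of_real (pi ^ CARD('n)) * (\<Prod>j\<in>UNIV. of_real (mass (\<eta> j)))"
      unfolding LPF using absolutely_integrable_on_lborel(2) by metis
  qed
qed

text \<open>Near \<open>y\<close> the form \<open>h cnj J\<close> is close to \<open>(h y / J y) |J|\<^sup>2\<close>, near the other points of the fibre it is
  small compared with \<open>|J|\<^sup>2\<close>, and the total mass of \<open>|J|\<^sup>2\<close> over small shells is bounded.\<close>

lemma coeff_at_regular_value:
  assumes h: "polyfun h" and y: "y \<in> U"
    and adm': "pushforward.adm (\<lambda>j x. P j x - P j y) U \<rho>" and \<rho>: "0 < \<rho>"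
    and reg: "\<And>x. x \<in> U \<Longrightarrow> (\<And>j. P j x = P j y) \<Longrightarrow> J x \<noteq> 0"
    and h0: "\<And>x. x \<in> U \<Longrightarrow> (\<And>j. P j x = P j y) \<Longrightarrow> x \<noteq> y \<Longrightarrow> h x = 0"
    and C: "is_coeff_at (\<lambda>j. P j y) U \<rho> h C"
  shows "C = of_real (pi ^ CARD('n)) * (h y / J y)"
proof -
  interpret P': pushforward "\<lambda>j x. P j x - P j y" by (rule pushforward_diff)
  have oU: "open U" using adm' by (simp add: P'.adm_def)
  have pJ: "polyfun J" by (rule polyfun_jac[OF P])
  have Jy: "J y \<noteq> 0" by (rule reg[OF y refl])
  \<comment> \<open>The coefficient of J controls the total mass of |J|^2 on the shells; all errors
    below are at most \<epsilon> times that mass.\<close>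
  obtain CJ where CJ: "is_coeff_at (\<lambda>j. P j y) U \<rho> J CJ" using P'.is_coeff_exists[OF pJ adm' \<rho>] by blast
  let ?k = "of_real (pi ^ CARD('n)) * (h y / J y)"
  have "cmod (C - ?k) \<le> \<epsilon> * cmod CJ" if \<epsilon>: "0 < \<epsilon>" for \<epsilon>
  proof -
    have cont: "continuous_on {x. J x \<noteq> 0} (\<lambda>x. h x / J x)"
      by (intro continuous_intros continuous_on_polyfun h pJ) auto
    have oJ: "open {x. J x \<noteq> 0}" by (intro open_Collect_neq continuous_on_polyfun pJ continuous_intros)
    define O1 where "O1 = {x \<in> {x. J x \<noteq> 0}. cmod (h x / J x - h y / J y) < \<epsilon>} \<inter> U"
    have "open ({x. J x \<noteq> 0} \<inter> (\<lambda>x. cmod (h x / J x - h y / J y)) -` {..<\<epsilon>})"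
      by (rule continuous_open_preimage[OF _ oJ open_lessThan]) (intro continuous_on_norm continuous_on_diff cont continuous_on_const)
    moreover have "{x. J x \<noteq> 0} \<inter> (\<lambda>x. cmod (h x / J x - h y / J y)) -` {..<\<epsilon>} = {x \<in> {x. J x \<noteq> 0}. cmod (h x / J x - h y / J y) < \<epsilon>}"
      by auto
    ultimately have "open {x \<in> {x. J x \<noteq> 0}. cmod (h x / J x - h y / J y) < \<epsilon>}" by simp
    then have O1: "open O1" "y \<in> O1" unfolding O1_def using oU y Jy \<epsilon> by auto
    obtain Uy r0 where Uy: "open Uy" "Uy \<subseteq> O1" "y \<in> Uy" "0 < r0" and
      mass: "\<forall>p q \<eta>. (\<forall>j. bump (p j) (q j) (\<eta> j) \<and> q j \<le> r0) \<longrightarrow>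
      LP Uy J (\<lambda>j. shift_fun (\<eta> j) (P j y)) = of_real (pi ^ CARD('n)) * (\<Prod>j\<in>UNIV. of_real (mass (\<eta> j)))"
      using local_mass[OF Jy O1] by (elim exE conjE) (rule that)
    \<comment> \<open>An open set containing the other points of the fibre within U, since h
      vanishes and J does not vanish there.\<close>
    define W where "W = {x. cmod (h x) < \<epsilon> * cmod (J x)}"
    have oW: "open W" unfolding W_def by (intro open_Collect_less continuous_intros continuous_on_polyfun h pJ)
    define K where "K = {x \<in> U. \<forall>j. (cmod (P j x - P j y))\<^sup>2 \<le> \<rho>}"
    have K: "compact K" using adm' by (simp add: P'.adm_def K_def)
    define s where "s x = (\<Sum>j\<in>UNIV. (cmod (P j x - P j y))\<^sup>2)" for x
    \<comment> \<open>Off \<open>Uy\<close> and \<open>W\<close> no fibre point is left, so the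
      squared distance of P to P(y) has a positive minimum on the compact remainder.\<close>
    have "\<exists>s0>0. \<forall>x\<in>K - (Uy \<union> W). s0 \<le> s x"
    proof (cases "K - (Uy \<union> W) = {}")
      case False
      have "compact (K - (Uy \<union> W))" using K Uy(1) oW by (simp add: compact_diff open_Un)
      moreover have "continuous_on (K - (Uy \<union> W)) s"
        unfolding s_def by (intro continuous_intros continuous_on_polyfun P)
      ultimately obtain x where x: "x \<in> K - (Uy \<union> W)" "\<forall>x'\<in>K - (Uy \<union> W). s x \<le> s x'"
        using continuous_attains_inf[OF _ False] by blast
      have "s x \<noteq> 0"
      proof
        assume "s x = 0"
        then have e: "P j x = P j y" for j unfolding s_def by (subst (asm) sum_nonneg_eq_0_iff) auto
        have xU: "x \<in> U" using x(1) by (simp add: K_def)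
        have "x \<noteq> y" using x(1) Uy(3) by auto
        then have "h x = 0" "J x \<noteq> 0" using h0[OF xU e] reg[OF xU e] by auto
        then have "x \<in> W" using \<epsilon> by (simp add: W_def)
        then show False using x(1) by simp
      qed
      moreover have "0 \<le> s x" unfolding s_def by (intro sum_nonneg) simp
      ultimately show ?thesis using x(2) by (intro exI[of _ "s x"]) auto
    qed (auto intro: exI[of _ 1])
    then obtain s0 where s0: "0 < s0" "\<And>x. x \<in> K - (Uy \<union> W) \<Longrightarrow> s0 \<le> s x" by blast
    \<comment> \<open>The last term makes the sum of n squared distances at most s0/2, so a shell of
      radius r cannot meet that remainder.\<close>
    define r where "r = min (min \<rho> r0) (s0 / (2 * real CARD('n)))"
    have r: "0 < r" "r \<le> \<rho>" "r \<le> r0" using \<rho> Uy(4) s0 by (auto simp: r_def)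
    have cover: "x \<in> Uy \<union> W" if "x \<in> U" "\<forall>j. (cmod (P j x - P j y))\<^sup>2 \<le> r" for x
    proof (rule ccontr)
      assume "x \<notin> Uy \<union> W"
      moreover have "x \<in> K" using that r(2) by (auto simp: K_def intro: order_trans)
      ultimately have "s0 \<le> s x" using s0(2) by blast
      also have "s x \<le> (\<Sum>j\<in>(UNIV::'n set). r)" unfolding s_def using that by (intro sum_mono) auto
      also have "\<dots> \<le> s0 / 2"
        using mult_left_mono[of r "s0 / (2 * real CARD('n))" "real CARD('n)"] by (simp add: r_def)
      finally show False using s0(1) by simp
    qed
    define \<theta> where "\<theta> = bumpsq (r/2) r"
    have b: "bump (r/2) r \<theta>" and m0: "0 < mass \<theta>"
      unfolding \<theta>_def using bump_bumpsq[of "r/2" r] mass_bumpsq_pos[of "r/2" r] r by auto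
    have \<theta>pos: "0 \<le> \<theta> s" for s unfolding \<theta>_def by (rule bumpsq_bounds) (use r in simp)
    define B where "B x = (\<Prod>j\<in>UNIV. \<theta> ((cmod (P j x - P j y))\<^sup>2))" for x
    have B0: "0 \<le> B x" for x unfolding B_def using \<theta>pos by (intro prod_nonneg) auto
    let ?\<xi> = "\<lambda>j. shift_fun \<theta> (P j y)"
    have Bx: "(\<Prod>j\<in>UNIV. ?\<xi> j (P j x)) = of_real (B x)" for x by (simp add: B_def shift_fun_def)
    have Bsupp: "B x \<noteq> 0 \<Longrightarrow> x \<in> U \<Longrightarrow> x \<in> Uy \<union> W" for x
    proof (rule cover, assumption, intro allI)
      fix j assume "B x \<noteq> 0"
      then have "\<theta> ((cmod (P j x - P j y))\<^sup>2) \<noteq> 0" by (auto simp: B_def)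
      then show "(cmod (P j x - P j y))\<^sup>2 \<le> r" using bump_zero[OF b] by (meson linear)
    qed
    let ?M = "of_real (mass \<theta> ^ CARD('n)) :: complex"
    have LPh: "LP U h ?\<xi> = C * ?M" using is_coeff_atD[OF C b r(2)] by simp
    have LPJ: "LP U J ?\<xi> = CJ * ?M" using is_coeff_atD[OF CJ b r(2)] by simp
    have LPy: "LP Uy J ?\<xi> = of_real (pi ^ CARD('n)) * ?M" using mass[rule_format, of "\<lambda>_. r/2" "\<lambda>_. r" "\<lambda>_. \<theta>"] b r(3) by simp
    have iP: "integrable lborel (\<lambda>x. indicator U x *\<^sub>R (g x * cnj (J x) * of_real (B x)))" if "polyfun g" for g
      using P'.integrable_LP[OF that adm' C1_test_fun_imp[OF C1_test_fun_shell_fun[OF b r(2)]], of "\<lambda>_. 0"]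
      unfolding jac_diff by (simp add: B_def shell_fun_def)
    define Fh where "Fh x = indicator U x *\<^sub>R (h x * cnj (J x) * of_real (B x))" for x
    define FJ where "FJ x = indicator U x * ((cmod (J x))\<^sup>2 * B x)" for x
    define Fy where "Fy x = indicator Uy x *\<^sub>R (J x * cnj (J x) * of_real (B x))" for x
    have Uy_U: "Uy \<subseteq> U" using Uy(2) by (auto simp: O1_def)
    have iFh: "integrable lborel Fh" unfolding Fh_def by (rule iP[OF h])
    have FJc: "(\<lambda>x. indicator U x *\<^sub>R (J x * cnj (J x) * of_real (B x))) = (\<lambda>x. complex_of_real (FJ x))"
      unfolding FJ_def complex_norm_square[symmetric] by (auto simp: scaleR_conv_of_real)
    have iFJ: "integrable lborel FJ"
      using iP[OF pJ] unfolding FJc by (subst (asm) complex_of_real_integrable_eq)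
    have iFy: "integrable lborel Fy"
    proof (rule Bochner_Integration.integrable_bound[OF iP[OF pJ]])
      have "continuous_on UNIV (\<lambda>x. J x * cnj (J x) * of_real (B x))"
        unfolding B_def using continuous_on_polyfun[OF pJ]
        by (intro continuous_intros continuous_on_cnj continuous_on_of_real continuous_on_compose2[OF bump_continuous[OF b]] continuous_on_polyfun[OF P]) auto
      then have "(\<lambda>x. J x * cnj (J x) * of_real (B x)) \<in> borel_measurable borel" by (rule borel_measurable_continuous_onI)
      moreover have "Uy \<in> sets borel" using Uy(1) by simp
      ultimately show "Fy \<in> borel_measurable lborel" unfolding Fy_def[abs_def] by measurable
    qed (use Uy_U in \<open>auto simp: Fy_def indicator_def\<close>)
    have Ih: "integral\<^sup>L lborel Fh = C * ?M" using LPh unfolding LP_def L_def Bx Fh_def[symmetric] .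
    have IJ: "complex_of_real (integral\<^sup>L lborel FJ) = CJ * ?M"
      using LPJ unfolding LP_def L_def Bx FJc by simp
    have Iy: "integral\<^sup>L lborel Fy = of_real (pi ^ CARD('n)) * ?M" using LPy unfolding LP_def L_def Bx Fy_def[symmetric] .
    have pt: "norm (Fh x - (h y / J y) * Fy x) \<le> \<epsilon> * FJ x" for x
    proof (cases "x \<in> U \<and> B x \<noteq> 0")
      case False
      then show ?thesis using Uy_U by (auto simp: Fh_def Fy_def FJ_def indicator_def)
    next
      case True
      then have xU: "x \<in> U" and "x \<in> Uy \<union> W" using Bsupp by auto
      show ?thesis
      proof (cases "x \<in> Uy")
        case xy: True
        then have J0: "J x \<noteq> 0" and cl: "cmod (h x / J x - h y / J y) < \<epsilon>" using Uy(2) by (auto simp: O1_def)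
        have "Fh x - (h y / J y) * Fy x = (h x / J x - h y / J y) * (J x * cnj (J x)) * of_real (B x)"
          using xU xy J0 by (simp add: Fh_def Fy_def field_simps)
        then have "norm (Fh x - (h y / J y) * Fy x) = cmod (h x / J x - h y / J y) * ((cmod (J x))\<^sup>2 * B x)"
          using B0[of x] by (simp add: norm_mult power2_eq_square)
        also have "\<dots> \<le> \<epsilon> * ((cmod (J x))\<^sup>2 * B x)" using cl B0[of x] by (intro mult_right_mono) auto
        finally show ?thesis using xU by (simp add: FJ_def)
      next
        case xy: False
        then have "cmod (h x) \<le> \<epsilon> * cmod (J x)" using \<open>x \<in> Uy \<union> W\<close> by (auto simp: W_def)
        then have "cmod (h x) * (cmod (J x) * B x) \<le> \<epsilon> * cmod (J x) * (cmod (J x) * B x)"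
          using B0[of x] by (intro mult_right_mono) auto
        then show ?thesis using xU xy B0[of x] by (simp add: Fh_def Fy_def FJ_def norm_mult power2_eq_square mult_ac)
      qed
    qed
    have "cmod (C * ?M - (h y / J y) * (of_real (pi ^ CARD('n)) * ?M)) = cmod (integral\<^sup>L lborel (\<lambda>x. Fh x - (h y / J y) * Fy x))"
      using iFh iFy Ih Iy by simp
    also have "\<dots> \<le> integral\<^sup>L lborel (\<lambda>x. \<epsilon> * FJ x)"
      by (rule order_trans[OF integral_norm_bound], rule integral_mono) (use iFh iFy iFJ pt in auto)
    also have "\<dots> = \<epsilon> * integral\<^sup>L lborel FJ" by simp
    also have "\<dots> \<le> \<epsilon> * cmod (CJ * ?M)"
      unfolding IJ[symmetric] using \<epsilon> by (intro mult_left_mono) auto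
    finally have "cmod ((C - ?k) * ?M) \<le> \<epsilon> * cmod (CJ * ?M)" by (simp add: algebra_simps)
    then have "cmod (C - ?k) * mass \<theta> ^ CARD('n) \<le> (\<epsilon> * cmod CJ) * mass \<theta> ^ CARD('n)"
      using m0 by (simp add: norm_mult norm_power)
    then show ?thesis using m0 by (simp add: mult_le_cancel_right)
  qed
  then have "cmod (C - ?k) \<le> 0 + \<epsilon>" if "0 < \<epsilon>" for \<epsilon>
  proof -
    have "0 < \<epsilon> / (cmod CJ + 1)" using that by (intro divide_pos_pos) (auto intro: add_nonneg_pos)
    from \<open>\<And>\<epsilon>. 0 < \<epsilon> \<Longrightarrow> cmod (C - ?k) \<le> \<epsilon> * cmod CJ\<close>[OF this]
    have "cmod (C - ?k) \<le> \<epsilon> * (cmod CJ / (cmod CJ + 1))" by simp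
    also have "\<dots> \<le> \<epsilon> * 1" using that add_nonneg_pos[OF norm_ge_zero zero_less_one, of CJ] by (intro mult_left_mono) (auto simp: divide_le_eq)
    finally show ?thesis by simp
  qed
  then have "cmod (C - ?k) \<le> 0" by (rule field_le_epsilon)
  then show ?thesis by simp
qed

end

section \<open>Density of points with regular value\<close>

lemma polyfun_line:
  assumes "polyfun f"
  shows "\<exists>p :: complex poly. \<forall>s. f (x + s *s v) = poly p s"
  using assms
proof induction
  case (const c)
  show ?case by (rule exI[of _ "[:c:]"]) simp
next
  case (coord i)
  show ?case by (rule exI[of _ "[:x $ i, v $ i:]"]) simp
next
  case (add f g)
  then obtain p q where "\<forall>s. f (x + s *s v) = poly p s" "\<forall>s. g (x + s *s v) = poly q s" by blast
  then show ?case by (intro exI[of _ "p + q"]) simp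
next
  case (mult f g)
  then obtain p q where "\<forall>s. f (x + s *s v) = poly p s" "\<forall>s. g (x + s *s v) = poly q s" by blast
  then show ?case by (intro exI[of _ "p * q"]) simp
qed

text \<open>On the complex line through x0 and x1 the function is a nonzero polynomial in one
  variable, with finitely many roots; small real parameters provide infinitely many points near
  x0.\<close>

lemma polyfun_dense:
  assumes f: "polyfun f" and x1: "f x1 \<noteq> 0" and e: "0 < e"
  shows "\<exists>x\<in>ball x0 e. f x \<noteq> 0"
proof -
  define v where "v = x1 - x0"
  obtain p where p: "\<And>s. f (x0 + s *s v) = poly p s" using polyfun_line[OF f] by blast
  have "poly p 1 \<noteq> 0" using p[of 1] x1 by (simp add: v_def)
  then have "p \<noteq> 0" by auto
  then have fin: "finite {s. poly p s = 0}" by (rule poly_roots_finite)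
  define d where "d = e / (norm v + 1)"
  have nv: "0 < norm v + 1" by (rule add_nonneg_pos) auto
  then have d: "0 < d" using e by (simp add: d_def)
  have "infinite (complex_of_real ` {0<..<d})"
    using d by (subst finite_image_iff) (auto simp: inj_on_def)
  then obtain s where s: "s \<in> {0<..<d}" "poly p (of_real s) \<noteq> 0"
    using fin by (metis (mono_tags, lifting) finite_subset image_subset_iff mem_Collect_eq)
  have "complex_of_real s *s v = s *\<^sub>R v" by (simp add: vec_eq_iff scaleR_conv_of_real[where 'a=complex])
  then have "norm (complex_of_real s *s v) = s * norm v" using s by simp
  also have "\<dots> \<le> s * (norm v + 1)" using s by (intro mult_left_mono) auto
  also have "\<dots> < d * (norm v + 1)" using s nv by (intro mult_strict_right_mono) auto
  also have "\<dots> = e" using nv by (simp add: d_def)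
  finally have "x0 + complex_of_real s *s v \<in> ball x0 e" by (simp add: dist_norm)
  then show ?thesis using p[of "of_real s"] s(2) by (intro bexI) auto
qed

text \<open>Sard's theorem in equal real dimensions: a vanishing complex determinant makes the real
  Jacobian, its squared modulus, vanish as well.\<close>

lemma sard_complex:
  fixes G :: "complex^'n::finite \<Rightarrow> complex^'n"
  assumes der: "\<And>x. x \<in> S \<Longrightarrow> (G has_derivative (*v) (A x)) (at x)"
    and det: "\<And>x. x \<in> S \<Longrightarrow> det (A x) = 0"
  shows "negligible (G ` S)"
proof -
  let ?R = "reindex_vec Abs_wo :: real^('n+'n) wo \<Rightarrow> real^('n+'n)"
  let ?R' = "reindex_vec Rep_wo :: real^('n+'n) \<Rightarrow> real^('n+'n) wo"
  let ?T = "\<lambda>x. realify (?R x) :: complex^'n"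
  let ?U = "\<lambda>z::complex^'n. ?R' (realify_inv z)"
  have RR: "?R (?R' y) = y" "?R' (?R x) = x" for x y
    by (auto simp: reindex_vec_def vec_eq_iff Abs_wo_inverse Rep_wo_inverse)
  have TU: "?T (?U z) = z" "?U (?T x) = x" for x z by (auto simp: RR)
  have lR: "linear ?R" "linear ?R'" by (auto intro!: linearI simp: reindex_vec_def vec_eq_iff)
  have lr: "linear (realify :: _ \<Rightarrow> complex^'n)" by (rule realify_iso)
  have lri: "linear (realify_inv :: complex^'n \<Rightarrow> _)" by (rule linearI) (auto simp: realify_inv_def vec_eq_iff split: sum.split)
  have blT: "bounded_linear ?T"
    using linear_compose[OF lR(1) lr] by (simp add: o_def linear_conv_bounded_linear)
  have blU: "bounded_linear ?U"
    using linear_compose[OF lri lR(2)] by (simp add: o_def linear_conv_bounded_linear)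
  define S' where "S' = ?U ` S"
  define h where "h = (\<lambda>x. ?U (G (?T x)))"
  define h' where "h' x = (\<lambda>v. ?U (A (?T x) *v ?T v))" for x
  have TS: "?T x \<in> S" if "x \<in> S'" for x using that by (auto simp: S'_def RR)
  have derh: "(h has_derivative h' x) (at x within S')" if "x \<in> S'" for x
  proof -
    have "(G \<circ> ?T has_derivative (*v) (A (?T x)) \<circ> ?T) (at x)"
      by (rule diff_chain_at[OF bounded_linear_imp_has_derivative[OF blT] der[OF TS[OF that]]])
    from bounded_linear.has_derivative[OF blU this] have "(h has_derivative h' x) (at x)"
      by (simp add: h_def h'_def o_def)
    then show ?thesis by (rule has_derivative_at_withinI)
  qed
  have deth: "det (matrix (h' x)) = 0" if "x \<in> S'" for x
  proof -
    define M where "M = matrix (\<lambda>v. realify_inv (A (?T x) *v realify v))"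
    have mv: "(N *v axis b c) $ a = N $ a $ b * c" for N :: "complex^'n^'n" and a b c
      by (simp add: matrix_vector_mult_def axis_def if_distrib cong: if_cong)
    have "det (matrix (h' x)) = det M"
    proof (rule det_embed[of Abs_wo])
      show "inj (Abs_wo :: 'n + 'n \<Rightarrow> ('n + 'n) wo)" by (metis Abs_wo_inject UNIV_I injI)
      have "?R (axis (Abs_wo j) 1) = axis j 1" for j
        by (auto simp: reindex_vec_def vec_eq_iff axis_def Abs_wo_inject)
      then show "matrix (h' x) $ Abs_wo i $ Abs_wo j = M $ i $ j" for i j
        by (simp add: matrix_def h'_def M_def reindex_vec_def[of Rep_wo] Abs_wo_inverse)
      show "i \<notin> range (Abs_wo::'n + 'n \<Rightarrow> ('n + 'n) wo) \<Longrightarrow> matrix (h' x) $ i $ j = of_bool (i = j)" for i j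
        by (metis UNIV_I UNIV_wo)
    qed
    also have "\<dots> = (cmod (det (A (?T x))))\<^sup>2"
      by (rule det_realification)
         (simp_all add: matrix_def M_def realify_axis mv, simp_all add: realify_inv_def mv)
    finally show ?thesis using det[OF TS[OF that]] by simp
  qed
  have "negligible (h ` S')"
    by (rule baby_Sard[OF order_refl derh]) (use deth det_eq_0_rank in blast)+
  moreover have "CARD(('n + 'n) wo) = CARD('n) * 2"
    using bij_betw_same_card[OF bij_Rep_wo[where 'a="'n + 'n"]] by simp
  moreover have "?T differentiable_on (h ` S')"
    by (intro differentiable_at_imp_differentiable_on bounded_linear_imp_differentiable blT)
  ultimately have "negligible (?T ` h ` S')"
    using negligible_differentiable_image_negligible[of "h ` S'" ?T] by simp
  moreover have "?T ` h ` S' = G ` S" unfolding S'_def h_def image_image by (simp add: TU)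
  ultimately show ?thesis by simp
qed

context proper_pushforward
begin

text \<open>If \<open>J\<close> vanished identically, so would the degree of \<open>P\<close>; but \<open>P + t id\<close> has a regular point for
  arbitrarily small \<open>t\<close>, hence degree at least one, and the degree is continuous in \<open>t\<close>.\<close>

lemma jac_nonzero: "\<exists>x. J x \<noteq> 0"
proof (rule ccontr)
  assume "\<not> (\<exists>x. J x \<noteq> 0)"
  then have J0: "J x = 0" for x by simp
  \<comment> \<open>Subtracting P(0) puts the origin into the zero fibre of every perturbed
    map.\<close>
  define Pt where "Pt t = (\<lambda>j x. P j x - P j 0 + t * x $ j)" for t :: complex
  define Jt where "Jt t = jac (Pt t)" for t
  have pf: "pushforward (Pt t)" for t
    unfolding Pt_def by unfold_locales (intro polyfun.add polyfun_diff polyfun.mult polyfun.const polyfun.coord P)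
  have Jt: "Jt t x = det (\<chi> j l. pd l (P j) x + (if j = l then t else 0))" for t x
  proof -
    have "pd l (Pt t j) x = pd l (P j) x + (if j = l then t else 0)" for j l
    proof -
      have "pd l (\<lambda>x. P j x - P j 0) = pd l (P j)"
        using pd_add[OF P[of j] polyfun.const[of "- P j 0"], of l] by simp
      then show ?thesis
        unfolding Pt_def using pd_add[OF polyfun_diff[OF P[of j] polyfun.const[of "P j 0"]] polyfun.mult[OF polyfun.const[of t] polyfun.coord[of j]], of l]
          pd_cmult[OF polyfun.coord[of j], of l t] by (simp add: pd_coord)
    qed
    then show ?thesis by (simp add: Jt_def jac_def jmat_def)
  qed
  have pJt: "polyfun (Jt t)" for t unfolding Jt_def by (rule polyfun_jac) (rule pushforward.P[OF pf])
  define m where "m = (\<Sum>j\<in>UNIV. cmod (P j 0))"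
  have mj: "cmod (P j 0) \<le> m" for j unfolding m_def by (rule member_le_sum) auto
  have "bounded {x \<in> UNIV. \<forall>j. (cmod (P j x))\<^sup>2 \<le> (2 + m)\<^sup>2}"
    using adm_UNIV[of "(2 + m)\<^sup>2"] by (simp add: adm_def compact_imp_bounded)
  then obtain B where B: "\<And>x. \<forall>j. (cmod (P j x))\<^sup>2 \<le> (2 + m)\<^sup>2 \<Longrightarrow> norm x \<le> B"
    unfolding bounded_iff by auto
  \<comment> \<open>On the sphere of radius \<open>R0\<close> some |P j| exceeds 2 + m. The 2
    absorbs |Pt| <= 1 and the perturbation, of size at most 1; m absorbs P(0). So the sublevel set
    of radius 1 misses the sphere and the ball is admissible.\<close>
  define R0 where "R0 = max B 0 + 1"
  have R0: "0 < R0" by (simp add: R0_def)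
  define U where "U = ball (0::complex^'n) R0"
  have adm_t: "pushforward.adm (Pt t) U 1" if t: "cmod t * R0 \<le> 1" for t
  proof -
    have "{x \<in> U. \<forall>j. (cmod (Pt t j x))\<^sup>2 \<le> 1} = cball 0 R0 \<inter> {x. \<forall>j. (cmod (Pt t j x))\<^sup>2 \<le> 1}"
    proof -
      have "norm x \<noteq> R0" if x: "\<forall>j. (cmod (Pt t j x))\<^sup>2 \<le> 1" for x
      proof
        assume n: "norm x = R0"
        then have "\<not> norm x \<le> B" by (simp add: R0_def)
        then obtain j where "\<not> (cmod (P j x))\<^sup>2 \<le> (2 + m)\<^sup>2" using B by blast
        moreover have "0 \<le> m" using mj[of j] norm_ge_zero order_trans by blast
        ultimately have 1: "2 + m < cmod (P j x)" by (meson norm_ge_zero not_le power_mono)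
        have "cmod (P j x) = cmod (Pt t j x + P j 0 - t * x $ j)" by (simp add: Pt_def)
        also have "\<dots> \<le> cmod (Pt t j x) + cmod (P j 0) + cmod (t * x $ j)"
          by (metis (no_types, opaque_lifting) add_mono_thms_linordered_semiring(3) norm_triangle_ineq norm_triangle_ineq4 order_trans)
        also have "cmod (t * x $ j) \<le> 1"
        proof -
          have "cmod (t * x $ j) \<le> cmod t * norm x" unfolding norm_mult by (intro mult_left_mono Finite_Cartesian_Product.norm_nth_le) auto
          then show ?thesis using t n by simp
        qed
        also have "cmod (Pt t j x) \<le> 1" using x[rule_format, of j] by (simp add: power_le_one_iff)
        finally show False using 1 mj[of j] by simp
      qed
      then show ?thesis unfolding U_def by force
    qed
    moreover have "closed {x. \<forall>j. (cmod (Pt t j x))\<^sup>2 \<le> 1}"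
      by (intro closed_Collect_all closed_Collect_le continuous_intros continuous_on_polyfun[OF pushforward.P[OF pf]])
    ultimately show ?thesis
      unfolding pushforward.adm_def[OF pf] by (simp add: U_def compact_Int_closed)
  qed
  define \<theta> where "\<theta> = bumpsq (1/2) (1::real)"
  have b: "bump (1/2) 1 \<theta>" and m0: "0 < mass \<theta>"
    unfolding \<theta>_def using bump_bumpsq[of "1/2" 1] mass_bumpsq_pos[of "1/2" 1] by auto
  define \<Phi> where "\<Phi> t = pushforward.LP (Pt t) U (Jt t) (\<lambda>j. shell_fun \<theta> 0)" for t
  have LPr: "pushforward.LP (Pt t) V (Jt t) (\<lambda>j. shell_fun \<eta> 0) =
     of_real (integral\<^sup>L lborel (\<lambda>x. indicator V x * ((cmod (Jt t x))\<^sup>2 * (\<Prod>j\<in>UNIV. \<eta> ((cmod (Pt t j x))\<^sup>2)))))" for V t \<eta>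
  proof -
    have e: "indicator V x *\<^sub>R (Jt t x * cnj (Jt t x) * (\<Prod>j\<in>UNIV. shell_fun \<eta> 0 (Pt t j x))) =
      complex_of_real (indicator V x * ((cmod (Jt t x))\<^sup>2 * (\<Prod>j\<in>UNIV. \<eta> ((cmod (Pt t j x))\<^sup>2))))" for x
      unfolding complex_norm_square[symmetric] by (simp add: shell_fun_def scaleR_conv_of_real)
    show ?thesis
      unfolding pushforward.LP_def[OF pf] pushforward.L_def[OF pf] Jt_def[symmetric] e integral_complex_of_real ..
  qed
  \<comment> \<open>The weight for h = Jt is nonnegative, so the mass near the regular point 0
    bounds the total from below. The coefficient is compared on small shells and then used on the
    fixed bump \<theta>.\<close>
  have lower: "(pi * mass \<theta>) ^ CARD('n) \<le> cmod (\<Phi> t)" if t: "cmod t * R0 \<le> 1" and nz: "Jt t 0 \<noteq> 0" for t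
  proof -
    obtain C where C: "pushforward.is_coeff (Pt t) U 1 (Jt t) (\<lambda>_. 0) C"
      using pushforward.is_coeff_exists[OF pf pJt adm_t[OF t]] by auto
    obtain V r where V: "open V" "V \<subseteq> U" "0 < r" and
      lm: "\<forall>p q \<eta>. (\<forall>j. bump (p j) (q j) (\<eta> j) \<and> q j \<le> r) \<longrightarrow>
        pushforward.LP (Pt t) V (jac (Pt t)) (\<lambda>j. shift_fun (\<eta> j) (Pt t j 0)) = of_real (pi ^ CARD('n)) * (\<Prod>j\<in>UNIV. of_real (mass (\<eta> j)))"
      using pushforward.local_mass[OF pf, of t 0 U] nz R0 unfolding Jt_def U_def by (auto elim!: exE conjE)
    define s where "s = min r 1"
    define \<eta> where "\<eta> = bumpsq (s/2) s"
    have s: "0 < s" "s \<le> r" "s \<le> 1" using V(3) by (auto simp: s_def)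
    have b\<eta>: "bump (s/2) s \<eta>" and m\<eta>: "0 < mass \<eta>"
      unfolding \<eta>_def using bump_bumpsq[of "s/2" s] mass_bumpsq_pos[of "s/2" s] s by auto
    have \<eta>0: "0 \<le> \<eta> u" for u unfolding \<eta>_def using bumpsq_bounds(1)[of "s/2" s u] s by simp
    define F where "F W x = indicator W x * ((cmod (Jt t x))\<^sup>2 * (\<Prod>j\<in>UNIV. \<eta> ((cmod (Pt t j x))\<^sup>2)))" for W :: "(complex^'n) set" and x
    have LPU: "C * of_real (mass \<eta> ^ CARD('n)) = of_real (integral\<^sup>L lborel (F U))"
      using C[unfolded pushforward.is_coeff_def[OF pf], rule_format, of "\<lambda>_. s/2" "\<lambda>_. s" "\<lambda>_. \<eta>"] b\<eta> s
      unfolding LPr F_def by simp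
    have "Pt t j 0 = 0" for j by (simp add: Pt_def)
    then have sh: "shift_fun \<eta> (Pt t j 0) = shell_fun \<eta> 0" for j by (auto simp: shift_fun_def shell_fun_def)
    have LPV: "of_real (pi ^ CARD('n)) * of_real (mass \<eta> ^ CARD('n)) = complex_of_real (integral\<^sup>L lborel (F V))"
      using lm[rule_format, of "\<lambda>_. s/2" "\<lambda>_. s" "\<lambda>_. \<eta>"] b\<eta> s
      unfolding sh Jt_def[symmetric] LPr F_def by simp
    have int: "integrable lborel (F U)"
    proof -
      have "integrable lborel (\<lambda>x. indicator U x *\<^sub>R (Jt t x * cnj (Jt t x) * (\<Prod>j\<in>UNIV. shell_fun \<eta> 0 (Pt t j x))))"
        using pushforward.integrable_LP[OF pf pJt adm_t[OF t] C1_test_fun_imp[OF C1_test_fun_shell_fun[OF b\<eta> s(3)]]]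
        unfolding Jt_def[symmetric] .
      moreover have "(\<lambda>x. indicator U x *\<^sub>R (Jt t x * cnj (Jt t x) * (\<Prod>j\<in>UNIV. shell_fun \<eta> 0 (Pt t j x)))) = (\<lambda>x. complex_of_real (F U x))"
        unfolding complex_norm_square[symmetric] F_def by (auto simp: shell_fun_def scaleR_conv_of_real)
      ultimately have "integrable lborel (\<lambda>x. complex_of_real (F U x))" by simp
      then show ?thesis by (subst (asm) complex_of_real_integrable_eq)
    qed
    have "integral\<^sup>L lborel (F V) \<le> integral\<^sup>L lborel (F U)"
      by (rule integral_mono_AE'[OF int])
         (use V(2) \<eta>0 in \<open>auto simp: F_def indicator_def intro!: AE_I2 mult_nonneg_nonneg prod_nonneg\<close>)
    then have "pi ^ CARD('n) * mass \<eta> ^ CARD('n) \<le> integral\<^sup>L lborel (F U)"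
      using LPV by (metis of_real_eq_iff of_real_mult)
    also have "\<dots> \<le> cmod (C * of_real (mass \<eta> ^ CARD('n)))" unfolding LPU by simp
    also have "\<dots> = cmod C * mass \<eta> ^ CARD('n)" using m\<eta> by (simp add: norm_mult norm_power)
    finally have "pi ^ CARD('n) \<le> cmod C" using m\<eta> by (simp add: mult_le_cancel_right)
    moreover have "\<Phi> t = C * of_real (mass \<theta> ^ CARD('n))"
      using C[unfolded pushforward.is_coeff_def[OF pf], rule_format, of "\<lambda>_. 1/2" "\<lambda>_. 1" "\<lambda>_. \<theta>"] b unfolding \<Phi>_def by simp
    ultimately show ?thesis
      using m0 by (simp add: norm_mult norm_power power_mult_distrib mult_right_mono)
  qed
  have ci: "continuous_on UNIV (\<lambda>x::complex \<times> (complex^'n). if b then fst x else 0)" for b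
    by (cases b) (auto intro!: continuous_intros)
  have contJt: "continuous_on UNIV (\<lambda>z. Jt (fst z) (snd z))"
    unfolding Jt det_def
    by (simp, intro continuous_intros ci continuous_on_prod continuous_on_compose2[OF continuous_on_polyfun[OF polyfun_pd[OF P]]])
       (auto intro!: continuous_intros ci)
  \<comment> \<open>The polynomial sending t to \<open>Jt t 0\<close>, written as a function of one
    coordinate of a vector so that \<open>polyfun_dense\<close> applies; the other coordinates are
    dummies.\<close>
  define f where "f x = det (\<chi> j l. pd l (P j) 0 + (if j = l then x $ (undefined::'n) else 0))" for x :: "complex^'n"
  have pu: "polyfun (\<lambda>x::complex^'n. if b then x $ (undefined::'n) else 0)" for b
    by (cases b) (simp_all add: polyfun.coord polyfun.const)
  have "polyfun f"
    unfolding f_def[abs_def] by (intro polyfun_det polyfun.add polyfun.const pu)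
  moreover have "\<exists>x. f x \<noteq> 0"
  proof -
    \<comment> \<open>With t = 1/s, scaling every row by s turns P'(0) + t into s P'(0) + 1, whose
      determinant tends to 1. So f is nonzero at a large t.\<close>
    have "((\<lambda>s::real. det (\<chi> j l. pd l (P j) 0 * of_real s + (if j = l then 1 else 0))) \<longlongrightarrow>
        det (\<chi> j l. pd l (P j) 0 * of_real 0 + (if j = l then 1 else 0))) (at 0)"
      unfolding det_def by (simp only: vec_lambda_beta) (intro tendsto_intros)
    moreover have "det (\<chi> j l. pd l (P j) 0 * of_real 0 + (if j = l then 1 else 0)) = 1"
    proof -
      have "(\<chi> j l. pd l (P j) 0 * of_real 0 + (if j = l then 1 else 0)) = mat 1"
        by (auto simp: mat_def vec_eq_iff)
      then show ?thesis by (simp only: det_I)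
    qed
    ultimately have "((\<lambda>s::real. det (\<chi> j l. pd l (P j) 0 * of_real s + (if j = l then 1 else 0))) \<longlongrightarrow> 1) (at 0)"
      by (simp only:)
    then have "eventually (\<lambda>s::real. det (\<chi> j l. pd l (P j) 0 * of_real s + (if j = l then 1 else 0)) \<noteq> 0) (at 0)"
      by (rule tendsto_imp_eventually_ne) simp
    then obtain d where d: "0 < d" "\<And>s::real. s \<noteq> 0 \<Longrightarrow> dist s 0 < d \<Longrightarrow> det (\<chi> j l. pd l (P j) 0 * of_real s + (if j = l then 1 else 0)) \<noteq> 0"
      unfolding eventually_at by auto
    define s where "s = d / 2"
    have s: "s \<noteq> 0" "det (\<chi> j l. pd l (P j) 0 * of_real s + (if j = l then 1 else 0)) \<noteq> 0"
      using d(1) d(2)[of s] by (auto simp: s_def)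
    define A where "A = (\<chi> j l. pd l (P j) 0 + (if j = l then inverse (of_real s) else 0))"
    have "(\<chi> j l. pd l (P j) 0 * of_real s + (if j = l then 1 else 0)) = (\<chi> i. of_real s *s (A $ i))"
      using s(1) by (auto simp: A_def vec_eq_iff algebra_simps)
    then have "det A \<noteq> 0" using s(2) det_rows_mul[of "\<lambda>_. of_real s" "\<lambda>i. A $ i"] by auto
    moreover have "f (\<chi> i. inverse (of_real s)) = det A" by (simp add: f_def A_def cong: if_cong)
    ultimately show ?thesis by metis
  qed
  ultimately have dense: "\<exists>x\<in>ball 0 e. f x \<noteq> 0" if "0 < e" for e
    using polyfun_dense that by blast
  have "\<exists>t. cmod t < inverse (real (Suc k)) / R0 \<and> Jt t 0 \<noteq> 0" for k
  proof -
    have "0 < inverse (real (Suc k)) / R0" using R0 by (intro divide_pos_pos) auto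
    from dense[OF this] obtain x where x: "norm x < inverse (real (Suc k)) / R0" "f x \<noteq> 0" by (auto simp: dist_norm)
    have "cmod (x $ undefined) \<le> norm x" by (rule Finite_Cartesian_Product.norm_nth_le)
    then show ?thesis using x by (intro exI[of _ "x $ undefined"]) (auto simp: Jt f_def)
  qed
  then obtain t where t: "\<And>k. cmod (t k) < inverse (real (Suc k)) / R0" "\<And>k. Jt (t k) 0 \<noteq> 0" by metis
  have tR: "cmod (t k) * R0 \<le> 1" for k
  proof -
    have "cmod (t k) * R0 \<le> inverse (real (Suc k)) / R0 * R0" using t(1)[of k] R0 by (intro mult_right_mono) auto
    also have "\<dots> \<le> 1" using R0 by (simp add: inverse_le_1_iff)
    finally show ?thesis .
  qed
  have t0: "t \<longlonglongrightarrow> 0"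
  proof (rule Lim_null_comparison)
    show "\<forall>\<^sub>F k in sequentially. norm (t k) \<le> inverse (real (Suc k)) / R0" using t(1) by (auto intro!: always_eventually less_imp_le)
    show "(\<lambda>k. inverse (real (Suc k)) / R0) \<longlonglongrightarrow> 0"
      using tendsto_divide[OF LIMSEQ_inverse_real_of_nat tendsto_const, of R0] R0 by simp
  qed
  have "compact ((\<lambda>z. Jt (fst z) (snd z)) ` (cball 0 (1/R0) \<times> cball 0 R0))"
    by (intro compact_continuous_image continuous_on_subset[OF contJt] compact_Times) auto
  from compact_imp_bounded[OF this] obtain M where M: "\<forall>y\<in>(\<lambda>z. Jt (fst z) (snd z)) ` (cball 0 (1/R0) \<times> cball 0 R0). norm y \<le> M"
    unfolding bounded_iff by blast
  define F where "F s x = indicator U x * ((cmod (Jt s x))\<^sup>2 * (\<Prod>j\<in>UNIV. \<theta> ((cmod (Pt s j x))\<^sup>2)))" for s x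
  have cPt: "continuous_on UNIV (\<lambda>x. (cmod (Jt s x))\<^sup>2 * (\<Prod>j\<in>UNIV. \<theta> ((cmod (Pt s j x))\<^sup>2)))" for s
    by (intro continuous_intros continuous_on_polyfun[OF pJt] continuous_on_compose2[OF bump_continuous[OF b]]
      continuous_on_polyfun[OF pushforward.P[OF pf]]) auto
  have mF: "F s \<in> borel_measurable lborel" for s
  proof -
    have "U \<in> sets borel" by (simp add: U_def)
    then have "indicator U \<in> borel_measurable borel" by (rule borel_measurable_indicator)
    from borel_measurable_times[OF this borel_measurable_continuous_onI[OF cPt]]
    show ?thesis unfolding F_def[abs_def] by simp
  qed
  have limF: "(\<lambda>k. F (t k) x) \<longlonglongrightarrow> F 0 x" for x
  proof -
    have "continuous_on UNIV (\<lambda>s. Jt s x)"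
      using continuous_on_compose2[OF contJt, of UNIV "\<lambda>s. (s, x)"] by (simp add: continuous_on_Pair)
    then have "(\<lambda>k. Jt (t k) x) \<longlonglongrightarrow> Jt 0 x"
      by (rule continuous_on_tendsto_compose[OF _ t0]) auto
    moreover have "(\<lambda>k. \<theta> ((cmod (Pt (t k) j x))\<^sup>2)) \<longlonglongrightarrow> \<theta> ((cmod (Pt 0 j x))\<^sup>2)" for j
    proof (rule continuous_on_tendsto_compose[OF bump_continuous[OF b, of UNIV]])
      show "(\<lambda>k. (cmod (Pt (t k) j x))\<^sup>2) \<longlonglongrightarrow> (cmod (Pt 0 j x))\<^sup>2"
        unfolding Pt_def by (intro tendsto_intros t0)
    qed auto
    ultimately show ?thesis unfolding F_def by (intro tendsto_intros)
  qed
  have bF: "norm (F (t k) x) \<le> indicator U x * M\<^sup>2" for k x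
  proof (cases "x \<in> U")
    case True
    have "cmod (t k) \<le> 1 / R0" using tR[of k] R0 by (simp add: field_simps)
    then have "cmod (Jt (t k) x) \<le> M" using M True by (force simp: U_def)
    then have "(cmod (Jt (t k) x))\<^sup>2 \<le> M\<^sup>2" by (intro power_mono) auto
    moreover have "norm (\<Prod>j\<in>UNIV. \<theta> ((cmod (Pt (t k) j x))\<^sup>2)) \<le> 1"
      unfolding prod_norm[symmetric] using bumpsq_bounds(1,2)[of "1/2" 1] by (intro prod_le_1) (auto simp: \<theta>_def)
    ultimately have "(cmod (Jt (t k) x))\<^sup>2 * norm (\<Prod>j\<in>UNIV. \<theta> ((cmod (Pt (t k) j x))\<^sup>2)) \<le> M\<^sup>2 * 1"
      by (intro mult_mono) auto
    then show ?thesis using True by (simp add: F_def abs_mult)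
  qed (simp add: F_def)
  have "integrable lborel (\<lambda>x. indicator U x * M\<^sup>2 :: real)"
    by (intro integrable_mult_left integrable_real_indicator) (auto simp: U_def intro!: emeasure_bounded_finite simp flip: infinity_ennreal_def)
  then have "(\<lambda>k. integral\<^sup>L lborel (F (t k))) \<longlonglongrightarrow> integral\<^sup>L lborel (F 0)"
    by (rule integral_dominated_convergence[where s="\<lambda>k. F (t k)", OF mF mF]) (rule AE_I2, rule limF, rule AE_I2, rule bF)
  moreover have "F 0 x = 0" for x
  proof -
    have "Jt 0 x = J x" by (simp add: Jt jac_def jmat_def)
    then show ?thesis by (simp add: F_def J0)
  qed
  then have "F 0 = (\<lambda>x. 0)" by auto
  ultimately have "(\<lambda>k. integral\<^sup>L lborel (F (t k))) \<longlonglongrightarrow> 0" by simp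
  then have "(\<lambda>k. cmod (\<Phi> (t k))) \<longlonglongrightarrow> 0"
    unfolding \<Phi>_def LPr F_def[symmetric] norm_of_real by (rule tendsto_rabs_zero)
  then have "(pi * mass \<theta>) ^ CARD('n) \<le> 0"
    by (rule LIMSEQ_le_const) (use lower[OF tR t(2)] in blast)
  moreover have "0 < (pi * mass \<theta>) ^ CARD('n)" using m0 by simp
  ultimately show False by simp
qed

text \<open>P is open near some point of W where J is nonzero, while its critical values form a null
  set by Sard. An open set of values contains a noncritical one, attained inside W.\<close>

lemma regular_dense:
  assumes W: "open W" "y0 \<in> W"
  shows "\<exists>y\<in>W. \<forall>x. (\<forall>j. P j x = P j y) \<longrightarrow> J x \<noteq> 0"
proof -
  define G where "G x = (\<chi> j. P j x)" for x
  have pJ: "polyfun J" by (rule polyfun_jac[OF P])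
  obtain e where e: "0 < e" "ball y0 e \<subseteq> W" using W by (meson openE)
  obtain x1 where "J x1 \<noteq> 0" using jac_nonzero by blast
  from polyfun_dense[OF pJ this e(1), of y0] obtain y1 where y1: "y1 \<in> ball y0 e" "J y1 \<noteq> 0" by blast
  define W' where "W' = ball y0 e \<inter> {x. J x \<noteq> 0}"
  have W': "open W'" "y1 \<in> W'"
    unfolding W'_def using y1 by (auto intro!: open_Int open_Collect_neq continuous_intros continuous_on_polyfun pJ)
  have derG: "(G has_derivative (*v) (jmat P x)) (at x)" for x
    unfolding G_def[abs_def] by (rule polyfun_vec_has_derivative[OF P])
  have cj: "continuous_on W' (\<lambda>x. jmat P x $ i $ j)" for i j
    unfolding jmat_def using continuous_on_polyfun[OF polyfun_pd[OF P]] by simp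
  have dt: "det (jmat P x) \<noteq> 0" if "x \<in> W'" for x using that by (simp add: W'_def jac_def)
  obtain U V g where U: "open U" "U \<subseteq> W'" "y1 \<in> U" "open V" "G y1 \<in> V" "homeomorphism U V G g"
    using complex_inverse_function[OF W'(1) derG cj W'(2) dt] by metis
  have neg: "negligible (G ` {x. J x = 0})"
    by (rule sard_complex[OF derG]) (simp add: jac_def)
  have "\<not> V \<subseteq> G ` {x. J x = 0}"
    using neg U(4,5) negligible_subset open_not_negligible by blast
  then obtain w where w: "w \<in> V" "w \<notin> G ` {x. J x = 0}" by blast
  then obtain y where y: "y \<in> U" "G y = w" using U(6) by (auto simp: homeomorphism_def)
  have "J x \<noteq> 0" if "\<forall>j. P j x = P j y" for x
  proof
    assume "J x = 0"
    moreover have "G x = w" using that y(2) by (auto simp: G_def)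
    ultimately show False using w(2) by blast
  qed
  moreover have "y \<in> W" using y(1) U(2) e(2) by (auto simp: W'_def)
  ultimately show ?thesis by blast
qed

end

section \<open>Finiteness from linear dependence of powers\<close>

text \<open>Gaussian elimination for a homogeneous system with more unknowns than equations, by
  induction on the equations.\<close>

lemma exists_linear_dependence:
  fixes c :: "'e \<Rightarrow> 'b \<Rightarrow> complex"
  assumes "finite B" "finite S" "card B < card S"
  shows "\<exists>d. (\<exists>e\<in>S. d e \<noteq> 0) \<and> (\<forall>\<beta>\<in>B. (\<Sum>e\<in>S. d e * c e \<beta>) = 0)"
  using assms
proof (induction B arbitrary: S c rule: finite_induct)
  case empty
  then have "S \<noteq> {}" by auto
  then show ?case by (intro exI[of _ "\<lambda>_. 1"]) auto
next
  case (insert \<beta> B)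
  show ?case
  proof (cases "\<forall>e\<in>S. c e \<beta> = 0")
    case True
    have "card B < card S" using insert by simp
    from insert.IH[OF insert.prems(1) this, of c] True show ?thesis by auto
  next
    case False
    then obtain e0 where e0: "e0 \<in> S" "c e0 \<beta> \<noteq> 0" by blast
    let ?S = "S - {e0}"
    have "finite ?S" "card B < card ?S" using insert e0 by (auto simp: card_Diff_singleton)
    from insert.IH[OF this, of "\<lambda>e \<gamma>. c e \<gamma> - c e \<beta> / c e0 \<beta> * c e0 \<gamma>"]
    obtain d where d: "\<exists>e\<in>?S. d e \<noteq> 0" "\<And>\<gamma>. \<gamma> \<in> B \<Longrightarrow> (\<Sum>e\<in>?S. d e * (c e \<gamma> - c e \<beta> / c e0 \<beta> * c e0 \<gamma>)) = 0"
      by blast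
    \<comment> \<open>The value at the pivot e0 is determined by equation \<beta>; the other
      equations were reduced by it.\<close>
    define d' where "d' = d(e0 := - (\<Sum>e\<in>?S. d e * c e \<beta>) / c e0 \<beta>)"
    have split: "(\<Sum>e\<in>S. d' e * c e \<gamma>) = d' e0 * c e0 \<gamma> + (\<Sum>e\<in>?S. d e * c e \<gamma>)" for \<gamma>
      using insert.prems(1) e0(1) by (subst sum.remove[of _ e0]) (auto simp: d'_def intro!: sum.cong)
    have "(\<Sum>e\<in>S. d' e * c e \<gamma>) = 0" if "\<gamma> \<in> insert \<beta> B" for \<gamma>
    proof (cases "\<gamma> = \<beta>")
      case True
      then show ?thesis unfolding split using e0 by (simp add: d'_def)
    next
      case False
      then have "(\<Sum>e\<in>?S. d e * (c e \<gamma> - c e \<beta> / c e0 \<beta> * c e0 \<gamma>)) = 0" using that d(2) by blast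
      also have "(\<Sum>e\<in>?S. d e * (c e \<gamma> - c e \<beta> / c e0 \<beta> * c e0 \<gamma>)) =
         (\<Sum>e\<in>?S. d e * c e \<gamma>) - (\<Sum>e\<in>?S. d e * c e \<beta>) / c e0 \<beta> * c e0 \<gamma>"
        by (simp add: algebra_simps sum_subtractf sum_distrib_left sum_divide_distrib)
      finally show ?thesis unfolding split by (simp add: d'_def)
    qed
    moreover have "\<exists>e\<in>S. d' e \<noteq> 0" using d(1) by (auto simp: d'_def)
    ultimately show ?thesis by blast
  qed
qed

text \<open>The card I + 1 powers 0, ..., card I of a coordinate lie in the span of card I functions
  on V. A dependence between their coefficient vectors is a nonzero polynomial that vanishes at that
  coordinate of every point of V.\<close>

lemma finite_of_powers_in_span:
  fixes V :: "(complex^'n::finite) set"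
  assumes I: "finite I" and span: "\<And>k e. \<exists>c. \<forall>y\<in>V. y $ k ^ e = (\<Sum>i\<in>I. c i * b i y)"
  shows "finite V"
proof -
  have fin: "finite ((\<lambda>y. y $ k) ` V)" for k
  proof -
    obtain c where c: "\<And>e y. y \<in> V \<Longrightarrow> y $ k ^ e = (\<Sum>i\<in>I. c e i * b i y)" using span by metis
    obtain d where d: "\<exists>e\<in>{..card I}. d e \<noteq> 0" "\<And>i. i \<in> I \<Longrightarrow> (\<Sum>e\<in>{..card I}. d e * c e i) = 0"
      using exists_linear_dependence[OF I, of "{..card I}" c] by auto
    define p where "p = (\<Sum>e\<in>{..card I}. monom (d e) e)"
    have co: "Polynomial.coeff p e = d e" if "e \<le> card I" for e
      unfolding p_def using that by (simp add: coeff_sum)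
    obtain e where "e \<le> card I" "d e \<noteq> 0" using d(1) by auto
    then have "p \<noteq> 0" using co[of e] by auto
    moreover have "poly p (y $ k) = 0" if "y \<in> V" for y
    proof -
      have "poly p (y $ k) = (\<Sum>e\<in>{..card I}. d e * (\<Sum>i\<in>I. c e i * b i y))"
        unfolding p_def poly_sum poly_monom using c[OF that] by simp
      also have "\<dots> = (\<Sum>i\<in>I. (\<Sum>e\<in>{..card I}. d e * c e i) * b i y)"
        unfolding sum_distrib_left sum_distrib_right by (subst sum.swap) (simp add: mult_ac)
      finally show ?thesis using d(2) by simp
    qed
    ultimately show ?thesis
      by (intro finite_subset[OF _ poly_roots_finite[of p]]) auto
  qed
  have "finite (vec_lambda ` (PiE UNIV (\<lambda>k. (\<lambda>y. y $ k) ` V)) :: (complex^'n) set)"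
    by (intro finite_imageI finite_PiE fin) auto
  moreover have "V \<subseteq> vec_lambda ` (PiE UNIV (\<lambda>k. (\<lambda>y. y $ k) ` V))"
  proof
    fix y assume "y \<in> V"
    then have "($) y \<in> PiE UNIV (\<lambda>k. (\<lambda>y. y $ k) ` V)" by auto
    then show "y \<in> vec_lambda ` (PiE UNIV (\<lambda>k. (\<lambda>y. y $ k) ` V))"
      by (metis image_eqI vec_nth_inverse)
  qed
  ultimately show ?thesis by (rule rev_finite_subset)
qed

section \<open>The division formula\<close>

context pushforward
begin

lemma is_coeff_lincomb:
  assumes U: "adm U \<rho>" and I: "finite I" and h: "\<And>i. i \<in> I \<Longrightarrow> polyfun (h i)"
    and C: "\<And>i. i \<in> I \<Longrightarrow> is_coeff U \<rho> (h i) m (C i)"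
  shows "is_coeff U \<rho> (\<lambda>x. \<Sum>i\<in>I. c i * h i x) m (\<Sum>i\<in>I. c i * C i)"
  unfolding is_coeff_def
proof (intro allI impI)
  fix p q :: "'n \<Rightarrow> real" and \<eta> :: "'n \<Rightarrow> real \<Rightarrow> real" assume b: "\<forall>j. bump (p j) (q j) (\<eta> j) \<and> q j \<le> \<rho>"
  define \<xi> where "\<xi> j = shell_fun (\<eta> j) (m j)" for j
  have t: "test_fun \<rho> (\<xi> j)" for j
    unfolding \<xi>_def using b by (intro C1_test_fun_imp C1_test_fun_shell_fun[of "p j" "q j"]) auto
  define G where "G i x = indicator U x *\<^sub>R (h i x * cnj (J x) * (\<Prod>j\<in>UNIV. \<xi> j (P j x)))" for i x
  have i: "integrable lborel (G i)" if "i \<in> I" for i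
    unfolding G_def by (rule integrable_LP[OF h[OF that] U t])
  have "LP U (\<lambda>x. \<Sum>i\<in>I. c i * h i x) \<xi> = integral\<^sup>L lborel (\<lambda>x. \<Sum>i\<in>I. c i * G i x)"
    unfolding LP_def L_def G_def sum_distrib_right scaleR_sum_right
    by (intro Bochner_Integration.integral_cong sum.cong refl) (simp add: mult_ac)
  also have "\<dots> = (\<Sum>i\<in>I. c i * integral\<^sup>L lborel (G i))"
    using i by (subst Bochner_Integration.integral_sum) auto
  also have "\<dots> = (\<Sum>i\<in>I. c i * (C i * (\<Prod>j\<in>UNIV. of_real (mass (\<eta> j)))))"
  proof (intro sum.cong refl arg_cong2[where f="(*)"])
    fix i assume "i \<in> I"
    then show "integral\<^sup>L lborel (G i) = C i * (\<Prod>j\<in>UNIV. of_real (mass (\<eta> j)))"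
      using C[of i, unfolded is_coeff_def, rule_format, of p q \<eta>] b
      unfolding LP_def L_def G_def \<xi>_def by blast
  qed
  finally show "LP U (\<lambda>x. \<Sum>i\<in>I. c i * h i x) (\<lambda>j. shell_fun (\<eta> j) (m j)) = (\<Sum>i\<in>I. c i * C i) * (\<Prod>j\<in>UNIV. of_real (mass (\<eta> j)))"
    unfolding \<xi>_def sum_distrib_right by (simp add: mult_ac)
qed

end

text \<open>On the diagonal, moving y along one coordinate axis turns the quotients into partial
  derivatives in the limit. For two points of one fibre, y - x is a nonzero kernel vector of the
  matrix.\<close>

lemma det_difference_quotients:
  fixes P :: "'n::finite \<Rightarrow> complex^'n \<Rightarrow> complex" and q :: "'n \<Rightarrow> 'n \<Rightarrow> complex^'n \<Rightarrow> complex^'n \<Rightarrow> complex"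
  assumes P: "\<And>j. polyfun (P j)" and cq: "\<And>j k x. continuous_on UNIV (q j k x)"
    and q: "\<And>j x y. P j y - P j x = (\<Sum>k\<in>UNIV. q j k x y * (y $ k - x $ k))"
  shows "det (\<chi> j k. q j k x x) = jac P x"
    and "x \<noteq> y \<Longrightarrow> (\<And>j. P j x = P j y) \<Longrightarrow> det (\<chi> j k. q j k x y) = 0"
proof -
  have "q j k x x = pd k (P j) x" for j k
  proof -
    let ?l = "\<lambda>s::complex. x + axis k s"
    have e: "P j (?l s) - P j x = q j k x (?l s) * s" for s
      unfolding q by (simp add: sum_axis)
    have contl: "continuous_on UNIV ?l"
    proof -
      have "continuous_on UNIV (\<lambda>s::complex. if i = k then s else 0)" for i
        by (cases "i = k") (auto intro!: continuous_intros)
      then show ?thesis unfolding axis_def by (intro continuous_on_add continuous_on_const continuous_on_vec_lambda)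
    qed
    have "continuous_on UNIV (\<lambda>s. q j k x (?l s))" by (rule continuous_on_compose2[OF cq contl]) simp
    then have lim: "((\<lambda>s. q j k x (?l s)) \<longlongrightarrow> q j k x (?l 0)) (at 0)"
      by (simp add: continuous_on_eq_continuous_at isCont_def)
    have "(?l has_derivative axis k) (at 0)"
    proof (rule has_derivative_vecI)
      fix i
      show "((\<lambda>s. ?l s $ i) has_derivative (\<lambda>s. axis k s $ i)) (at 0)"
        by (cases "i = k") (auto simp: axis_def intro!: derivative_eq_intros)
    qed
    note dl = this
    have a0: "axis k (0::complex) = (0::complex^'n)" by (simp add: axis_def vec_eq_iff)
    have "((\<lambda>s. P j (?l s)) has_derivative (\<lambda>s. pd k (P j) x * s)) (at 0)"
      using diff_chain_at[of ?l "axis k" 0 "P j", OF dl polyfun_has_derivative[OF P]] by (simp add: o_def a0)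
    then have "((\<lambda>s. P j (?l s)) has_field_derivative pd k (P j) x) (at 0)"
      by (simp add: has_field_derivative_def)
    then have "((\<lambda>s. (P j (?l s) - P j (?l 0)) / (s - 0)) \<longlongrightarrow> pd k (P j) x) (at 0)"
      by (simp only: has_field_derivative_iff)
    then have "((\<lambda>s. q j k x (?l s)) \<longlongrightarrow> pd k (P j) x) (at 0)"
      by (rule Lim_transform_eventually) (auto simp: eventually_at_filter a0 e)
    then have "pd k (P j) x = q j k x (?l 0)" using lim by (rule tendsto_unique[OF at_neq_bot])
    then show ?thesis using a0 by simp
  qed
  then show "det (\<chi> j k. q j k x x) = jac P x" by (simp add: jac_def jmat_def)
  assume xy: "x \<noteq> y" and e: "\<And>j. P j x = P j y"
  let ?M = "(\<chi> j k. q j k x y) :: complex^'n^'n"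
  have "?M *v (y - x) = 0"
    unfolding vec_eq_iff using q[of _ y x] e by (auto simp: matrix_vector_mult_def)
  note z = this
  have "\<not> invertible ?M"
  proof
    assume "invertible ?M"
    then obtain B where B: "B ** ?M = mat 1" unfolding invertible_def by blast
    have "y - x = (B ** ?M) *v (y - x)" unfolding B by simp
    also have "\<dots> = B *v (?M *v (y - x))" by (simp only: matrix_vector_mul_assoc)
    also have "\<dots> = 0" unfolding z by simp
    finally show False using xy by simp
  qed
  then show "det ?M = 0" by (simp add: invertible_det_nz)
qed

context proper_pushforward
begin

lemma adm_at_UNIV: "pushforward.adm (\<lambda>j x. P j x - a j) UNIV \<rho>"
proof -
  interpret P': pushforward "\<lambda>j x. P j x - a j" by (rule pushforward_diff)
  define s where "s = sqrt \<bar>\<rho>\<bar> + (\<Sum>j\<in>UNIV. cmod (a j))"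
  have s: "cmod (a j) \<le> (\<Sum>j\<in>UNIV. cmod (a j))" for j by (rule member_le_sum) auto
  have "{x \<in> UNIV. \<forall>j. (cmod (P j x - a j))\<^sup>2 \<le> \<rho>} \<subseteq> {x \<in> UNIV. \<forall>j. (cmod (P j x))\<^sup>2 \<le> s\<^sup>2}"
  proof (rule Collect_mono, intro impI conjI allI UNIV_I)
    fix x j assume "x \<in> UNIV \<and> (\<forall>j. (cmod (P j x - a j))\<^sup>2 \<le> \<rho>)"
    then have "(cmod (P j x - a j))\<^sup>2 \<le> \<bar>\<rho>\<bar>" by (meson abs_ge_self order_trans)
    then have "cmod (P j x - a j) \<le> sqrt \<bar>\<rho>\<bar>" by (rule real_le_rsqrt)
    moreover have "cmod (P j x) \<le> cmod (P j x - a j) + cmod (a j)" by (metis diff_add_cancel norm_triangle_ineq)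
    ultimately have "cmod (P j x) \<le> s" using s[of j] unfolding s_def by linarith
    then show "(cmod (P j x))\<^sup>2 \<le> s\<^sup>2" by (intro power_mono) auto
  qed
  moreover have "bounded {x \<in> UNIV. \<forall>j. (cmod (P j x))\<^sup>2 \<le> s\<^sup>2}"
    using adm_UNIV[of "s\<^sup>2"] unfolding adm_def by (blast intro: compact_imp_bounded)
  ultimately have "bounded {x \<in> UNIV. \<forall>j. (cmod (P j x - a j))\<^sup>2 \<le> \<rho>}" using bounded_subset by blast
  moreover have "closed {x \<in> UNIV. \<forall>j. (cmod (P j x - a j))\<^sup>2 \<le> \<rho>}"
    by (simp, intro closed_Collect_all closed_Collect_le continuous_intros continuous_on_polyfun[OF P])
  ultimately show ?thesis by (simp add: P'.adm_def compact_eq_bounded_closed)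
qed

text \<open>The coefficient over the value a is computed from shells centred at a;
  \<open>LP_shift\<close> recentres them at 0 and \<open>LP_geom\<close> expands the result in
  powers of a.\<close>

lemma is_coeff_at_expansion:
  assumes h: "polyfun h" and F: "finite F" "\<And>m. m \<notin> F \<Longrightarrow> coeff h m = 0"
  shows "is_coeff_at a UNIV \<rho> h (\<Sum>m\<in>F. coeff h m * (\<Prod>j\<in>UNIV. a j ^ m j))"
proof -
  interpret P': pushforward "\<lambda>j x. P j x - a j" by (rule pushforward_diff)
  \<comment> \<open>Chosen so that a j lies strictly inside the hole of the annulus p j < |w|^2 < q
    j.\<close>
  define p where "p j = (cmod (a j))\<^sup>2 + 1" for j
  define q where "q j = p j + 1" for j
  have pq: "0 < p j" "p j < q j" for j by (auto simp: p_def q_def add_nonneg_pos)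
  define \<eta> where "\<eta> j = bumpsq (p j) (q j)" for j
  have b: "bump (p j) (q j) (\<eta> j)" and m0: "0 < mass (\<eta> j)" for j
    unfolding \<eta>_def by (rule bump_bumpsq[OF pq], rule mass_bumpsq_pos[OF pq])
  define \<rho>1 where "\<rho>1 = max \<rho> (\<Sum>j\<in>UNIV. (sqrt (q j) + cmod (a j))\<^sup>2)"
  have \<rho>1: "(sqrt (q j) + cmod (a j))\<^sup>2 \<le> \<rho>1" for j
    unfolding \<rho>1_def by (rule max.coboundedI2, rule member_le_sum) auto
  have q1: "q j \<le> \<rho>1" for j
  proof -
    have "(sqrt (q j))\<^sup>2 \<le> (sqrt (q j) + cmod (a j))\<^sup>2" using pq[of j] by (intro power_mono) auto
    then show ?thesis using \<rho>1[of j] pq[of j] by simp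
  qed
  have pos: "0 < \<rho>1" using q1 pq by (meson less_le_trans less_trans)
  obtain C where C: "P'.is_coeff UNIV \<rho>1 h (\<lambda>_. 0) C"
    using P'.is_coeff_exists[OF h adm_at_UNIV pos] by blast
  have ap: "(cmod (a j))\<^sup>2 < p j" for j by (simp add: p_def)
  have "C * (\<Prod>j\<in>UNIV. of_real (mass (\<eta> j))) = LP UNIV h (\<lambda>j. shift_fun (\<eta> j) (a j))"
    by (rule is_coeff_atD[OF C b q1, symmetric])
  also have "\<dots> = LP UNIV h (\<lambda>j. geom_fun (\<eta> j) (a j))"
    by (rule LP_shift[OF h adm_UNIV b ap \<rho>1])
  also have "\<dots> = (\<Sum>m\<in>F. coeff h m * (\<Prod>j\<in>UNIV. a j ^ m j)) * (\<Prod>j\<in>UNIV. of_real (mass (\<eta> j)))"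
    by (rule LP_geom[OF h adm_UNIV b q1 ap is_coeff_coeff[OF h] F])
  finally have "C = (\<Sum>m\<in>F. coeff h m * (\<Prod>j\<in>UNIV. a j ^ m j))"
    using m0 by (simp add: less_imp_neq[symmetric])
  moreover have "\<rho> \<le> \<rho>1" by (simp add: \<rho>1_def)
  ultimately show ?thesis using P'.is_coeff_mono[OF C, of \<rho>] by simp
qed

text \<open>For fixed y, the polynomial Q(x) det q(x, y) in x has a coefficient over P(y) that is
  evaluated twice: its expansion in powers of P(y) gives the double sum, and localisation gives pi^n
  Q(y) if P(y) is a regular value, since the determinant is J at x = y and zero elsewhere on the
  fibre. Density and continuity cover the remaining y.\<close>

theorem division_identity:
  fixes q :: "'n \<Rightarrow> 'n \<Rightarrow> complex^'n \<Rightarrow> complex^'n \<Rightarrow> complex"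
  assumes Q: "polyfun Q" and I: "finite I" and h: "\<And>i. polyfun (h i)" and b: "\<And>i. polyfun (b i)"
    and F: "\<And>i. finite (F i)" "\<And>i m. m \<notin> F i \<Longrightarrow> coeff (h i) m = 0"
    and cq: "\<And>j k x. continuous_on UNIV (q j k x)"
    and q: "\<And>j x y. P j y - P j x = (\<Sum>k\<in>UNIV. q j k x y * (y $ k - x $ k))"
    and det: "\<And>x y. Q x * det (\<chi> j k. q j k x y) = (\<Sum>i\<in>I. b i y * h i x)"
  shows "Q y = (\<Sum>i\<in>I. b i y * (\<Sum>m\<in>F i. coeff (h i) m * (\<Prod>j\<in>UNIV. P j y ^ m j))) / of_real (pi ^ CARD('n))"
proof -
  let ?R = "\<lambda>y. (\<Sum>i\<in>I. b i y * (\<Sum>m\<in>F i. coeff (h i) m * (\<Prod>j\<in>UNIV. P j y ^ m j))) / of_real (pi ^ CARD('n))"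
  have good: "Q y = ?R y" if reg: "\<forall>x. (\<forall>j. P j x = P j y) \<longrightarrow> J x \<noteq> 0" for y
  proof -
    interpret P': pushforward "\<lambda>j x. P j x - P j y" by (rule pushforward_diff)
    let ?C = "\<Sum>i\<in>I. b i y * (\<Sum>m\<in>F i. coeff (h i) m * (\<Prod>j\<in>UNIV. P j y ^ m j))"
    let ?h = "\<lambda>x. \<Sum>i\<in>I. b i y * h i x"
    have ph: "polyfun ?h" by (intro polyfun_sum polyfun.mult polyfun.const h)
    have C: "is_coeff_at (\<lambda>j. P j y) UNIV 1 ?h ?C"
      by (rule P'.is_coeff_lincomb[OF adm_at_UNIV I h is_coeff_at_expansion[OF h F]])
    have "?C = of_real (pi ^ CARD('n)) * (?h y / J y)"
    proof (rule coeff_at_regular_value[OF ph UNIV_I adm_at_UNIV zero_less_one _ _ C])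
      show "J x \<noteq> 0" if "\<And>j. P j x = P j y" for x using reg that by blast
      show "?h x = 0" if "\<And>j. P j x = P j y" "x \<noteq> y" for x
        unfolding det[symmetric] using det_difference_quotients(2)[OF P cq q that(2,1)] by simp
    qed
    moreover have "?h y = Q y * J y"
      unfolding det[symmetric] using det_difference_quotients(1)[OF P cq q] by simp
    moreover have "J y \<noteq> 0" using reg by blast
    ultimately show ?thesis by simp
  qed
  have contR: "continuous_on UNIV ?R"
    by (intro continuous_intros continuous_on_polyfun[OF b] continuous_on_polyfun[OF P]) simp
  have "open {y. Q y \<noteq> ?R y}" by (intro open_Collect_neq continuous_on_polyfun[OF Q] contR)
  then show ?thesis
    using regular_dense[of "{y. Q y \<noteq> ?R y}" y] good by blast
qed

end

section \<open>Integration tools for slicing\<close>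

text \<open>\<open>ennreal\<close> cuts off negative values, so the two densities are the positive
  and negative parts of g. They define measures that agree on boxes, an intersection stable
  generator, hence agree almost everywhere.\<close>

lemma AE_zero_from_boxes:
  fixes g :: "'a::euclidean_space \<Rightarrow> real"
  assumes g: "integrable lborel g" and z: "\<And>a b. integral\<^sup>L lborel (\<lambda>x. indicator (box a b) x * g x) = 0"
  shows "AE x in lborel. g x = 0"
proof -
  have m: "g \<in> borel_measurable borel" using borel_measurable_integrable[OF g] by simp
  let ?N = "density lborel (\<lambda>x. ennreal (g x))" and ?N' = "density lborel (\<lambda>x. ennreal (- g x))"
  let ?E = "range (\<lambda>(a, b). box a b::'a set)"
  have inj: "X = Y" if "enn2real X = enn2real Y" "X \<noteq> \<infinity>" "Y \<noteq> \<infinity>" for X Y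
    using that by (metis ennreal_enn2real infinity_ennreal_def less_top)
  have eq: "emeasure ?N (box a b) = emeasure ?N' (box a b) \<and> emeasure ?N (box a b) \<noteq> \<infinity>" for a b
  proof -
    let ?g = "\<lambda>x. indicator (box a b) x * g x"
    have i: "integrable lborel ?g"
      using integrable_mult_indicator[OF _ g, of "box a b"] by simp
    have e: "emeasure ?N (box a b) = (\<integral>\<^sup>+x. ennreal (?g x) \<partial>lborel)" "emeasure ?N' (box a b) = (\<integral>\<^sup>+x. ennreal (- ?g x) \<partial>lborel)"
      using m by (auto simp: emeasure_density indicator_def intro!: nn_integral_cong)
    have fin: "(\<integral>\<^sup>+x. ennreal (?g x) \<partial>lborel) \<noteq> \<infinity>" "(\<integral>\<^sup>+x. ennreal (- ?g x) \<partial>lborel) \<noteq> \<infinity>"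
      using i unfolding real_integrable_def by auto
    have "enn2real (\<integral>\<^sup>+x. ennreal (?g x) \<partial>lborel) = enn2real (\<integral>\<^sup>+x. ennreal (- ?g x) \<partial>lborel)"
      using real_lebesgue_integral_def[OF i] z[of a b] by simp
    then have "(\<integral>\<^sup>+x. ennreal (?g x) \<partial>lborel) = (\<integral>\<^sup>+x. ennreal (- ?g x) \<partial>lborel)"
      by (rule inj) (use fin in auto)
    then show ?thesis using e fin by simp
  qed
  have "?N = ?N'"
  proof (rule measure_eqI_generator_eq)
    show "Int_stable ?E" by (auto simp: Int_stable_def Int_interval box_Int_box)
    show "?E \<subseteq> Pow UNIV" "sets ?N = sigma_sets UNIV ?E" "sets ?N' = sigma_sets UNIV ?E"
      by (simp_all add: borel_eq_box)
    let ?A = "\<lambda>n::nat. box (- (real n *\<^sub>R One)) (real n *\<^sub>R One) :: 'a set"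
    show "range ?A \<subseteq> ?E" "(\<Union>i. ?A i) = UNIV" unfolding UN_box_eq_UNIV by auto
    show "emeasure ?N (?A i) \<noteq> \<infinity>" for i using eq by blast
    show "emeasure ?N X = emeasure ?N' X" if "X \<in> ?E" for X using that eq by auto
  qed
  then have "AE x in lborel. ennreal (g x) = ennreal (- g x)"
    using m by (intro sigma_finite_measure.density_unique[OF sigma_finite_lborel]) auto
  then show ?thesis
  proof eventually_elim
    case (elim x)
    then show ?case
      by (cases "0 \<le> g x") (auto simp: ennreal_neg ennreal_eq_0_iff dest: sym)
  qed
qed

lemma set_integral_sums:
  fixes f :: "'a \<Rightarrow> 'b::{banach, second_countable_topology}"
  assumes A: "\<And>i::nat. A i \<in> sets M" "disjoint_family A" and f: "set_integrable M (\<Union>i. A i) f"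
  shows "(\<lambda>i. LINT x:A i|M. f x) sums (LINT x:(\<Union>i. A i)|M. f x)"
proof -
  let ?U = "\<Union>i. A i"
  have fA: "set_integrable M (A i) f" for i
    by (rule set_integrable_subset[OF f]) (use A in auto)
  have fm: "(\<lambda>x. indicator ?U x *\<^sub>R f x) \<in> borel_measurable M"
    using f unfolding set_integrable_def by auto
  have ind: "(\<Sum>i<n. indicator (A i) x *\<^sub>R f x) = indicator (\<Union>i<n. A i) x *\<^sub>R f x" for n x
  proof -
    have "(\<Sum>i<n. indicator (A i) x) = (indicator (\<Union>i<n. A i) x :: real)"
      using A(2) by (intro indicator_UN_disjoint[symmetric]) (auto simp: disjoint_family_on_def)
    then show ?thesis by (simp flip: scaleR_left.sum)
  qed
  have "(\<lambda>n. integral\<^sup>L M (\<lambda>x. \<Sum>i<n. indicator (A i) x *\<^sub>R f x)) \<longlonglongrightarrow> integral\<^sup>L M (\<lambda>x. indicator ?U x *\<^sub>R f x)"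
  proof (rule integral_dominated_convergence[where w="\<lambda>x. norm (indicator ?U x *\<^sub>R f x)"])
    show "integrable M (\<lambda>x. norm (indicator ?U x *\<^sub>R f x))"
      using f unfolding set_integrable_def by (rule integrable_norm)
    show "(\<lambda>x. \<Sum>i<n. indicator (A i) x *\<^sub>R f x) \<in> borel_measurable M" for n
      using fA unfolding set_integrable_def by (intro borel_measurable_sum borel_measurable_integrable)
    show "AE x in M. norm (\<Sum>i<n. indicator (A i) x *\<^sub>R f x) \<le> norm (indicator ?U x *\<^sub>R f x)" for n
      unfolding ind by (rule AE_I2) (auto simp: indicator_def)
    show "AE x in M. (\<lambda>n. \<Sum>i<n. indicator (A i) x *\<^sub>R f x) \<longlonglongrightarrow> indicator ?U x *\<^sub>R f x"
    proof (rule AE_I2)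
      fix x
      show "(\<lambda>n. \<Sum>i<n. indicator (A i) x *\<^sub>R f x) \<longlonglongrightarrow> indicator ?U x *\<^sub>R f x"
      proof (cases "x \<in> ?U")
        case True
        then obtain k where "x \<in> A k" by blast
        then have "indicator (\<Union>i<n. A i) x *\<^sub>R f x = indicator ?U x *\<^sub>R f x" if "Suc k \<le> n" for n
          using that by (auto simp: indicator_def)
        then show ?thesis unfolding ind
          by (intro tendsto_eventually) (auto simp: eventually_sequentially)
      next
        case False
        then have "indicator (\<Union>i<n. A i) x *\<^sub>R f x = 0" for n by auto
        then show ?thesis unfolding ind using False by simp
      qed
    qed
  qed (rule fm)
  moreover have "integral\<^sup>L M (\<lambda>x. \<Sum>i<n. indicator (A i) x *\<^sub>R f x) = (\<Sum>i<n. LINT x:A i|M. f x)" for n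
    using fA unfolding set_integrable_def set_lebesgue_integral_def by (intro Bochner_Integration.integral_sum) auto
  ultimately show ?thesis unfolding sums_def set_lebesgue_integral_def by simp
qed

lemma absolutely_integrable_UN_sums:
  fixes f :: "'a::euclidean_space \<Rightarrow> complex"
  assumes A: "\<And>i::nat. A i \<in> sets lebesgue" "disjoint_family A" and f: "f absolutely_integrable_on (\<Union>i. A i)"
  shows "((\<lambda>i. integral (A i) f) has_sum integral (\<Union>i. A i) f) UNIV"
    "(\<lambda>i. norm (integral (A i) f)) summable_on UNIV"
    "infsum (\<lambda>i. norm (integral (A i) f)) UNIV \<le> integral (\<Union>i. A i) (\<lambda>x. norm (f x))"
proof -
  have fA: "f absolutely_integrable_on A i" for i
    by (rule set_integrable_subset[OF f]) (use A in auto)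
  have nf: "(\<lambda>x. norm (f x)) absolutely_integrable_on (\<Union>i. A i)" and nfA: "(\<lambda>x. norm (f x)) absolutely_integrable_on A i" for i
    using absolutely_integrable_norm[OF f] absolutely_integrable_norm[OF fA[of i]] unfolding o_def by blast+
  note e = set_lebesgue_integral_eq_integral(2)
  have s1: "(\<lambda>i. integral (A i) f) sums integral (\<Union>i. A i) f"
    using set_integral_sums[OF A f] by (simp add: e[OF f] e[OF fA])
  have s2: "(\<lambda>i. integral (A i) (\<lambda>x. norm (f x))) sums integral (\<Union>i. A i) (\<lambda>x. norm (f x))"
    using set_integral_sums[OF A nf] by (simp add: e[OF nf] e[OF nfA])
  have le: "norm (integral (A i) f) \<le> integral (A i) (\<lambda>x. norm (f x))" for i
    using fA[of i] by (intro integral_norm_bound_integral) (auto simp: absolutely_integrable_on_def)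
  have sm: "summable (\<lambda>i. norm (integral (A i) f))"
    by (rule summable_comparison_test'[OF sums_summable[OF s2]]) (use le in simp)
  show "((\<lambda>i. integral (A i) f) has_sum integral (\<Union>i. A i) f) UNIV"
    by (rule norm_summable_imp_has_sum[OF sm s1])
  show sb: "(\<lambda>i. norm (integral (A i) f)) summable_on UNIV"
    by (rule summable_nonneg_imp_summable_on[OF sm]) simp
  have "((\<lambda>i. norm (integral (A i) f)) has_sum infsum (\<lambda>i. norm (integral (A i) f)) UNIV) UNIV" using sb by simp
  then have "(\<lambda>i. norm (integral (A i) f)) sums infsum (\<lambda>i. norm (integral (A i) f)) UNIV" by (rule has_sum_imp_sums)
  then show "infsum (\<lambda>i. norm (integral (A i) f)) UNIV \<le> integral (\<Union>i. A i) (\<lambda>x. norm (f x))"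
    using s2 le by (rule sums_le[rotated])
qed

text \<open>Two countable decompositions of the same object are compared on their common refinement,
  where the pieces have equal integrals. This yields independence of the cycle integral from the
  chosen charts.\<close>

lemma double_partition_sums:
  fixes f k :: "nat \<Rightarrow> 'a::euclidean_space \<Rightarrow> complex"
  assumes A: "\<And>l i. A l i \<in> sets lebesgue" "\<And>l. disjoint_family (A l)" "\<And>l. (\<Union>i. A l i) = X l"
    and E: "\<And>i l. E i l \<in> sets lebesgue" "\<And>i. disjoint_family (E i)" "\<And>i. (\<Union>l. E i l) = Y i"
    and f: "\<And>l. f l absolutely_integrable_on X l" "summable (\<lambda>l. integral (X l) (\<lambda>x. norm (f l x)))"
    and I: "(\<lambda>l. integral (X l) (f l)) sums I"
    and k: "\<And>i. k i absolutely_integrable_on Y i"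
    and eq: "\<And>l i. integral (A l i) (f l) = integral (E i l) (k i)"
  shows "(\<lambda>i. integral (Y i) (k i)) sums I"
proof -
  define a where "a l i = integral (A l i) (f l)" for l i
  have f': "f l absolutely_integrable_on (\<Union>i. A l i)" for l using f(1) by (simp add: A(3))
  have k': "k i absolutely_integrable_on (\<Union>l. E i l)" for i using k by (simp add: E(3))
  note sf = absolutely_integrable_UN_sums[OF A(1,2) f', unfolded A(3), folded a_def]
  note sk = absolutely_integrable_UN_sums[OF E(1,2) k', unfolded E(3), folded eq, folded a_def]
  \<comment> \<open>Absolute summability over pairs, which permits exchanging the sums: inside a row
    by integrability of \<open>f l\<close>, across rows by the assumed summability of the integrals
    of its norm.\<close>
  have "(\<lambda>p. norm (case p of (l, i) \<Rightarrow> a l i)) summable_on UNIV \<times> UNIV"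
  proof (subst Infinite_Sum.abs_summable_on_Sigma_iff, intro conjI ballI)
    show "(\<lambda>y. norm (case (x, y) of (l, i) \<Rightarrow> a l i)) summable_on UNIV" for x using sf(2)[of x] by simp
    have "(\<lambda>l. integral (X l) (\<lambda>x. norm (f l x))) summable_on UNIV"
      using f(2) by (rule summable_nonneg_imp_summable_on) (auto intro!: integral_nonneg f(1)[unfolded absolutely_integrable_on_def, THEN conjunct2])
    then have "(\<lambda>l. infsum (\<lambda>i. norm (a l i)) UNIV) summable_on UNIV"
      by (rule summable_on_comparison_test) (use sf(3) in \<open>auto intro!: infsum_nonneg\<close>)
    then show "(\<lambda>x. norm (infsum (\<lambda>y. norm (case (x, y) of (l, i) \<Rightarrow> a l i)) UNIV)) summable_on UNIV"
      by (simp add: infsum_nonneg)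
  qed
  then have sum2: "(\<lambda>(l, i). a l i) summable_on UNIV \<times> UNIV" by (rule Infinite_Sum.abs_summable_summable)
  then have sum2': "(\<lambda>(i, l). a l i) summable_on UNIV \<times> UNIV"
    by (subst (asm) summable_on_swap) (simp add: case_prod_unfold)
  have row: "infsum (\<lambda>i. a l i) UNIV = integral (X l) (f l)" for l using sf(1) by (rule infsumI)
  have col: "infsum (\<lambda>l. a l i) UNIV = integral (Y i) (k i)" for i using sk(1) by (rule infsumI)
  have "(\<lambda>l. infsum (\<lambda>i. a l i) UNIV) summable_on UNIV"
    using summable_on_Sigma_banach[of a UNIV "\<lambda>_. UNIV"] sum2 by simp
  then have "((\<lambda>l. integral (X l) (f l)) has_sum infsum (\<lambda>l. infsum (\<lambda>i. a l i) UNIV) UNIV) UNIV"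
    unfolding row by simp
  then have "I = infsum (\<lambda>l. infsum (\<lambda>i. a l i) UNIV) UNIV"
    using has_sum_imp_sums sums_unique2[OF I] by blast
  also have "\<dots> = infsum (\<lambda>i. infsum (\<lambda>l. a l i) UNIV) UNIV"
    by (rule infsum_swap_banach[OF sum2])
  finally have I': "I = infsum (\<lambda>i. integral (Y i) (k i)) UNIV" unfolding col .
  have "(\<lambda>i. infsum (\<lambda>l. a l i) UNIV) summable_on UNIV"
    using summable_on_Sigma_banach[of "\<lambda>i l. a l i" UNIV "\<lambda>_. UNIV"] sum2' by simp
  then have "((\<lambda>i. integral (Y i) (k i)) has_sum I) UNIV" unfolding col I' by simp
  then show ?thesis by (rule has_sum_imp_sums)
qed

definition cvec :: "real^'n::finite \<Rightarrow> real^'n \<Rightarrow> complex^'n" where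
  "cvec u t = (\<chi> j. Complex (u $ j) (t $ j))"

lemma cvec_iso:
  defines "T \<equiv> (\<lambda>p. cvec (fst p) (snd p)) :: (real^'n::finite) \<times> (real^'n) \<Rightarrow> complex^'n"
  shows "linear T" "bij_betw T Basis Basis" "\<And>x y. T x \<bullet> T y = x \<bullet> y" "surj T"
proof -
  show lin: "linear T" unfolding T_def by (rule linearI) (auto simp: cvec_def vec_eq_iff complex_eq_iff)
  define T' where "T' z = ((\<chi> j. Re (z $ j)), (\<chi> j. Im (z $ j)))" for z :: "complex^'n"
  have TT: "T (T' z) = z" "T' (T p) = p" for z p
    by (auto simp: T_def T'_def cvec_def vec_eq_iff prod_eq_iff)
  show "T x \<bullet> T y = x \<bullet> y" for x y
    by (simp add: T_def cvec_def inner_vec_def inner_complex_def inner_prod_def sum.distrib)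
  show "surj T" using TT(1) by (metis surjI)
  have a1: "T (axis i 1, 0) = axis i 1" "T (0, axis i 1) = axis i \<i>" for i
    by (auto simp: T_def cvec_def vec_eq_iff axis_def complex_eq_iff)
  have a2: "T' (axis i 1) = (axis i 1, 0)" "T' (axis i \<i>) = (0, axis i 1)" for i
    by (metis a1 TT(2))+
  show "bij_betw T Basis Basis"
  proof (rule bij_betw_byWitness[where f'=T'])
    show "T ` Basis \<subseteq> Basis"
      by (auto simp: Basis_prod_def Basis_vec_def a1 Basis_complex_def)
    show "T' ` Basis \<subseteq> Basis"
      by (auto simp: Basis_prod_def Basis_vec_def a2 Basis_complex_def)
  qed (use TT in auto)
qed

text \<open>In logarithmic coordinates z = u + i t the vector u fixes the radii |P_j| and t runs
  along the cycle. The versions with norms supply the absolute convergence demanded by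
  \<open>cycle_integral\<close>.\<close>

lemma fubini_cvec:
  fixes F :: "complex^'n::finite \<Rightarrow> complex"
  assumes F: "integrable lborel F"
  shows "AE u in lborel. integrable lborel (\<lambda>t. F (cvec u t))"
    "integrable lborel (\<lambda>u. integral\<^sup>L lborel (\<lambda>t. F (cvec u t)))"
    "integral\<^sup>L lborel (\<lambda>u. integral\<^sup>L lborel (\<lambda>t. F (cvec u t))) = integral\<^sup>L lborel F"
    "integrable lborel (\<lambda>u. integral\<^sup>L lborel (\<lambda>t. norm (F (cvec u t))))"
    "integral\<^sup>L lborel (\<lambda>u. integral\<^sup>L lborel (\<lambda>t. norm (F (cvec u t)))) = integral\<^sup>L lborel (\<lambda>z. norm (F z))"
proof -
  let ?T = "(\<lambda>p. cvec (fst p) (snd p)) :: (real^'n) \<times> (real^'n) \<Rightarrow> complex^'n"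
  have d: "distr lborel borel ?T = lborel" by (rule lborel_basis_iso[OF cvec_iso])
  have mT: "?T \<in> borel_measurable borel"
    using cvec_iso(1) by (intro borel_measurable_continuous_onI linear_continuous_on) (simp add: linear_conv_bounded_linear)
  have main: "AE u in lborel. integrable lborel (\<lambda>t. G (cvec u t))"
    "integrable lborel (\<lambda>u. integral\<^sup>L lborel (\<lambda>t. G (cvec u t)))"
    "integral\<^sup>L lborel (\<lambda>u. integral\<^sup>L lborel (\<lambda>t. G (cvec u t))) = integral\<^sup>L lborel G"
    if G: "integrable lborel G" for G :: "complex^'n \<Rightarrow> 'b::{banach, second_countable_topology}"
  proof -
    have mG: "G \<in> borel_measurable borel" using borel_measurable_integrable[OF G] by simp
    have "integrable (distr lborel borel ?T) G" using G d by simp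
    then have "integrable lborel (\<lambda>p. G (?T p))" by (subst (asm) integrable_distr_eq) (use mT mG in auto)
    then have i: "integrable (lborel \<Otimes>\<^sub>M lborel) (\<lambda>(u, t). G (cvec u t))"
      unfolding lborel_prod by (simp add: case_prod_unfold)
    show "AE u in lborel. integrable lborel (\<lambda>t. G (cvec u t))"
      using lborel_pair.AE_integrable_fst[OF i] by simp
    show "integrable lborel (\<lambda>u. integral\<^sup>L lborel (\<lambda>t. G (cvec u t)))"
      using lborel_pair.integrable_fst[OF i] by simp
    have "integral\<^sup>L lborel (\<lambda>u. integral\<^sup>L lborel (\<lambda>t. G (cvec u t))) = integral\<^sup>L (lborel \<Otimes>\<^sub>M lborel) (\<lambda>(u, t). G (cvec u t))"
      using lborel_pair.integral_fst[OF i] by simp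
    also have "\<dots> = integral\<^sup>L lborel (\<lambda>p. G (?T p))" unfolding lborel_prod by (simp add: case_prod_unfold)
    also have "\<dots> = integral\<^sup>L (distr lborel borel ?T) G"
      by (rule integral_distr[symmetric]) (use mT mG in auto)
    finally show "integral\<^sup>L lborel (\<lambda>u. integral\<^sup>L lborel (\<lambda>t. G (cvec u t))) = integral\<^sup>L lborel G" by (simp add: d)
  qed
  show "AE u in lborel. integrable lborel (\<lambda>t. F (cvec u t))"
    "integrable lborel (\<lambda>u. integral\<^sup>L lborel (\<lambda>t. F (cvec u t)))"
    "integral\<^sup>L lborel (\<lambda>u. integral\<^sup>L lborel (\<lambda>t. F (cvec u t))) = integral\<^sup>L lborel F"
    by (rule main[OF F])+
  show "integrable lborel (\<lambda>u. integral\<^sup>L lborel (\<lambda>t. norm (F (cvec u t))))"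
    "integral\<^sup>L lborel (\<lambda>u. integral\<^sup>L lborel (\<lambda>t. norm (F (cvec u t)))) = integral\<^sup>L lborel (\<lambda>z. norm (F z))"
    by (rule main[OF integrable_norm[OF F]])+
qed

section \<open>Logarithmic coordinates and charts of the cycles\<close>

text \<open>Cramer's rule for the inverse. It makes the entries continuous wherever the determinant
  is nonzero, as charts of class C^1 require.\<close>

lemma matrix_inv_entry:
  fixes A :: "complex^'n^'n::finite"
  assumes "det A \<noteq> 0"
  shows "matrix_inv A $ i $ j = det (\<chi> a b. if b = i then axis j 1 $ a else A $ a $ b) / det A"
proof -
  have "A *v (matrix_inv A *v axis j 1) = axis j 1"
    by (simp add: matrix_vector_mul_assoc matrix_inv_left_right[OF assms])
  then have "matrix_inv A *v axis j 1 = (\<chi> k. det (\<chi> a b. if b = k then axis j 1 $ a else A $ a $ b) / det A)"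
    using cramer[OF assms] by blast
  moreover have "(matrix_inv A *v axis j 1) $ i = matrix_inv A $ i $ j"
    by (simp add: matrix_vector_mult_def)
  ultimately show ?thesis by simp
qed

lemma continuous_on_det:
  fixes A :: "'a::topological_space \<Rightarrow> 'n::finite \<Rightarrow> 'n \<Rightarrow> complex"
  assumes "\<And>i j. continuous_on S (\<lambda>x. A x i j)"
  shows "continuous_on S (\<lambda>x. det (\<chi> i j. A x i j))"
  unfolding det_def by (simp only: vec_lambda_beta) (intro continuous_intros continuous_on_prod assms)

lemma det_scale_ii:
  fixes A :: "complex^'n^'n::finite"
  shows "det (\<chi> i j. c i * A $ i $ j) = (\<Prod>i\<in>UNIV. c i) * det A"
proof -
  have "(\<chi> i j. c i * A $ i $ j) = (\<chi> i. c i *s (A $ i))" by (simp add: vec_eq_iff)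
  then show ?thesis by (simp add: det_rows_mul)
qed

lemma cvec_has_derivative: "(cvec u has_derivative (\<lambda>v. \<chi> j. \<i> * of_real (v $ j))) (at t)"
proof (rule has_derivative_vecI)
  fix i
  have "((\<lambda>s. of_real (u $ i) + \<i> * of_real (s $ i)) has_derivative (\<lambda>v. \<i> * of_real (v $ i))) (at t)"
    by (auto intro!: derivative_eq_intros bounded_linear_imp_has_derivative[OF bounded_linear_vec_nth])
  then show "((\<lambda>s. cvec u s $ i) has_derivative (\<lambda>v. (\<chi> j. \<i> * of_real (v $ j)) $ i)) (at t)"
    by (simp add: cvec_def Complex_eq)
qed

lemma continuous_on_cvec: "continuous_on S (cvec u)"
  using cvec_has_derivative by (blast intro: continuous_at_imp_continuous_on has_derivative_continuous)

lemma inj_cvec: "cvec u t = cvec u t' \<Longrightarrow> t = t'"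
  by (auto simp: cvec_def vec_eq_iff)

context pushforward
begin

text \<open>The Jacobian matrix of (ln P_1, ..., ln P_n).\<close>

definition lmat :: "complex^'n \<Rightarrow> complex^'n^'n" where
  "lmat x = (\<chi> j l. pd l (P j) x / P j x)"

lemma det_lmat: "det (lmat x) = J x / (\<Prod>j\<in>UNIV. P j x)"
proof -
  have "lmat x = (\<chi> i j. inverse (P i x) * jmat P x $ i $ j)"
    by (simp add: lmat_def jmat_def divide_inverse mult.commute)
  then have "det (lmat x) = (\<Prod>i\<in>UNIV. inverse (P i x)) * J x" by (simp add: det_scale_ii jac_def)
  then show ?thesis by (simp add: prod_inversef[symmetric] divide_inverse mult.commute flip: prod_inversef)
qed

text \<open>The points at which branches of the ln P_j form local coordinates. Shell integrands
  vanish at the other points of U, and \<open>chart_point\<close> shows that oriented charts of the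
  cycles stay inside this set.\<close>

definition regset :: "(complex^'n) set \<Rightarrow> (complex^'n) set" where
  "regset U = {x \<in> U. J x \<noteq> 0 \<and> (\<forall>j. P j x \<noteq> 0)}"

text \<open>\<Lambda> is a branch of (ln P_1, ..., ln P_n) that maps B biholomorphically onto V, and
  g is its inverse.\<close>

definition patch :: "(complex^'n) set \<Rightarrow> (complex^'n) set \<Rightarrow> (complex^'n \<Rightarrow> complex^'n) \<Rightarrow> (complex^'n) set \<Rightarrow> (complex^'n \<Rightarrow> complex^'n) \<Rightarrow> bool" where
  "patch U B \<Lambda> V g \<longleftrightarrow> open B \<and> B \<subseteq> regset U \<and> open V \<and> homeomorphism B V \<Lambda> g \<and>
     (\<forall>x\<in>B. \<forall>j. exp (\<Lambda> x $ j) = P j x) \<and> (\<forall>x\<in>B. (\<Lambda> has_derivative (*v) (lmat x)) (at x)) \<and>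
     (\<forall>z\<in>V. (g has_derivative (*v) (matrix_inv (lmat (g z)))) (at z))"

lemma open_regset:
  assumes "open U" shows "open (regset U)"
proof -
  have "regset U = U \<inter> ({x. J x \<noteq> 0} \<inter> (\<Inter>j. {x. P j x \<noteq> 0}))" by (auto simp: regset_def)
  moreover have "open {x. P j x \<noteq> 0}" for j by (intro open_Collect_neq continuous_on_polyfun[OF P] continuous_intros)
  moreover have "open {x. J x \<noteq> 0}" by (intro open_Collect_neq continuous_on_polyfun[OF polyfun_jac[OF P]] continuous_intros)
  ultimately show ?thesis using assms by (simp only:) (intro open_Int open_INT ballI finite, auto)
qed

lemma patch_exists:
  assumes U: "open U" and x0: "x0 \<in> regset U"
  shows "\<exists>B \<Lambda> V g. patch U B \<Lambda> V g \<and> x0 \<in> B"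
proof -
  define b where "b j = P j x0" for j
  have b0: "b j \<noteq> 0" for j using x0 by (simp add: b_def regset_def)
  \<comment> \<open>On W the quotients P j / b j have positive real part, so the principal logarithm
    is holomorphic there and Ln (P j / b j) + Ln (b j) is a branch of ln P j.\<close>
  define W where "W = regset U \<inter> (\<Inter>j. {x. 0 < Re (P j x / b j)})"
  have "open {x. 0 < Re (P j x / b j)}" for j
    using b0 by (intro open_Collect_less continuous_intros continuous_on_polyfun[OF P]) auto
  then have oW: "open W" unfolding W_def using open_regset[OF U] by (intro open_Int open_INT ballI finite) auto
  have x0W: "x0 \<in> W" using x0 b0 by (simp add: W_def b_def)
  have W: "J x \<noteq> 0" "P j x \<noteq> 0" "0 < Re (P j x / b j)" if "x \<in> W" for x j
    using that by (auto simp: W_def regset_def)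
  define \<Lambda> where "\<Lambda> x = (\<chi> j. Ln (P j x / b j) + Ln (b j))" for x
  have ex: "exp (\<Lambda> x $ j) = P j x" if "x \<in> W" for x j
    using W(2)[OF that] b0 by (simp add: \<Lambda>_def exp_add)
  have der: "(\<Lambda> has_derivative (*v) (lmat x)) (at x)" if x: "x \<in> W" for x
  proof (rule has_derivative_vecI)
    fix j
    have nr: "P j x / b j \<notin> \<real>\<^sub>\<le>\<^sub>0" using W(3)[OF x, of j] by (auto simp: complex_nonpos_Reals_iff)
    have 1: "((\<lambda>x. P j x / b j) has_derivative (\<lambda>v. (\<Sum>l\<in>UNIV. pd l (P j) x * v $ l) / b j)) (at x)"
      using has_derivative_mult_left[OF P_deriv[of j x], of "inverse (b j)"] by (simp add: divide_inverse)
    have "(Ln has_derivative (\<lambda>h. inverse (P j x / b j) * h)) (at (P j x / b j))"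
      using has_field_derivative_Ln[OF nr] by (simp only: has_field_derivative_def)
    from diff_chain_at[OF 1 this]
    have "((\<lambda>x. Ln (P j x / b j)) has_derivative (\<lambda>v. inverse (P j x / b j) * ((\<Sum>l\<in>UNIV. pd l (P j) x * v $ l) / b j))) (at x)"
      by (simp only: o_def)
    then have "((\<lambda>x. Ln (P j x / b j) + Ln (b j)) has_derivative (\<lambda>v. inverse (P j x / b j) * ((\<Sum>l\<in>UNIV. pd l (P j) x * v $ l) / b j))) (at x)"
      by (rule has_derivative_add_const)
    moreover have "inverse (P j x / b j) * ((\<Sum>l\<in>UNIV. pd l (P j) x * v $ l) / b j) = (lmat x *v v) $ j" for v
    proof -
      have r: "inverse (p / c) * (S / c) = S / p" if "c \<noteq> 0" for p c S :: complex using that by simp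
      show ?thesis unfolding r[OF b0] by (simp add: lmat_def matrix_vector_mult_def sum_divide_distrib)
    qed
    ultimately show "((\<lambda>x. \<Lambda> x $ j) has_derivative (\<lambda>v. (lmat x *v v) $ j)) (at x)"
      by (simp only: \<Lambda>_def vec_lambda_beta)
  qed
  have cl: "continuous_on W (\<lambda>x. lmat x $ i $ j)" for i j
    unfolding lmat_def using W(2)
    by (simp, intro continuous_intros continuous_on_polyfun[OF polyfun_pd[OF P]] continuous_on_polyfun[OF P]) auto
  have dl: "det (lmat x) \<noteq> 0" if "x \<in> W" for x using W[OF that] by (simp add: det_lmat)
  obtain B V g where *: "open B" "B \<subseteq> W" "x0 \<in> B" "open V" "\<Lambda> x0 \<in> V" "homeomorphism B V \<Lambda> g"
    "\<And>y. y \<in> V \<Longrightarrow> (g has_derivative (*v) (matrix_inv (lmat (g y)))) (at y)"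
    using complex_inverse_function[OF oW der cl x0W dl] by metis
  have "patch U B \<Lambda> V g"
    unfolding patch_def using * ex der by (auto simp: W_def subset_iff)
  then show ?thesis using *(3) by blast
qed

lemma patches_exist:
  assumes U: "open U"
  shows "\<exists>(B::nat \<Rightarrow> _) \<Lambda> V g. (\<forall>i. patch U (B i) (\<Lambda> i) (V i) (g i)) \<and> (\<Union>i. B i) = regset U"
proof -
  let ?F = "{B. \<exists>\<Lambda> V g. patch U B \<Lambda> V g}"
  have op: "\<And>S. S \<in> ?F \<Longrightarrow> open S" by (auto simp: patch_def)
  obtain F' where F': "F' \<subseteq> ?F" "countable F'" "\<Union>F' = \<Union>?F" by (rule Lindelof[of ?F]) (rule op, assumption, rule that)
  have "\<Union>?F = regset U"
  proof
    show "\<Union>?F \<subseteq> regset U" by (auto simp: patch_def)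
    show "regset U \<subseteq> \<Union>?F" using patch_exists[OF U] by blast
  qed
  \<comment> \<open>The empty patch keeps the family nonempty, so it can be enumerated by the
    natural numbers even if the regular set is empty.\<close>
  moreover have e: "patch U {} id {} id" by (auto simp: patch_def homeomorphism_def)
  define F where "F = insert {} F'"
  have F: "F \<subseteq> ?F" "countable F" "F \<noteq> {}" "\<Union>F = regset U" using F' e calculation by (auto simp: F_def)
  have r: "range (from_nat_into F) = F" using F by (simp add: range_from_nat_into)
  have "\<forall>i. \<exists>\<Lambda> V g. patch U (from_nat_into F i) \<Lambda> V g" using F(1) r by blast
  then obtain \<Lambda> V g where "\<forall>i. patch U (from_nat_into F i) (\<Lambda> i) (V i) (g i)" by metis
  moreover have "(\<Union>i. from_nat_into F i) = regset U" using r F(4) by simp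
  ultimately show ?thesis by blast
qed

end

locale residue_setup = pushforward P for P :: "'n::finite \<Rightarrow> complex^'n \<Rightarrow> complex" +
  fixes U :: "(complex^'n) set" and \<mu> :: "'n \<Rightarrow> nat" and h :: "complex^'n \<Rightarrow> complex"
  assumes U: "open U" and h: "polyfun h"
begin

definition f :: "'n \<Rightarrow> complex^'n \<Rightarrow> complex" where
  "f j x = P j x ^ (\<mu> j + 1)"

text \<open>The radii of the functions \<open>f j\<close> on the cycle given by ln |P_j| =
  u_j.\<close>

definition eps :: "real^'n \<Rightarrow> real^'n" where
  "eps u = (\<chi> j. exp (u $ j) ^ (\<mu> j + 1))"

abbreviation cyc :: "real^'n \<Rightarrow> (complex^'n) set" where
  "cyc u \<equiv> res_cycle f U (eps u)"

text \<open>The coefficient of the residue form h dX / \<Prod>P_j^(\<mu>_j + 1) in the coordinates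
  z_j = ln P_j: dividing by the logarithmic Jacobian J / \<Prod>P_j lowers each exponent by
  one.\<close>

definition ker :: "complex^'n \<Rightarrow> complex" where
  "ker x = h x / (J x * (\<Prod>j\<in>UNIV. P j x ^ \<mu> j))"

lemma cyc_iff: "x \<in> cyc u \<longleftrightarrow> x \<in> U \<and> (\<forall>j. cmod (P j x) = exp (u $ j))"
proof -
  have "cmod (P j x) ^ (\<mu> j + 1) = exp (u $ j) ^ (\<mu> j + 1) \<longleftrightarrow> cmod (P j x) = exp (u $ j)" for j
    by (rule power_eq_iff_eq_base) auto
  then show ?thesis by (simp add: res_cycle_def f_def eps_def norm_power del: power_Suc Suc_eq_plus1)
qed

lemma patchD:
  assumes "patch U B \<Lambda> V g"
  shows "open B" "B \<subseteq> regset U" "open V" "homeomorphism B V \<Lambda> g" "\<And>x j. x \<in> B \<Longrightarrow> exp (\<Lambda> x $ j) = P j x"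
    "\<And>x. x \<in> B \<Longrightarrow> (\<Lambda> has_derivative (*v) (lmat x)) (at x)"
    "\<And>z. z \<in> V \<Longrightarrow> (g has_derivative (*v) (matrix_inv (lmat (g z)))) (at z)"
    "\<And>z. z \<in> V \<Longrightarrow> g z \<in> B" "\<And>x. x \<in> B \<Longrightarrow> \<Lambda> x \<in> V" "\<And>x. x \<in> B \<Longrightarrow> g (\<Lambda> x) = x" "\<And>z. z \<in> V \<Longrightarrow> \<Lambda> (g z) = z"
    "\<And>x. x \<in> B \<Longrightarrow> det (lmat x) \<noteq> 0"
  using assms by (auto simp: patch_def homeomorphism_def det_lmat regset_def subset_iff)

text \<open>On the slice z = u + i t the argument of \<open>f j\<close> is (\<mu> j + 1) t_j up to a
  constant, so the orientation coefficient is the product of the numbers \<mu> j + 1, which is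
  positive. The factor i^n is the determinant of t \<mapsto> i t.\<close>

lemma patch_chart:
  assumes p: "patch U B \<Lambda> V g"
  shows "oriented_chart f (cyc u) {t. cvec u t \<in> V} (\<lambda>t. g (cvec u t))"
    and "\<And>t. cvec u t \<in> V \<Longrightarrow> det (partials (\<lambda>t. g (cvec u t)) t) = \<i> ^ CARD('n) / det (lmat (g (cvec u t)))"
proof -
  note p = patchD[OF p]
  let ?W = "{t. cvec u t \<in> V}"
  let ?\<phi> = "\<lambda>t. g (cvec u t)"
  have oW: "open ?W"
    using open_vimage[OF p(3) continuous_on_cvec] by (simp add: vimage_def)
  have der: "(?\<phi> has_derivative (\<lambda>v. matrix_inv (lmat (?\<phi> t)) *v (\<chi> j. \<i> * of_real (v $ j)))) (at t)" if "t \<in> ?W" for t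
    using diff_chain_at[OF cvec_has_derivative p(7)] that by (simp add: o_def)
  have ax: "(\<chi> j. \<i> * of_real (axis k 1 $ j)) = (axis k \<i> :: complex^'n)" for k
    by (auto simp: vec_eq_iff axis_def)
  have mv: "(M *v axis k c) $ i = M $ i $ k * c" for M :: "complex^'n^'n" and i k c
    by (simp add: matrix_vector_mult_def)
  have part: "partials ?\<phi> t = (\<chi> i k. \<i> * matrix_inv (lmat (?\<phi> t)) $ i $ k)" if "t \<in> ?W" for t
    unfolding partials_def frechet_derivative_at[OF der[OF that], symmetric] ax
    by (simp add: mv vec_eq_iff mult.commute)
  have detp: "det (partials ?\<phi> t) = \<i> ^ CARD('n) / det (lmat (?\<phi> t))" if "t \<in> ?W" for t
  proof -
    have d0: "det (lmat (?\<phi> t)) \<noteq> 0" using p(8,12) that by simp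
    have "det (matrix_inv (lmat (?\<phi> t))) * det (lmat (?\<phi> t)) = 1"
      using matrix_inv_left_right(1)[OF d0] by (metis det_I det_mul)
    then have "det (matrix_inv (lmat (?\<phi> t))) = 1 / det (lmat (?\<phi> t))" using d0 by (simp add: field_simps)
    then show ?thesis unfolding part[OF that] det_scale_ii by simp
  qed
  then show "\<And>t. cvec u t \<in> V \<Longrightarrow> det (partials ?\<phi> t) = \<i> ^ CARD('n) / det (lmat (g (cvec u t)))" by simp
  have cont\<phi>: "continuous_on ?W ?\<phi>"
    using der by (blast intro: continuous_at_imp_continuous_on has_derivative_continuous)
  have fW: "f j (?\<phi> t) = exp (cvec u t $ j) ^ (\<mu> j + 1)" if "t \<in> ?W" for j t
  proof -
    have "g (cvec u t) \<in> B" using p(8) that by simp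
    from p(5)[OF this, of j] show ?thesis using p(11) that by (simp add: f_def)
  qed
  show "oriented_chart f (cyc u) ?W ?\<phi>"
    unfolding oriented_chart_def
  proof (intro conjI ballI)
    show "open ?W" by (rule oW)
    show "inj_on ?\<phi> ?W"
    proof (rule inj_onI)
      fix t t' assume "t \<in> ?W" "t' \<in> ?W" "?\<phi> t = ?\<phi> t'"
      then have "cvec u t = cvec u t'" using p(11) by (metis mem_Collect_eq)
      then show "t = t'" by (rule inj_cvec)
    qed
    show "?\<phi> ` ?W \<subseteq> cyc u"
    proof
      fix x assume "x \<in> ?\<phi> ` ?W"
      then obtain t where t: "t \<in> ?W" "x = ?\<phi> t" by blast
      then have xB: "x \<in> B" using p(8) by simp
      have "P j x = exp (cvec u t $ j)" for j using p(5)[OF xB, of j] p(11) t by simp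
      then show "x \<in> cyc u" using xB p(2) by (auto simp: cyc_iff regset_def cvec_def)
    qed
    show "?\<phi> differentiable_on ?W"
      using der by (intro differentiable_at_imp_differentiable_on) (auto simp: differentiable_def)
    show "continuous_on ?W (partials ?\<phi>)"
    proof (subst continuous_on_cong[OF refl part])
      have cl: "continuous_on ?W (\<lambda>t. lmat (?\<phi> t) $ i $ j)" for i j
      proof -
        have "\<forall>t\<in>?W. P i (?\<phi> t) \<noteq> 0" using p(2,8) by (auto simp: regset_def subset_iff)
        then show ?thesis
          unfolding lmat_def by (simp, intro continuous_intros continuous_on_compose2[OF continuous_on_polyfun[OF polyfun_pd[OF P]] cont\<phi>]
            continuous_on_compose2[OF continuous_on_polyfun[OF P] cont\<phi>]) auto
      qed
      have d0: "det (lmat (?\<phi> t)) \<noteq> 0" if "t \<in> ?W" for t using p(8,12) that by simp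
      have cl': "continuous_on ?W (\<lambda>t. if b then c else lmat (?\<phi> t) $ i $ j)" for b c i j
        by (cases b) (auto intro: cl)
      have "continuous_on ?W (\<lambda>t. det (\<chi> i j. lmat (?\<phi> t) $ i $ j))"
        by (rule continuous_on_det) (rule cl)
      then have cd: "continuous_on ?W (\<lambda>t. det (lmat (?\<phi> t)))" by simp
      have ci: "continuous_on ?W (\<lambda>t. matrix_inv (lmat (?\<phi> t)) $ i $ j)" for i j
      proof (subst continuous_on_cong[OF refl matrix_inv_entry[OF d0]])
        show "continuous_on ?W (\<lambda>t. det (\<chi> a b. if b = i then axis j 1 $ a else lmat (?\<phi> t) $ a $ b) / det (lmat (?\<phi> t)))"
          by (intro continuous_on_divide continuous_on_det cl' cd ballI d0)
      qed
      show "continuous_on ?W (\<lambda>t. \<chi> i k. \<i> * matrix_inv (lmat (?\<phi> t)) $ i $ k)"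
        by (intro continuous_on_vec_lambda continuous_on_mult continuous_on_const ci)
    qed
    fix t assume t: "t \<in> ?W"
    have "frechet_derivative (\<lambda>s. f j (?\<phi> s)) (at t) (axis k 1) / f j (?\<phi> t) = (if j = k then of_nat (\<mu> j + 1) * \<i> else 0)" for j k
    proof -
      let ?e = "\<lambda>s. exp (of_nat (\<mu> j + 1) * cvec u s $ j)"
      have "((\<lambda>s. cvec u s $ j) has_derivative (\<lambda>v. \<i> * of_real (v $ j))) (at t)"
        using bounded_linear.has_derivative[OF bounded_linear_vec_nth[of j] cvec_has_derivative[of u t]] by simp
      from has_derivative_mult_right[OF this, of "of_nat (\<mu> j + 1)"]
      have 1: "((\<lambda>s. of_nat (\<mu> j + 1) * cvec u s $ j) has_derivative (\<lambda>v. of_nat (\<mu> j + 1) * (\<i> * of_real (v $ j)))) (at t)" .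
      have 2: "(exp has_derivative (\<lambda>h. exp (of_nat (\<mu> j + 1) * cvec u t $ j) * h)) (at (of_nat (\<mu> j + 1) * cvec u t $ j))"
        using DERIV_exp[of "of_nat (\<mu> j + 1) * cvec u t $ j"] by (simp only: has_field_derivative_def)
      have "(?e has_derivative (\<lambda>v. ?e t * (of_nat (\<mu> j + 1) * (\<i> * of_real (v $ j))))) (at t)"
        using diff_chain_at[OF 1 2] by (simp only: o_def)
      then have "((\<lambda>s. f j (?\<phi> s)) has_derivative (\<lambda>v. ?e t * (of_nat (\<mu> j + 1) * (\<i> * of_real (v $ j))))) (at t)"
        by (rule has_derivative_transform_within_open[OF _ oW t]) (simp only: fW exp_of_nat_mult)
      from frechet_derivative_at[OF this]
      have "frechet_derivative (\<lambda>s. f j (?\<phi> s)) (at t) (axis k 1) = ?e t * (of_nat (\<mu> j + 1) * (\<i> * of_real (axis k 1 $ j)))"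
        by (simp add: fun_eq_iff)
      moreover have "f j (?\<phi> t) = ?e t" using fW[OF t, of j] by (simp only: exp_of_nat_mult)
      ultimately show ?thesis by (simp add: axis_def)
    qed
    then have "darg_coeff f ?\<phi> t = det (\<chi> j k. if j = k then real (\<mu> j + 1) else 0)"
      unfolding darg_coeff_def by (simp add: if_distrib[of Im] cong: if_cong)
    also have "\<dots> = (\<Prod>j\<in>UNIV. real (\<mu> j + 1))" by (subst det_diagonal) auto
    also have "\<dots> > 0" by (intro prod_pos) auto
    finally show "darg_coeff f ?\<phi> t > 0" .
  qed
qed

text \<open>For an arbitrary oriented chart, constancy of |P_j| makes the derivative of ln P_j
  purely imaginary. So lmat times the partials is i times a real matrix with positive determinant by
  orientation. In particular lmat is invertible and the point is regular.\<close>

lemma chart_point: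
  assumes ch: "oriented_chart f (cyc u) W \<psi>" and t: "t \<in> W"
  defines "\<psi>' \<equiv> frechet_derivative \<psi> (at t)"
  defines "E \<equiv> (\<lambda>j k. (lmat (\<psi> t) *v \<psi>' (axis k 1)) $ j)"
  shows "\<psi> t \<in> regset U" "\<And>j. cmod (P j (\<psi> t)) = exp (u $ j)"
    "0 < det (\<chi> j k. Im (E j k))"
    "det (partials \<psi> t) = \<i> ^ CARD('n) * of_real (det (\<chi> j k. Im (E j k))) / det (lmat (\<psi> t))"
    "(\<psi> has_derivative \<psi>') (at t)"
proof -
  have oW: "open W" and im: "\<psi> ` W \<subseteq> cyc u" and diff: "\<psi> differentiable_on W" and da: "darg_coeff f \<psi> t > 0"
    using ch t by (auto simp: oriented_chart_def)
  have "\<psi> differentiable (at t)" using diff t oW by (simp add: differentiable_on_eq_differentiable_at)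
  then show der: "(\<psi> has_derivative \<psi>') (at t)" unfolding \<psi>'_def by (simp add: frechet_derivative_works)
  have cy: "\<psi> s \<in> U" "cmod (P j (\<psi> s)) = exp (u $ j)" if "s \<in> W" for s j
    using im that by (auto simp: cyc_iff subset_iff image_iff)
  show cP: "\<And>j. cmod (P j (\<psi> t)) = exp (u $ j)" using cy t by blast
  have P0: "P j (\<psi> t) \<noteq> 0" for j using cP[of j] by (metis exp_not_eq_zero norm_zero)
  let ?m = "\<lambda>j. of_nat (\<mu> j + 1) :: complex"
  have dPd: "((\<lambda>s. P j (\<psi> s)) has_derivative (\<lambda>v. \<Sum>l\<in>UNIV. pd l (P j) (\<psi> t) * \<psi>' v $ l)) (at t)" for j
    using diff_chain_at[OF der P_deriv] by (simp add: o_def)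
  have Ev: "(\<Sum>l\<in>UNIV. pd l (P j) (\<psi> t) * \<psi>' (axis k 1) $ l) = P j (\<psi> t) * E j k" for j k
    unfolding E_def using P0[of j] by (simp add: matrix_vector_mult_def lmat_def sum_distrib_left)
  \<comment> \<open>Differentiation of the constant |P_j|^2 along the chart: its derivative is 2
    |P_j|^2 Re E.\<close>
  have ReE: "Re (E j k) = 0" for j k
  proof -
    let ?d = "\<lambda>v. \<Sum>l\<in>UNIV. pd l (P j) (\<psi> t) * \<psi>' v $ l"
    have "((\<lambda>s. P j (\<psi> s) \<bullet> P j (\<psi> s)) has_derivative (\<lambda>v. P j (\<psi> t) \<bullet> ?d v + ?d v \<bullet> P j (\<psi> t))) (at t)"
      by (rule has_derivative_inner[OF dPd dPd])
    moreover have "((\<lambda>s. P j (\<psi> s) \<bullet> P j (\<psi> s)) has_derivative (\<lambda>v. 0)) (at t)"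
      by (rule has_derivative_transform_within_open[OF has_derivative_const[of "(exp (u $ j))\<^sup>2"] oW t])
         (use cy(2) in \<open>simp flip: power2_norm_eq_inner\<close>)
    ultimately have "(\<lambda>v. P j (\<psi> t) \<bullet> ?d v + ?d v \<bullet> P j (\<psi> t)) = (\<lambda>v. 0)" by (rule has_derivative_unique)
    then have "P j (\<psi> t) \<bullet> ?d (axis k 1) + ?d (axis k 1) \<bullet> P j (\<psi> t) = 0" by (rule fun_cong)
    then have "P j (\<psi> t) \<bullet> (P j (\<psi> t) * E j k) = 0" unfolding Ev by (simp add: inner_commute)
    moreover have "z \<bullet> (z * e) = (cmod z)\<^sup>2 * Re e" for z e :: complex
      unfolding cmod_power2 by (simp add: inner_complex_def power2_eq_square algebra_simps)
    ultimately show ?thesis using P0[of j] by simp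
  qed
  have quot: "frechet_derivative (\<lambda>s. f j (\<psi> s)) (at t) (axis k 1) / f j (\<psi> t) = ?m j * E j k" for j k
  proof -
    have "((\<lambda>s. P j (\<psi> s) ^ (\<mu> j + 1)) has_derivative (\<lambda>v. ?m j * (\<Sum>l\<in>UNIV. pd l (P j) (\<psi> t) * \<psi>' v $ l) * P j (\<psi> t) ^ \<mu> j)) (at t)"
      using has_derivative_power[OF dPd[of j], of "\<mu> j + 1"] by (simp add: algebra_simps)
    from fun_cong[OF frechet_derivative_at[OF this], of "axis k 1", symmetric]
    have "frechet_derivative (\<lambda>s. f j (\<psi> s)) (at t) (axis k 1) = ?m j * (P j (\<psi> t) * E j k) * P j (\<psi> t) ^ \<mu> j"
      by (simp only: f_def Ev)
    then show ?thesis using P0[of j] by (simp add: f_def)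
  qed
  let ?D = "(\<chi> j k. Im (E j k)) :: real^'n^'n"
  have "darg_coeff f \<psi> t = det (\<chi> j k. real (\<mu> j + 1) * ?D $ j $ k)"
    unfolding darg_coeff_def quot by simp
  also have "\<dots> = (\<Prod>j\<in>UNIV. real (\<mu> j + 1)) * det ?D"
  proof -
    have "(\<chi> j k. real (\<mu> j + 1) * ?D $ j $ k) = (\<chi> j. real (\<mu> j + 1) *s (?D $ j))" by (simp add: vec_eq_iff algebra_simps)
    then show ?thesis using det_rows_mul[of "\<lambda>j. real (\<mu> j + 1)" "\<lambda>j. ?D $ j"] by simp
  qed
  finally have "0 < (\<Prod>j\<in>UNIV. real (\<mu> j + 1)) * det ?D" using da by simp
  moreover have "0 < (\<Prod>j\<in>UNIV. real (\<mu> j + 1))" by (intro prod_pos) auto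
  ultimately show dD: "0 < det ?D" by (rule zero_less_mult_pos)
  have "lmat (\<psi> t) ** partials \<psi> t = (\<chi> j k. E j k)"
    unfolding partials_def E_def \<psi>'_def by (simp add: matrix_matrix_mult_def matrix_vector_mult_def)
  also have "\<dots> = (\<chi> j k. \<i> * (\<chi> j k. complex_of_real (?D $ j $ k)) $ j $ k)"
    using ReE by (auto simp: vec_eq_iff complex_eq_iff)
  finally have e: "det (lmat (\<psi> t)) * det (partials \<psi> t) = \<i> ^ CARD('n) * of_real (det ?D)"
    using det_mul[of "lmat (\<psi> t)" "partials \<psi> t"] by (simp only: det_scale_ii det_of_real prod_constant)
  then have nz: "det (lmat (\<psi> t)) \<noteq> 0" using dD by auto
  then show "det (partials \<psi> t) = \<i> ^ CARD('n) * of_real (det ?D) / det (lmat (\<psi> t))"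
    using e by (simp add: field_simps)
  show "\<psi> t \<in> regset U" using nz P0 cy(1)[OF t] by (simp add: det_lmat regset_def)
qed

end

section \<open>Existence and uniqueness of cycle integrals\<close>

lemma preimage_disjointed_borel:
  fixes \<phi> :: "'a::topological_space \<Rightarrow> 'b::topological_space"
  assumes W: "open W" and c: "continuous_on W \<phi>" and B: "\<And>i. open (B i)"
  shows "W \<inter> \<phi> -` disjointed B i \<in> sets borel"
proof -
  have o: "open (W \<inter> \<phi> -` B k)" for k by (rule continuous_open_preimage[OF c W B])
  have "W \<inter> \<phi> -` disjointed B i = (W \<inter> \<phi> -` B i) - (\<Union>k\<in>{0..<i}. W \<inter> \<phi> -` B k)"
    by (auto simp: disjointed_def)
  also have "\<dots> \<in> sets borel"
    by (intro sets.Diff sets.finite_UN borel_open o) auto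
  finally show ?thesis .
qed

lemma AE_summable_integrals:
  fixes f :: "nat \<Rightarrow> 'a \<Rightarrow> real"
  assumes i: "\<And>i. integrable M (f i)" and nn: "\<And>i x. 0 \<le> f i x" and s: "summable (\<lambda>i. integral\<^sup>L M (f i))"
  shows "AE x in M. summable (\<lambda>i. f i x)"
proof -
  have m: "(\<lambda>x. ennreal (f i x)) \<in> borel_measurable M" for i using i by measurable
  have "(\<integral>\<^sup>+x. suminf (\<lambda>i. ennreal (f i x)) \<partial>M) = suminf (\<lambda>i. \<integral>\<^sup>+x. ennreal (f i x) \<partial>M)"
    by (rule nn_integral_suminf[OF m])
  also have "\<dots> = suminf (\<lambda>i. ennreal (integral\<^sup>L M (f i)))"
    using i nn by (simp add: nn_integral_eq_integral)
  also have "\<dots> = ennreal (suminf (\<lambda>i. integral\<^sup>L M (f i)))"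
    using s nn by (intro suminf_ennreal2) (auto intro!: integral_nonneg_AE)
  finally have fin: "(\<integral>\<^sup>+x. suminf (\<lambda>i. ennreal (f i x)) \<partial>M) \<noteq> \<infinity>" by simp
  have "AE x in M. suminf (\<lambda>i. ennreal (f i x)) \<noteq> \<infinity>"
    by (rule nn_integral_PInf_AE[OF _ fin]) (intro borel_measurable_suminf_order m)
  then show ?thesis
  proof eventually_elim
    case (elim x)
    then show ?case by (intro summable_suminf_not_top) (auto simp: nn)
  qed
qed

locale residue_patches = residue_setup P U \<mu> h
  for P :: "'n::finite \<Rightarrow> complex^'n \<Rightarrow> complex" and U \<mu> h +
  fixes B V :: "nat \<Rightarrow> (complex^'n) set" and \<Lambda> g :: "nat \<Rightarrow> complex^'n \<Rightarrow> complex^'n"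
  assumes pt: "\<And>i. patch U (B i) (\<Lambda> i) (V i) (g i)" and cov: "(\<Union>i. B i) = regset U"
begin

text \<open>\<open>S\<close> cuts the regular set into disjoint Borel pieces. \<open>T\<close> and
  \<open>\<kappa>\<close> carry the pieces and the residue form over to logarithmic coordinates;
  \<open>Su u\<close> and \<open>q u\<close> are their slices over u, the latter with the factor i^n
  of the slice parametrisation.\<close>

definition S :: "nat \<Rightarrow> (complex^'n) set" where "S = disjointed B"
definition T :: "nat \<Rightarrow> (complex^'n) set" where "T i = V i \<inter> g i -` S i"
definition \<kappa> :: "nat \<Rightarrow> complex^'n \<Rightarrow> complex" where "\<kappa> i z = indicator (T i) z *\<^sub>R ker (g i z)"
definition Su :: "real^'n \<Rightarrow> nat \<Rightarrow> (real^'n) set" where "Su u i = {t. cvec u t \<in> T i}"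
definition q :: "real^'n \<Rightarrow> nat \<Rightarrow> real^'n \<Rightarrow> complex" where "q u i t = \<i> ^ CARD('n) * ker (g i (cvec u t))"
definition G :: "complex^'n \<Rightarrow> complex" where "G x = h x / (\<Prod>j\<in>UNIV. f j x)"

lemmas pD = patchD[OF pt]

lemma S_B: "S i \<subseteq> B i" unfolding S_def by (rule disjointed_subset)
lemma S_disj: "disjoint_family S" unfolding S_def by (rule disjoint_family_disjointed)
lemma S_UN: "(\<Union>i. S i) = regset U" unfolding S_def UN_disjointed_eq cov ..

lemma S_borel: "S i \<in> sets borel"
proof -
  have "UNIV \<inter> (\<lambda>x. x) -` disjointed B i \<in> sets borel"
    by (rule preimage_disjointed_borel) (auto intro: pD(1))
  then show ?thesis by (simp add: S_def)
qed

lemma contg: "continuous_on (V i) (g i)"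
  using pD(4) by (simp add: homeomorphism_def)

lemma T_borel: "T i \<in> sets borel"
  unfolding T_def S_def by (rule preimage_disjointed_borel[OF pD(3) contg pD(1)])

lemma T_image: "T i = \<Lambda> i ` S i"
proof
  show "T i \<subseteq> \<Lambda> i ` S i"
  proof
    fix z assume "z \<in> T i"
    then have "z \<in> V i" "g i z \<in> S i" by (auto simp: T_def)
    then show "z \<in> \<Lambda> i ` S i" using pD(11)[of z i] by (intro image_eqI[of _ _ "g i z"]) auto
  qed
  show "\<Lambda> i ` S i \<subseteq> T i"
    using S_B[of i] pD(9,10)[of _ i] by (auto simp: T_def)
qed

lemma Su_borel: "Su u i \<in> sets borel"
proof -
  have "cvec u \<in> borel_measurable borel" by (intro borel_measurable_continuous_onI continuous_on_cvec)
  from measurable_sets[OF this T_borel[of i]] show ?thesis by (simp add: Su_def vimage_def)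
qed

lemma P_nz: "x \<in> regset U \<Longrightarrow> P j x \<noteq> 0" "x \<in> regset U \<Longrightarrow> J x \<noteq> 0"
  by (auto simp: regset_def)

lemma G_ker: "x \<in> regset U \<Longrightarrow> G x * (c / det (lmat x)) = c * ker x"
  using P_nz[of x] by (simp add: G_def ker_def f_def det_lmat prod.distrib mult_ac)

lemma kappa_measurable: "\<kappa> i \<in> borel_measurable borel"
proof -
  have gT: "g i z \<in> regset U" if "z \<in> T i" for z
    using that pD(2)[of i] pD(8)[of _ i] by (auto simp: T_def)
  have "continuous_on (regset U) ker"
    unfolding ker_def using P_nz
    by (intro continuous_intros continuous_on_polyfun[OF h] continuous_on_polyfun[OF polyfun_jac[OF P]] continuous_on_polyfun[OF P]) auto
  then have "continuous_on (T i) (\<lambda>z. ker (g i z))"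
    by (rule continuous_on_compose2[OF _ continuous_on_subset[OF contg]]) (use gT in \<open>auto simp: T_def\<close>)
  from borel_measurable_continuous_on_indicator[OF T_borel this]
  show ?thesis by (simp add: \<kappa>_def[abs_def])
qed

lemma q_integral:
  assumes "integrable lborel (\<lambda>t. \<kappa> i (cvec u t))"
  shows "q u i absolutely_integrable_on Su u i" "integral (Su u i) (q u i) = \<i> ^ CARD('n) * integral\<^sup>L lborel (\<lambda>t. \<kappa> i (cvec u t))"
    "integral (Su u i) (\<lambda>t. norm (q u i t)) = integral\<^sup>L lborel (\<lambda>t. norm (\<kappa> i (cvec u t)))"
proof -
  have e: "(\<lambda>t. indicator (Su u i) t *\<^sub>R q u i t) = (\<lambda>t. \<i> ^ CARD('n) * \<kappa> i (cvec u t))"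
    by (auto simp: Su_def q_def \<kappa>_def indicator_def fun_eq_iff)
  have en: "(\<lambda>t. indicator (Su u i) t *\<^sub>R norm (q u i t)) = (\<lambda>t. norm (\<kappa> i (cvec u t)))"
    by (auto simp: Su_def q_def \<kappa>_def indicator_def fun_eq_iff norm_mult norm_power)
  have i: "integrable lborel (\<lambda>t. \<i> ^ CARD('n) * \<kappa> i (cvec u t))" using assms by simp
  have m: "(\<lambda>t. indicator (Su u i) t *\<^sub>R q u i t) \<in> borel_measurable borel"
    unfolding e using borel_measurable_integrable[OF i] by simp
  have mn: "(\<lambda>t. indicator (Su u i) t *\<^sub>R norm (q u i t)) \<in> borel_measurable borel"
    unfolding en using borel_measurable_integrable[OF integrable_norm[OF assms]] by simp
  show a: "q u i absolutely_integrable_on Su u i"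
    unfolding absolutely_integrable_on_lborel(1)[OF m] e by (rule i)
  show "integral (Su u i) (q u i) = \<i> ^ CARD('n) * integral\<^sup>L lborel (\<lambda>t. \<kappa> i (cvec u t))"
    unfolding absolutely_integrable_on_lborel(2)[OF m a] e by simp
  have an: "(\<lambda>t. norm (q u i t)) absolutely_integrable_on Su u i"
    unfolding absolutely_integrable_on_lborel(1)[OF mn] en by (rule integrable_norm[OF assms])
  show "integral (Su u i) (\<lambda>t. norm (q u i t)) = integral\<^sup>L lborel (\<lambda>t. norm (\<kappa> i (cvec u t)))"
    unfolding absolutely_integrable_on_lborel(2)[OF mn an] en ..
qed

lemma Lambda_cyc:
  assumes x: "x \<in> B i" and c: "\<And>j. cmod (P j x) = exp (u $ j)"
  shows "\<Lambda> i x = cvec u (\<chi> j. Im (\<Lambda> i x $ j))"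
proof -
  have "Re (\<Lambda> i x $ j) = u $ j" for j
  proof -
    have "exp (Re (\<Lambda> i x $ j)) = cmod (P j x)" using pD(5)[OF x, of j] by (metis norm_exp_eq_Re)
    then show ?thesis using c[of j] by simp
  qed
  then show ?thesis by (simp add: cvec_def vec_eq_iff complex_eq_iff)
qed

text \<open>\<open>chart_point\<close> places every point of an oriented chart in the regular set,
  and there the branch of the logarithms has real part u, so the point occurs in a canonical
  slice.\<close>

lemma chart_cover:
  "(\<Union>i. (\<lambda>t. g i (cvec u t)) ` Su u i) = {\<zeta>. \<exists>W \<psi>. oriented_chart f (cyc u) W \<psi> \<and> \<zeta> \<in> \<psi> ` W}"
proof (intro equalityI subsetI)
  fix \<zeta> assume "\<zeta> \<in> (\<Union>i. (\<lambda>t. g i (cvec u t)) ` Su u i)"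
  then obtain i t where "t \<in> Su u i" "\<zeta> = g i (cvec u t)" by blast
  moreover have "oriented_chart f (cyc u) {t. cvec u t \<in> V i} (\<lambda>t. g i (cvec u t))" by (rule patch_chart(1)[OF pt])
  ultimately show "\<zeta> \<in> {\<zeta>. \<exists>W \<psi>. oriented_chart f (cyc u) W \<psi> \<and> \<zeta> \<in> \<psi> ` W}"
    by (intro CollectI exI[of _ "{t. cvec u t \<in> V i}"] exI[of _ "\<lambda>t. g i (cvec u t)"]) (auto simp: Su_def T_def)
next
  fix \<zeta> assume "\<zeta> \<in> {\<zeta>. \<exists>W \<psi>. oriented_chart f (cyc u) W \<psi> \<and> \<zeta> \<in> \<psi> ` W}"
  then obtain W \<psi> t where ch: "oriented_chart f (cyc u) W \<psi>" "t \<in> W" and z: "\<zeta> = \<psi> t" by blast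
  note cp = chart_point(1,2)[OF ch]
  obtain i where i: "\<zeta> \<in> S i" using cp(1) S_UN z by blast
  then have iB: "\<zeta> \<in> B i" using S_B by blast
  define s where "s = (\<chi> j. Im (\<Lambda> i \<zeta> $ j))"
  have L: "\<Lambda> i \<zeta> = cvec u s" unfolding s_def by (rule Lambda_cyc[OF iB]) (use cp(2) z in simp)
  have "g i (cvec u s) = \<zeta>" using pD(10)[OF iB] L by simp
  moreover have "s \<in> Su u i" using pD(9)[OF iB] L calculation i by (simp add: Su_def T_def)
  ultimately show "\<zeta> \<in> (\<Union>i. (\<lambda>t. g i (cvec u t)) ` Su u i)" by blast
qed

context
  fixes u :: "real^'n"
  assumes int: "\<And>i. integrable lborel (\<lambda>t. \<kappa> i (cvec u t))"
    and summ: "summable (\<lambda>i. integral\<^sup>L lborel (\<lambda>t. norm (\<kappa> i (cvec u t))))"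
begin

lemma canonical_sums:
  "(\<lambda>i. integral (Su u i) (q u i)) sums (\<i> ^ CARD('n) * suminf (\<lambda>i. integral\<^sup>L lborel (\<lambda>t. \<kappa> i (cvec u t))))"
proof -
  have "summable (\<lambda>i. integral\<^sup>L lborel (\<lambda>t. \<kappa> i (cvec u t)))"
    by (rule summable_comparison_test'[OF summ]) (rule integral_norm_bound)
  then show ?thesis unfolding q_integral(2)[OF int] by (intro sums_mult summable_sums)
qed

lemma cycle_integral_exists:
  "cycle_integral f (cyc u) G (\<i> ^ CARD('n) * suminf (\<lambda>i. integral\<^sup>L lborel (\<lambda>t. \<kappa> i (cvec u t))))"
proof -
  let ?\<phi> = "\<lambda>i t. g i (cvec u t)"
  let ?F = "\<lambda>i t. G (?\<phi> i t) * det (partials (?\<phi> i) t)"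
  have Fq: "?F i t = q u i t" if "t \<in> Su u i" for i t
  proof -
    have tV: "cvec u t \<in> V i" using that by (simp add: Su_def T_def)
    then have "?\<phi> i t \<in> regset U" using pD(2)[of i] pD(8)[of _ i] by blast
    then show ?thesis unfolding patch_chart(2)[OF pt tV] q_def by (rule G_ker)
  qed
  have a: "?F i absolutely_integrable_on Su u i \<and> integral (Su u i) (?F i) = integral (Su u i) (q u i)" for i
    by (rule iffD2[OF absolutely_integrable_integral_cong[OF Fq] conjI[OF q_integral(1)[OF int] refl]])
  have n: "integral (Su u i) (\<lambda>t. norm (?F i t)) = integral\<^sup>L lborel (\<lambda>t. norm (\<kappa> i (cvec u t)))" for i
    unfolding q_integral(3)[OF int, symmetric] by (rule integral_cong) (simp only: Fq)
  have disj: "disjoint_family (\<lambda>i. ?\<phi> i ` Su u i)"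
  proof -
    have "?\<phi> i ` Su u i \<subseteq> S i" for i by (auto simp: Su_def T_def)
    then show ?thesis using S_disj unfolding disjoint_family_on_def by blast
  qed
  show ?thesis
    unfolding cycle_integral_def
  proof (rule exI[of _ "\<lambda>i. {t. cvec u t \<in> V i}"], rule exI[of _ "Su u"], rule exI[of _ ?\<phi>], intro conjI allI)
    show "oriented_chart f (cyc u) {t. cvec u t \<in> V i} (?\<phi> i)" for i by (rule patch_chart(1)[OF pt])
    show "Su u i \<subseteq> {t. cvec u t \<in> V i}" for i by (auto simp: Su_def T_def)
    show "Su u i \<in> sets lebesgue" for i using Su_borel by (simp add: sets_completionI_sets)
    show "disjoint_family (\<lambda>i. ?\<phi> i ` Su u i)" by (rule disj)
    show "(\<Union>i. ?\<phi> i ` Su u i) = {\<zeta>. \<exists>V \<psi>. oriented_chart f (cyc u) V \<psi> \<and> \<zeta> \<in> \<psi> ` V}" by (rule chart_cover)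
    show "?F i absolutely_integrable_on Su u i" for i using a by blast
    show "summable (\<lambda>i. integral (Su u i) (\<lambda>t. norm (?F i t)))" unfolding n by (rule summ)
    show "(\<lambda>i. integral (Su u i) (?F i)) sums (\<i> ^ CARD('n) * suminf (\<lambda>i. integral\<^sup>L lborel (\<lambda>t. \<kappa> i (cvec u t))))"
      using canonical_sums a by simp
  qed
qed

text \<open>The definition of \<open>cycle_integral\<close> leaves the charts free. Any
  decomposition is compared with the canonical one on the common refinement; the transition to the
  coordinates t has positive Jacobian, so the change of variables involves no sign.\<close>

lemma cycle_integral_unique:
  assumes "cycle_integral f (cyc u) G I"
  shows "I = \<i> ^ CARD('n) * suminf (\<lambda>i. integral\<^sup>L lborel (\<lambda>t. \<kappa> i (cvec u t)))"
proof -
  obtain W S' \<phi> where X: "(\<forall>l. oriented_chart f (cyc u) (W l) (\<phi> l) \<and> S' l \<subseteq> W l \<and> S' l \<in> sets lebesgue) \<and>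
      disjoint_family (\<lambda>l. \<phi> l ` S' l) \<and>
      (\<Union>l. \<phi> l ` S' l) = {\<zeta>. \<exists>V \<psi>. oriented_chart f (cyc u) V \<psi> \<and> \<zeta> \<in> \<psi> ` V} \<and>
      (\<forall>l. (\<lambda>t. G (\<phi> l t) * det (partials (\<phi> l) t)) absolutely_integrable_on S' l) \<and>
      summable (\<lambda>l. integral (S' l) (\<lambda>t. norm (G (\<phi> l t) * det (partials (\<phi> l) t)))) \<and>
      (\<lambda>l. integral (S' l) (\<lambda>t. G (\<phi> l t) * det (partials (\<phi> l) t))) sums I"
    using assms unfolding cycle_integral_def by (elim exE) (rule that)
  have ch: "oriented_chart f (cyc u) (W l) (\<phi> l)" and SW: "S' l \<subseteq> W l" and SL: "S' l \<in> sets lebesgue"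
    and ai: "(\<lambda>t. G (\<phi> l t) * det (partials (\<phi> l) t)) absolutely_integrable_on S' l" for l
    using X by blast+
  have disj: "disjoint_family (\<lambda>l. \<phi> l ` S' l)"
    and un: "(\<Union>l. \<phi> l ` S' l) = {\<zeta>. \<exists>V \<psi>. oriented_chart f (cyc u) V \<psi> \<and> \<zeta> \<in> \<psi> ` V}"
    and sm: "summable (\<lambda>l. integral (S' l) (\<lambda>t. norm (G (\<phi> l t) * det (partials (\<phi> l) t))))"
    and su: "(\<lambda>l. integral (S' l) (\<lambda>t. G (\<phi> l t) * det (partials (\<phi> l) t))) sums I"
    using X by blast+
  have oW: "open (W l)" and injW: "inj_on (\<phi> l) (W l)" for l using ch by (auto simp: oriented_chart_def)
  note cp = chart_point[OF ch]
  have contW: "continuous_on (W l) (\<phi> l)" for l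
    using cp(5) by (intro continuous_at_imp_continuous_on ballI has_derivative_continuous)
  \<comment> \<open>Parameters of the l-th given piece that land in the i-th canonical piece; \<tau>
    below is the transition to canonical coordinates and \<open>E i l\<close> the image
    there.\<close>
  define A where "A l i = S' l \<inter> (W l \<inter> \<phi> l -` S i)" for l i
  define \<tau> where "\<tau> l i t = (\<chi> j. Im (\<Lambda> i (\<phi> l t) $ j))" for l i t
  define E where "E i l = \<tau> l i ` A l i" for i l
  have AW: "t \<in> W l" "t \<in> S' l" "\<phi> l t \<in> S i" "\<phi> l t \<in> B i" if "t \<in> A l i" for l i t
    using that S_B[of i] by (auto simp: A_def)
  have L: "\<Lambda> i (\<phi> l t) = cvec u (\<tau> l i t)" if "t \<in> A l i" for l i t
    unfolding \<tau>_def by (rule Lambda_cyc[OF AW(4)[OF that] cp(2)[OF AW(1)[OF that]]])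
  have gt: "g i (cvec u (\<tau> l i t)) = \<phi> l t" if "t \<in> A l i" for l i t
    using pD(10)[OF AW(4)[OF that]] L[OF that] by simp
  have Alm: "A l i \<in> sets lebesgue" for l i
  proof -
    have "W l \<inter> \<phi> l -` S i \<in> sets borel" unfolding S_def by (rule preimage_disjointed_borel[OF oW contW pD(1)])
    then have "W l \<inter> \<phi> l -` S i \<in> sets lebesgue" by (simp add: sets_completionI_sets)
    then show ?thesis unfolding A_def by (rule sets.Int[OF SL])
  qed
  have injt: "inj_on (\<tau> l i) (A l i)" for l i
  proof (rule inj_onI)
    fix s t assume st: "s \<in> A l i" "t \<in> A l i" "\<tau> l i s = \<tau> l i t"
    then have "\<phi> l s = \<phi> l t" using gt[OF st(1)] gt[OF st(2)] by simp
    then show "s = t" using injW[of l] AW(1)[OF st(1)] AW(1)[OF st(2)] by (simp add: inj_on_eq_iff)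
  qed
  let ?dt = "\<lambda>l i t v. (\<chi> j. Im ((lmat (\<phi> l t) *v frechet_derivative (\<phi> l) (at t) v) $ j))"
  have dert: "(\<tau> l i has_derivative ?dt l i t) (at t)" if "t \<in> A l i" for l i t
  proof (rule has_derivative_vecI)
    fix j
    have "((\<lambda>s. \<Lambda> i (\<phi> l s)) has_derivative (\<lambda>v. lmat (\<phi> l t) *v frechet_derivative (\<phi> l) (at t) v)) (at t)"
      using diff_chain_at[OF cp(5)[OF AW(1)[OF that]] pD(6)[OF AW(4)[OF that]]] by (simp only: o_def)
    from bounded_linear.has_derivative[OF bounded_linear_Im bounded_linear.has_derivative[OF bounded_linear_vec_nth[of j] this]]
    show "((\<lambda>s. \<tau> l i s $ j) has_derivative (\<lambda>v. ?dt l i t v $ j)) (at t)" by (simp add: \<tau>_def)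
  qed
  have Elm: "E i l \<in> sets lebesgue" for i l
  proof -
    have "\<tau> l i differentiable_on A l i"
      by (rule differentiable_at_imp_differentiable_on) (rule differentiableI[OF dert])
    then show ?thesis unfolding E_def by (intro differentiable_image_in_sets_lebesgue[OF Alm]) auto
  qed
  have ESu: "(\<Union>l. E i l) = Su u i" for i
  proof (intro equalityI subsetI)
    fix s assume "s \<in> (\<Union>l. E i l)"
    then obtain l t where t: "t \<in> A l i" "s = \<tau> l i t" by (auto simp: E_def)
    have "cvec u s \<in> V i" using pD(9)[OF AW(4)[OF t(1)]] L[OF t(1)] t(2) by simp
    moreover have "g i (cvec u s) \<in> S i" using gt[OF t(1)] AW(3)[OF t(1)] t(2) by simp
    ultimately show "s \<in> Su u i" by (simp add: Su_def T_def)
  next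
    fix s assume s: "s \<in> Su u i"
    then have "g i (cvec u s) \<in> (\<Union>i. (\<lambda>t. g i (cvec u t)) ` Su u i)" by blast
    then have "g i (cvec u s) \<in> (\<Union>l. \<phi> l ` S' l)" unfolding chart_cover un .
    then obtain l t where t: "t \<in> S' l" "\<phi> l t = g i (cvec u s)" by auto
    have "t \<in> A l i" using t s SW[of l] by (auto simp: A_def Su_def T_def)
    moreover have "\<tau> l i t = s"
      using L[OF calculation] t(2) pD(11)[of "cvec u s" i] s inj_cvec by (auto simp: Su_def T_def)
    ultimately show "s \<in> (\<Union>l. E i l)" by (auto simp: E_def)
  qed
  have Edisj: "disjoint_family (E i)" for i
    unfolding disjoint_family_on_def
  proof (intro ballI impI)
    fix l l' :: nat assume ll: "l \<noteq> l'"
    show "E i l \<inter> E i l' = {}"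
    proof (rule ccontr)
      assume "E i l \<inter> E i l' \<noteq> {}"
      then obtain t t' where t: "t \<in> A l i" "t' \<in> A l' i" "\<tau> l i t = \<tau> l' i t'" by (auto simp: E_def)
      have "\<phi> l t = \<phi> l' t'" using gt[OF t(1)] gt[OF t(2)] t(3) by simp
      then have "\<phi> l t \<in> \<phi> l' ` S' l'" using imageI[OF AW(2)[OF t(2)], of "\<phi> l'"] by simp
      moreover have "\<phi> l t \<in> \<phi> l ` S' l" by (rule imageI[OF AW(2)[OF t(1)]])
      moreover have "\<phi> l ` S' l \<inter> \<phi> l' ` S' l' = {}" using disj ll unfolding disjoint_family_on_def by blast
      ultimately show False by blast
    qed
  qed
  have Aun: "(\<Union>i. A l i) = S' l" for l
  proof (intro equalityI subsetI)
    fix t assume t: "t \<in> S' l"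
    then have "\<phi> l t \<in> regset U" using cp(1) SW[of l] by blast
    then obtain i where "\<phi> l t \<in> S i" using S_UN by blast
    then show "t \<in> (\<Union>i. A l i)" using t SW[of l] by (auto simp: A_def)
  qed (auto simp: A_def)
  have Adisj: "disjoint_family (A l)" for l
    using S_disj unfolding disjoint_family_on_def A_def by blast
  have eq: "integral (A l i) (\<lambda>t. G (\<phi> l t) * det (partials (\<phi> l) t)) = integral (E i l) (q u i)" for l i
  proof -
    have qE: "q u i absolutely_integrable_on E i l"
      by (rule set_integrable_subset[OF q_integral(1)[OF int] Elm]) (use ESu[of i] in blast)
    have der': "(\<tau> l i has_derivative ?dt l i t) (at t within A l i)" if "t \<in> A l i" for t
      by (rule has_derivative_at_withinI[OF dert[OF that]])
    have CV: "(\<lambda>t. \<bar>det (matrix (?dt l i t))\<bar> *\<^sub>R q u i (\<tau> l i t)) absolutely_integrable_on A l i \<and>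
       integral (A l i) (\<lambda>t. \<bar>det (matrix (?dt l i t))\<bar> *\<^sub>R q u i (\<tau> l i t)) = integral (E i l) (q u i)"
      by (rule iffD2[OF change_of_variables_real_vec[OF Alm der' injt, where f="q u i"]])
         (use qE in \<open>auto simp: E_def\<close>)
    have pt: "\<bar>det (matrix (?dt l i t))\<bar> *\<^sub>R q u i (\<tau> l i t) = G (\<phi> l t) * det (partials (\<phi> l) t)" if t: "t \<in> A l i" for t
    proof -
      note c = cp[OF AW(1)[OF t]]
      let ?D = "det (\<chi> j k. Im ((lmat (\<phi> l t) *v frechet_derivative (\<phi> l) (at t) (axis k 1)) $ j))"
      have m: "matrix (?dt l i t) = (\<chi> j k. Im ((lmat (\<phi> l t) *v frechet_derivative (\<phi> l) (at t) (axis k 1)) $ j))"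
        by (simp add: matrix_def)
      have "G (\<phi> l t) * det (partials (\<phi> l) t) = of_real ?D * (G (\<phi> l t) * (\<i> ^ CARD('n) / det (lmat (\<phi> l t))))"
        unfolding c(4) by simp
      also have "\<dots> = of_real ?D * (\<i> ^ CARD('n) * ker (\<phi> l t))" unfolding G_ker[OF c(1)] ..
      finally show ?thesis using c(3) unfolding m q_def gt[OF t] by (simp add: scaleR_conv_of_real)
    qed
    show ?thesis by (rule trans[OF integral_cong[OF pt, symmetric] conjunct2[OF CV]])
  qed
  have "(\<lambda>i. integral (Su u i) (q u i)) sums I"
    by (rule double_partition_sums[OF Alm Adisj Aun Elm Edisj ESu ai sm su q_integral(1)[OF int] eq])
  then show ?thesis using canonical_sums by (rule sums_unique2)
qed

end

end

section \<open>Slicing LP into cycle integrals\<close>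

lemma measure_box_cart:
  fixes a b :: "real^'n::finite"
  assumes "\<And>j. a $ j < b $ j"
  shows "measure lborel (box a b) = (\<Prod>j\<in>UNIV. b $ j - a $ j)"
proof -
  have "cbox a b \<noteq> {}" using assms by (simp add: interval_ne_empty_cart less_imp_le)
  then have "measure lborel (cbox a b) = (\<Prod>j\<in>UNIV. b $ j - a $ j)" by (rule content_cbox_cart)
  then show ?thesis by (simp only: measure_lborel_box_eq measure_lborel_cbox_eq)
qed

lemma integral_box_const:
  fixes a b :: "real^'n::finite" and z :: complex
  assumes "\<And>j. a $ j < b $ j"
  shows "integrable lborel (\<lambda>u. indicator (box a b) u *\<^sub>R z)"
    "integral\<^sup>L lborel (\<lambda>u. indicator (box a b) u *\<^sub>R z) = of_real (\<Prod>j\<in>UNIV. b $ j - a $ j) * z"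
proof -
  have i: "integrable lborel (indicator (box a b) :: real^'n \<Rightarrow> real)"
    by (rule integrable_real_indicator[OF _ emeasure_lborel_box_finite]) simp
  then show "integrable lborel (\<lambda>u. indicator (box a b) u *\<^sub>R z)" by (intro integrable_scaleR_left)
  have "integral\<^sup>L lborel (\<lambda>u. indicator (box a b) u *\<^sub>R z) = integral\<^sup>L lborel (indicator (box a b) :: real^'n \<Rightarrow> real) *\<^sub>R z"
    using i by (intro integral_scaleR_left)
  then show "integral\<^sup>L lborel (\<lambda>u. indicator (box a b) u *\<^sub>R z) = of_real (\<Prod>j\<in>UNIV. b $ j - a $ j) * z"
    using measure_box_cart[OF assms] by (simp add: scaleR_conv_of_real)
qed

context residue_patches
begin

definition good :: "real^'n \<Rightarrow> bool" where
  "good u \<longleftrightarrow> (\<forall>i. integrable lborel (\<lambda>t. \<kappa> i (cvec u t))) \<and>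
     summable (\<lambda>i. integral\<^sup>L lborel (\<lambda>t. norm (\<kappa> i (cvec u t))))"

text \<open>For \<open>good u\<close> this is the cycle integral over \<open>cyc u\<close> without
  the factor i^n.\<close>

definition total :: "real^'n \<Rightarrow> complex" where
  "total u = suminf (\<lambda>i. integral\<^sup>L lborel (\<lambda>t. \<kappa> i (cvec u t)))"

lemma patch_change_of_variables:
  fixes \<Phi> \<Psi> :: "complex^'n \<Rightarrow> complex"
  assumes 1: "integrable lborel (\<lambda>x. indicator (S i) x *\<^sub>R \<Phi> x)"
    and 2: "(\<lambda>z. indicator (T i) z *\<^sub>R \<Psi> z) \<in> borel_measurable borel"
    and 3: "\<And>x. x \<in> S i \<Longrightarrow> \<Phi> x = (cmod (det (lmat x)))\<^sup>2 *\<^sub>R \<Psi> (\<Lambda> i x)"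
  shows "integrable lborel (\<lambda>z. indicator (T i) z *\<^sub>R \<Psi> z)"
    "integral\<^sup>L lborel (\<lambda>z. indicator (T i) z *\<^sub>R \<Psi> z) = integral\<^sup>L lborel (\<lambda>x. indicator (S i) x *\<^sub>R \<Phi> x)"
proof -
  have m: "(\<lambda>x. indicator (S i) x *\<^sub>R \<Phi> x) \<in> borel_measurable borel" using borel_measurable_integrable[OF 1] by simp
  have a: "\<Phi> absolutely_integrable_on S i" unfolding absolutely_integrable_on_lborel(1)[OF m] by (rule 1)
  have Sl: "S i \<in> sets lebesgue" using S_borel by (simp add: sets_completionI_sets)
  have der: "(\<Lambda> i has_derivative (*v) (lmat x)) (at x within S i)" if "x \<in> S i" for x
    by (rule has_derivative_at_withinI[OF pD(6)]) (use that S_B in blast)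
  have inj: "inj_on (\<Lambda> i) (S i)" by (rule inj_on_inverseI[of _ "g i"]) (use S_B[of i] pD(10)[of _ i] in blast)
  have "(\<lambda>x. (cmod (det (lmat x)))\<^sup>2 *\<^sub>R \<Psi> (\<Lambda> i x)) absolutely_integrable_on S i \<and>
      integral (S i) (\<lambda>x. (cmod (det (lmat x)))\<^sup>2 *\<^sub>R \<Psi> (\<Lambda> i x)) = integral (S i) \<Phi>"
    by (rule iffD1[OF absolutely_integrable_integral_cong[OF 3] conjI[OF a refl]])
  from iffD1[OF change_of_variables_complex_vec[OF Sl der inj] this]
  have t: "\<Psi> absolutely_integrable_on T i" "integral (T i) \<Psi> = integral (S i) \<Phi>" by (simp_all add: T_image)
  show "integrable lborel (\<lambda>z. indicator (T i) z *\<^sub>R \<Psi> z)"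
    using t(1) unfolding absolutely_integrable_on_lborel(1)[OF 2] .
  show "integral\<^sup>L lborel (\<lambda>z. indicator (T i) z *\<^sub>R \<Psi> z) = integral\<^sup>L lborel (\<lambda>x. indicator (S i) x *\<^sub>R \<Phi> x)"
    using t(2) unfolding absolutely_integrable_on_lborel(2)[OF 2 t(1)] absolutely_integrable_on_lborel(2)[OF m a] .
qed

text \<open>|det lmat|^2 is J cnj J divided by the product of the |P_j|^2. The shell weights supply
  the denominators and \<open>cnj J\<close> one factor of the numerator; what remains of h is
  \<open>ker\<close>. The exponents carry a 2 because shells are measured in |P_j|^2 and boxes in ln
  |P_j|.\<close>

lemma shell_integrand_patch:
  fixes a b :: "real^'n"
  assumes x: "x \<in> S i"
  shows "h x * cnj (J x) * (\<Prod>j\<in>UNIV. shell_fun (ind_shell (exp (2 * a $ j)) (exp (2 * b $ j))) (\<mu> j) (P j x)) =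
    (cmod (det (lmat x)))\<^sup>2 *\<^sub>R (indicator (box a b) (\<chi> j. Re (\<Lambda> i x $ j)) *\<^sub>R \<kappa> i (\<Lambda> i x))"
proof -
  have xB: "x \<in> B i" using S_B x by blast
  then have xr: "x \<in> regset U" using pD(2)[of i] by blast
  have nz: "P j x \<noteq> 0" "J x \<noteq> 0" for j using xr by (auto simp: regset_def)
  have "\<Lambda> i x \<in> T i" using T_image x by blast
  then have k: "\<kappa> i (\<Lambda> i x) = ker x" using pD(10)[OF xB] by (simp add: \<kappa>_def)
  define X M r where "X = (\<Prod>j\<in>UNIV. P j x)" and "M = (\<Prod>j\<in>UNIV. P j x ^ \<mu> j)" and "r = (\<lambda>j. Re (\<Lambda> i x $ j))"
  define ind :: "'n \<Rightarrow> real" where "ind j = indicator {a $ j<..<b $ j} (r j)" for j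
  have cP: "cmod (P j x) = exp (r j)" for j using pD(5)[OF xB, of j] unfolding r_def by (metis norm_exp_eq_Re)
  have sh: "shell_fun (ind_shell (exp (2 * a $ j)) (exp (2 * b $ j))) (\<mu> j) (P j x) =
      of_real (ind j) / of_real ((cmod (P j x))\<^sup>2) / P j x ^ \<mu> j" for j
  proof -
    have "(cmod (P j x))\<^sup>2 = exp (2 * r j)" unfolding cP by (simp add: exp_double)
    then have "indicator {exp (2 * a $ j)<..<exp (2 * b $ j)} ((cmod (P j x))\<^sup>2) = ind j"
      by (simp add: ind_def indicator_def)
    then show ?thesis by (simp add: shell_fun_def ind_shell_def divide_inverse power_inverse)
  qed
  have box: "(\<Prod>j\<in>UNIV. complex_of_real (ind j)) = of_real (indicator (box a b) (\<chi> j. r j))"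
  proof (cases "\<forall>j. r j \<in> {a $ j<..<b $ j}")
    case True
    then show ?thesis by (simp add: ind_def indicator_def mem_box_cart)
  next
    case False
    then obtain j where "r j \<notin> {a $ j<..<b $ j}" by blast
    then have "complex_of_real (ind j) = 0" by (simp add: ind_def)
    then have "(\<Prod>j\<in>UNIV. complex_of_real (ind j)) = 0" by (subst prod_zero_iff) auto
    moreover have "(\<chi> j. r j) \<notin> box a b" using False by (auto simp: mem_box_cart)
    ultimately show ?thesis by simp
  qed
  have sq: "(\<Prod>j\<in>UNIV. complex_of_real ((cmod (P j x))\<^sup>2)) = of_real ((cmod X)\<^sup>2)"
    by (simp add: X_def prod_norm[symmetric] prod_power_distrib)
  define Y :: complex where "Y = of_real ((cmod X)\<^sup>2)"
  define E :: complex where "E = of_real (indicator (box a b) (\<chi> j. r j))"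
  have pr: "(\<Prod>j\<in>UNIV. shell_fun (ind_shell (exp (2 * a $ j)) (exp (2 * b $ j))) (\<mu> j) (P j x)) = E / Y / M"
    unfolding sh prod_dividef box sq M_def E_def Y_def ..
  have e2: "ker x = h x / (J x * M)" by (simp only: ker_def M_def)
  have e3: "complex_of_real ((cmod (det (lmat x)))\<^sup>2) = J x * cnj (J x) / Y"
    unfolding Y_def X_def det_lmat by (simp only: norm_divide power_divide of_real_divide complex_norm_square)
  have alg: "H * cJ * (e / y / n) = K * cJ / y * (e * (H / (K * n)))" if "K \<noteq> 0" for H cJ e y n K :: complex
    using that by (cases "y = 0"; cases "n = 0") (auto simp: field_simps)
  show ?thesis
    unfolding pr k scaleR_conv_of_real e3 e2 r_def[symmetric] E_def[unfolded r_def, symmetric]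
    using alg[OF nz(2)] by (simp add: E_def r_def)
qed

text \<open>The value of \<open>LP\<close> on sharp shells is known from the coefficient, with
  logarithmic length 2 (b_j - a_j). The same integral, taken in logarithmic coordinates patch by
  patch, is by Fubini the integral of \<open>total\<close> over the box.\<close>

lemma coarea_box:
  fixes a b :: "real^'n"
  assumes adm: "adm U \<rho>" and C: "is_coeff U \<rho> h \<mu> C" and ab: "\<And>j. a $ j < b $ j" and b: "\<And>j. exp (2 * b $ j) \<le> \<rho>"
  shows "AE u in lborel. u \<in> box a b \<longrightarrow> good u"
    "integrable lborel (\<lambda>u. indicator (box a b) u *\<^sub>R total u)"
    "integral\<^sup>L lborel (\<lambda>u. indicator (box a b) u *\<^sub>R total u) = C * of_real (\<Prod>j\<in>UNIV. 2 * (b $ j - a $ j))"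
proof -
  define \<xi> where "\<xi> = (\<lambda>j. shell_fun (ind_shell (exp (2 * a $ j)) (exp (2 * b $ j))) (\<mu> j))"
  define F where "F x = h x * cnj (J x) * (\<Prod>j\<in>UNIV. \<xi> j (P j x))" for x
  define Fi where "Fi i z = indicator (box a b) (\<chi> j. Re (z $ j)) *\<^sub>R \<kappa> i z" for i z
  have pq: "0 < exp (2 * a $ j)" "exp (2 * a $ j) < exp (2 * b $ j)" for j using ab by auto
  have tf: "test_fun \<rho> (\<xi> j)" for j unfolding \<xi>_def by (rule test_fun_ind_shell[OF pq(1) b])
  have intF: "integrable lborel (\<lambda>x. indicator U x *\<^sub>R F x)" unfolding F_def by (rule integrable_LP[OF h adm tf])
  have "LP U h \<xi> = C * (\<Prod>j\<in>UNIV. of_real (ln (exp (2 * b $ j) / exp (2 * a $ j))))"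
    unfolding \<xi>_def by (rule LP_ind_shell[OF h adm C pq b])
  moreover have "ln (exp (2 * b $ j) / exp (2 * a $ j)) = 2 * (b $ j - a $ j)" for j by (simp add: ln_div)
  ultimately have LPF: "integral\<^sup>L lborel (\<lambda>x. indicator U x *\<^sub>R F x) = C * of_real (\<Prod>j\<in>UNIV. 2 * (b $ j - a $ j))"
    by (simp only: LP_def L_def F_def of_real_prod)
  \<comment> \<open>The factor \<open>cnj J\<close> kills the critical points and the shells exclude
    the zeros of each P j, so nothing is lost outside the patches.\<close>
  have F_reg: "F x = 0" if "x \<in> U" "x \<notin> regset U" for x
  proof -
    from that have "J x = 0 \<or> (\<exists>j. P j x = 0)" by (auto simp: regset_def)
    then show ?thesis
    proof
      assume "\<exists>j. P j x = 0" then obtain j where j: "P j x = 0" by blast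
      have "\<xi> j (P j x) = 0" by (simp add: \<xi>_def shell_fun_def ind_shell_def j)
      then have "(\<Prod>j\<in>UNIV. \<xi> j (P j x)) = 0" by (subst prod_zero_iff) auto
      then show ?thesis by (simp add: F_def)
    qed (simp add: F_def)
  qed
  have SU: "S i \<subseteq> U" for i using S_UN by (auto simp: regset_def)
  have F_S: "F x = (cmod (det (lmat x)))\<^sup>2 *\<^sub>R Fi i (\<Lambda> i x)" if "x \<in> S i" for i x
    unfolding F_def Fi_def \<xi>_def by (rule shell_integrand_patch[OF that])
  have Sm: "S i \<in> sets lborel" for i using S_borel by simp
  have indSU: "indicator A x *\<^sub>R indicator U x *\<^sub>R F x = indicator A x *\<^sub>R F x" if "A \<subseteq> U" for A x
    using that by (auto simp: indicator_def)
  have intA: "integrable lborel (\<lambda>x. indicator A x *\<^sub>R F x)" if "A \<subseteq> U" "A \<in> sets lborel" for A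
    using integrable_mult_indicator[OF that(2) intF] unfolding indSU[OF that(1)] .
  have regm: "regset U \<in> sets lborel" using open_regset[OF U] by simp
  have regU: "regset U \<subseteq> U" by (auto simp: regset_def)
  have rU: "indicator (regset U) x *\<^sub>R F x = indicator U x *\<^sub>R F x" for x
    using F_reg[of x] regU by (auto simp: indicator_def)
  have regF: "integral\<^sup>L lborel (\<lambda>x. indicator (regset U) x *\<^sub>R F x) = C * of_real (\<Prod>j\<in>UNIV. 2 * (b $ j - a $ j))"
    unfolding rU by (rule LPF)
  have TFi: "(\<lambda>z. indicator (T i) z *\<^sub>R Fi i z) = Fi i" for i
    by (auto simp: Fi_def \<kappa>_def indicator_def fun_eq_iff)
  have mFi: "Fi i \<in> borel_measurable borel" for i
  proof -
    have "continuous_on UNIV (\<lambda>z :: complex^'n. \<chi> j. Re (z $ j))"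
      by (intro continuous_on_vec_lambda continuous_intros)
    from open_vimage[OF open_box this, of a b] have "{z :: complex^'n. (\<chi> j. Re (z $ j)) \<in> box a b} \<in> sets borel"
      by (auto simp: vimage_def)
    then have "(\<lambda>z. indicator {z :: complex^'n. (\<chi> j. Re (z $ j)) \<in> box a b} z *\<^sub>R \<kappa> i z) \<in> borel_measurable borel"
      by (intro borel_measurable_scaleR borel_measurable_indicator kappa_measurable)
    moreover have "Fi i = (\<lambda>z. indicator {z :: complex^'n. (\<chi> j. Re (z $ j)) \<in> box a b} z *\<^sub>R \<kappa> i z)"
      by (simp add: Fi_def indicator_def fun_eq_iff)
    ultimately show ?thesis by simp
  qed
  have Fi_int: "integrable lborel (Fi i)" "integral\<^sup>L lborel (Fi i) = integral\<^sup>L lborel (\<lambda>x. indicator (S i) x *\<^sub>R F x)" for i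
    using patch_change_of_variables[OF intA[OF SU Sm], of i "Fi i"] F_S mFi unfolding TFi by blast+
  have Fi_norm: "integral\<^sup>L lborel (\<lambda>z. norm (Fi i z)) = integral\<^sup>L lborel (\<lambda>x. indicator (S i) x *\<^sub>R norm (F x))" for i
  proof -
    have e1: "(\<lambda>x. indicator (S i) x *\<^sub>R complex_of_real (norm (F x))) = (\<lambda>x. of_real (indicator (S i) x *\<^sub>R norm (F x)))"
      by (simp add: fun_eq_iff scaleR_conv_of_real)
    have e2: "(\<lambda>z. indicator (T i) z *\<^sub>R complex_of_real (norm (Fi i z))) = (\<lambda>z. of_real (norm (Fi i z)))"
      by (auto simp: Fi_def \<kappa>_def indicator_def fun_eq_iff)
    have "(\<lambda>x. norm (indicator (S i) x *\<^sub>R F x)) = (\<lambda>x. indicator (S i) x *\<^sub>R norm (F x))" by (simp add: fun_eq_iff)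
    then have "integrable lborel (\<lambda>x. indicator (S i) x *\<^sub>R norm (F x))"
      using integrable_norm[OF intA[OF SU Sm, of i]] by simp
    then have 1: "integrable lborel (\<lambda>x. indicator (S i) x *\<^sub>R complex_of_real (norm (F x)))"
      unfolding e1 by (rule integrable_of_real)
    have 2: "(\<lambda>z. indicator (T i) z *\<^sub>R complex_of_real (norm (Fi i z))) \<in> borel_measurable borel"
      unfolding e2 using mFi by measurable
    have 3: "complex_of_real (norm (F x)) = (cmod (det (lmat x)))\<^sup>2 *\<^sub>R complex_of_real (norm (Fi i (\<Lambda> i x)))" if "x \<in> S i" for x
      unfolding F_S[OF that] norm_scaleR by (simp add: scaleR_conv_of_real)
    show ?thesis
      using patch_change_of_variables(2)[OF 1 2 3] unfolding e1 e2 integral_complex_of_real of_real_eq_iff .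
  qed
  have Fc: "Fi i (cvec u t) = indicator (box a b) u *\<^sub>R \<kappa> i (cvec u t)" for i u t
  proof -
    have "(\<chi> j. Re (cvec u t $ j)) = u" by (simp add: cvec_def vec_eq_iff)
    then show ?thesis by (simp add: Fi_def)
  qed
  note fub = fubini_cvec[OF Fi_int(1)]
  define N where "N i u = integral\<^sup>L lborel (\<lambda>t. norm (Fi i (cvec u t)))" for i u
  define Dd where "Dd i u = integral\<^sup>L lborel (\<lambda>t. Fi i (cvec u t))" for i u
  have N0: "0 \<le> N i u" for i u unfolding N_def by (rule integral_nonneg_AE) simp
  have DN: "norm (Dd i u) \<le> N i u" for i u unfolding N_def Dd_def by (rule integral_norm_bound)
  have iN: "integrable lborel (N i)" for i unfolding N_def[abs_def] by (rule fub(4))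
  have iD: "integrable lborel (Dd i)" for i unfolding Dd_def[abs_def] by (rule fub(2))
  have NN: "integral\<^sup>L lborel (N i) = integral\<^sup>L lborel (\<lambda>x. indicator (S i) x *\<^sub>R norm (F x))" for i
    unfolding N_def[abs_def] fub(5) Fi_norm ..
  have sumN: "summable (\<lambda>i. integral\<^sup>L lborel (N i))"
  proof -
    have "(\<lambda>x. norm (indicator (regset U) x *\<^sub>R F x)) = (\<lambda>x. indicator (regset U) x *\<^sub>R norm (F x))" by (simp add: fun_eq_iff)
    then have "set_integrable lborel (\<Union>i. S i) (\<lambda>x. norm (F x))"
      unfolding set_integrable_def S_UN using integrable_norm[OF intA[OF regU regm]] by simp
    from sums_summable[OF set_integral_sums[OF Sm S_disj this]]
    show ?thesis unfolding NN set_lebesgue_integral_def .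
  qed
  have AEs: "AE u in lborel. summable (\<lambda>i. N i u)" by (rule AE_summable_integrals[OF iN N0 sumN])
  have AEi: "AE u in lborel. \<forall>i. integrable lborel (\<lambda>t. Fi i (cvec u t))"
    using fub(1) by (simp add: AE_all_countable)
  from AEs AEi show "AE u in lborel. u \<in> box a b \<longrightarrow> good u"
    by eventually_elim (auto simp: good_def N_def Fc)
  have tot: "indicator (box a b) u *\<^sub>R total u = suminf (\<lambda>i. Dd i u)" for u
    by (cases "u \<in> box a b") (simp_all add: Dd_def total_def Fc)
  have AED: "AE u in lborel. summable (\<lambda>i. norm (Dd i u))"
    using AEs
  proof eventually_elim
    case (elim u)
    then show ?case by (rule summable_comparison_test') (simp add: DN)
  qed
  have sumD: "summable (\<lambda>i. integral\<^sup>L lborel (\<lambda>u. norm (Dd i u)))"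
  proof (rule summable_comparison_test'[OF sumN])
    fix i :: nat
    have "integral\<^sup>L lborel (\<lambda>u. norm (Dd i u)) \<le> integral\<^sup>L lborel (N i)"
      by (rule integral_mono[OF integrable_norm[OF iD] iN DN])
    moreover have "0 \<le> integral\<^sup>L lborel (\<lambda>u. norm (Dd i u))" by (rule integral_nonneg_AE) simp
    ultimately show "norm (integral\<^sup>L lborel (\<lambda>u. norm (Dd i u))) \<le> integral\<^sup>L lborel (N i)" by simp
  qed
  show "integrable lborel (\<lambda>u. indicator (box a b) u *\<^sub>R total u)"
    unfolding tot by (rule integrable_suminf[OF iD AED sumD])
  have s1: "(\<lambda>i. integral\<^sup>L lborel (Dd i)) sums (integral\<^sup>L lborel (\<lambda>u. suminf (\<lambda>i. Dd i u)))"
    by (rule sums_integral[OF iD AED sumD])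
  have "set_integrable lborel (\<Union>i. S i) F"
    unfolding set_integrable_def S_UN by (rule intA[OF regU regm])
  from set_integral_sums[OF Sm S_disj this]
  have s2: "(\<lambda>i. integral\<^sup>L lborel (\<lambda>x. indicator (S i) x *\<^sub>R F x)) sums (C * of_real (\<Prod>j\<in>UNIV. 2 * (b $ j - a $ j)))"
    unfolding set_lebesgue_integral_def S_UN regF .
  have "integral\<^sup>L lborel (Dd i) = integral\<^sup>L lborel (\<lambda>x. indicator (S i) x *\<^sub>R F x)" for i
    unfolding Dd_def[abs_def] fub(3) Fi_int(2) ..
  then show "integral\<^sup>L lborel (\<lambda>u. indicator (box a b) u *\<^sub>R total u) = C * of_real (\<Prod>j\<in>UNIV. 2 * (b $ j - a $ j))"
    using s1 s2 unfolding tot by (simp add: sums_unique2)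
qed

text \<open>\<open>total\<close> and the constant 2^n C have the same integral over every sub-box;
  2^n stems from the logarithmic lengths in |P_j|^2.\<close>

lemma total_AE_box:
  fixes a b :: "real^'n"
  assumes adm: "adm U \<rho>" and C: "is_coeff U \<rho> h \<mu> C" and ab: "\<And>j. a $ j < b $ j" and b: "\<And>j. exp (2 * b $ j) \<le> \<rho>"
  shows "AE u in lborel. u \<in> box a b \<longrightarrow> total u = 2 ^ CARD('n) * C"
proof -
  let ?z = "2 ^ CARD('n) * C"
  define w where "w u = indicator (box a b) u *\<^sub>R (total u - ?z)" for u
  have split: "indicator (box c d) u *\<^sub>R (total u - ?z) = indicator (box c d) u *\<^sub>R total u - indicator (box c d) u *\<^sub>R ?z" for c d u
    by (rule scaleR_diff_right)
  have iw: "integrable lborel w"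
    unfolding w_def[abs_def] split
    by (intro Bochner_Integration.integrable_diff coarea_box(2)[OF adm C ab b] integral_box_const(1)[OF ab])
  have zero: "integral\<^sup>L lborel (\<lambda>u. indicator (box a' b') u *\<^sub>R w u) = 0" for a' b'
  proof -
    \<comment> \<open>The intersection of two boxes is again a box, so \<open>coarea_box\<close>
      computes the integral unless it is empty.\<close>
    define c d where "c = (\<chi> j. max (a $ j) (a' $ j))" and "d = (\<chi> j. min (b $ j) (b' $ j))"
    have "box a' b' \<inter> box a b = box c d" by (auto simp: c_def d_def mem_box_cart)
    then have e: "indicator (box a' b') u *\<^sub>R w u = indicator (box c d) u *\<^sub>R (total u - ?z)" for u
      by (auto simp: w_def indicator_def split: if_splits)
    show ?thesis
    proof (cases "\<forall>j. c $ j < d $ j")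
      case True
      then have cd: "c $ j < d $ j" for j by blast
      have d: "exp (2 * d $ j) \<le> \<rho>" for j
      proof -
        have "exp (2 * d $ j) \<le> exp (2 * b $ j)" by (simp add: d_def)
        then show ?thesis using b[of j] by linarith
      qed
      have "integral\<^sup>L lborel (\<lambda>u. indicator (box c d) u *\<^sub>R (total u - ?z)) =
          C * of_real (\<Prod>j\<in>UNIV. 2 * (d $ j - c $ j)) - of_real (\<Prod>j\<in>UNIV. d $ j - c $ j) * ?z"
        unfolding split
        by (subst Bochner_Integration.integral_diff[OF coarea_box(2)[OF adm C cd d] integral_box_const(1)[OF cd]])
           (simp only: coarea_box(3)[OF adm C cd d] integral_box_const(2)[OF cd])
      also have "\<dots> = 0"
      proof -
        have pr: "(\<Prod>j\<in>UNIV. 2 * (d $ j - c $ j)) = 2 ^ CARD('n) * (\<Prod>j\<in>UNIV. d $ j - c $ j)"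
          by (simp only: prod.distrib prod_constant)
        show ?thesis unfolding pr by (simp add: mult_ac)
      qed
      finally show ?thesis unfolding e .
    next
      case False
      then obtain j where j: "\<not> c $ j < d $ j" by blast
      have "u \<notin> box c d" for u
      proof
        assume "u \<in> box c d"
        then have "c $ j < u $ j" "u $ j < d $ j" by (auto simp: mem_box_cart)
        then show False using j by simp
      qed
      then show ?thesis unfolding e by simp
    qed
  qed
  have part: "AE u in lborel. l (w u) = 0" if l: "bounded_linear l" for l :: "complex \<Rightarrow> real"
  proof (rule AE_zero_from_boxes)
    show "integrable lborel (\<lambda>u. l (w u))" by (rule integrable_bounded_linear[OF l iw])
    fix a' b' :: "real^'n"
    have "integrable lborel (\<lambda>u. indicator (box a' b') u *\<^sub>R w u)" by (rule integrable_mult_indicator[OF _ iw]) simp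
    from integral_bounded_linear[OF l this]
    show "integral\<^sup>L lborel (\<lambda>u. indicator (box a' b') u * l (w u)) = 0"
      unfolding zero by (simp add: linear_scale[OF bounded_linear.linear[OF l]] linear_0[OF bounded_linear.linear[OF l]])
  qed
  from part[OF bounded_linear_Re] part[OF bounded_linear_Im] show ?thesis
    by eventually_elim (auto simp: w_def complex_eq_iff)
qed

lemma total_AE:
  assumes adm: "adm U \<rho>" and C: "is_coeff U \<rho> h \<mu> C" and \<rho>: "0 < \<rho>"
  shows "AE u in lborel. (\<forall>j. exp (2 * u $ j) < \<rho>) \<longrightarrow> good u \<and> total u = 2 ^ CARD('n) * C"
proof -
  define \<beta> where "\<beta> = ln \<rho> / 2"
  \<comment> \<open>Lower corners tending to minus infinity: countably many boxes exhaust the region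
    below \<beta>, so the exceptional sets stay null.\<close>
  define a where "a m = (\<chi> j. \<beta> - 1 - real m :: real^'n)" for m :: nat
  define b where "b = (\<chi> j. \<beta> :: real^'n)"
  have ab: "a m $ j < b $ j" for m j by (simp add: a_def b_def)
  have b\<rho>: "exp (2 * b $ j) \<le> \<rho>" for j using \<rho> by (simp add: b_def \<beta>_def)
  have "AE u in lborel. \<forall>m. u \<in> box (a m) b \<longrightarrow> good u \<and> total u = 2 ^ CARD('n) * C"
    unfolding AE_all_countable
  proof
    fix m
    from coarea_box(1)[OF adm C ab b\<rho>, of m] total_AE_box[OF adm C ab b\<rho>, of m]
    show "AE u in lborel. u \<in> box (a m) b \<longrightarrow> good u \<and> total u = 2 ^ CARD('n) * C"
      by eventually_elim blast
  qed
  then show ?thesis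
  proof eventually_elim
    case (elim u)
    show ?case
    proof
      assume u: "\<forall>j. exp (2 * u $ j) < \<rho>"
      have up: "u $ j < \<beta>" for j
      proof -
        have "exp (2 * u $ j) < exp (ln \<rho>)" using u \<rho> by simp
        then have "2 * u $ j < ln \<rho>" by (simp only: exp_less_cancel_iff)
        then show ?thesis by (simp add: \<beta>_def)
      qed
      obtain m :: nat where m: "\<beta> + norm u < real m" using reals_Archimedean2 by blast
      have "\<beta> - 1 - real m < u $ j" for j
        using m component_le_norm_cart[of u j] by linarith
      then have "u \<in> box (a m) b" using up by (simp add: mem_box_cart a_def b_def)
      then show "good u \<and> total u = 2 ^ CARD('n) * C" using elim by blast
    qed
  qed
qed

text \<open>The map \<open>eps\<close> from logarithmic radii to the radii of the \<open>f j\<close>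
  is differentiable and carries null sets to null sets, so genericity in u becomes genericity in
  \<epsilon>.\<close>

lemma cycle_integral_AE:
  assumes adm: "adm U \<rho>" and C: "is_coeff U \<rho> h \<mu> C" and \<rho>: "0 < \<rho>"
  shows "\<exists>\<rho>'>0. AE \<epsilon> in lborel. (\<forall>j. 0 < \<epsilon> $ j \<and> \<epsilon> $ j < \<rho>') \<longrightarrow>
    (\<forall>I. cycle_integral f (res_cycle f U \<epsilon>) G I \<longleftrightarrow> I = \<i> ^ CARD('n) * (2 ^ CARD('n) * C))"
proof -
  have "AE u in lborel. (\<forall>j. exp (2 * u $ j) < \<rho>) \<longrightarrow>
      (\<forall>I. cycle_integral f (cyc u) G I \<longleftrightarrow> I = \<i> ^ CARD('n) * (2 ^ CARD('n) * C))"
    using total_AE[OF adm C \<rho>]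
  proof eventually_elim
    case (elim u)
    show ?case
    proof (intro impI)
      assume "\<forall>j. exp (2 * u $ j) < \<rho>"
      then have g: "good u" and t: "total u = 2 ^ CARD('n) * C" using elim by auto
      have i: "\<And>i. integrable lborel (\<lambda>t. \<kappa> i (cvec u t))"
        and s: "summable (\<lambda>i. integral\<^sup>L lborel (\<lambda>t. norm (\<kappa> i (cvec u t))))" using g by (auto simp: good_def)
      show "\<forall>I. cycle_integral f (cyc u) G I \<longleftrightarrow> I = \<i> ^ CARD('n) * (2 ^ CARD('n) * C)"
        using cycle_integral_exists[OF i s] cycle_integral_unique[OF i s] unfolding total_def[symmetric] t by blast
    qed
  qed
  then obtain N where N: "{u. \<not> ((\<forall>j. exp (2 * u $ j) < \<rho>) \<longrightarrow>
      (\<forall>I. cycle_integral f (cyc u) G I \<longleftrightarrow> I = \<i> ^ CARD('n) * (2 ^ CARD('n) * C)))} \<subseteq> N" "N \<in> null_sets lborel"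
    unfolding eventually_ae_filter by auto
  have "negligible N" using N(2) by (simp add: negligible_iff_null_sets null_sets_completionI)
  moreover have "eps differentiable_on N"
  proof (rule differentiable_at_imp_differentiable_on)
    fix u assume "u \<in> N"
    have "\<forall>j. \<exists>d. ((\<lambda>u. eps u $ j) has_derivative d) (at u)"
    proof
      fix j
      have "((\<lambda>u. exp (u $ j)) has_derivative (\<lambda>v. v $ j * exp (u $ j))) (at u)"
        by (rule has_derivative_exp[OF bounded_linear_imp_has_derivative[OF bounded_linear_vec_nth]])
      from has_derivative_power[OF this, of "\<mu> j + 1"]
      show "\<exists>d. ((\<lambda>u. eps u $ j) has_derivative d) (at u)" unfolding eps_def vec_lambda_beta by blast
    qed
    then obtain d where d: "\<And>j. ((\<lambda>u. eps u $ j) has_derivative d j) (at u)" by metis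
    have "(eps has_derivative (\<lambda>v. \<chi> j. d j v)) (at u)"
      by (rule has_derivative_vecI) (use d in simp)
    then show "eps differentiable at u" by (auto simp: differentiable_def)
  qed
  ultimately have "negligible (eps ` N)" by (rule negligible_differentiable_image_negligible[OF order_refl])
  then have "AE \<epsilon> in lebesgue. \<epsilon> \<notin> eps ` N" by (simp add: negligible_iff_null_sets AE_not_in)
  then have AE: "AE \<epsilon> in lborel. \<epsilon> \<notin> eps ` N" by (simp only: AE_completion_iff)
  \<comment> \<open>Below this bound every |P j| is less than sqrt \<rho> on the cycle, because
    \<epsilon> j = |P j|^(\<mu> j + 1) there.\<close>
  define \<rho>' where "\<rho>' = Min (range (\<lambda>j. sqrt \<rho> ^ (\<mu> j + 1)))"
  have "0 < \<rho>'" unfolding \<rho>'_def using \<rho> by (subst Min_gr_iff) auto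
  moreover have "AE \<epsilon> in lborel. (\<forall>j. 0 < \<epsilon> $ j \<and> \<epsilon> $ j < \<rho>') \<longrightarrow>
    (\<forall>I. cycle_integral f (res_cycle f U \<epsilon>) G I \<longleftrightarrow> I = \<i> ^ CARD('n) * (2 ^ CARD('n) * C))"
    using AE
  proof eventually_elim
    case (elim \<epsilon>)
    show ?case
    proof (rule impI)
      assume e: "\<forall>j. 0 < \<epsilon> $ j \<and> \<epsilon> $ j < \<rho>'"
      define u where "u = (\<chi> j. ln (\<epsilon> $ j) / real (\<mu> j + 1))"
      have eu: "exp (u $ j) ^ (\<mu> j + 1) = \<epsilon> $ j" for j
      proof -
        have "exp (u $ j) ^ (\<mu> j + 1) = exp (real (\<mu> j + 1) * u $ j)" by (rule exp_of_nat_mult[symmetric])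
        also have "real (\<mu> j + 1) * u $ j = ln (\<epsilon> $ j)" unfolding u_def by (simp del: of_nat_Suc of_nat_add)
        finally show ?thesis using e by simp
      qed
      then have eps: "eps u = \<epsilon>" by (simp add: eps_def vec_eq_iff del: power_Suc)
      then have "u \<notin> N" using elim by blast
      moreover have "exp (2 * u $ j) < \<rho>" for j
      proof -
        have "\<rho>' \<le> sqrt \<rho> ^ (\<mu> j + 1)" unfolding \<rho>'_def by (rule Min_le) auto
        then have "exp (u $ j) ^ (\<mu> j + 1) < sqrt \<rho> ^ (\<mu> j + 1)" unfolding eu using e by (meson less_le_trans)
        then have "exp (u $ j) < sqrt \<rho>" by (rule power_less_imp_less_base) (use \<rho> in simp)
        then have "exp (u $ j) ^ 2 < sqrt \<rho> ^ 2" by (intro power_strict_mono) auto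
        then show ?thesis using \<rho> by (simp add: exp_double)
      qed
      ultimately show "\<forall>I. cycle_integral f (res_cycle f U \<epsilon>) G I \<longleftrightarrow> I = \<i> ^ CARD('n) * (2 ^ CARD('n) * C)"
        using N(1) unfolding eps[symmetric] by blast
    qed
  qed
  ultimately show ?thesis by blast
qed

end

section \<open>Local and global residues\<close>

text \<open>Cubes at the origin have positive measure; hence two properties that hold for almost all
  small radii hold together for some radii, which makes the residue limit unique.\<close>

lemma not_AE_outside_cube:
  assumes "0 < s" shows "\<not> (AE \<epsilon> in (lborel :: (real^'n::finite) measure). \<not> (\<forall>j. 0 < \<epsilon> $ j \<and> \<epsilon> $ j < s))"
proof
  let ?b = "(\<chi> j. s) :: real^'n"
  assume "AE \<epsilon> in (lborel :: (real^'n) measure). \<not> (\<forall>j. 0 < \<epsilon> $ j \<and> \<epsilon> $ j < s)"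
  then have "AE \<epsilon> in lborel. \<epsilon> \<notin> box 0 ?b" by (simp add: mem_box_cart)
  then have "box 0 ?b \<in> null_sets lborel" by (subst AE_iff_null_sets) auto
  then have "measure lborel (box 0 ?b) = 0" by (rule measure_eq_0_null_sets)
  moreover have "measure lborel (box 0 ?b) = s ^ CARD('n)" using measure_box_cart[of 0 ?b] assms by simp
  ultimately show False using assms by simp
qed

text \<open>For almost all small radii the cycle integral is not merely close to but equal to (2
  i)^n C, so the limit exists and is determined.\<close>

lemma (in pushforward) residue_limit_iff:
  assumes h: "polyfun h" and adm: "adm U \<rho>" and \<rho>: "0 < \<rho>" and C: "is_coeff U \<rho> h \<mu> C"
  shows "residue_limit (\<lambda>j x. P j x ^ (\<mu> j + 1)) h U r \<longleftrightarrow> r = C / of_real (pi ^ CARD('n))"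
proof -
  have U: "open U" using adm by (simp add: adm_def)
  obtain B :: "nat \<Rightarrow> (complex^'n) set" and \<Lambda> V g where pt: "\<forall>i. patch U (B i) (\<Lambda> i) (V i) (g i)" "(\<Union>i. B i) = regset U"
    using patches_exist[OF U] by (elim exE conjE) (rule that)
  interpret rp: residue_patches P U \<mu> h B V \<Lambda> g
    by unfold_locales (use U h pt in auto)
  let ?f = "\<lambda>j x. P j x ^ (\<mu> j + 1)"
  let ?I = "\<i> ^ CARD('n) * (2 ^ CARD('n) * C)"
  have fe: "rp.f = ?f" by (simp add: rp.f_def fun_eq_iff)
  have Ge: "rp.G = (\<lambda>\<zeta>. h \<zeta> / (\<Prod>j\<in>UNIV. ?f j \<zeta>))" unfolding rp.G_def[abs_def] fe ..
  obtain \<rho>' where \<rho>': "0 < \<rho>'" and AE: "AE \<epsilon> in lborel. (\<forall>j. 0 < \<epsilon> $ j \<and> \<epsilon> $ j < \<rho>') \<longrightarrow>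
    (\<forall>I. cycle_integral ?f (res_cycle ?f U \<epsilon>) (\<lambda>\<zeta>. h \<zeta> / (\<Prod>j\<in>UNIV. ?f j \<zeta>)) I \<longleftrightarrow> I = ?I)"
    using rp.cycle_integral_AE[OF adm C \<rho>] unfolding fe Ge by blast
  \<comment> \<open>Here i^n comes from the parametrisation of the cycle and 2^n from measuring
    shells in |P_j|^2; division by (2 pi i)^n leaves pi^n in the denominator.\<close>
  have val: "?I / (2 * of_real pi * \<i>) ^ CARD('n) = C / of_real (pi ^ CARD('n))"
    by (simp add: power_mult_distrib)
  show ?thesis
  proof
    assume r: "r = C / of_real (pi ^ CARD('n))"
    show "residue_limit ?f h U r"
      unfolding residue_limit_def
    proof (intro allI impI exI conjI)
      fix e :: real assume e: "0 < e"
      show "0 < \<rho>'" by (rule \<rho>')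
      show "AE \<epsilon> in lborel. (\<forall>j. 0 < \<epsilon> $ j \<and> \<epsilon> $ j < \<rho>') \<longrightarrow>
        (\<exists>I. cycle_integral ?f (res_cycle ?f U \<epsilon>) (\<lambda>\<zeta>. h \<zeta> / (\<Prod>j\<in>UNIV. ?f j \<zeta>)) I \<and> dist (I / (2 * of_real pi * \<i>) ^ CARD('n)) r < e)"
        using AE
      proof eventually_elim
        case (elim \<epsilon>)
        show ?case
        proof (intro impI exI[of _ ?I] conjI)
          assume "\<forall>j. 0 < \<epsilon> $ j \<and> \<epsilon> $ j < \<rho>'"
          then show "cycle_integral ?f (res_cycle ?f U \<epsilon>) (\<lambda>\<zeta>. h \<zeta> / (\<Prod>j\<in>UNIV. ?f j \<zeta>)) ?I" using elim by blast
          show "dist (?I / (2 * of_real pi * \<i>) ^ CARD('n)) r < e" unfolding val r using e by simp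
        qed
      qed
    qed
  next
    assume lim: "residue_limit ?f h U r"
    have "dist (C / of_real (pi ^ CARD('n))) r < e" if "0 < e" for e
    proof (rule ccontr)
      assume far: "\<not> dist (C / of_real (pi ^ CARD('n))) r < e"
      have ex: "\<exists>s>0. AE \<epsilon> in lborel. (\<forall>j. 0 < \<epsilon> $ j \<and> \<epsilon> $ j < s) \<longrightarrow>
        (\<exists>I. cycle_integral ?f (res_cycle ?f U \<epsilon>) (\<lambda>\<zeta>. h \<zeta> / (\<Prod>j\<in>UNIV. ?f j \<zeta>)) I \<and> dist (I / (2 * of_real pi * \<i>) ^ CARD('n)) r < e)"
        by (rule mp[OF spec[OF lim[unfolded residue_limit_def]] that])
      obtain s where s: "0 < s" and AE2: "AE \<epsilon> in lborel. (\<forall>j. 0 < \<epsilon> $ j \<and> \<epsilon> $ j < s) \<longrightarrow>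
        (\<exists>I. cycle_integral ?f (res_cycle ?f U \<epsilon>) (\<lambda>\<zeta>. h \<zeta> / (\<Prod>j\<in>UNIV. ?f j \<zeta>)) I \<and> dist (I / (2 * of_real pi * \<i>) ^ CARD('n)) r < e)"
        using ex by (elim exE conjE) (rule that)
      have AEn: "AE \<epsilon> in (lborel :: (real^'n) measure). \<not> (\<forall>j. 0 < \<epsilon> $ j \<and> \<epsilon> $ j < min s \<rho>')"
        using AE AE2
      proof eventually_elim
        case (elim \<epsilon>)
        show ?case
        proof
          assume "\<forall>j. 0 < \<epsilon> $ j \<and> \<epsilon> $ j < min s \<rho>'"
          then have small: "\<forall>j. 0 < \<epsilon> $ j \<and> \<epsilon> $ j < s" "\<forall>j. 0 < \<epsilon> $ j \<and> \<epsilon> $ j < \<rho>'" by auto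
          obtain I where I: "cycle_integral ?f (res_cycle ?f U \<epsilon>) (\<lambda>\<zeta>. h \<zeta> / (\<Prod>j\<in>UNIV. ?f j \<zeta>)) I"
            "dist (I / (2 * of_real pi * \<i>) ^ CARD('n)) r < e" using elim(2) small(1) by blast
          have "I = ?I" using elim(1) small(2) I(1) by blast
          then show False using I(2) far unfolding val[symmetric] by simp
        qed
      qed
      show False by (rule notE[OF not_AE_outside_cube AEn]) (use s \<rho>' in simp)
    qed
    then have "\<not> 0 < dist (C / of_real (pi ^ CARD('n))) r" by (metis less_irrefl)
    then show "r = C / of_real (pi ^ CARD('n))" by simp
  qed
qed

context pushforward
begin

lemma adm_mono:
  assumes "adm U \<rho>" "\<rho>' \<le> \<rho>"
  shows "adm U \<rho>'"
proof -
  have "closed {x. (cmod (P j x))\<^sup>2 \<le> \<rho>'}" for j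
    by (intro closed_Collect_le continuous_intros continuous_on_polyfun[OF P])
  then have "closed (\<Inter>j. {x. (cmod (P j x))\<^sup>2 \<le> \<rho>'})" by blast
  moreover have "{x \<in> U. \<forall>j. (cmod (P j x))\<^sup>2 \<le> \<rho>'} = {x \<in> U. \<forall>j. (cmod (P j x))\<^sup>2 \<le> \<rho>} \<inter> (\<Inter>j. {x. (cmod (P j x))\<^sup>2 \<le> \<rho>'})"
    using assms(2) by (auto intro: order_trans)
  ultimately show ?thesis using assms(1) by (simp add: adm_def compact_Int_closed)
qed

lemma csupp_shell_fun: "bump p q \<eta> \<Longrightarrow> q \<le> \<rho> \<Longrightarrow> csupp \<rho> (shell_fun \<eta> m)"
  using C1_test_fun_shell_fun by (simp add: C1_test_fun_def)

lemma prod_csupp_zero: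
  assumes "\<And>j. csupp \<rho> (\<xi> j)" "\<not> (\<forall>j. (cmod (P j x))\<^sup>2 \<le> \<rho>)"
  shows "(\<Prod>j\<in>UNIV. \<xi> j (P j x)) = 0"
proof -
  obtain j where "\<rho> < (cmod (P j x))\<^sup>2" using assms(2) by (auto simp: not_le)
  then have "\<xi> j (P j x) = 0" using assms(1)[of j] by (simp add: csupp_def)
  then show ?thesis by (subst prod_zero_iff) auto
qed

lemma is_coeff_cong:
  assumes eq: "{x \<in> U. \<forall>j. (cmod (P j x))\<^sup>2 \<le> \<rho>} = {x \<in> U'. \<forall>j. (cmod (P j x))\<^sup>2 \<le> \<rho>}"
    and C: "is_coeff U \<rho> h m C"
  shows "is_coeff U' \<rho> h m C"
  unfolding is_coeff_def
proof (intro allI impI)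
  fix p q :: "'n \<Rightarrow> real" and \<eta> :: "'n \<Rightarrow> real \<Rightarrow> real" assume b: "\<forall>j. bump (p j) (q j) (\<eta> j) \<and> q j \<le> \<rho>"
  define \<xi> where "\<xi> j = shell_fun (\<eta> j) (m j)" for j
  have cs: "csupp \<rho> (\<xi> j)" for j unfolding \<xi>_def using b csupp_shell_fun by blast
  have "indicator U x *\<^sub>R (h x * cnj (J x) * (\<Prod>j\<in>UNIV. \<xi> j (P j x))) = indicator U' x *\<^sub>R (h x * cnj (J x) * (\<Prod>j\<in>UNIV. \<xi> j (P j x)))" for x
  proof (cases "\<forall>j. (cmod (P j x))\<^sup>2 \<le> \<rho>")
    case True
    then have "x \<in> U \<longleftrightarrow> x \<in> U'" using eq by blast
    then show ?thesis by (simp add: indicator_def)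
  next
    case False
    then show ?thesis using prod_csupp_zero[OF cs False] by simp
  qed
  then have "LP U h \<xi> = LP U' h \<xi>" by (simp only: LP_def L_def)
  moreover have "LP U h \<xi> = C * (\<Prod>j\<in>UNIV. of_real (mass (\<eta> j)))"
    using C b unfolding is_coeff_def \<xi>_def by blast
  ultimately show "LP U' h (\<lambda>j. shell_fun (\<eta> j) (m j)) = C * (\<Prod>j\<in>UNIV. of_real (mass (\<eta> j)))"
    by (simp add: \<xi>_def[abs_def])
qed

text \<open>The sum of the |P_j|^2 has a positive minimum on K; \<rho> is that minimum over 2 n, so
  terms all bounded by \<rho> would sum to at most half of it.\<close>

lemma compact_zero_free:
  assumes K: "compact K" "K \<inter> common_zeros P = {}"
  shows "\<exists>\<rho>>0. \<forall>x\<in>K. \<not> (\<forall>j. (cmod (P j x))\<^sup>2 \<le> \<rho>)"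
proof (cases "K = {}")
  case True then show ?thesis by (intro exI[of _ 1]) auto
next
  case False
  let ?\<phi> = "\<lambda>x. \<Sum>j\<in>UNIV. (cmod (P j x))\<^sup>2"
  have "continuous_on K ?\<phi>" by (intro continuous_intros continuous_on_polyfun[OF P])
  from continuous_attains_inf[OF K(1) False this]
  obtain x0 where x0: "x0 \<in> K" "\<forall>y\<in>K. ?\<phi> x0 \<le> ?\<phi> y" by blast
  have nn: "0 \<le> (\<Sum>j\<in>UNIV. (cmod (P j x0))\<^sup>2)" by (intro sum_nonneg) auto
  have "?\<phi> x0 \<noteq> 0"
  proof
    assume "?\<phi> x0 = 0"
    then have "\<forall>j\<in>UNIV. (cmod (P j x0))\<^sup>2 = 0" by (subst (asm) sum_nonneg_eq_0_iff) auto
    then have "x0 \<in> common_zeros P" by (simp add: common_zeros_def)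
    then show False using x0(1) K(2) by blast
  qed
  then have pos: "0 < ?\<phi> x0" using nn by linarith
  define \<rho> where "\<rho> = ?\<phi> x0 / (2 * real CARD('n))"
  have "0 < \<rho>" unfolding \<rho>_def using pos by (intro divide_pos_pos) auto
  moreover have "\<not> (\<forall>j. (cmod (P j x))\<^sup>2 \<le> \<rho>)" if x: "x \<in> K" for x
  proof
    assume "\<forall>j. (cmod (P j x))\<^sup>2 \<le> \<rho>"
    then have "?\<phi> x \<le> of_nat (card (UNIV :: 'n set)) * \<rho>" by (intro sum_bounded_above) auto
    also have "\<dots> = ?\<phi> x0 / 2" by (simp add: \<rho>_def)
    finally show False using x0(2) x pos by force
  qed
  ultimately show ?thesis by blast
qed

text \<open>The closure of U without the neighbourhood W of a is compact and free of zeros. Small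
  sublevel sets in U therefore lie in W and are closed, which makes U admissible.\<close>

lemma local_region:
  assumes U: "open U" "bounded U" "a \<in> U" "closure U \<inter> common_zeros P = {a}" and W: "open W" "a \<in> W"
  shows "\<exists>\<rho>>0. adm U \<rho> \<and> {x \<in> U. \<forall>j. (cmod (P j x))\<^sup>2 \<le> \<rho>} \<subseteq> W"
proof -
  let ?K = "closure U - (W \<inter> U)"
  have cU: "compact (closure U)" using U(2) by (simp add: compact_eq_bounded_closed bounded_closure)
  then have "compact ?K" using U(1) W(1) by (intro compact_diff open_Int)
  moreover have "x = a" if "x \<in> closure U" "x \<in> common_zeros P" for x using U(4) that by blast
  then have "?K \<inter> common_zeros P = {}" using U(3) W(2) by auto
  ultimately obtain \<rho> where \<rho>: "0 < \<rho>" "\<And>x. x \<in> ?K \<Longrightarrow> \<not> (\<forall>j. (cmod (P j x))\<^sup>2 \<le> \<rho>)"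
    using compact_zero_free[of ?K] by blast
  have eq: "{x \<in> U. \<forall>j. (cmod (P j x))\<^sup>2 \<le> \<rho>} = closure U \<inter> (\<Inter>j. {x. (cmod (P j x))\<^sup>2 \<le> \<rho>})"
    using \<rho>(2) closure_subset[of U] by blast
  have "closed {x. (cmod (P j x))\<^sup>2 \<le> \<rho>}" for j
    by (intro closed_Collect_le continuous_intros continuous_on_polyfun[OF P])
  then have "closed (\<Inter>j. {x. (cmod (P j x))\<^sup>2 \<le> \<rho>})" by blast
  then have "adm U \<rho>" unfolding adm_def eq using U(1) cU by (simp add: compact_Int_closed)
  moreover have "{x \<in> U. \<forall>j. (cmod (P j x))\<^sup>2 \<le> \<rho>} \<subseteq> W" using \<rho>(2) closure_subset[of U] by blast
  ultimately show ?thesis using \<rho>(1) by blast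
qed

text \<open>Two neighbourhoods of the zero have the same small sublevel sets, hence the same
  coefficient and the same residue limit. Thus one number works for all of them, and the given U
  shows that no other does.\<close>

lemma local_residue_eq:
  assumes h: "polyfun h" and U: "open U" "bounded U" "a \<in> U" "closure U \<inter> common_zeros P = {a}"
    and r: "adm U \<rho>" "0 < \<rho>" and C: "is_coeff U \<rho> h \<mu> C"
  shows "local_residue (\<lambda>j x. P j x ^ (\<mu> j + 1)) h a = C / of_real (pi ^ CARD('n))"
proof -
  let ?f = "\<lambda>j x. P j x ^ (\<mu> j + 1)"
  have Z: "common_zeros ?f = common_zeros P" by (auto simp: common_zeros_def)
  have lim: "residue_limit ?f h U' r \<longleftrightarrow> r = C / of_real (pi ^ CARD('n))"
    if U': "open U'" "bounded U'" "a \<in> U'" "closure U' \<inter> common_zeros P = {a}" for U' r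
  proof -
    obtain \<rho>1 where 1: "0 < \<rho>1" "{x \<in> U. \<forall>j. (cmod (P j x))\<^sup>2 \<le> \<rho>1} \<subseteq> U'"
      using local_region[OF U U'(1,3)] by blast
    obtain \<rho>2 where 2: "0 < \<rho>2" "adm U' \<rho>2" "{x \<in> U'. \<forall>j. (cmod (P j x))\<^sup>2 \<le> \<rho>2} \<subseteq> U"
      using local_region[OF U' U(1,3)] by blast
    define \<rho>' where "\<rho>' = min \<rho> (min \<rho>1 \<rho>2)"
    have \<rho>': "0 < \<rho>'" "\<rho>' \<le> \<rho>" "\<rho>' \<le> \<rho>1" "\<rho>' \<le> \<rho>2" using 1 2 r by (auto simp: \<rho>'_def)
    have sub: "{x \<in> U. \<forall>j. (cmod (P j x))\<^sup>2 \<le> \<rho>'} \<subseteq> {x \<in> U. \<forall>j. (cmod (P j x))\<^sup>2 \<le> \<rho>1}"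
      "{x \<in> U'. \<forall>j. (cmod (P j x))\<^sup>2 \<le> \<rho>'} \<subseteq> {x \<in> U'. \<forall>j. (cmod (P j x))\<^sup>2 \<le> \<rho>2}"
      using \<rho>' by (auto intro: order_trans)
    have "{x \<in> U. \<forall>j. (cmod (P j x))\<^sup>2 \<le> \<rho>'} = {x \<in> U'. \<forall>j. (cmod (P j x))\<^sup>2 \<le> \<rho>'}"
      using sub 1(2) 2(3) by blast
    from is_coeff_cong[OF this is_coeff_mono[OF C \<rho>'(2)]]
    have "is_coeff U' \<rho>' h \<mu> C" .
    from residue_limit_iff[OF h adm_mono[OF 2(2) \<rho>'(4)] \<rho>'(1) this] show ?thesis .
  qed
  show ?thesis
    unfolding local_residue_def Z
  proof (rule the_equality)
    show "\<forall>U. open U \<and> bounded U \<and> a \<in> U \<and> closure U \<inter> common_zeros P = {a} \<longrightarrow>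
       residue_limit ?f h U (C / of_real (pi ^ CARD('n)))"
    proof (intro allI impI)
      fix U' assume "open U' \<and> bounded U' \<and> a \<in> U' \<and> closure U' \<inter> common_zeros P = {a}"
      then show "residue_limit ?f h U' (C / of_real (pi ^ CARD('n)))" using lim[of U'] by simp
    qed
    fix r assume "\<forall>U. open U \<and> bounded U \<and> a \<in> U \<and> closure U \<inter> common_zeros P = {a} \<longrightarrow> residue_limit ?f h U r"
    then have "residue_limit ?f h U r" using U by simp
    then show "r = C / of_real (pi ^ CARD('n))" unfolding lim[OF U] .
  qed
qed

end

context proper_pushforward
begin

text \<open>For small \<rho> the sublevel set of the whole space breaks into disjoint parts in balls
  around the zeros, so the coefficient over the whole space is the sum of the local ones.\<close>

theorem global_residue_eq:
  assumes h: "polyfun h" and fin: "finite (common_zeros P)"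
  shows "global_residue h (\<lambda>j x. P j x ^ (\<mu> j + 1)) = coeff h \<mu> / of_real (pi ^ CARD('n))"
proof -
  let ?Z = "common_zeros P"
  have "\<forall>a. \<exists>d>0. \<forall>x\<in>?Z. x \<noteq> a \<longrightarrow> d \<le> dist a x" using finite_set_avoid[OF fin] by blast
  then obtain d where d: "\<And>a. 0 < d a" "\<And>a x. x \<in> ?Z \<Longrightarrow> x \<noteq> a \<Longrightarrow> d a \<le> dist a x" by metis
  \<comment> \<open>A third of the smallest distance between zeros keeps the balls disjoint and the
    other zeros off their closures.\<close>
  define e where "e = Min (insert 1 (d ` ?Z)) / 3"
  have e0: "0 < e" unfolding e_def using fin d(1) by simp
  have ed: "3 * e \<le> d a" if "a \<in> ?Z" for a unfolding e_def using fin that by simp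
  have sep: "3 * e \<le> dist a b" if "a \<in> ?Z" "b \<in> ?Z" "a \<noteq> b" for a b
    using ed[OF that(1)] d(2)[OF that(2), of a] that(3) by auto
  define U where "U a = ball a e" for a :: "complex^'n"
  have Uo: "open (U a)" "bounded (U a)" "a \<in> U a" for a using e0 by (auto simp: U_def)
  have Uc: "closure (U a) \<inter> ?Z = {a}" if "a \<in> ?Z" for a
  proof -
    have "x = a" if x: "x \<in> cball a e" "x \<in> ?Z" for x
    proof (rule ccontr)
      assume "x \<noteq> a"
      then have "3 * e \<le> dist a x" using sep[OF \<open>a \<in> ?Z\<close> x(2)] by auto
      then show False using x(1) e0 by simp
    qed
    then show ?thesis using that e0 by (auto simp: U_def)
  qed
  have Ud: "a = b" if "a \<in> ?Z" "b \<in> ?Z" "x \<in> U a" "x \<in> U b" for a b x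
  proof (rule ccontr)
    assume "a \<noteq> b"
    then have "3 * e \<le> dist a b" using sep that by blast
    also have "dist a b \<le> dist a x + dist b x" by (rule dist_triangle2)
    finally show False using that(3,4) e0 by (simp add: U_def)
  qed
  have "\<forall>a. \<exists>\<rho>>0. a \<in> ?Z \<longrightarrow> adm (U a) \<rho>"
  proof
    fix a show "\<exists>\<rho>>0. a \<in> ?Z \<longrightarrow> adm (U a) \<rho>"
    proof (cases "a \<in> ?Z")
      case True
      then show ?thesis using local_region[OF Uo Uc[OF True] open_UNIV UNIV_I] by blast
    next
      case False then show ?thesis by (intro exI[of _ 1]) auto
    qed
  qed
  then obtain \<rho>a where \<rho>a: "\<And>a. 0 < \<rho>a a" "\<And>a. a \<in> ?Z \<Longrightarrow> adm (U a) (\<rho>a a)" by metis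
  \<comment> \<open>The part of a compact sublevel set outside the balls has no zeros, so a smaller
    radius empties it.\<close>
  let ?K = "{x \<in> UNIV. \<forall>j. (cmod (P j x))\<^sup>2 \<le> 1} - (\<Union>a\<in>?Z. U a)"
  have "compact ?K" using adm_UNIV[of 1] Uo(1) by (intro compact_diff open_UN) (auto simp: adm_def)
  moreover have "?K \<inter> ?Z = {}" using Uo(3) by blast
  ultimately obtain \<rho>1 where \<rho>1: "0 < \<rho>1" "\<And>x. x \<in> ?K \<Longrightarrow> \<not> (\<forall>j. (cmod (P j x))\<^sup>2 \<le> \<rho>1)"
    using compact_zero_free[of ?K] by blast
  define \<rho> where "\<rho> = Min (insert 1 (insert \<rho>1 (\<rho>a ` ?Z)))"
  have \<rho>0: "0 < \<rho>" unfolding \<rho>_def using fin \<rho>a(1) \<rho>1(1) by simp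
  have "\<rho> \<le> t" if "t \<in> insert 1 (insert \<rho>1 (\<rho>a ` ?Z))" for t
    unfolding \<rho>_def by (rule Min_le[OF _ that]) (use fin in simp)
  then have \<rho>le: "\<rho> \<le> 1" "\<rho> \<le> \<rho>1" "\<And>a. a \<in> ?Z \<Longrightarrow> \<rho> \<le> \<rho>a a" by blast+
  have adm: "adm (U a) \<rho>" if "a \<in> ?Z" for a by (rule adm_mono[OF \<rho>a(2)[OF that] \<rho>le(3)[OF that]])
  have cover: "\<exists>a\<in>?Z. x \<in> U a" if x: "\<forall>j. (cmod (P j x))\<^sup>2 \<le> \<rho>" for x
  proof -
    have "\<forall>j. (cmod (P j x))\<^sup>2 \<le> 1" "\<forall>j. (cmod (P j x))\<^sup>2 \<le> \<rho>1" using x \<rho>le(1,2) order_trans by blast+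
    then show ?thesis using \<rho>1(2)[of x] by blast
  qed
  have "\<forall>a. \<exists>C. a \<in> ?Z \<longrightarrow> is_coeff (U a) \<rho> h \<mu> C" using is_coeff_exists[OF h adm \<rho>0] by blast
  then obtain C where C: "\<And>a. a \<in> ?Z \<Longrightarrow> is_coeff (U a) \<rho> h \<mu> (C a)" by metis
  have "is_coeff UNIV \<rho> h \<mu> (\<Sum>a\<in>?Z. C a)"
    unfolding is_coeff_def
  proof (intro allI impI)
    fix p q :: "'n \<Rightarrow> real" and \<eta> :: "'n \<Rightarrow> real \<Rightarrow> real" assume b: "\<forall>j. bump (p j) (q j) (\<eta> j) \<and> q j \<le> \<rho>"
    define \<xi> where "\<xi> j = shell_fun (\<eta> j) (\<mu> j)" for j
    define F where "F x = h x * cnj (J x) * (\<Prod>j\<in>UNIV. \<xi> j (P j x))" for x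
    have cs: "csupp \<rho> (\<xi> j)" for j unfolding \<xi>_def using b csupp_shell_fun by blast
    have tf: "test_fun \<rho> (\<xi> j)" for j
      unfolding \<xi>_def using b C1_test_fun_imp C1_test_fun_shell_fun by blast
    have int: "integrable lborel (\<lambda>x. indicator (U a) x *\<^sub>R F x)" if "a \<in> ?Z" for a
      unfolding F_def by (rule integrable_LP[OF h adm[OF that] tf])
    have split: "indicator UNIV x *\<^sub>R F x = (\<Sum>a\<in>?Z. indicator (U a) x *\<^sub>R F x)" for x
    proof (cases "\<forall>j. (cmod (P j x))\<^sup>2 \<le> \<rho>")
      case True
      then obtain a where a: "a \<in> ?Z" "x \<in> U a" using cover by blast
      have "(\<Sum>b\<in>?Z. indicator (U b) x *\<^sub>R F x) = (\<Sum>b\<in>?Z. if b = a then F x else 0)"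
      proof (rule sum.cong[OF refl])
        fix b assume bZ: "b \<in> ?Z"
        show "indicator (U b) x *\<^sub>R F x = (if b = a then F x else 0)"
        proof (cases "b = a")
          case True then show ?thesis using a(2) by simp
        next
          case False
          then have "x \<notin> U b" using Ud[OF bZ a(1) _ a(2)] by blast
          then show ?thesis using False by simp
        qed
      qed
      then show ?thesis using a fin by simp
    next
      case False
      then have "F x = 0" using prod_csupp_zero[OF cs False] by (simp add: F_def)
      then show ?thesis by simp
    qed
    have "LP UNIV h \<xi> = integral\<^sup>L lborel (\<lambda>x. indicator UNIV x *\<^sub>R F x)" by (simp only: LP_def L_def F_def)
    also have "\<dots> = (\<Sum>a\<in>?Z. integral\<^sup>L lborel (\<lambda>x. indicator (U a) x *\<^sub>R F x))"
      unfolding split by (rule Bochner_Integration.integral_sum) (rule int)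
    also have "\<dots> = (\<Sum>a\<in>?Z. LP (U a) h \<xi>)" by (simp only: LP_def L_def F_def)
    also have "\<dots> = (\<Sum>a\<in>?Z. C a * (\<Prod>j\<in>UNIV. of_real (mass (\<eta> j))))"
    proof (rule sum.cong[OF refl])
      fix a assume "a \<in> ?Z"
      from C[OF this] show "LP (U a) h \<xi> = C a * (\<Prod>j\<in>UNIV. of_real (mass (\<eta> j)))"
        using b unfolding is_coeff_def \<xi>_def by blast
    qed
    finally show "LP UNIV h (\<lambda>j. shell_fun (\<eta> j) (\<mu> j)) = (\<Sum>a\<in>?Z. C a) * (\<Prod>j\<in>UNIV. of_real (mass (\<eta> j)))"
      by (simp add: \<xi>_def[abs_def] sum_distrib_right)
  qed
  from is_coeff_unique[OF is_coeff_coeff[OF h] this \<rho>0]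
  have sumC: "coeff h \<mu> = (\<Sum>a\<in>?Z. C a)" .
  have "common_zeros (\<lambda>j x. P j x ^ (\<mu> j + 1)) = ?Z" by (auto simp: common_zeros_def)
  then have "global_residue h (\<lambda>j x. P j x ^ (\<mu> j + 1)) = (\<Sum>a\<in>?Z. local_residue (\<lambda>j x. P j x ^ (\<mu> j + 1)) h a)"
    by (simp only: global_residue_def)
  also have "\<dots> = (\<Sum>a\<in>?Z. C a / of_real (pi ^ CARD('n)))"
    by (rule sum.cong[OF refl]) (rule local_residue_eq[OF h Uo Uc adm \<rho>0 C])
  finally show ?thesis by (simp only: sumC sum_divide_distrib)
qed

end

section \<open>Growth bounds, index sets and the theorem\<close>

lemma cmod_mi_power_le:
  fixes x :: "complex^'n::finite"
  shows "cmod (mi_power (($) x) m) \<le> (1 + norm x) ^ mi_abs m"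
proof -
  have "cmod (mi_power (($) x) m) = (\<Prod>i\<in>UNIV. cmod (x $ i) ^ Poly_Mapping.lookup m i)"
    by (simp add: mi_power_def norm_power flip: prod_norm)
  also have "\<dots> \<le> (\<Prod>i\<in>UNIV. (1 + norm x) ^ Poly_Mapping.lookup m i)"
  proof (rule prod_mono)
    fix i
    have "cmod (x $ i) \<le> 1 + norm x" using Finite_Cartesian_Product.norm_nth_le[of x i] by simp
    then show "0 \<le> cmod (x $ i) ^ Poly_Mapping.lookup m i \<and> cmod (x $ i) ^ Poly_Mapping.lookup m i \<le> (1 + norm x) ^ Poly_Mapping.lookup m i"
      by (simp add: power_mono)
  qed
  also have "\<dots> = (1 + norm x) ^ mi_abs m" by (simp add: mi_abs_def power_sum)
  finally show ?thesis .
qed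

lemma cmod_peval_le:
  fixes p :: "'n::finite cpoly"
  shows "\<exists>K. \<forall>x :: complex^'n. cmod (peval p (($) x)) \<le> K * (1 + norm x) ^ total_degree p"
proof (intro exI allI)
  fix x :: "complex^'n"
  have "cmod (peval p (($) x)) \<le> (\<Sum>m\<in>Poly_Mapping.keys p. cmod (Poly_Mapping.lookup p m * mi_power (($) x) m))"
    unfolding peval_def by (rule norm_sum)
  also have "\<dots> \<le> (\<Sum>m\<in>Poly_Mapping.keys p. cmod (Poly_Mapping.lookup p m) * (1 + norm x) ^ total_degree p)"
  proof (rule sum_mono)
    fix m assume m: "m \<in> Poly_Mapping.keys p"
    have "mi_abs m \<le> total_degree p" unfolding total_degree_def using m by (intro Max_ge) auto
    then have "(1 + norm x) ^ mi_abs m \<le> (1 + norm x) ^ total_degree p" by (intro power_increasing) auto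
    then have "cmod (mi_power (($) x) m) \<le> (1 + norm x) ^ total_degree p" using cmod_mi_power_le[of x m] by linarith
    then show "cmod (Poly_Mapping.lookup p m * mi_power (($) x) m) \<le> cmod (Poly_Mapping.lookup p m) * (1 + norm x) ^ total_degree p"
      unfolding norm_mult by (rule mult_left_mono) simp
  qed
  finally show "cmod (peval p (($) x)) \<le> (\<Sum>m\<in>Poly_Mapping.keys p. cmod (Poly_Mapping.lookup p m)) * (1 + norm x) ^ total_degree p"
    by (simp only: sum_distrib_right)
qed

lemma lookup_Abs_finite: "Poly_Mapping.lookup (Abs_poly_mapping m) = (m :: 'n::finite \<Rightarrow> nat)"
  by (rule Abs_poly_mapping_inverse) simp

lemma finite_bounded_exponents:
  fixes N :: "'n::finite \<Rightarrow> nat"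
  assumes "\<And>m j. m \<in> A \<Longrightarrow> m j \<le> N j"
  shows "finite A"
proof (rule finite_subset)
  show "A \<subseteq> Pi\<^sub>E UNIV (\<lambda>j. {..N j})" using assms by (auto simp: PiE_iff)
  show "finite (Pi\<^sub>E UNIV (\<lambda>j. {..N j}))" by (intro finite_PiE) auto
qed

lemma finite_mi_abs_le: "finite {m :: 'n::finite multi_index. mi_abs m \<le> N}"
proof (rule finite_imageD)
  show "finite (Poly_Mapping.lookup ` {m :: 'n multi_index. mi_abs m \<le> N})"
  proof (rule finite_bounded_exponents[of _ "\<lambda>_. N"])
    fix f :: "'n \<Rightarrow> nat" and j assume "f \<in> Poly_Mapping.lookup ` {m :: 'n multi_index. mi_abs m \<le> N}"
    then obtain m :: "'n multi_index" where m: "f = Poly_Mapping.lookup m" "mi_abs m \<le> N" by blast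
    have "Poly_Mapping.lookup m j \<le> mi_abs m" unfolding mi_abs_def by (rule member_le_sum) auto
    then show "f j \<le> N" using m by simp
  qed
  show "inj_on Poly_Mapping.lookup {m :: 'n multi_index. mi_abs m \<le> N}" by (rule inj_onI) (simp add: lookup_inject)
qed

lemma continuous_on_peval2: "continuous_on S (peval2 p x)"
proof -
  have c: "continuous_on S (\<lambda>y. case_sum (($) x) (($) y) i)" for i
    by (cases i) (auto intro: linear_continuous_on[OF bounded_linear_vec_nth])
  have "continuous_on S (\<lambda>y. peval2 p x y)"
    unfolding peval2_def peval_def mi_power_def
    by (intro continuous_on_sum continuous_on_mult continuous_on_const continuous_on_prod continuous_on_power c)
  then show ?thesis by simp
qed

theorem proposition4p1:
  fixes P :: "'n::finite \<Rightarrow> 'n cpoly"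
    and \<delta> :: "'n \<Rightarrow> rat"
    and D :: "'n \<Rightarrow> nat"
    and q :: "'n \<Rightarrow> 'n \<Rightarrow> ('n + 'n) cpoly"
    and \<gamma> :: "'n multi_index \<Rightarrow> 'n multi_index \<Rightarrow> complex"
    and Q :: "'n cpoly"
    and d :: nat
  assumes proper: "delta_proper \<delta> P"
    and D: "\<And>j. D j = total_degree (P j)"
    and q_degree: "\<And>j k. total_degree (q j k) \<le> D j - 1"
    and q_eq: "\<And>j (x :: complex ^ 'n) y.
      peval (P j) (($) y) - peval (P j) (($) x) = (\<Sum>k\<in>UNIV. peval2 (q j k) x y * (y $ k - x $ k))"
    and det_eq: "\<And>(x :: complex ^ 'n) y.
      det (\<chi> j k. peval2 (q j k) x y) =
      (\<Sum>(\<alpha>, \<beta>) | mi_abs \<alpha> + mi_abs \<beta> + CARD('n) \<le> (\<Sum>j\<in>UNIV. D j).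
         \<gamma> \<alpha> \<beta> * mi_power (($) x) \<alpha> * mi_power (($) y) \<beta>)"
    and d: "total_degree Q = d"
  shows "\<forall>y :: complex ^ 'n.
    peval Q (($) y) =
      (\<Sum>(\<alpha>, \<beta>) | mi_abs \<alpha> + mi_abs \<beta> + CARD('n) \<le> (\<Sum>j\<in>UNIV. D j).
        \<Sum>\<mu> :: 'n multi_index | (\<Sum>j\<in>UNIV. (of_nat (Poly_Mapping.lookup \<mu> j) + 1) * \<delta> j)
                                 \<le> of_nat (mi_abs \<alpha> + d + CARD('n)).
          \<gamma> \<alpha> \<beta>
          * global_residue (\<lambda>x. peval Q (($) x) * mi_power (($) x) \<alpha>)
                           (\<lambda>j x. peval (P j) (($) x) ^ (Poly_Mapping.lookup \<mu> j + 1))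
          * mi_power (($) y) \<beta> * mi_power (\<lambda>j. peval (P j) (($) y)) \<mu>)"
proof
  fix y :: "complex^'n"
  define p where "p j x = peval (P j) (($) x)" for j and x :: "complex^'n"
  define \<omega> where "\<omega> j = real_of_rat (\<delta> j)" for j
  have \<delta>0: "0 < \<delta> j" for j using proper by (auto simp: delta_proper_def)
  then have \<omega>0: "0 < \<omega> j" for j by (simp add: \<omega>_def)
  have "\<exists>c>0. \<exists>R>0. \<forall>\<zeta> :: complex ^ 'n. norm \<zeta> \<ge> R \<longrightarrow>
      (\<Sum>j\<in>UNIV. cmod (p j \<zeta>) * (1 + (norm \<zeta>)\<^sup>2) powr (- \<omega> j / 2)) \<ge> c"
    unfolding p_def \<omega>_def by (rule conjunct2[OF proper[unfolded delta_proper_def]])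
  then obtain c R where cR: "0 < c" "0 < R"
    "\<And>\<zeta> :: complex ^ 'n. R \<le> norm \<zeta> \<Longrightarrow> c \<le> (\<Sum>j\<in>UNIV. cmod (p j \<zeta>) * (1 + (norm \<zeta>)\<^sup>2) powr (- \<omega> j / 2))"
    by blast
  have pp: "polyfun (p j)" for j unfolding p_def[abs_def] by (rule polyfun_peval)
  interpret pp: proper_pushforward p \<omega> c R
    by unfold_locales (rule pp \<omega>0 cR | assumption)+
  define I where "I = {(\<alpha> :: 'n multi_index, \<beta> :: 'n multi_index). mi_abs \<alpha> + mi_abs \<beta> + CARD('n) \<le> (\<Sum>j\<in>UNIV. D j)}"
  have finI: "finite I"
    by (rule finite_subset[of _ "{m. mi_abs m \<le> (\<Sum>j\<in>UNIV. D j)} \<times> {m. mi_abs m \<le> (\<Sum>j\<in>UNIV. D j)}"])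
       (auto simp: I_def intro: finite_mi_abs_le)
  define b where "b i y = \<gamma> (fst i) (snd i) * mi_power (($) y) (snd i)" for i and y :: "complex^'n"
  \<comment> \<open>Outside this set \<open>coeff_eq_0\<close> applies to a function of growth
    degree e times X^\<alpha>; positive weights make the set finite.\<close>
  define F where "F e \<alpha> = {m. (\<Sum>j\<in>UNIV. (real (m j) + 1) * \<omega> j) \<le> real (e + mi_abs \<alpha> + CARD('n))}" for e :: nat and \<alpha> :: "'n multi_index"
  have finF: "finite (F e \<alpha>)" for e \<alpha>
  proof (rule finite_bounded_exponents[of _ "\<lambda>j. nat \<lfloor>real (e + mi_abs \<alpha> + CARD('n)) / \<omega> j\<rfloor>"])
    fix m j assume "m \<in> F e \<alpha>"
    then have "(\<Sum>j\<in>UNIV. (real (m j) + 1) * \<omega> j) \<le> real (e + mi_abs \<alpha> + CARD('n))" by (simp add: F_def)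
    moreover have "(real (m j) + 1) * \<omega> j \<le> (\<Sum>j\<in>UNIV. (real (m j) + 1) * \<omega> j)"
      by (rule member_le_sum) (use \<omega>0 in \<open>auto intro!: mult_nonneg_nonneg simp: less_imp_le\<close>)
    moreover have "real (m j) * \<omega> j \<le> (real (m j) + 1) * \<omega> j" using \<omega>0[of j] by (intro mult_right_mono) auto
    ultimately have "real (m j) * \<omega> j \<le> real (e + mi_abs \<alpha> + CARD('n))" by linarith
    then have "real (m j) \<le> real (e + mi_abs \<alpha> + CARD('n)) / \<omega> j" using \<omega>0[of j] by (simp add: pos_le_divide_eq)
    then show "m j \<le> nat \<lfloor>real (e + mi_abs \<alpha> + CARD('n)) / \<omega> j\<rfloor>" by (rule le_nat_floor)
  qed
  \<comment> \<open>Stated for any polynomial function with a growth bound, since it is applied to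
    powers of coordinates for the finiteness of the zero set and then to Q.\<close>
  have key: "f z = (\<Sum>i\<in>I. b i z * (\<Sum>m\<in>F e (fst i). pp.coeff (\<lambda>x. f x * mi_power (($) x) (fst i)) m * (\<Prod>j\<in>UNIV. p j z ^ m j))) / of_real (pi ^ CARD('n))"
    if f: "polyfun f" and K: "\<And>x. cmod (f x) \<le> K * (1 + norm x) ^ e" for f :: "complex^'n \<Rightarrow> complex" and K e z
  proof (rule pp.division_identity[where q="\<lambda>j k. peval2 (q j k)"])
    show "polyfun f" by (rule f)
    show "finite I" by (rule finI)
    show pf: "polyfun (\<lambda>x. f x * mi_power (($) x) (fst i))" for i :: "'n multi_index \<times> 'n multi_index"
      by (intro polyfun.mult f polyfun_mi_power)
    show "polyfun (b i)" for i unfolding b_def[abs_def] by (intro polyfun.mult polyfun.const polyfun_mi_power)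
    show "finite (F e (fst i))" for i :: "'n multi_index \<times> 'n multi_index" by (rule finF)
    show "pp.coeff (\<lambda>x. f x * mi_power (($) x) (fst i)) m = 0" if "m \<notin> F e (fst i)" for i :: "'n multi_index \<times> 'n multi_index" and m
    proof (rule pp.coeff_eq_0[OF pf])
      fix x
      have "cmod (f x * mi_power (($) x) (fst i)) \<le> (K * (1 + norm x) ^ e) * (1 + norm x) ^ mi_abs (fst i)"
        unfolding norm_mult using order_trans[OF norm_ge_zero K[of x]] by (intro mult_mono K cmod_mi_power_le) auto
      then show "cmod (f x * mi_power (($) x) (fst i)) \<le> K * (1 + norm x) ^ (e + mi_abs (fst i))"
        by (simp add: power_add mult.assoc)
      show "real (e + mi_abs (fst i) + CARD('n)) < (\<Sum>j\<in>UNIV. (real (m j) + 1) * \<omega> j)"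
        using that by (simp add: F_def)
    qed
    show "continuous_on UNIV (peval2 (q j k) x)" for j k x by (rule continuous_on_peval2)
    show "p j y - p j x = (\<Sum>k\<in>UNIV. peval2 (q j k) x y * (y $ k - x $ k))" for j x y unfolding p_def by (rule q_eq)
    show "f x * det (\<chi> j k. peval2 (q j k) x y) = (\<Sum>i\<in>I. b i y * (f x * mi_power (($) x) (fst i)))" for x y
      unfolding det_eq sum_distrib_left I_def b_def by (intro sum.cong) (auto simp: mult_ac)
  qed
  have finZ: "finite (common_zeros p)"
  proof (rule finite_of_powers_in_span[OF finI])
    fix k :: 'n and e :: nat
    have f: "polyfun (\<lambda>x :: complex^'n. x $ k ^ e)" by (intro polyfun_power polyfun.coord)
    have K: "cmod (x $ k ^ e) \<le> 1 * (1 + norm x) ^ e" for x :: "complex^'n"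
    proof -
      have "cmod (x $ k) \<le> 1 + norm x" using Finite_Cartesian_Product.norm_nth_le[of x k] by simp
      then show ?thesis by (simp add: norm_power power_mono)
    qed
    \<comment> \<open>At a common zero the powers of P become powers of 0, a constant. So every
      power of a coordinate is a combination of the fixed finite family \<open>b\<close>, with
      coefficients independent of the zero.\<close>
    define X where "X i = (\<Sum>m\<in>F e (fst i). pp.coeff (\<lambda>x. x $ k ^ e * mi_power (($) x) (fst i)) m * (\<Prod>j\<in>(UNIV::'n set). 0 ^ m j))" for i :: "'n multi_index \<times> 'n multi_index"
    have comm: "u * v / w = v / w * u" for u v w :: complex by (simp add: mult.commute)
    show "\<exists>c. \<forall>y\<in>common_zeros p. y $ k ^ e = (\<Sum>i\<in>I. c i * b i y)"
    proof (intro exI[of _ "\<lambda>i. X i / of_real (pi ^ CARD('n))"] ballI)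
      fix y assume "y \<in> common_zeros p"
      then have z: "p j y = 0" for j by (simp add: common_zeros_def)
      have "y $ k ^ e = (\<Sum>i\<in>I. b i y * X i) / of_real (pi ^ CARD('n))"
        using key[OF f K, of y] unfolding z X_def .
      also have "\<dots> = (\<Sum>i\<in>I. X i / of_real (pi ^ CARD('n)) * b i y)"
        unfolding sum_divide_distrib by (rule sum.cong[OF refl comm])
      finally show "y $ k ^ e = (\<Sum>i\<in>I. X i / of_real (pi ^ CARD('n)) * b i y)" .
    qed
  qed
  obtain K where K: "\<And>x :: complex^'n. cmod (peval Q (($) x)) \<le> K * (1 + norm x) ^ d"
    using cmod_peval_le[of Q] d by blast
  \<comment> \<open>Translates the rational inequality over finitely supported exponents into the
    real one over functions, which \<open>coeff_eq_0\<close> uses.\<close>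
  have cond: "(\<Sum>j\<in>UNIV. (of_nat (Poly_Mapping.lookup \<mu> j) + 1) * \<delta> j) \<le> of_nat (mi_abs \<alpha> + d + CARD('n))
      \<longleftrightarrow> Poly_Mapping.lookup \<mu> \<in> F d \<alpha>" for \<mu> \<alpha> :: "'n multi_index"
  proof -
    have "(\<Sum>j\<in>UNIV. (real (Poly_Mapping.lookup \<mu> j) + 1) * \<omega> j) = of_rat (\<Sum>j\<in>UNIV. (of_nat (Poly_Mapping.lookup \<mu> j) + 1) * \<delta> j)"
      by (simp add: \<omega>_def of_rat_sum of_rat_mult of_rat_add)
    moreover have "real (d + mi_abs \<alpha> + CARD('n)) = of_rat (of_nat (mi_abs \<alpha> + d + CARD('n)))"
      by (simp only: of_rat_of_nat_eq add.commute[of d])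
    ultimately show ?thesis unfolding F_def mem_Collect_eq by (simp only: of_rat_less_eq)
  qed
  have bij: "bij_betw Poly_Mapping.lookup {\<mu>. (\<Sum>j\<in>UNIV. (of_nat (Poly_Mapping.lookup \<mu> j) + 1) * \<delta> j) \<le> of_nat (mi_abs \<alpha> + d + CARD('n))} (F d \<alpha>)"
    for \<alpha> :: "'n multi_index"
    unfolding cond
  proof (rule bij_betw_imageI)
    show "inj_on Poly_Mapping.lookup {\<mu> :: 'n multi_index. Poly_Mapping.lookup \<mu> \<in> F d \<alpha>}"
      by (rule inj_onI) (simp add: lookup_inject)
    show "Poly_Mapping.lookup ` {\<mu> :: 'n multi_index. Poly_Mapping.lookup \<mu> \<in> F d \<alpha>} = F d \<alpha>"
    proof (intro equalityI subsetI)
      fix m assume "m \<in> F d \<alpha>"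
      then show "m \<in> Poly_Mapping.lookup ` {\<mu> :: 'n multi_index. Poly_Mapping.lookup \<mu> \<in> F d \<alpha>}"
        by (intro image_eqI[of _ _ "Abs_poly_mapping m"]) (auto simp: lookup_Abs_finite)
    qed auto
  qed
  let ?h = "\<lambda>\<alpha> x. peval Q (($) x) * mi_power (($) x) \<alpha>"
  have res: "global_residue (?h \<alpha>) (\<lambda>j x. p j x ^ (Poly_Mapping.lookup \<mu> j + 1)) = pp.coeff (?h \<alpha>) (Poly_Mapping.lookup \<mu>) / of_real (pi ^ CARD('n))"
    for \<alpha> \<mu> :: "'n multi_index"
    by (rule pp.global_residue_eq[OF _ finZ]) (intro polyfun.mult polyfun_peval polyfun_mi_power)
  have "peval Q (($) y) = (\<Sum>i\<in>I. b i y * (\<Sum>m\<in>F d (fst i). pp.coeff (?h (fst i)) m * (\<Prod>j\<in>UNIV. p j y ^ m j))) / of_real (pi ^ CARD('n))"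
    by (rule key[OF polyfun_peval K])
  also have "\<dots> = (\<Sum>i\<in>I. case i of (\<alpha>, \<beta>) \<Rightarrow>
      \<Sum>\<mu> :: 'n multi_index | (\<Sum>j\<in>UNIV. (of_nat (Poly_Mapping.lookup \<mu> j) + 1) * \<delta> j) \<le> of_nat (mi_abs \<alpha> + d + CARD('n)).
        \<gamma> \<alpha> \<beta> * global_residue (?h \<alpha>) (\<lambda>j x. p j x ^ (Poly_Mapping.lookup \<mu> j + 1)) * mi_power (($) y) \<beta> * mi_power (\<lambda>j. p j y) \<mu>)"
    unfolding sum_divide_distrib
  proof (rule sum.cong[OF refl])
    fix i assume "i \<in> I"
    obtain \<alpha> \<beta> where i: "i = (\<alpha>, \<beta>)" by (cases i)
    have "b i y * (\<Sum>m\<in>F d (fst i). pp.coeff (?h (fst i)) m * (\<Prod>j\<in>UNIV. p j y ^ m j)) / of_real (pi ^ CARD('n))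
       = (\<Sum>m\<in>F d \<alpha>. \<gamma> \<alpha> \<beta> * (pp.coeff (?h \<alpha>) m / of_real (pi ^ CARD('n))) * mi_power (($) y) \<beta> * (\<Prod>j\<in>UNIV. p j y ^ m j))"
      unfolding i fst_conv snd_conv b_def sum_distrib_left sum_divide_distrib by (rule sum.cong) (auto simp: mult_ac)
    also have "\<dots> = (\<Sum>\<mu> :: 'n multi_index | (\<Sum>j\<in>UNIV. (of_nat (Poly_Mapping.lookup \<mu> j) + 1) * \<delta> j) \<le> of_nat (mi_abs \<alpha> + d + CARD('n)).
        \<gamma> \<alpha> \<beta> * (pp.coeff (?h \<alpha>) (Poly_Mapping.lookup \<mu>) / of_real (pi ^ CARD('n))) * mi_power (($) y) \<beta> * (\<Prod>j\<in>UNIV. p j y ^ Poly_Mapping.lookup \<mu> j))"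
      by (rule sum.reindex_bij_betw[OF bij, symmetric])
    finally show "b i y * (\<Sum>m\<in>F d (fst i). pp.coeff (?h (fst i)) m * (\<Prod>j\<in>UNIV. p j y ^ m j)) / of_real (pi ^ CARD('n)) =
      (case i of (\<alpha>, \<beta>) \<Rightarrow> \<Sum>\<mu> :: 'n multi_index | (\<Sum>j\<in>UNIV. (of_nat (Poly_Mapping.lookup \<mu> j) + 1) * \<delta> j) \<le> of_nat (mi_abs \<alpha> + d + CARD('n)).
        \<gamma> \<alpha> \<beta> * global_residue (?h \<alpha>) (\<lambda>j x. p j x ^ (Poly_Mapping.lookup \<mu> j + 1)) * mi_power (($) y) \<beta> * mi_power (\<lambda>j. p j y) \<mu>)"
      unfolding i prod.case res mi_power_def[of "\<lambda>j. p j y"] .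
  qed
  finally show "peval Q (($) y) = (\<Sum>(\<alpha>, \<beta>) | mi_abs \<alpha> + mi_abs \<beta> + CARD('n) \<le> (\<Sum>j\<in>UNIV. D j).
        \<Sum>\<mu> :: 'n multi_index | (\<Sum>j\<in>UNIV. (of_nat (Poly_Mapping.lookup \<mu> j) + 1) * \<delta> j)
                                 \<le> of_nat (mi_abs \<alpha> + d + CARD('n)).
          \<gamma> \<alpha> \<beta>
          * global_residue (\<lambda>x. peval Q (($) x) * mi_power (($) x) \<alpha>)
                           (\<lambda>j x. peval (P j) (($) x) ^ (Poly_Mapping.lookup \<mu> j + 1))
          * mi_power (($) y) \<beta> * mi_power (\<lambda>j. peval (P j) (($) y)) \<mu>)"
    unfolding I_def p_def .
qed

end
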